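(* Let $\mathbb{F}$ be a field of characteristic $3$. Denote by $\mathrm{Isom}(\mathrm{Cayley})$, $\mathrm{Isom}(G_2)$ and $\mathrm{Isom}(\bar A_2)$ the sets of isomorphism classes of, respectively, Cayley algebras over $\mathbb{F}$, twisted forms over $\mathbb{F}$ of the Chevalley algebra of type $G_2$, and twisted forms over $\mathbb{F}$ of the Lie algebra $\mathfrak{psl}_3(\mathbb{F})$. Writing $[\mathcal{A}]$ for the isomorphism class of an algebra $\mathcal{A}$, the maps $$[\mathcal{C}]\mapsto[\mathrm{Der}(\mathcal{C})]\qquad\text{and}\qquad[\mathcal{C}]\mapsto[\mathcal{C}^0]$$ give bijections $\mathrm{Isom}(\mathrm{Cayley})\to\mathrm{Isom}(G_2)$ and $\mathrm{Isom}(\mathrm{Cayley})\to\mathrm{Isom}(\bar A_2)$, respectively.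
   Context: A Cayley algebra over a field $\mathbb{F}$ is a unital nonassociative $\mathbb{F}$-algebra $\mathcal{C}$ of dimension $8$ endowed with a quadratic form $q:\mathcal{C}\to\mathbb{F}$ (the norm) that is multiplicative ($q(xy)=q(x)q(y)$) and nonsingular, i.e. the polar form $b_q(x,y)=q(x+y)-q(x)-q(y)$ is nondegenerate. $\mathcal{C}^0=\{x\in\mathcal{C}:b_q(x,1)=0\}$ is the subspace of trace zero elements; it is closed under the commutator $[x,y]=xy-yx$, and in characteristic $3$ the algebra $(\mathcal{C}^0,[\,,\,])$ is a simple Lie algebra, a twisted form of $\mathfrak{psl}_3(\mathbb{F})$; $\mathcal{C}^0$ is always considered with this bracket. $\mathrm{Der}(\mathcal{C})=\{d\in\mathfrak{gl}(\mathcal{C}): d(xy)=d(x)y+xd(y)\ \forall x,y\in\mathcal{C}\}$. The split Cayley algebra $\mathcal{C}_s$ is the unique (up to isomorphism) Cayley algebra over $\mathbb{F}$ with isotropic norm. The Chevalley algebra of type $G_2$ over $\mathbb{F}$ is $\mathfrak{g}_{\mathbb{Z}}\otimes_{\mathbb{Z}}\mathbb{F}$, where $\mathfrak{g}_{\mathbb{Z}}$ is the $\mathbb{Z}$-span of a Chevalley basis of the complex simple Lie algebra of type $G_2$; it is isomorphic to $\mathrm{Der}(\mathcal{C}_s)$. $\mathfrak{psl}_3(\mathbb{F})=\mathfrak{sl}_3(\mathbb{F})/\mathbb{F}I_3$ (characteristic $3$). An $\mathbb{F}$-algebra $\mathcal{A}$ is a twisted form of an $\mathbb{F}$-algebra $\mathcal{B}$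 if $\mathcal{A}\otimes_{\mathbb{F}}\mathbb{F}_{\mathrm{alg}}\cong\mathcal{B}\otimes_{\mathbb{F}}\mathbb{F}_{\mathrm{alg}}$, where $\mathbb{F}_{\mathrm{alg}}$ is an algebraic closure of $\mathbb{F}$. *)

theory Defs
  imports "HOL-Analysis.Analysis" "HOL-Algebra.QuotRing" "HOL-Algebra.Algebraic_Closure_Type"
begin

section \<open>Nonassociative algebras\<close>

text \<open>
  A nonassociative algebra over the commutative ring \<open>'r\<close> is a record of type
  \<open>('r, 'v) module\<close> whose \<^const>\<open>mult\<close> is bilinear on the carrier. The field \<^const>\<open>one\<close> of
  the record is not part of the algebra structure: it is only meaningful where it is required to
  be a unit, and isomorphisms ignore it. It is \<^const>\<open>undefined\<close> or arbitrary for Lie algebras,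
  whose bracket is \<^const>\<open>mult\<close>.
\<close>

definition nonassoc_algebra :: "('r::comm_ring_1, 'v) module \<Rightarrow> bool" where
  "nonassoc_algebra A \<longleftrightarrow>
     Module.module (ring_of_type_algebra :: 'r ring) A \<and>
     (\<forall>x\<in>carrier A. \<forall>y\<in>carrier A. x \<otimes>\<^bsub>A\<^esub> y \<in> carrier A) \<and>
     (\<forall>x\<in>carrier A. \<forall>y\<in>carrier A. \<forall>z\<in>carrier A.
        (x \<oplus>\<^bsub>A\<^esub> y) \<otimes>\<^bsub>A\<^esub> z = x \<otimes>\<^bsub>A\<^esub> z \<oplus>\<^bsub>A\<^esub> y \<otimes>\<^bsub>A\<^esub> z \<and>
        z \<otimes>\<^bsub>A\<^esub> (x \<oplus>\<^bsub>A\<^esub> y) = z \<otimes>\<^bsub>A\<^esub> x \<oplus>\<^bsub>A\<^esub> z \<otimes>\<^bsub>A\<^esub> y) \<and>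
     (\<forall>c. \<forall>x\<in>carrier A. \<forall>y\<in>carrier A.
        (c \<odot>\<^bsub>A\<^esub> x) \<otimes>\<^bsub>A\<^esub> y = c \<odot>\<^bsub>A\<^esub> (x \<otimes>\<^bsub>A\<^esub> y) \<and>
        x \<otimes>\<^bsub>A\<^esub> (c \<odot>\<^bsub>A\<^esub> y) = c \<odot>\<^bsub>A\<^esub> (x \<otimes>\<^bsub>A\<^esub> y))"

definition lie_algebra :: "('r::comm_ring_1, 'v) module \<Rightarrow> bool" where
  "lie_algebra L \<longleftrightarrow>
     nonassoc_algebra L \<and>
     (\<forall>x\<in>carrier L. x \<otimes>\<^bsub>L\<^esub> x = \<zero>\<^bsub>L\<^esub>) \<and>
     (\<forall>x\<in>carrier L. \<forall>y\<in>carrier L. \<forall>z\<in>carrier L.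
        x \<otimes>\<^bsub>L\<^esub> (y \<otimes>\<^bsub>L\<^esub> z) \<oplus>\<^bsub>L\<^esub> y \<otimes>\<^bsub>L\<^esub> (z \<otimes>\<^bsub>L\<^esub> x) \<oplus>\<^bsub>L\<^esub> z \<otimes>\<^bsub>L\<^esub> (x \<otimes>\<^bsub>L\<^esub> y) = \<zero>\<^bsub>L\<^esub>)"

definition algebra_basis :: "('r::comm_ring_1, 'v) module \<Rightarrow> 'i set \<Rightarrow> ('i \<Rightarrow> 'v) \<Rightarrow> bool" where
  "algebra_basis A I b \<longleftrightarrow>
     finite I \<and> b \<in> I \<rightarrow> carrier A \<and>
     (\<forall>x\<in>carrier A. \<exists>!c. c \<in> extensional I \<and> x = (\<Oplus>\<^bsub>A\<^esub>i\<in>I. c i \<odot>\<^bsub>A\<^esub> b i))"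

definition algebra_iso :: "('r::comm_ring_1, 'v) module \<Rightarrow> ('r, 'w) module \<Rightarrow> bool" where
  "algebra_iso A B \<longleftrightarrow>
     (\<exists>f. bij_betw f (carrier A) (carrier B) \<and>
        (\<forall>x\<in>carrier A. \<forall>y\<in>carrier A. f (x \<oplus>\<^bsub>A\<^esub> y) = f x \<oplus>\<^bsub>B\<^esub> f y) \<and>
        (\<forall>c. \<forall>x\<in>carrier A. f (c \<odot>\<^bsub>A\<^esub> x) = c \<odot>\<^bsub>B\<^esub> f x) \<and>
        (\<forall>x\<in>carrier A. \<forall>y\<in>carrier A. f (x \<otimes>\<^bsub>A\<^esub> y) = f x \<otimes>\<^bsub>B\<^esub> f y))"

text \<open>
  Isomorphism classes are taken among the algebras carried by subsets of \<open>nat \<Rightarrow> 'r\<close>, with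
  arbitrary operations. Over a field, every finite-dimensional algebra has an isomorphic copy
  there. The algebra \<open>A\<close> itself may live on any type.
\<close>

definition iso_class :: "('r::comm_ring_1, 'v) module \<Rightarrow> ('r, nat \<Rightarrow> 'r) module set" where
  "iso_class A = {B. nonassoc_algebra B \<and> algebra_iso A B}"

definition quotient_algebra :: "('r, 'v) module \<Rightarrow> 'v set \<Rightarrow> ('r, 'v set) module" where
  "quotient_algebra A I =
     \<lparr>carrier = a_rcosets\<^bsub>A\<^esub> I, mult = rcoset_mult A I, one = I +>\<^bsub>A\<^esub> \<one>\<^bsub>A\<^esub>,
      zero = I, add = set_add A, smult = (\<lambda>c Y. \<Union>x\<in>Y. I +>\<^bsub>A\<^esub> (c \<odot>\<^bsub>A\<^esub> x))\<rparr>"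


section \<open>Extension of scalars\<close>

text \<open>
  For a ring homomorphism \<open>\<phi>\<close> from \<open>'r\<close> to \<open>'s\<close>, the tensor product of an \<open>'r\<close>-algebra \<open>A\<close>
  with \<open>'s\<close> over \<open>'r\<close>, by generators and relations. The generator \<open>x \<otimes> 1\<close> is the class of
  \<open>single_fun x\<close>; the free \<open>'s\<close>-module on the carrier of \<open>A\<close> consists of the finitely supported
  functions, with the product extended bilinearly from the generators.
\<close>

definition single_fun :: "'v \<Rightarrow> 'v \<Rightarrow> 's::comm_ring_1" where
  "single_fun x = (\<lambda>z. if z = x then 1 else 0)"

definition free_algebra :: "('r, 'v) module \<Rightarrow> ('s::comm_ring_1, 'v \<Rightarrow> 's) module" where
  "free_algebra A =
     \<lparr>carrier = {u. finite {x. u x \<noteq> 0} \<and> {x. u x \<noteq> 0} \<subseteq> carrier A},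
      mult = (\<lambda>u v z. \<Sum>x | u x \<noteq> 0. \<Sum>y | v y \<noteq> 0. if x \<otimes>\<^bsub>A\<^esub> y = z then u x * v y else 0),
      one = single_fun \<one>\<^bsub>A\<^esub>,
      zero = (\<lambda>z. 0),
      add = (\<lambda>u v z. u z + v z),
      smult = (\<lambda>c u z. c * u z)\<rparr>"

definition tensor_relations ::
  "('r \<Rightarrow> 's::comm_ring_1) \<Rightarrow> ('r, 'v) module \<Rightarrow> ('v \<Rightarrow> 's) set" where
  "tensor_relations \<phi> A =
     {(\<lambda>z. single_fun (x \<oplus>\<^bsub>A\<^esub> y) z - single_fun x z - single_fun y z) | x y.
        x \<in> carrier A \<and> y \<in> carrier A} \<union>
     {(\<lambda>z. single_fun (c \<odot>\<^bsub>A\<^esub> x) z - \<phi> c * single_fun x z) | c x. x \<in> carrier A}"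

definition scalar_extension ::
  "('r \<Rightarrow> 's::comm_ring_1) \<Rightarrow> ('r, 'v) module \<Rightarrow> ('s, ('v \<Rightarrow> 's) set) module" where
  "scalar_extension \<phi> A =
     quotient_algebra (free_algebra A)
       (\<Inter>{N. submodule N (ring_of_type_algebra :: 's ring) (free_algebra A :: ('s, 'v \<Rightarrow> 's) module) \<and>
            tensor_relations \<phi> A \<subseteq> N})"

definition twisted_form :: "('a::field, 'v) module \<Rightarrow> ('a, 'w) module \<Rightarrow> bool" where
  "twisted_form A B \<longleftrightarrow>
     nonassoc_algebra A \<and> algebra_iso (scalar_extension to_ac A) (scalar_extension to_ac B)"


section \<open>Cayley algebras\<close>

definition polar_form :: "('a::field, 'v) module \<Rightarrow> ('v \<Rightarrow> 'a) \<Rightarrow> 'v \<Rightarrow> 'v \<Rightarrow> 'a" where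
  "polar_form V q x y = q (x \<oplus>\<^bsub>V\<^esub> y) - q x - q y"

definition quadratic_form :: "('a::field, 'v) module \<Rightarrow> ('v \<Rightarrow> 'a) \<Rightarrow> bool" where
  "quadratic_form V q \<longleftrightarrow>
     (\<forall>c. \<forall>x\<in>carrier V. q (c \<odot>\<^bsub>V\<^esub> x) = c\<^sup>2 * q x) \<and>
     (\<forall>x\<in>carrier V. \<forall>y\<in>carrier V. \<forall>z\<in>carrier V.
        polar_form V q (x \<oplus>\<^bsub>V\<^esub> y) z = polar_form V q x z + polar_form V q y z) \<and>
     (\<forall>c. \<forall>x\<in>carrier V. \<forall>y\<in>carrier V.
        polar_form V q (c \<odot>\<^bsub>V\<^esub> x) y = c * polar_form V q x y)"

definition cayley_algebra :: "('a::field, 'v) module \<Rightarrow> ('v \<Rightarrow> 'a) \<Rightarrow> bool" where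
  "cayley_algebra C q \<longleftrightarrow>
     nonassoc_algebra C \<and>
     (\<exists>b. algebra_basis C {..<8::nat} b) \<and>
     \<one>\<^bsub>C\<^esub> \<in> carrier C \<and>
     (\<forall>x\<in>carrier C. \<one>\<^bsub>C\<^esub> \<otimes>\<^bsub>C\<^esub> x = x \<and> x \<otimes>\<^bsub>C\<^esub> \<one>\<^bsub>C\<^esub> = x) \<and>
     quadratic_form C q \<and>
     (\<forall>x\<in>carrier C. \<forall>y\<in>carrier C. q (x \<otimes>\<^bsub>C\<^esub> y) = q x * q y) \<and>
     (\<forall>x\<in>carrier C. (\<forall>y\<in>carrier C. polar_form C q x y = 0) \<longrightarrow> x = \<zero>\<^bsub>C\<^esub>)"

definition trace_zero_algebra :: "('a::field, 'v) module \<Rightarrow> ('v \<Rightarrow> 'a) \<Rightarrow> ('a, 'v) module" where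
  "trace_zero_algebra C q =
     C\<lparr>carrier := {x \<in> carrier C. polar_form C q x \<one>\<^bsub>C\<^esub> = 0},
       mult := (\<lambda>x y. x \<otimes>\<^bsub>C\<^esub> y \<ominus>\<^bsub>C\<^esub> y \<otimes>\<^bsub>C\<^esub> x)\<rparr>"

definition derivation_algebra :: "('a::field, 'v) module \<Rightarrow> ('a, 'v \<Rightarrow> 'v) module" where
  "derivation_algebra C =
     \<lparr>carrier = {d \<in> carrier C \<rightarrow>\<^sub>E carrier C.
        (\<forall>x\<in>carrier C. \<forall>y\<in>carrier C. d (x \<oplus>\<^bsub>C\<^esub> y) = d x \<oplus>\<^bsub>C\<^esub> d y) \<and>
        (\<forall>c. \<forall>x\<in>carrier C. d (c \<odot>\<^bsub>C\<^esub> x) = c \<odot>\<^bsub>C\<^esub> d x) \<and>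
        (\<forall>x\<in>carrier C. \<forall>y\<in>carrier C. d (x \<otimes>\<^bsub>C\<^esub> y) = d x \<otimes>\<^bsub>C\<^esub> y \<oplus>\<^bsub>C\<^esub> x \<otimes>\<^bsub>C\<^esub> d y)},
      mult = (\<lambda>d e. \<lambda>x\<in>carrier C. d (e x) \<ominus>\<^bsub>C\<^esub> e (d x)),
      one = undefined,
      zero = (\<lambda>x\<in>carrier C. \<zero>\<^bsub>C\<^esub>),
      add = (\<lambda>d e. \<lambda>x\<in>carrier C. d x \<oplus>\<^bsub>C\<^esub> e x),
      smult = (\<lambda>c d. \<lambda>x\<in>carrier C. c \<odot>\<^bsub>C\<^esub> d x)\<rparr>"


section \<open>The Lie algebra \<open>psl\<^sub>3\<close> in characteristic 3\<close>

definition sl3 :: "('a::field, 'a ^ 3 ^ 3) module" where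
  "sl3 =
     \<lparr>carrier = {M. trace M = 0}, mult = (\<lambda>M N. M ** N - N ** M), one = undefined,
      zero = 0, add = (+), smult = (\<lambda>c M. \<chi> i j. c * M $ i $ j)\<rparr>"

text \<open>Scalar matrices have trace zero precisely because the characteristic is 3.\<close>

definition psl3 :: "('a::field, ('a ^ 3 ^ 3) set) module" where
  "psl3 = quotient_algebra sl3 (range mat)"


section \<open>Chevalley algebras of type \<open>G\<^sub>2\<close>\<close>

text \<open>
  The pair \<open>(m, n)\<close> stands for \<open>m \<alpha>\<^sub>1 + n \<alpha>\<^sub>2\<close>, where \<open>\<alpha>\<^sub>1\<close> is the short and \<open>\<alpha>\<^sub>2\<close> the long
  simple root. The inner product is normalised by \<open>(\<alpha>\<^sub>1, \<alpha>\<^sub>1) = 2\<close>, so that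
  \<open>(\<alpha>\<^sub>2, \<alpha>\<^sub>2) = 6\<close> and \<open>(\<alpha>\<^sub>1, \<alpha>\<^sub>2) = -3\<close>.
\<close>

definition G2_simple_roots :: "(int \<times> int) set" where
  "G2_simple_roots = {(1, 0), (0, 1)}"

definition G2_positive_roots :: "(int \<times> int) set" where
  "G2_positive_roots = {(1, 0), (0, 1), (1, 1), (2, 1), (3, 1), (3, 2)}"

definition G2_roots :: "(int \<times> int) set" where
  "G2_roots = G2_positive_roots \<union> uminus ` G2_positive_roots"

fun G2_inner :: "int \<times> int \<Rightarrow> int \<times> int \<Rightarrow> int" where
  "G2_inner (a, b) (c, d) = 2 * a * c - 3 * a * d - 3 * b * c + 6 * b * d"

text \<open>The Cartan integer \<open>\<langle>\<beta>, \<alpha>\<rangle> = 2 (\<beta>, \<alpha>) / (\<alpha>, \<alpha>)\<close>; the division is exact for roots.\<close>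

definition G2_cartan :: "int \<times> int \<Rightarrow> int \<times> int \<Rightarrow> int" where
  "G2_cartan \<beta> \<alpha> = 2 * G2_inner \<beta> \<alpha> div G2_inner \<alpha> \<alpha>"

text \<open>The greatest \<open>r\<close> such that \<open>\<beta> - r \<alpha>\<close> is a root.\<close>

definition G2_string :: "int \<times> int \<Rightarrow> int \<times> int \<Rightarrow> nat" where
  "G2_string \<alpha> \<beta> = Max {r. (fst \<beta> - int r * fst \<alpha>, snd \<beta> - int r * snd \<alpha>) \<in> G2_roots}"

text \<open>
  A Chevalley basis consists of the elements \<open>h \<alpha>\<close> for simple \<open>\<alpha>\<close> and \<open>x \<alpha>\<close> for all roots \<open>\<alpha>\<close>;
  for nonsimple \<open>\<alpha>\<close>, \<open>h \<alpha>\<close> is merely a name for the coroot element \<open>[x \<alpha>, x (- \<alpha>)]\<close>.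
  The relations say that the span of the \<open>h \<alpha>\<close> is a Cartan subalgebra with root system
  \<open>G\<^sub>2\<close> and root vectors \<open>x \<alpha>\<close>. In particular, a complex Lie algebra with such a basis is
  the simple Lie algebra of type \<open>G\<^sub>2\<close>.
\<close>

definition G2_chevalley_indices :: "((int \<times> int) + (int \<times> int)) set" where
  "G2_chevalley_indices = G2_simple_roots <+> G2_roots"

definition G2_chevalley_basis ::
  "(complex, 'v) module \<Rightarrow> (int \<times> int \<Rightarrow> 'v) \<Rightarrow> (int \<times> int \<Rightarrow> 'v) \<Rightarrow> bool" where
  "G2_chevalley_basis L h x \<longleftrightarrow>
     lie_algebra L \<and>
     algebra_basis L G2_chevalley_indices (case_sum h x) \<and>
     (\<forall>\<alpha>\<in>G2_roots. \<forall>\<beta>\<in>G2_roots. h \<alpha> \<otimes>\<^bsub>L\<^esub> h \<beta> = \<zero>\<^bsub>L\<^esub>) \<and>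
     (\<forall>\<alpha>\<in>G2_roots. \<forall>\<beta>\<in>G2_roots. h \<alpha> \<otimes>\<^bsub>L\<^esub> x \<beta> = of_int (G2_cartan \<beta> \<alpha>) \<odot>\<^bsub>L\<^esub> x \<beta>) \<and>
     (\<forall>\<alpha>\<in>G2_roots. x \<alpha> \<otimes>\<^bsub>L\<^esub> x (- \<alpha>) = h \<alpha>) \<and>
     (\<forall>\<alpha>\<in>G2_roots. \<forall>\<beta>\<in>G2_roots. \<alpha> + \<beta> \<in> G2_roots \<longrightarrow>
        (\<exists>s\<in>{1, - 1}. x \<alpha> \<otimes>\<^bsub>L\<^esub> x \<beta> = (s * of_nat (G2_string \<alpha> \<beta> + 1)) \<odot>\<^bsub>L\<^esub> x (\<alpha> + \<beta>))) \<and>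
     (\<forall>\<alpha>\<in>G2_roots. \<forall>\<beta>\<in>G2_roots. \<alpha> + \<beta> \<noteq> 0 \<and> \<alpha> + \<beta> \<notin> G2_roots \<longrightarrow>
        x \<alpha> \<otimes>\<^bsub>L\<^esub> x \<beta> = \<zero>\<^bsub>L\<^esub>)"

definition integral_span :: "(complex, 'v) module \<Rightarrow> 'i set \<Rightarrow> ('i \<Rightarrow> 'v) \<Rightarrow> (int, 'v) module" where
  "integral_span L I b =
     \<lparr>carrier = {(\<Oplus>\<^bsub>L\<^esub>i\<in>I. of_int (c i) \<odot>\<^bsub>L\<^esub> b i) | c :: 'i \<Rightarrow> int. True},
      mult = mult L, one = one L, zero = zero L, add = add L,
      smult = (\<lambda>n v. of_int n \<odot>\<^bsub>L\<^esub> v)\<rparr>"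

definition G2_chevalley_algebra ::
  "(complex, 'v) module \<Rightarrow> (int \<times> int \<Rightarrow> 'v) \<Rightarrow> (int \<times> int \<Rightarrow> 'v) \<Rightarrow>
     ('a::field, ('v \<Rightarrow> 'a) set) module" where
  "G2_chevalley_algebra L h x =
     scalar_extension of_int (integral_span L G2_chevalley_indices (case_sum h x))"

text \<open>
  The Chevalley algebra is determined up to isomorphism, independently of the choice of the
  Chevalley basis.
\<close>

definition G2_twisted_form :: "('a::field, 'v) module \<Rightarrow> bool" where
  "G2_twisted_form A \<longleftrightarrow>
     (\<exists>(L :: (complex, nat \<Rightarrow> complex) module) h x.
        G2_chevalley_basis L h x \<and> twisted_form A (G2_chevalley_algebra L h x))"


section \<open>Sets of isomorphism classes\<close>

definition Isom_Cayley :: "('a::field, nat \<Rightarrow> 'a) module set set" where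
  "Isom_Cayley = {iso_class C | (C :: ('a, nat \<Rightarrow> 'a) module) q. cayley_algebra C q}"

definition Isom_G2 :: "('a::field, nat \<Rightarrow> 'a) module set set" where
  "Isom_G2 = {iso_class A | A :: ('a, nat \<Rightarrow> 'a) module. G2_twisted_form A}"

definition Isom_A2_bar :: "('a::field, nat \<Rightarrow> 'a) module set set" where
  "Isom_A2_bar =
     {iso_class A | A :: ('a, nat \<Rightarrow> 'a) module. twisted_form A (psl3 :: ('a, ('a ^ 3 ^ 3) set) module)}"

end

theory Submission
  imports Defs
begin

text \<open>
  All arguments are reduced to one structure, the cross product. On the trace zero elements of a
  Cayley algebra the commutator and the polar form \<open>b\<close> satisfy, in characteristic 3,
  \<open>[x, [x, y]] = b(x, x) y - b(x, y) x\<close>. Conversely, a space \<open>V\<close> with an antisymmetric bracket and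
  a nondegenerate symmetric form related by this identity makes \<open>F \<times> V\<close> a Cayley algebra under
  \<open>(a, x) (c, y) = (a c + b(x, y), a y + c x - [x, y])\<close>. Comparing coefficients in the identity
  recovers \<open>b\<close> from the bracket alone. Hence \<open>C\<^sup>0\<close> determines \<open>C\<close> (\<open>octonions_iso\<close>), and a bracket
  that has a compatible form over the algebraic closure has one over the ground field
  (\<open>cross_product_descent\<close>).

  Over an algebraically closed field, \<open>ad h\<close> for a vector with \<open>b(h, h) = 1\<close> is diagonalisable with
  eigenvalues \<open>0, 1, -1\<close>, and dual bases of the two eigenspaces bring every seven-dimensional cross
  product into the same split form (\<open>cross_product_unique\<close>), whose bracket is \<open>psl\<^sub>3\<close>
  (\<open>psl3_split\<close>). So the algebras \<open>C\<^sup>0\<close> are exactly the twisted forms of \<open>psl\<^sub>3\<close>.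

  For derivations, the inner derivations of a cross product \<open>V\<close> lie in every nonzero ideal of
  \<open>Der V\<close>; an isomorphism \<open>Der V \<rightarrow> Der V'\<close> therefore restricts to one from \<open>V\<close> to \<open>V'\<close>
  (\<open>Der_iso_imp_iso\<close>), and \<open>Der C \<cong> Der C\<^sup>0\<close> determines \<open>C\<close> as well. In characteristic 3 the
  Chevalley algebra of type \<open>G\<^sub>2\<close> has a seven-dimensional ideal, spanned by the short root vectors
  and the coroot of the short simple root: bracketing from a short root to a long one produces the
  coefficient \<open>\<plusminus>3\<close>. The ideal is a split cross product, the algebra acts on it faithfully, and
  \<open>Der\<close> of the split cross product has dimension at most 14, so the Chevalley algebra is that
  derivation algebra. The ideal is also the radical of the Killing form. The radical is cut out by
  linear equations with coefficients in the ground field, so a twisted form \<open>A\<close> contains a twisted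
  form \<open>J\<close> of the ideal; \<open>J\<close> is a cross product, and \<open>A = Der J\<close> by dimension
  (\<open>chevalley_form_is_Der\<close>).

  Finite-dimensional algebras are represented by tables of structure constants. Extending scalars
  means applying the field embedding to the entries (\<open>scalar_extension_coord\<close>), and an algebra that
  becomes finite-dimensional after extension already was (\<open>scalar_extension_descent\<close>).
\<close>

(* The dollar sign denotes components of vectors only. *)
no_notation fps_nth (infixl \<open>$\<close> 75)

section \<open>Homomorphisms and quotients of nonassociative algebras\<close>

text \<open>
  Closure is all that inverting an isomorphism requires, so that symmetry also holds for scalar extensions and
  derivation algebras, without first making them modules.
\<close>

definition closed_algebra :: "('r::comm_ring_1, 'v) module => bool" where
  "closed_algebra A \<longleftrightarrow>
     (\<forall>x\<in>carrier A. \<forall>y\<in>carrier A. x \<oplus>\<^bsub>A\<^esub> y \<in> carrier A \<and> x \<otimes>\<^bsub>A\<^esub> y \<in> carrier A) \<and>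
     (\<forall>c. \<forall>x\<in>carrier A. c \<odot>\<^bsub>A\<^esub> x \<in> carrier A)"

definition algebra_hom ::
  "('r::comm_ring_1, 'v) module => ('r, 'w) module => ('v => 'w) => bool" where
  "algebra_hom A B f \<longleftrightarrow> f ` carrier A \<subseteq> carrier B \<and>
     (\<forall>x\<in>carrier A. \<forall>y\<in>carrier A. f (x \<oplus>\<^bsub>A\<^esub> y) = f x \<oplus>\<^bsub>B\<^esub> f y) \<and>
     (\<forall>c. \<forall>x\<in>carrier A. f (c \<odot>\<^bsub>A\<^esub> x) = c \<odot>\<^bsub>B\<^esub> f x) \<and>
     (\<forall>x\<in>carrier A. \<forall>y\<in>carrier A. f (x \<otimes>\<^bsub>A\<^esub> y) = f x \<otimes>\<^bsub>B\<^esub> f y)"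

lemma algebra_homI:
  fixes A (structure)
  assumes "\<And>x. x \<in> carrier A ==> f x \<in> carrier B"
    and "\<And>x y. \<lbrakk>x \<in> carrier A; y \<in> carrier A\<rbrakk> \<Longrightarrow> f (x \<oplus> y) = f x \<oplus>\<^bsub>B\<^esub> f y"
    and "\<And>c x. x \<in> carrier A ==> f (c \<odot> x) = c \<odot>\<^bsub>B\<^esub> f x"
    and "\<And>x y. \<lbrakk>x \<in> carrier A; y \<in> carrier A\<rbrakk> \<Longrightarrow> f (x \<otimes> y) = f x \<otimes>\<^bsub>B\<^esub> f y"
  shows "algebra_hom A B f"
  using assms by (auto simp: algebra_hom_def)

lemma algebra_homD:
  fixes A (structure)
  assumes "algebra_hom A B f"
  shows "x \<in> carrier A ==> f x \<in> carrier B"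
    and "\<lbrakk>x \<in> carrier A; y \<in> carrier A\<rbrakk> \<Longrightarrow> f (x \<oplus> y) = f x \<oplus>\<^bsub>B\<^esub> f y"
    and "x \<in> carrier A ==> f (c \<odot> x) = c \<odot>\<^bsub>B\<^esub> f x"
    and "\<lbrakk>x \<in> carrier A; y \<in> carrier A\<rbrakk> \<Longrightarrow> f (x \<otimes> y) = f x \<otimes>\<^bsub>B\<^esub> f y"
  using assms by (auto simp: algebra_hom_def)

lemma algebra_iso_iff:
  "algebra_iso A B \<longleftrightarrow> (\<exists>f. algebra_hom A B f \<and> bij_betw f (carrier A) (carrier B))"
  unfolding algebra_iso_def algebra_hom_def by (intro ex_cong1) (auto simp: bij_betw_def)

lemma algebra_isoI:
  "algebra_hom A B f ==> bij_betw f (carrier A) (carrier B) ==> algebra_iso A B"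
  using algebra_iso_iff by blast

lemma algebra_isoE:
  assumes "algebra_iso A B"
  obtains f where "algebra_hom A B f" "bij_betw f (carrier A) (carrier B)"
  using assms algebra_iso_iff by blast

lemma nonassoc_algebra_closed: "nonassoc_algebra A ==> closed_algebra A"
proof -
  assume A: "nonassoc_algebra A"
  then interpret M: Module.module "ring_of_type_algebra" A
    by (simp add: nonassoc_algebra_def)
  show ?thesis
    using A M.smult_closed
    by (auto simp: closed_algebra_def nonassoc_algebra_def ring_of_type_algebra_def)
qed

lemma algebra_iso_refl: "algebra_iso A A"
  unfolding algebra_iso_def by (rule exI[of _ id]) auto

lemma algebra_hom_comp:
  "algebra_hom A B f ==> algebra_hom B C g ==> algebra_hom A C (g \<circ> f)"
  by (auto simp: algebra_hom_def image_subset_iff)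

lemma algebra_iso_trans: "algebra_iso A B ==> algebra_iso B C ==> algebra_iso A C"
  by (meson algebra_hom_comp algebra_iso_iff bij_betw_trans)

lemma algebra_hom_inv:
  fixes A (structure)
  assumes A: "closed_algebra A" and f: "algebra_hom A B f"
    and bij: "bij_betw f (carrier A) (carrier B)"
  shows "algebra_hom B A (the_inv_into (carrier A) f)"
proof (rule algebra_homI)
  let ?g = "the_inv_into (carrier A) f"
  have inj: "inj_on f (carrier A)" using bij by (simp add: bij_betw_def)
  have g: "?g y \<in> carrier A" "f (?g y) = y" if "y \<in> carrier B" for y
    using bij that by (auto simp: bij_betw_def f_the_inv_into_f the_inv_into_into)
  have gf: "?g (f x) = x" if "x \<in> carrier A" for x
    by (rule the_inv_into_f_f[OF inj that])
  show "?g y \<in> carrier A" if "y \<in> carrier B" for y by (rule g(1)[OF that])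
  fix x y assume x: "x \<in> carrier B" and y: "y \<in> carrier B"
  have "f (?g x \<oplus> ?g y) = x \<oplus>\<^bsub>B\<^esub> y" "f (?g x \<otimes> ?g y) = x \<otimes>\<^bsub>B\<^esub> y"
    using g[OF x] g[OF y] algebra_homD[OF f] by auto
  then show "?g (x \<oplus>\<^bsub>B\<^esub> y) = ?g x \<oplus> ?g y" "?g (x \<otimes>\<^bsub>B\<^esub> y) = ?g x \<otimes> ?g y"
    using gf A g(1)[OF x] g(1)[OF y] by (metis closed_algebra_def)+
next
  fix c y assume y: "y \<in> carrier B"
  let ?g = "the_inv_into (carrier A) f"
  have inj: "inj_on f (carrier A)" using bij by (simp add: bij_betw_def)
  have g: "?g y \<in> carrier A" "f (?g y) = y"
    using bij y by (auto simp: bij_betw_def f_the_inv_into_f the_inv_into_into)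
  then have "f (c \<odot> ?g y) = c \<odot>\<^bsub>B\<^esub> y" using algebra_homD[OF f] by auto
  then show "?g (c \<odot>\<^bsub>B\<^esub> y) = c \<odot> ?g y"
    using A g(1) the_inv_into_f_f[OF inj] by (metis closed_algebra_def)
qed

lemma algebra_iso_sym: "closed_algebra A ==> algebra_iso A B ==> algebra_iso B A"
  by (meson algebra_hom_inv algebra_isoE algebra_isoI bij_betw_the_inv_into)

lemma closed_algebra_iso: "closed_algebra A ==> algebra_iso A B ==> closed_algebra B"
proof -
  assume A: "closed_algebra A" and "algebra_iso A B"
  then obtain f where f: "algebra_hom A B f" and bij: "bij_betw f (carrier A) (carrier B)"
    by (auto elim: algebra_isoE)
  have "f (x \<oplus>\<^bsub>A\<^esub> y) \<in> carrier B" "f (x \<otimes>\<^bsub>A\<^esub> y) \<in> carrier B" "f (c \<odot>\<^bsub>A\<^esub> x) \<in> carrier B"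
    if "x \<in> carrier A" "y \<in> carrier A" for x y c
    using that A algebra_homD(1)[OF f] by (auto simp: closed_algebra_def)
  moreover have "carrier B = f ` carrier A" using bij by (simp add: bij_betw_def)
  ultimately show ?thesis using algebra_homD[OF f] by (auto simp: closed_algebra_def)
qed

lemma iso_class_eqI:
  assumes "closed_algebra A" "algebra_iso A B"
  shows "iso_class A = iso_class B"
  unfolding iso_class_def
  by (meson assms algebra_iso_sym algebra_iso_trans)

text \<open>
  An algebra on \<open>nat \<Rightarrow> 'r\<close> belongs to its own class; one on another type cannot, which
  is why the type matters here.
\<close>

lemma iso_class_eqD:
  fixes A :: "('r::comm_ring_1, nat => 'r) module"
  assumes "iso_class A = iso_class B" "nonassoc_algebra A"
  shows "algebra_iso B A"
proof -
  have "A \<in> iso_class A" using assms(2) algebra_iso_refl by (simp add: iso_class_def)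
  then have "A \<in> iso_class B" using assms(1) by simp
  then show ?thesis by (simp add: iso_class_def)
qed

lemma a_rcosetI: "n \<in> N ==> y = n \<oplus>\<^bsub>A\<^esub> x ==> y \<in> N +>\<^bsub>A\<^esub> x"
  by (auto simp: a_r_coset_def r_coset_def)

lemma a_rcosetE: "y \<in> N +>\<^bsub>A\<^esub> x ==> \<exists>n\<in>N. y = n \<oplus>\<^bsub>A\<^esub> x"
  by (auto simp: a_r_coset_def r_coset_def)

lemma set_add_iff: "z \<in> set_add A S T \<longleftrightarrow> (\<exists>x\<in>S. \<exists>y\<in>T. z = x \<oplus>\<^bsub>A\<^esub> y)"
  by (auto simp: set_add_def set_mult_def)

text \<open>
  The first isomorphism theorem. Every quotient below, \<open>psl\<^sub>3\<close> and the tensor product, is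
  identified through it.
\<close>

theorem quotient_algebra_iso:
  fixes A (structure)
  assumes A: "abelian_group A" "closed_algebra A" and B: "abelian_group B" "closed_algebra B"
    and f: "algebra_hom A B f" and surj: "f ` carrier A = carrier B"
    and N: "N = {x \<in> carrier A. f x = \<zero>\<^bsub>B\<^esub>}"
  shows "algebra_iso B (quotient_algebra A N)"
proof -
  interpret A: abelian_group A by fact
  interpret B: abelian_group B by fact
  note fD = algebra_homD[OF f]
  define F where "F z = {x \<in> carrier A. f x = z}" for z
  have coset: "N +> x = F (f x)" if x: "x \<in> carrier A" for x
  proof (intro subset_antisym subsetI)
    fix y assume "y \<in> N +> x"
    then show "y \<in> F (f x)"
      using x fD by (auto simp: N F_def dest!: a_rcosetE)
  next
    fix y assume y: "y \<in> F (f x)"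
    then have yA: "y \<in> carrier A" and fy: "f y = f x" by (auto simp: F_def)
    have eq: "y = (y \<ominus> x) \<oplus> x"
      using x yA by (simp add: a_minus_def A.a_assoc A.l_neg)
    have "f (y \<ominus> x) \<oplus>\<^bsub>B\<^esub> f x = f ((y \<ominus> x) \<oplus> x)"
      using fD(2) x yA by simp
    also have "\<dots> = f x" by (simp only: eq[symmetric] fy)
    finally have "f (y \<ominus> x) \<oplus>\<^bsub>B\<^esub> f x = f x" .
    moreover have "f (y \<ominus> x) \<in> carrier B" "f x \<in> carrier B"
      using fD(1) x yA by simp_all
    ultimately have "f (y \<ominus> x) = \<zero>\<^bsub>B\<^esub>"
      using B.add.r_cancel_one by blast
    then have "y \<ominus> x \<in> N" using x yA by (simp add: N)
    then show "y \<in> N +> x" using eq by (rule a_rcosetI)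
  qed
  have ne: "\<exists>x. x \<in> carrier A \<and> f x = z" if "z \<in> carrier B" for z
    using that by (metis surj imageE)
  have "carrier (quotient_algebra A N) = (\<Union>x\<in>carrier A. {N +> x})"
    by (simp add: quotient_algebra_def A_RCOSETS_def RCOSETS_def a_r_coset_def)
  also have "\<dots> = (\<lambda>x. N +> x) ` carrier A" by blast
  also have "\<dots> = (\<lambda>x. F (f x)) ` carrier A" by (rule image_cong[OF refl coset])
  also have "\<dots> = F ` f ` carrier A" by (simp only: image_image)
  finally have car: "carrier (quotient_algebra A N) = F ` carrier B" using surj by simp
  have inj: "inj_on F (carrier B)"
    using ne by (auto simp: inj_on_def F_def)
  have "algebra_hom B (quotient_algebra A N) F"
  proof (rule algebra_homI)
    show "F z \<in> carrier (quotient_algebra A N)" if "z \<in> carrier B" for z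
      using car that by simp
  next
    fix z w assume z: "z \<in> carrier B" and w: "w \<in> carrier B"
    have "F (z \<oplus>\<^bsub>B\<^esub> w) = set_add A (F z) (F w)"
    proof (intro subset_antisym subsetI)
      fix y assume "y \<in> F (z \<oplus>\<^bsub>B\<^esub> w)"
      then have y: "y \<in> carrier A" "f y = z \<oplus>\<^bsub>B\<^esub> w" by (auto simp: F_def)
      obtain a where a: "a \<in> carrier A" "f a = z" using ne[OF z] by blast
      define c where "c = \<ominus> a \<oplus> y"
      have c: "c \<in> carrier A" "y = a \<oplus> c"
        using a y by (auto simp: c_def A.a_assoc[symmetric] A.r_neg)
      then have "z \<oplus>\<^bsub>B\<^esub> f c = z \<oplus>\<^bsub>B\<^esub> w" using y a fD(2)[of a c] by simp
      then have "f c = w" using z w fD(1)[OF c(1)] by simp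
      then show "y \<in> set_add A (F z) (F w)"
        using a c by (auto simp: set_add_iff F_def)
    next
      fix y assume "y \<in> set_add A (F z) (F w)"
      then show "y \<in> F (z \<oplus>\<^bsub>B\<^esub> w)"
        using fD by (auto simp: set_add_iff F_def)
    qed
    then show "F (z \<oplus>\<^bsub>B\<^esub> w) = F z \<oplus>\<^bsub>quotient_algebra A N\<^esub> F w"
      by (simp add: quotient_algebra_def)
    have "N +> (x \<otimes> y) = F (z \<otimes>\<^bsub>B\<^esub> w)" if "x \<in> F z" "y \<in> F w" for x y
      using that coset[of "x \<otimes> y"] A(2) fD(4)[of x y] by (auto simp: F_def closed_algebra_def)
    then have "rcoset_mult A N (F z) (F w) = (\<Union>x\<in>F z. \<Union>y\<in>F w. F (z \<otimes>\<^bsub>B\<^esub> w))"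
      unfolding rcoset_mult_def by auto
    also have "\<dots> = F (z \<otimes>\<^bsub>B\<^esub> w)"
      using ne[OF z] ne[OF w] by (auto simp: F_def)
    finally show "F (z \<otimes>\<^bsub>B\<^esub> w) = F z \<otimes>\<^bsub>quotient_algebra A N\<^esub> F w"
      by (simp add: quotient_algebra_def)
  next
    fix c z assume z: "z \<in> carrier B"
    have "N +> (c \<odot> x) = F (c \<odot>\<^bsub>B\<^esub> z)" if "x \<in> F z" for x
      using that coset[of "c \<odot> x"] A(2) fD(3)[of x c] by (auto simp: F_def closed_algebra_def)
    then have "(\<Union>x\<in>F z. N +> (c \<odot> x)) = (\<Union>x\<in>F z. F (c \<odot>\<^bsub>B\<^esub> z))"
      by auto
    also have "\<dots> = F (c \<odot>\<^bsub>B\<^esub> z)" using ne[OF z] by (auto simp: F_def)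
    finally show "F (c \<odot>\<^bsub>B\<^esub> z) = c \<odot>\<^bsub>quotient_algebra A N\<^esub> F z"
      by (simp add: quotient_algebra_def)
  qed
  then show ?thesis
    using inj car by (intro algebra_isoI[of _ _ F]) (auto simp: bij_betw_def)
qed

section \<open>Algebras given by structure constants\<close>

type_synonym ('r, 'n) table = "'n => 'n => ('r, 'n) vec"

definition sc_mult :: "('r::comm_ring_1, 'n::finite) table => 'r^'n => 'r^'n => 'r^'n" where
  "sc_mult G x y = (\<Sum>i\<in>UNIV. \<Sum>j\<in>UNIV. (x $ i * y $ j) *s G i j)"

text \<open>Isomorphism ignores the unit, so a table only has to describe the product.\<close>

definition coord_algebra :: "('r::comm_ring_1, 'n::finite) table => ('r, 'r^'n) module" where
  "coord_algebra G =
     \<lparr>carrier = UNIV, mult = sc_mult G, one = undefined, zero = 0, add = (+), smult = (*s)\<rparr>"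

lemma coord_algebra_simps [simp]:
  "carrier (coord_algebra G) = UNIV" "x \<otimes>\<^bsub>coord_algebra G\<^esub> y = sc_mult G x y"
  "\<zero>\<^bsub>coord_algebra G\<^esub> = 0" "x \<oplus>\<^bsub>coord_algebra G\<^esub> y = x + y" "c \<odot>\<^bsub>coord_algebra G\<^esub> x = c *s x"
  by (simp_all add: coord_algebra_def)

lemma closed_coord_algebra: "closed_algebra (coord_algebra G)"
  by (simp add: closed_algebra_def)

lemma abelian_group_coord_algebra: "abelian_group (coord_algebra G)"
proof (rule abelian_groupI)
  show "\<exists>y\<in>carrier (coord_algebra G). y \<oplus>\<^bsub>coord_algebra G\<^esub> x = \<zero>\<^bsub>coord_algebra G\<^esub>" for x
    by (intro bexI[of _ "- x"]) auto
qed (auto simp: algebra_simps)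

lemma scale_sum_left: "(\<Sum>i\<in>I. f i) *s (x::'r::comm_ring_1^'n) = (\<Sum>i\<in>I. f i *s x)"
  by (simp add: vec_eq_iff sum_distrib_right)

lemma scale_sum_right: "c *s (\<Sum>i\<in>I. f i) = (\<Sum>i\<in>I. c *s (f i::'r::comm_ring_1^'n))"
  by (simp add: vec_eq_iff sum_distrib_left)

lemma vector_scale_scale: "c *s (d *s x) = (c * d) *s (x::'r::comm_ring_1^'n)"
  by (simp add: vec_eq_iff mult.assoc)

lemma basis_expansion_ring: "(\<Sum>i\<in>UNIV. (x $ i) *s axis i 1) = (x::'r::comm_ring_1^'n::finite)"
  by (simp add: vec_eq_iff axis_def if_distrib[of "\<lambda>t. _ * t"] cong: if_cong)

lemma sc_mult_add:
  "sc_mult G (x + y) z = sc_mult G x z + sc_mult G y z"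
  "sc_mult G z (x + y) = sc_mult G z x + sc_mult G z y"
  by (simp_all add: sc_mult_def vec_eq_iff distrib_left distrib_right sum.distrib)

lemma sc_mult_scale:
  "sc_mult G (c *s x) z = c *s sc_mult G x z"
  "sc_mult G z (c *s x) = c *s sc_mult G z x"
  by (simp_all add: sc_mult_def vec_eq_iff sum_distrib_left mult.assoc mult.left_commute)

lemma sc_mult_zero [simp]: "sc_mult G 0 z = 0" "sc_mult G z 0 = 0"
  by (simp_all add: sc_mult_def vec_eq_iff)

lemma sc_mult_minus:
  "sc_mult G (- x) z = - sc_mult G x z" "sc_mult G z (- x) = - sc_mult G z x"
  by (simp_all add: sc_mult_def vec_eq_iff sum_negf)

lemma sc_mult_diff:
  "sc_mult G (x - y) z = sc_mult G x z - sc_mult G y z"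
  "sc_mult G z (x - y) = sc_mult G z x - sc_mult G z y"
  by (simp_all add: sc_mult_def vec_eq_iff left_diff_distrib right_diff_distrib sum_subtractf)

lemma sc_mult_sum:
  "sc_mult G (\<Sum>i\<in>I. f i) z = (\<Sum>i\<in>I. sc_mult G (f i) z)"
  "sc_mult G z (\<Sum>i\<in>I. f i) = (\<Sum>i\<in>I. sc_mult G z (f i))"
  by (induct I rule: infinite_finite_induct) (simp_all add: sc_mult_add)

lemma sc_mult_axis [simp]: "sc_mult G (axis i 1) (axis j 1) = G i j"
proof -
  have "sc_mult G (axis i 1) (axis j 1) =
      (\<Sum>k\<in>UNIV. if k = i then (\<Sum>l\<in>UNIV. if l = j then G k l else 0) else 0)"
    unfolding sc_mult_def by (intro sum.cong refl) (auto simp: axis_def vec_eq_iff if_distrib[of "\<lambda>t. t * _"] cong: if_cong intro!: sum.neutral)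
  then show ?thesis by simp
qed

lemma bilinear_eq_sc_mult:
  fixes m :: "'r::comm_ring_1^'n::finite => 'r^'n => 'r^'n"
  assumes "\<And>x y z. m (x + y) z = m x z + m y z" "\<And>x y z. m z (x + y) = m z x + m z y"
    and "\<And>c x z. m (c *s x) z = c *s m x z" "\<And>c x z. m z (c *s x) = c *s m z x"
  shows "m = sc_mult (\<lambda>i j. m (axis i 1) (axis j 1))"
proof (intro ext)
  fix x y
  have z: "m 0 z = 0" "m z 0 = 0" for z
    using assms(3)[of 0 0 z] assms(4)[of z 0 0] by (simp_all add: vec_eq_iff)
  have s: "m (\<Sum>i\<in>I. f i) z = (\<Sum>i\<in>I. m (f i) z)" "m z (\<Sum>i\<in>I. f i) = (\<Sum>i\<in>I. m z (f i))"
    for I :: "'n set" and f z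
    by (induct I rule: infinite_finite_induct) (simp_all add: assms z)
  have "m x y = m (\<Sum>i\<in>UNIV. (x $ i) *s axis i 1) (\<Sum>i\<in>UNIV. (y $ i) *s axis i 1)"
    by (simp only: basis_expansion_ring)
  also have "\<dots> = sc_mult (\<lambda>i j. m (axis i 1) (axis j 1)) x y"
    unfolding s assms sc_mult_def
    by (subst sum.swap) (simp add: vector_scale_scale scale_sum_right mult.commute)
  finally show "m x y = sc_mult (\<lambda>i j. m (axis i 1) (axis j 1)) x y" .
qed

text \<open>The product is pulled back along a linear parametrisation.\<close>

lemma coord_algebra_isoI:
  fixes A :: "('r::comm_ring_1, 'v) module" (structure) and g :: "'r^'n::finite => 'v"
  assumes A: "nonassoc_algebra A" and bij: "bij_betw g UNIV (carrier A)"
    and add: "\<And>x y. g (x + y) = g x \<oplus> g y" and scale: "\<And>c x. g (c *s x) = c \<odot> g x"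
  shows "\<exists>G. algebra_hom (coord_algebra G) A g"
proof -
  define h where "h = the_inv_into UNIV g"
  have g: "g x \<in> carrier A" for x using bij by (auto simp: bij_betw_def)
  have hg: "h (g x) = x" for x
    unfolding h_def using bij by (simp add: bij_betw_def the_inv_into_f_f)
  have gh: "g (h y) = y" if "y \<in> carrier A" for y
    unfolding h_def using bij that by (simp add: bij_betw_def f_the_inv_into_f)
  have hadd: "h (x \<oplus> y) = h x + h y" if "x \<in> carrier A" "y \<in> carrier A" for x y
    using hg[of "h x + h y"] gh that by (simp add: add)
  have hscale: "h (c \<odot> x) = c *s h x" if "x \<in> carrier A" for c x
    using hg[of "c *s h x"] gh that by (simp add: scale)
  define m where "m x y = h (g x \<otimes> g y)" for x y
  have mA: "g x \<otimes> g y \<in> carrier A" for x y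
    using A g by (auto simp: nonassoc_algebra_def)
  have meq: "m = sc_mult (\<lambda>i j. m (axis i 1) (axis j 1))"
  proof (rule bilinear_eq_sc_mult)
    fix x y z
    have "(g x \<oplus> g y) \<otimes> g z = g x \<otimes> g z \<oplus> g y \<otimes> g z"
      "g z \<otimes> (g x \<oplus> g y) = g z \<otimes> g x \<oplus> g z \<otimes> g y"
      using A g by (auto simp: nonassoc_algebra_def)
    then show "m (x + y) z = m x z + m y z" "m z (x + y) = m z x + m z y"
      by (simp_all add: m_def add hadd mA)
  next
    fix c x z
    have "(c \<odot> g x) \<otimes> g z = c \<odot> (g x \<otimes> g z)"
      "g z \<otimes> (c \<odot> g x) = c \<odot> (g z \<otimes> g x)"
      using A g by (auto simp: nonassoc_algebra_def)
    then show "m (c *s x) z = c *s m x z" "m z (c *s x) = c *s m z x"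
      by (simp_all add: m_def scale hscale mA)
  qed
  have "g (m x y) = g x \<otimes> g y" for x y
    by (simp add: m_def gh mA)
  then have "algebra_hom (coord_algebra (\<lambda>i j. m (axis i 1) (axis j 1))) A g"
    using g by (intro algebra_homI) (simp_all add: add scale meq[symmetric])
  then show ?thesis by blast
qed

section \<open>Modules over a commutative ring type\<close>

lemma nonassoc_algebraD:
  fixes A :: "('r::comm_ring_1, 'v) module" (structure)
  assumes A: "nonassoc_algebra A"
  shows "Module.module (ring_of_type_algebra :: 'r ring) A" and "abelian_group A"
    and "x \<in> carrier A ==> c \<odot> x \<in> carrier A"
    and "x \<in> carrier A ==> (c + d) \<odot> x = c \<odot> x \<oplus> d \<odot> x"
    and "x \<in> carrier A ==> y \<in> carrier A ==> c \<odot> (x \<oplus> y) = c \<odot> x \<oplus> c \<odot> y"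
    and "x \<in> carrier A ==> (c * d) \<odot> x = c \<odot> (d \<odot> x)"
    and "x \<in> carrier A ==> 1 \<odot> x = x"
    and "x \<in> carrier A ==> 0 \<odot> x = \<zero>"
    and "c \<odot> \<zero> = \<zero>"
    and "x \<in> carrier A ==> (- 1) \<odot> x = \<ominus> x"
proof -
  show m: "Module.module (ring_of_type_algebra :: 'r ring) A"
    using A by (simp add: nonassoc_algebra_def)
  then interpret M: Module.module "ring_of_type_algebra :: 'r ring" A .
  show "abelian_group A" by (rule M.abelian_group_axioms)
  show 1: "x \<in> carrier A ==> c \<odot> x \<in> carrier A" for x c
    using M.smult_closed[of c x] by (simp add: ring_of_type_algebra_def)
  show 2: "x \<in> carrier A ==> (c + d) \<odot> x = c \<odot> x \<oplus> d \<odot> x" for x c d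
    using M.smult_l_distr[of c d x] by (simp add: ring_of_type_algebra_def)
  show "x \<in> carrier A ==> y \<in> carrier A ==> c \<odot> (x \<oplus> y) = c \<odot> x \<oplus> c \<odot> y"
    using M.smult_r_distr[of c x y] by (simp add: ring_of_type_algebra_def)
  show "x \<in> carrier A ==> (c * d) \<odot> x = c \<odot> (d \<odot> x)"
    using M.smult_assoc1[of c d x] by (simp add: ring_of_type_algebra_def)
  show 3: "x \<in> carrier A ==> 1 \<odot> x = x" for x
    using M.smult_one[of x] by (simp add: ring_of_type_algebra_def)
  show 4: "x \<in> carrier A ==> 0 \<odot> x = \<zero>" for x
    using M.smult_l_null[of x] by (simp add: ring_of_type_algebra_def)
  show "c \<odot> \<zero> = \<zero>"
    using M.smult_r_null[of c] by (simp add: ring_of_type_algebra_def)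
  show "(- 1) \<odot> x = \<ominus> x" if x: "x \<in> carrier A"
  proof -
    have "(- 1) \<odot> x \<oplus> x = \<zero>"
      using 2[OF x, of "- 1" 1] 3[OF x] 4[OF x] by simp
    then show ?thesis using M.minus_equality x 1 by metis
  qed
qed

lemma module_ring_of_typeI:
  fixes A :: "('r::comm_ring_1, 'v) module" (structure)
  assumes "abelian_group A"
    and "\<And>c x. x \<in> carrier A ==> c \<odot> x \<in> carrier A"
    and "\<And>c d x. x \<in> carrier A ==> (c + d) \<odot> x = c \<odot> x \<oplus> d \<odot> x"
    and "\<And>c x y. x \<in> carrier A ==> y \<in> carrier A ==>
          c \<odot> (x \<oplus> y) = c \<odot> x \<oplus> c \<odot> y"
    and "\<And>c d x. x \<in> carrier A ==> (c * d) \<odot> x = c \<odot> (d \<odot> x)"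
    and "\<And>x. x \<in> carrier A ==> 1 \<odot> x = x"
  shows "Module.module (ring_of_type_algebra :: 'r ring) A"
proof (rule moduleI)
  show "cring (ring_of_type_algebra :: 'r ring)" by (rule cring_from_type_algebra)
qed (use assms in \<open>auto simp: ring_of_type_algebra_def\<close>)

lemma additive_finsum:
  fixes A :: "('r::comm_ring_1, 'v) module" (structure) and f :: "'v => 's::comm_ring_1^'m::finite"
  assumes A: "nonassoc_algebra A"
    and f: "\<And>x y. x \<in> carrier A ==> y \<in> carrier A ==> f (x \<oplus> y) = f x + f y"
    and S: "finite S" "\<And>k. k \<in> S ==> e k \<in> carrier A"
  shows "f (finsum A e S) = (\<Sum>k\<in>S. f (e k))"
  using S
proof (induct S rule: finite_induct)
  case empty
  interpret M: abelian_group A by (rule nonassoc_algebraD(2)[OF A])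
  show ?case using f[of "\<zero>" "\<zero>"] by simp
next
  case (insert k S)
  interpret M: abelian_group A by (rule nonassoc_algebraD(2)[OF A])
  have "finsum A e (insert k S) = e k \<oplus> finsum A e S"
    using insert by (intro M.finsum_insert) auto
  moreover have "finsum A e S \<in> carrier A" using insert by (intro M.finsum_closed) auto
  ultimately show ?case using insert f by simp
qed

lemma finsum_coord_linear:
  fixes A :: "('r::comm_ring_1, 'v) module" (structure) and e :: "'n::finite => 'v" and x y :: "'r^'n"
  assumes A: "nonassoc_algebra A" and e: "\<And>k. e k \<in> carrier A"
  shows "(\<Oplus>k\<in>UNIV. ((x + y) $ k) \<odot> e k) =
      (\<Oplus>k\<in>UNIV. (x $ k) \<odot> e k) \<oplus> (\<Oplus>k\<in>UNIV. (y $ k) \<odot> e k)"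
    and "(\<Oplus>k\<in>UNIV. ((c *s x) $ k) \<odot> e k) = c \<odot> (\<Oplus>k\<in>UNIV. (x $ k) \<odot> e k)"
proof -
  note D = nonassoc_algebraD[OF A]
  interpret M: Module.module "ring_of_type_algebra :: 'r ring" A by (rule D(1))
  show "(\<Oplus>k\<in>UNIV. ((x + y) $ k) \<odot> e k) =
      (\<Oplus>k\<in>UNIV. (x $ k) \<odot> e k) \<oplus> (\<Oplus>k\<in>UNIV. (y $ k) \<odot> e k)"
    using e D(3) by (subst M.finsum_addf[symmetric]) (auto simp: D(4) intro!: M.finsum_cong')
  show "(\<Oplus>k\<in>UNIV. ((c *s x) $ k) \<odot> e k) = c \<odot> (\<Oplus>k\<in>UNIV. (x $ k) \<odot> e k)"
    using e D(3)
    by (subst M.finsum_smult_ldistr) (auto simp: D(6) ring_of_type_algebra_def intro!: M.finsum_cong')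
qed

lemma coord_algebra_basis:
  fixes A :: "('r::comm_ring_1, 'v) module" (structure) and e :: "'n::finite => 'v"
  assumes A: "nonassoc_algebra A" and e: "\<And>k. e k \<in> carrier A"
    and g: "g = (\<lambda>c::'r^'n. \<Oplus>k\<in>UNIV. (c $ k) \<odot> e k)"
    and bij: "bij_betw g UNIV (carrier A)"
  shows "\<exists>G. algebra_hom (coord_algebra G) A g"
  by (rule coord_algebra_isoI[OF A bij]) (simp_all only: g finsum_coord_linear[OF A e])

text \<open>
  Zorn's lemma gives a subspace \<open>S\<close> that contains \<open>W\<close> and is maximal among those
  without \<open>x0\<close>. Then \<open>S\<close> and \<open>x0\<close> span \<open>A\<close>, and the
  coefficient of \<open>x0\<close> is the functional. No basis of \<open>A\<close> is known at this point:
  finite dimensionality is what the functional serves to prove.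
\<close>

lemma exists_functional:
  fixes A :: "('a::field, 'v) module" (structure)
  assumes A: "nonassoc_algebra A"
    and W: "W \<subseteq> carrier A" "\<zero> \<in> W" "\<And>x y. x \<in> W ==> y \<in> W ==> x \<oplus> y \<in> W"
      "\<And>c x. x \<in> W ==> c \<odot> x \<in> W"
    and x0: "x0 \<in> carrier A" "x0 \<notin> W"
  shows "\<exists>f::'v => 'a. (\<forall>x\<in>carrier A. \<forall>y\<in>carrier A. f (x \<oplus> y) = f x + f y) \<and>
    (\<forall>c. \<forall>x\<in>carrier A. f (c \<odot> x) = c * f x) \<and> (\<forall>x\<in>W. f x = 0) \<and> f x0 = 1"
proof -
  note D = nonassoc_algebraD[OF A]
  interpret M: abelian_group A by (rule D(2))
  define subsp where "subsp S \<longleftrightarrow> W \<subseteq> S \<and> S \<subseteq> carrier A \<and> (\<forall>x\<in>S. \<forall>y\<in>S. x \<oplus> y \<in> S) \<and>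
    (\<forall>c. \<forall>x\<in>S. c \<odot> x \<in> S) \<and> x0 \<notin> S" for S
  have "\<exists>S\<in>Collect subsp. \<forall>T\<in>Collect subsp. S \<subseteq> T --> T = S"
  proof (rule subset_Zorn_nonempty)
    show "Collect subsp \<noteq> {}" using W x0 by (auto simp: subsp_def intro!: exI[of _ W])
  next
    fix C assume ne: "C \<noteq> {}" and ch: "subset.chain (Collect subsp) C"
    then have C: "\<And>S. S \<in> C ==> subsp S" and
      lin: "\<And>S T. S \<in> C ==> T \<in> C ==> S \<subseteq> T \<or> T \<subseteq> S"
      by (auto simp: subset_chain_def)
    have "x \<oplus> y \<in> \<Union>C" if h: "x \<in> \<Union>C" "y \<in> \<Union>C" for x y
    proof -
      obtain S T where "S \<in> C" "T \<in> C" "x \<in> S" "y \<in> T" using h by blast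
      then have "\<exists>S\<in>C. x \<in> S \<and> y \<in> S" using lin by (metis in_mono)
      then show ?thesis using C unfolding subsp_def by (metis UnionI)
    qed
    moreover have "c \<odot> x \<in> \<Union>C" if "x \<in> \<Union>C" for c x
      using that C unfolding subsp_def by (metis UnionE UnionI)
    moreover have "W \<subseteq> \<Union>C" "\<Union>C \<subseteq> carrier A" "x0 \<notin> \<Union>C"
      using ne C unfolding subsp_def by (blast+)
    ultimately show "\<Union>C \<in> Collect subsp" by (simp add: subsp_def)
  qed
  then obtain S where S: "subsp S" and max: "\<And>T. subsp T ==> S \<subseteq> T ==> T = S" by auto
  have Sc: "\<And>x. x \<in> S ==> x \<in> carrier A" and S0: "\<zero> \<in> S" and WS: "W \<subseteq> S" and x0S: "x0 \<notin> S"
    and Sadd: "\<And>x y. x \<in> S ==> y \<in> S ==> x \<oplus> y \<in> S"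
    and Sscale: "\<And>c x. x \<in> S ==> c \<odot> x \<in> S"
    using S W(2) by (auto simp: subsp_def)
  have ex: "\<exists>c. \<exists>s\<in>S. y = s \<oplus> c \<odot> x0" if y: "y \<in> carrier A" for y
  proof (cases "y \<in> S")
    case True
    then show ?thesis using x0 y D(8) by (intro exI[of _ 0] bexI[of _ y]) auto
  next
    case False
    \<comment> \<open>by maximality, adjoining \<open>y\<close> to \<open>S\<close> brings in \<open>x0\<close>\<close>
    define T where "T = {s \<oplus> d \<odot> y | s d. s \<in> S}"
    have yT: "y \<in> T"
      unfolding T_def using S0 y D(7) by (auto intro!: exI[of _ "\<zero>"] exI[of _ 1])
    have ST: "S \<subseteq> T"
    proof
      fix s assume s: "s \<in> S"
      then have "s = s \<oplus> 0 \<odot> y" using Sc y D(8) by simp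
      then show "s \<in> T" unfolding T_def using s by blast
    qed
    have "x0 \<in> T"
    proof (rule ccontr)
      assume "x0 \<notin> T"
      have "u \<oplus> v \<in> T" if h: "u \<in> T" "v \<in> T" for u v
      proof -
        obtain s d t e where *: "u = s \<oplus> d \<odot> y" "v = t \<oplus> e \<odot> y" "s \<in> S" "t \<in> S"
          using h unfolding T_def by blast
        have "u \<oplus> v = (s \<oplus> t) \<oplus> (d + e) \<odot> y"
          using * Sc y D(3,4) by (simp add: M.a_ac)
        then show ?thesis unfolding T_def using Sadd * by blast
      qed
      moreover have "c \<odot> u \<in> T" if h: "u \<in> T" for c u
      proof -
        obtain s d where *: "u = s \<oplus> d \<odot> y" "s \<in> S"
          using h unfolding T_def by blast
        have "c \<odot> u = c \<odot> s \<oplus> (c * d) \<odot> y"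
          using * Sc y D(3,5,6) by simp
        then show ?thesis unfolding T_def using Sscale * by blast
      qed
      moreover have "T \<subseteq> carrier A" unfolding T_def using Sc y D(3) by auto
      ultimately have "subsp T"
        using \<open>x0 \<notin> T\<close> ST WS unfolding subsp_def by blast
      then show False using max ST yT False by blast
    qed
    then obtain s d where s: "s \<in> S" and eq: "x0 = s \<oplus> d \<odot> y" unfolding T_def by blast
    have d: "d \<noteq> 0"
      using eq s Sc[OF s] D(8)[OF y] x0S by (metis M.r_zero)
    have "(- inverse d) \<odot> s \<oplus> inverse d \<odot> x0 =
        ((- inverse d) \<odot> s \<oplus> inverse d \<odot> s) \<oplus> (inverse d * d) \<odot> y"
      using s Sc y D(3,5,6) by (simp add: eq M.a_assoc)
    also have "\<dots> = y"
      using s Sc y D(4)[of s "- inverse d" "inverse d", symmetric] D(7,8) d by simp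
    finally show ?thesis
      using s Sscale by (intro exI[of _ "inverse d"] bexI[of _ "(- inverse d) \<odot> s"]) auto
  qed
  have uniq: "c = d" if "s \<in> S" "t \<in> S" and eq: "s \<oplus> c \<odot> x0 = t \<oplus> d \<odot> x0" for c d s t
  proof (rule ccontr)
    assume "c \<noteq> d"
    have mem: "s \<in> carrier A" "t \<in> carrier A" "c \<odot> x0 \<in> carrier A" "d \<odot> x0 \<in> carrier A"
      "(- 1) \<odot> s \<in> carrier A" "(- d) \<odot> x0 \<in> carrier A"
      using that Sc x0 D(3) by auto
    have "(c - d) \<odot> x0 = (((- 1) \<odot> s \<oplus> s) \<oplus> c \<odot> x0) \<oplus> (- d) \<odot> x0"
      using D(4)[OF x0(1), of c "- d"] D(10)[OF mem(1)] mem by (simp add: M.l_neg)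
    also have "\<dots> = (- 1) \<odot> s \<oplus> (s \<oplus> c \<odot> x0) \<oplus> (- d) \<odot> x0"
      using mem by (simp add: M.a_assoc)
    also have "\<dots> = (- 1) \<odot> s \<oplus> t \<oplus> (d \<odot> x0 \<oplus> (- d) \<odot> x0)"
      unfolding eq using mem by (simp add: M.a_assoc)
    also have "\<dots> = (- 1) \<odot> s \<oplus> t"
      using D(4)[OF x0(1), of d "- d"] D(8)[OF x0(1)] mem by simp
    finally have "(c - d) \<odot> x0 \<in> S" using that Sadd Sscale by simp
    then have "inverse (c - d) \<odot> ((c - d) \<odot> x0) \<in> S" by (rule Sscale)
    then show False
      using D(6)[OF x0(1), of "inverse (c - d)" "c - d"] D(7)[OF x0(1)] \<open>c \<noteq> d\<close> x0S by simp
  qed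
  define f where "f y = (THE c. \<exists>s\<in>S. y = s \<oplus> c \<odot> x0)" for y
  have feq: "f y = c" if "s \<in> S" "y = s \<oplus> c \<odot> x0" for y c s
    unfolding f_def by (rule the_equality) (use that uniq in blast)+
  show ?thesis
  proof (intro exI[of _ f] conjI ballI allI)
    fix x y assume x: "x \<in> carrier A" and y: "y \<in> carrier A"
    obtain c s d t where *: "x = s \<oplus> c \<odot> x0" "y = t \<oplus> d \<odot> x0" "s \<in> S" "t \<in> S"
      using ex[OF x] ex[OF y] by blast
    have "x \<oplus> y = (s \<oplus> t) \<oplus> (c + d) \<odot> x0"
      using * Sc x0 D(3,4) by (simp add: M.a_ac)
    from feq[OF Sadd[OF *(3,4)] this] show "f (x \<oplus> y) = f x + f y"
      using feq[OF *(3) *(1)] feq[OF *(4) *(2)] by simp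
  next
    fix k x assume x: "x \<in> carrier A"
    obtain c s where *: "x = s \<oplus> c \<odot> x0" "s \<in> S" using ex[OF x] by blast
    have "k \<odot> x = k \<odot> s \<oplus> (k * c) \<odot> x0"
      using * Sc x0 D(3,5,6) by simp
    from feq[OF Sscale[OF *(2)] this] show "f (k \<odot> x) = k * f x" using feq[OF *(2,1)] by simp
  next
    fix x assume "x \<in> W"
    then have "x \<in> S" using WS by blast
    then show "f x = 0" using feq[of x x 0] Sc x0 D(8) by simp
  next
    show "f x0 = 1" using feq[of "\<zero>" x0 1] S0 x0 D(7) by simp
  qed
qed

section \<open>Extension of scalars in coordinates\<close>

text \<open>
  Ring homomorphisms, as functions between types. The maps used later are the embedding into the algebraic
  closure and the reduction of the integers into a field.
\<close>

locale scalar_map =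
  fixes \<phi> :: "'r::comm_ring_1 => 's::comm_ring_1"
  assumes one [simp]: "\<phi> 1 = 1" and add: "\<phi> (x + y) = \<phi> x + \<phi> y" and mult: "\<phi> (x * y) = \<phi> x * \<phi> y"
begin

lemma zero [simp]: "\<phi> 0 = 0" using add[of 0 0] by simp

lemma minus: "\<phi> (- x) = - \<phi> x" using add[of x "- x"] by (simp add: eq_neg_iff_add_eq_0 add.commute)

lemma diff: "\<phi> (x - y) = \<phi> x - \<phi> y" using add[of x "- y"] by (simp add: minus)

lemma sum: "\<phi> (\<Sum>i\<in>I. f i) = (\<Sum>i\<in>I. \<phi> (f i))"
  by (induct I rule: infinite_finite_induct) (auto simp: add)

end

lemma field_map_eq_0_iff: "scalar_map \<phi> ==> \<phi> x = 0 \<longleftrightarrow> x = 0"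
  for \<phi> :: "'a::field => 's::field"
  using scalar_map.mult[of \<phi> x "inverse x"] scalar_map.one[of \<phi>] scalar_map.zero[of \<phi>]
  by (cases "x = 0") auto

lemma field_map_inj: "scalar_map \<phi> ==> \<phi> x = \<phi> y \<longleftrightarrow> x = y"
  for \<phi> :: "'a::field => 's::field"
  using field_map_eq_0_iff[of \<phi> "x - y"] scalar_map.diff[of \<phi> x y] by simp

definition map_vec :: "('r => 's) => 'r^'n::finite => 's^'n" where
  "map_vec \<phi> x = (\<chi> i. \<phi> (x $ i))"

lemma map_vec_nth [simp]: "map_vec \<phi> x $ i = \<phi> (x $ i)"
  by (simp add: map_vec_def)

definition base_change ::
  "('r => 's) => ('r::comm_ring_1, 'n::finite) table => ('s::comm_ring_1, 'n) table" where
  "base_change \<phi> G i j = map_vec \<phi> (G i j)"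

context scalar_map
begin

lemma map_vec_add: "map_vec \<phi> (x + y) = map_vec \<phi> x + map_vec \<phi> y"
  by (simp add: vec_eq_iff add)

lemma map_vec_minus: "map_vec \<phi> (- x) = - map_vec \<phi> x"
  by (simp add: vec_eq_iff minus)

lemma map_vec_diff: "map_vec \<phi> (x - y) = map_vec \<phi> x - map_vec \<phi> y"
  by (simp add: vec_eq_iff diff)

lemma map_vec_scale: "map_vec \<phi> (c *s x) = \<phi> c *s map_vec \<phi> x"
  by (simp add: vec_eq_iff mult)

lemma map_vec_0 [simp]: "map_vec \<phi> 0 = 0"
  by (simp add: vec_eq_iff)

lemma map_vec_sum: "map_vec \<phi> (\<Sum>i\<in>I. f i) = (\<Sum>i\<in>I. map_vec \<phi> (f i))"
  by (simp add: vec_eq_iff sum)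

lemma map_vec_axis [simp]: "map_vec \<phi> (axis i 1) = axis i 1"
  by (simp add: vec_eq_iff axis_def)

lemma map_vec_sc_mult:
  "map_vec \<phi> (sc_mult G x y) = sc_mult (base_change \<phi> G) (map_vec \<phi> x) (map_vec \<phi> y)"
  by (simp add: sc_mult_def map_vec_sum map_vec_scale base_change_def mult)

end

lemma base_change_base_change:
  "base_change \<psi> (base_change \<phi> G) = base_change (\<psi> \<circ> \<phi>) G"
  by (simp add: fun_eq_iff base_change_def vec_eq_iff)

text \<open>
  The universal property of the free module: the linear extension of a map defined on the generators.
\<close>

definition lin_ext :: "('v => 's::comm_ring_1^'m) => ('v => 's) => 's^'m" where
  "lin_ext w u = (\<Sum>x | u x \<noteq> 0. u x *s w x)"

lemma lin_ext_superset:
  "finite S ==> {x. u x \<noteq> 0} \<subseteq> S ==> lin_ext w u = (\<Sum>x\<in>S. u x *s w x)"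
  unfolding lin_ext_def by (rule sum.mono_neutral_left) auto

lemma lin_ext_add:
  assumes "finite {x. u x \<noteq> 0}" "finite {x. v x \<noteq> 0}"
  shows "lin_ext w (\<lambda>z. u z + v z) = lin_ext w u + lin_ext w v"
proof -
  let ?S = "{x. u x \<noteq> 0} \<union> {x. v x \<noteq> 0}"
  have "lin_ext w (\<lambda>z. u z + v z) = (\<Sum>x\<in>?S. (u x + v x) *s w x)"
    using assms by (intro lin_ext_superset) auto
  also have "\<dots> = (\<Sum>x\<in>?S. u x *s w x) + (\<Sum>x\<in>?S. v x *s w x)"
    by (simp add: sum.distrib vector_sadd_rdistrib)
  also have "\<dots> = lin_ext w u + lin_ext w v"
    using assms by (simp add: lin_ext_superset[of ?S u] lin_ext_superset[of ?S v])
  finally show ?thesis .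
qed

lemma lin_ext_scale:
  assumes "finite {x. u x \<noteq> 0}"
  shows "lin_ext w (\<lambda>z. c * u z) = c *s lin_ext w u"
proof -
  have "lin_ext w (\<lambda>z. c * u z) = (\<Sum>x | u x \<noteq> 0. (c * u x) *s w x)"
    using assms by (intro lin_ext_superset) auto
  then show ?thesis by (simp add: lin_ext_def scale_sum_right vector_scale_scale)
qed

lemma lin_ext_single [simp]: "lin_ext w (single_fun x) = w x"
proof -
  have "lin_ext w (single_fun x) = (\<Sum>y\<in>{x}. single_fun x y *s w y)"
    by (rule lin_ext_superset) (auto simp: single_fun_def)
  then show ?thesis by (simp add: single_fun_def)
qed

lemma lin_ext_mult:
  fixes A (structure)
  assumes u: "finite {x. u x \<noteq> 0}" and v: "finite {x. v x \<noteq> 0}"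
  shows "lin_ext w (u \<otimes>\<^bsub>free_algebra A\<^esub> v) =
    (\<Sum>x | u x \<noteq> 0. \<Sum>y | v y \<noteq> 0. (u x * v y) *s w (x \<otimes> y))"
proof -
  let ?U = "{x. u x \<noteq> 0}" and ?V = "{x. v x \<noteq> 0}"
  define S where "S = (\<lambda>(x, y). x \<otimes> y) ` (?U \<times> ?V)"
  have S: "finite S" using u v by (simp add: S_def)
  have memS: "x \<otimes> y \<in> S" if "u x \<noteq> 0" "v y \<noteq> 0" for x y
    using that unfolding S_def by force
  have m: "(u \<otimes>\<^bsub>free_algebra A\<^esub> v) z = (\<Sum>x\<in>?U. \<Sum>y\<in>?V. if x \<otimes> y = z then u x * v y else 0)" for z
    by (simp add: free_algebra_def)
  have supp: "{z. (u \<otimes>\<^bsub>free_algebra A\<^esub> v) z \<noteq> 0} \<subseteq> S"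
  proof
    fix z assume z: "z \<in> {z. (u \<otimes>\<^bsub>free_algebra A\<^esub> v) z \<noteq> 0}"
    show "z \<in> S"
    proof (rule ccontr)
      assume "z \<notin> S"
      then have "(u \<otimes>\<^bsub>free_algebra A\<^esub> v) z = 0"
        unfolding m using memS by (intro sum.neutral ballI) auto
      with z show False by simp
    qed
  qed
  have "lin_ext w (u \<otimes>\<^bsub>free_algebra A\<^esub> v) =
      (\<Sum>z\<in>S. (\<Sum>x\<in>?U. \<Sum>y\<in>?V. if x \<otimes> y = z then u x * v y else 0) *s w z)"
    unfolding lin_ext_superset[OF S supp] by (intro sum.cong refl) (simp only: m)
  also have "\<dots> = (\<Sum>z\<in>S. \<Sum>x\<in>?U. \<Sum>y\<in>?V. if x \<otimes> y = z then (u x * v y) *s w z else 0)"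
    unfolding scale_sum_left by (intro sum.cong refl) auto
  also have "\<dots> = (\<Sum>x\<in>?U. \<Sum>y\<in>?V. \<Sum>z\<in>S. if x \<otimes> y = z then (u x * v y) *s w z else 0)"
    by (rule trans[OF sum.swap]) (rule sum.cong[OF refl], rule sum.swap)
  also have "\<dots> = (\<Sum>x\<in>?U. \<Sum>y\<in>?V. (u x * v y) *s w (x \<otimes> y))"
    using memS S by (intro sum.cong refl) simp
  finally show ?thesis .
qed

lemma free_algebra_simps:
  "u \<in> carrier (free_algebra A) \<longleftrightarrow> finite {x. u x \<noteq> 0} \<and> {x. u x \<noteq> 0} \<subseteq> carrier A"
  "\<zero>\<^bsub>free_algebra A\<^esub> = (\<lambda>z. 0)" "u \<oplus>\<^bsub>free_algebra A\<^esub> v = (\<lambda>z. u z + v z)"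
  "c \<odot>\<^bsub>free_algebra A\<^esub> u = (\<lambda>z. c * u z)"
  by (simp_all add: free_algebra_def)

lemma free_algebra_add_closed:
  "u \<in> carrier (free_algebra A) ==> v \<in> carrier (free_algebra A) ==>
    (\<lambda>z. u z + v z) \<in> carrier (free_algebra A)"
proof -
  assume uv: "u \<in> carrier (free_algebra A)" "v \<in> carrier (free_algebra A)"
  have "{x. u x + v x \<noteq> 0} \<subseteq> {x. u x \<noteq> 0} \<union> {x. v x \<noteq> 0}" by auto
  moreover have "finite ({x. u x \<noteq> 0} \<union> {x. v x \<noteq> 0})" "{x. u x \<noteq> 0} \<union> {x. v x \<noteq> 0} \<subseteq> carrier A"
    using uv by (auto simp: free_algebra_simps)
  ultimately show ?thesis unfolding free_algebra_simps by (meson finite_subset subset_trans)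
qed

lemma free_algebra_scale_closed:
  "u \<in> carrier (free_algebra A) ==> (\<lambda>z. c * u z) \<in> carrier (free_algebra A)"
  unfolding free_algebra_simps by (auto intro: finite_subset[of _ "{x. u x \<noteq> 0}"])

lemma abelian_group_free_algebra: "abelian_group (free_algebra A :: ('s::comm_ring_1, 'v => 's) module)"
proof (rule abelian_groupI)
  fix u v :: "'v => 's" assume u: "u \<in> carrier (free_algebra A)"
  show "\<exists>v\<in>carrier (free_algebra A). v \<oplus>\<^bsub>free_algebra A\<^esub> u = \<zero>\<^bsub>free_algebra A\<^esub>"
    using free_algebra_scale_closed[OF u, of "- 1"]
    by (intro bexI[of _ "\<lambda>z. - 1 * u z"]) (auto simp: free_algebra_simps)
  assume "v \<in> carrier (free_algebra A)"
  then show "u \<oplus>\<^bsub>free_algebra A\<^esub> v \<in> carrier (free_algebra A)"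
    using free_algebra_add_closed[OF u] by (simp add: free_algebra_simps(3))
qed (auto simp: free_algebra_simps algebra_simps)

lemma module_free_algebra:
  "Module.module (ring_of_type_algebra :: 's ring) (free_algebra A :: ('s::comm_ring_1, 'v => 's) module)"
  by (rule module_ring_of_typeI)
    (use abelian_group_free_algebra free_algebra_scale_closed in
      \<open>auto simp: free_algebra_simps(3,4) algebra_simps\<close>)

lemma closed_free_algebra:
  assumes "closed_algebra A" shows "closed_algebra (free_algebra A :: ('s::comm_ring_1, 'v => 's) module)"
proof -
  have "u \<otimes>\<^bsub>free_algebra A\<^esub> v \<in> carrier (free_algebra A)"
    if u: "u \<in> carrier (free_algebra A)" and v: "v \<in> carrier (free_algebra A)" for u v :: "'v => 's"
  proof -
    let ?S = "(\<lambda>(x, y). x \<otimes>\<^bsub>A\<^esub> y) ` ({x. u x \<noteq> 0} \<times> {x. v x \<noteq> 0})"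
    have "(u \<otimes>\<^bsub>free_algebra A\<^esub> v) z = 0" if "z \<notin> ?S" for z
      unfolding free_algebra_def using that by (auto intro!: sum.neutral)
    then have sub: "{z. (u \<otimes>\<^bsub>free_algebra A\<^esub> v) z \<noteq> 0} \<subseteq> ?S" by blast
    moreover have "finite ?S" using u v by (simp add: free_algebra_simps)
    moreover have "?S \<subseteq> carrier A" using u v assms by (auto simp: free_algebra_simps closed_algebra_def)
    ultimately show ?thesis unfolding free_algebra_simps by (meson finite_subset subset_trans)
  qed
  then show ?thesis
    using free_algebra_add_closed free_algebra_scale_closed
    unfolding closed_algebra_def by (auto simp: free_algebra_simps(3,4))
qed

lemma single_fun_mem: "x \<in> carrier A ==> (single_fun x :: 'v => 's::comm_ring_1) \<in> carrier (free_algebra A)"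
  by (auto simp: free_algebra_simps single_fun_def intro: finite_subset[of _ "{x}"])

definition tensor_kernel :: "('r => 's::comm_ring_1) => ('r, 'v) module => ('v => 's) set" where
  "tensor_kernel \<phi> A =
     \<Inter>{N. submodule N (ring_of_type_algebra :: 's ring) (free_algebra A :: ('s, 'v => 's) module) \<and>
        tensor_relations \<phi> A \<subseteq> N}"

lemma scalar_extension_eq: "scalar_extension \<phi> A = quotient_algebra (free_algebra A) (tensor_kernel \<phi> A)"
  by (simp add: scalar_extension_def tensor_kernel_def)

lemma tensor_relations_memI:
  "x \<in> carrier A ==> y \<in> carrier A ==>
     (\<lambda>z. single_fun (x \<oplus>\<^bsub>A\<^esub> y) z - single_fun x z - single_fun y z) \<in> tensor_relations \<phi> A"
  "x \<in> carrier A ==>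
     (\<lambda>z. single_fun (c \<odot>\<^bsub>A\<^esub> x) z - \<phi> c * single_fun x z) \<in> tensor_relations \<phi> A"
  by (auto simp: tensor_relations_def)

lemma tensor_kernel_closed:
  fixes A :: "('r, 'v) module" and \<phi> :: "'r => 's::comm_ring_1"
  shows "tensor_relations \<phi> A \<subseteq> tensor_kernel \<phi> A"
    and "(\<lambda>z. 0) \<in> tensor_kernel \<phi> A"
    and "u \<in> tensor_kernel \<phi> A ==> v \<in> tensor_kernel \<phi> A ==> (\<lambda>z. u z + v z) \<in> tensor_kernel \<phi> A"
    and "u \<in> tensor_kernel \<phi> A ==> (\<lambda>z. c * u z) \<in> tensor_kernel \<phi> A"
proof -
  let ?M = "free_algebra A :: ('s, 'v => 's) module"
  interpret M: Module.module "ring_of_type_algebra :: 's ring" ?M by (rule module_free_algebra)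
  have sm: "(\<lambda>z. 0) \<in> N" "u \<in> N ==> v \<in> N ==> (\<lambda>z. u z + v z) \<in> N"
    "u \<in> N ==> (\<lambda>z. c * u z) \<in> N"
    if N: "submodule N (ring_of_type_algebra :: 's ring) ?M" for N u v c
  proof -
    show "(\<lambda>z. 0) \<in> N"
      using subgroup.one_closed[OF submodule.axioms(1)[OF N]] by (simp add: free_algebra_simps)
    show "u \<in> N ==> v \<in> N ==> (\<lambda>z. u z + v z) \<in> N"
      using M.submoduleE(5)[OF N, of u v] by (simp add: free_algebra_simps)
    show "u \<in> N ==> (\<lambda>z. c * u z) \<in> N"
      using M.submoduleE(4)[OF N, of c u] by (simp add: free_algebra_simps ring_of_type_algebra_def)
  qed
  show "tensor_relations \<phi> A \<subseteq> tensor_kernel \<phi> A" unfolding tensor_kernel_def by blast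
  show "(\<lambda>z. 0) \<in> tensor_kernel \<phi> A" unfolding tensor_kernel_def using sm(1) by blast
  show "u \<in> tensor_kernel \<phi> A ==> v \<in> tensor_kernel \<phi> A ==> (\<lambda>z. u z + v z) \<in> tensor_kernel \<phi> A"
    unfolding tensor_kernel_def using sm(2) by blast
  show "u \<in> tensor_kernel \<phi> A ==> (\<lambda>z. c * u z) \<in> tensor_kernel \<phi> A"
    unfolding tensor_kernel_def using sm(3) by blast
qed

lemma tensor_kernel_sum:
  "(\<And>k. k \<in> S ==> u k \<in> tensor_kernel \<phi> A) ==> (\<lambda>z. \<Sum>k\<in>S. u k z) \<in> tensor_kernel \<phi> A"
  by (induct S rule: infinite_finite_induct) (auto simp: tensor_kernel_closed)

text \<open>The functions with this property form a submodule that contains the defining relations.\<close>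

lemma lin_ext_tensor_kernel:
  fixes A :: "('r::comm_ring_1, 'v) module" (structure) and \<phi> :: "'r => 's::comm_ring_1" and w :: "'v => 's^'m"
  assumes A: "closed_algebra A"
    and add: "\<And>x y. x \<in> carrier A ==> y \<in> carrier A ==> w (x \<oplus> y) = w x + w y"
    and scale: "\<And>c x. x \<in> carrier A ==> w (c \<odot> x) = \<phi> c *s w x"
    and u: "u \<in> tensor_kernel \<phi> A"
  shows "u \<in> carrier (free_algebra A) \<and> lin_ext w u = 0"
proof -
  let ?M = "free_algebra A :: ('s, 'v => 's) module"
  interpret M: Module.module "ring_of_type_algebra :: 's ring" ?M by (rule module_free_algebra)
  define N where "N = {u \<in> carrier ?M. lin_ext w u = 0}"
  have fin: "finite {x. u x \<noteq> 0}" if "u \<in> carrier ?M" for u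
    using that by (simp add: free_algebra_simps)
  have "submodule N (ring_of_type_algebra :: 's ring) ?M"
  proof (rule M.submoduleI)
    show "N \<subseteq> carrier ?M" by (auto simp: N_def)
    show "\<zero>\<^bsub>?M\<^esub> \<in> N" unfolding N_def by (simp add: lin_ext_def free_algebra_simps(2)) (simp add: free_algebra_simps)
    show scN: "c \<odot>\<^bsub>?M\<^esub> u \<in> N" if "u \<in> N" for c u
      using that free_algebra_scale_closed[of u A c] lin_ext_scale[OF fin, of u w c]
      by (simp add: N_def free_algebra_simps(4))
    show "u \<oplus>\<^bsub>?M\<^esub> v \<in> N" if "u \<in> N" "v \<in> N" for u v
      using that free_algebra_add_closed[of u A v] lin_ext_add[OF fin fin, of u v w]
      by (simp add: N_def free_algebra_simps(3))
    show "\<ominus>\<^bsub>?M\<^esub> u \<in> N" if u: "u \<in> N" for u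
    proof -
      have "(- 1) \<odot>\<^bsub>?M\<^esub> u \<oplus>\<^bsub>?M\<^esub> u = \<zero>\<^bsub>?M\<^esub>" by (simp add: free_algebra_simps)
      moreover have "u \<in> carrier ?M" "(- 1) \<odot>\<^bsub>?M\<^esub> u \<in> carrier ?M"
        using u scN[OF u, of "- 1"] by (auto simp: N_def)
      ultimately have "\<ominus>\<^bsub>?M\<^esub> u = (- 1) \<odot>\<^bsub>?M\<^esub> u" by (rule M.minus_equality)
      then show ?thesis using scN[OF u] by simp
    qed
  qed
  moreover have "tensor_relations \<phi> A \<subseteq> N"
  proof
    fix r assume "r \<in> tensor_relations \<phi> A"
    then consider x y where "x \<in> carrier A" "y \<in> carrier A"
        "r = (\<lambda>z. single_fun (x \<oplus> y) z - single_fun x z - single_fun y z)"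
      | c x where "x \<in> carrier A" "r = (\<lambda>z. single_fun (c \<odot> x) z - \<phi> c * single_fun x z)"
      unfolding tensor_relations_def by blast
    then show "r \<in> N"
    proof cases
      case 1
      note m = single_fun_mem[where 's = 's]
      have xy: "x \<oplus> y \<in> carrier A" using A 1 by (simp add: closed_algebra_def)
      have r: "r = (\<lambda>z. single_fun (x \<oplus> y) z + - 1 * (single_fun x z + single_fun y z))"
        by (simp add: 1(3) fun_eq_iff)
      note m2 = free_algebra_add_closed[OF m[OF 1(1)] m[OF 1(2)]]
      note m3 = free_algebra_scale_closed[OF m2, of "- 1"]
      have "r \<in> carrier ?M" unfolding r by (rule free_algebra_add_closed[OF m[OF xy] m3])
      moreover have "lin_ext w r = 0"
        unfolding r lin_ext_add[OF fin[OF m[OF xy]] fin[OF m3]] lin_ext_scale[OF fin[OF m2]]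
          lin_ext_add[OF fin[OF m[OF 1(1)]] fin[OF m[OF 1(2)]]]
        using 1 by (simp add: add vec_eq_iff)
      ultimately show ?thesis by (simp add: N_def)
    next
      case 2
      note m = single_fun_mem[where 's = 's]
      have cx: "c \<odot> x \<in> carrier A" using A 2 by (simp add: closed_algebra_def)
      have r: "r = (\<lambda>z. single_fun (c \<odot> x) z + - \<phi> c * single_fun x z)"
        by (simp add: 2(2) fun_eq_iff)
      note m3 = free_algebra_scale_closed[OF m[OF 2(1)], of "- \<phi> c"]
      have "r \<in> carrier ?M" unfolding r by (rule free_algebra_add_closed[OF m[OF cx] m3])
      moreover have "lin_ext w r = 0"
        unfolding r lin_ext_add[OF fin[OF m[OF cx]] fin[OF m3]] lin_ext_scale[OF fin[OF m[OF 2(1)]]]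
        using 2 by (simp add: scale vec_eq_iff)
      ultimately show ?thesis by (simp add: N_def)
    qed
  qed
  ultimately have "tensor_kernel \<phi> A \<subseteq> N" unfolding tensor_kernel_def by blast
  then show ?thesis using u by (auto simp: N_def)
qed

text \<open>
  The basis gives a linear map from the free module to coordinate vectors. Its kernel is the module of
  relations, since modulo the relations each generator is a combination of the finitely many basis generators.
\<close>

theorem scalar_extension_coord:
  fixes A :: "('r::comm_ring_1, 'v) module" (structure) and G :: "('r, 'n::finite) table"
    and \<phi> :: "'r => 's::comm_ring_1"
  assumes \<phi>: "scalar_map \<phi>" and iso: "algebra_iso (coord_algebra G) A"
  shows "algebra_iso (coord_algebra (base_change \<phi> G)) (scalar_extension \<phi> A)"
proof -
  interpret \<phi>: scalar_map \<phi> by fact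
  have cA: "closed_algebra A" by (rule closed_algebra_iso[OF closed_coord_algebra iso])
  obtain g where g: "algebra_hom (coord_algebra G) A g" and bij: "bij_betw g UNIV (carrier A)"
    using iso by (auto elim!: algebra_isoE)
  define f where "f = the_inv_into UNIV g"
  have f: "algebra_hom A (coord_algebra G) f"
    using algebra_hom_inv[OF closed_coord_algebra g] bij by (simp add: f_def)
  have fg: "f (g x) = x" for x
    unfolding f_def using bij by (simp add: bij_betw_def the_inv_into_f_f)
  have gf: "g (f x) = x" if "x \<in> carrier A" for x
    unfolding f_def using bij that by (simp add: bij_betw_def f_the_inv_into_f)
  have gmem: "g x \<in> carrier A" for x using bij by (auto simp: bij_betw_def)
  have gadd: "g (x + y) = g x \<oplus> g y" and gscale: "g (c *s x) = c \<odot> g x" for x y c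
    using algebra_homD[OF g] by auto
  let ?M = "free_algebra A :: ('s, 'v => 's) module"
  let ?B = "coord_algebra (base_change \<phi> G)"
  define w where "w x = map_vec \<phi> (f x)" for x
  have wadd: "w (x \<oplus> y) = w x + w y" if "x \<in> carrier A" "y \<in> carrier A" for x y
    using algebra_homD(2)[OF f that] by (simp add: w_def \<phi>.map_vec_add)
  have wscale: "w (c \<odot> x) = \<phi> c *s w x" if "x \<in> carrier A" for c x
    using algebra_homD(3)[OF f that, of c] by (simp add: w_def \<phi>.map_vec_scale)
  have fin: "finite {x. u x \<noteq> 0}" if "u \<in> carrier ?M" for u
    using that by (simp add: free_algebra_simps)
  note K = tensor_kernel_closed[where \<phi> = \<phi> and A = A]
  define e where "e k = g (axis k 1)" for k
  have w_e: "w (e k) = axis k 1" for k by (simp add: w_def e_def fg)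
  \<comment> \<open>modulo the relations, every generator is the combination of the basis given by its coordinates\<close>
  have partial: "(\<lambda>z. single_fun (g (\<Sum>k\<in>S. (c $ k) *s axis k 1)) z - (\<Sum>k\<in>S. \<phi> (c $ k) * single_fun (e k) z))
      \<in> tensor_kernel \<phi> A" for c and S :: "'n set"
  proof (induct S rule: infinite_finite_induct)
    case (infinite S) then show ?case using finite by blast
  next
    case empty
    have "g 0 = 0 \<odot> g 0" using gscale[of 0 0] by simp
    moreover have "(\<lambda>z. single_fun (0 \<odot> g 0) z - \<phi> 0 * single_fun (g 0) z) \<in> tensor_kernel \<phi> A"
      using K(1) tensor_relations_memI(2)[OF gmem, of 0 0 \<phi>] by blast
    ultimately show ?case by simp
  next
    case (insert k S)
    let ?s = "\<Sum>k\<in>S. (c $ k) *s axis k 1" and ?t = "(c $ k) *s axis k (1::'r)"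
    have 1: "(\<lambda>z. single_fun (g ?t \<oplus> g ?s) z - single_fun (g ?t) z - single_fun (g ?s) z) \<in> tensor_kernel \<phi> A"
      using K(1) tensor_relations_memI(1)[OF gmem gmem, of ?t ?s \<phi>] by blast
    have 2: "(\<lambda>z. single_fun (c $ k \<odot> e k) z - \<phi> (c $ k) * single_fun (e k) z) \<in> tensor_kernel \<phi> A"
      using K(1) tensor_relations_memI(2)[OF gmem, of "c $ k" "axis k 1" \<phi>] unfolding e_def by blast
    have "g (\<Sum>k\<in>insert k S. (c $ k) *s axis k 1) = g ?t \<oplus> g ?s"
      using insert(1,2) by (simp add: gadd)
    moreover have "c $ k \<odot> e k = g ?t" by (simp add: gscale e_def)
    ultimately show ?case
      using K(3)[OF K(3)[OF 1 2] insert(3)] insert(1,2) by (simp add: algebra_simps)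
  qed
  have generator: "(\<lambda>z. single_fun x z - (\<Sum>k\<in>UNIV. w x $ k * single_fun (e k) z)) \<in> tensor_kernel \<phi> A"
    if "x \<in> carrier A" for x
    using partial[of "f x" UNIV] gf[OF that] by (simp add: basis_expansion_ring w_def)
  have kernel: "tensor_kernel \<phi> A = {u \<in> carrier ?M. lin_ext w u = \<zero>\<^bsub>?B\<^esub>}"
  proof (intro subset_antisym subsetI)
    fix u assume "u \<in> tensor_kernel \<phi> A"
    then show "u \<in> {u \<in> carrier ?M. lin_ext w u = \<zero>\<^bsub>?B\<^esub>}"
      using lin_ext_tensor_kernel[OF cA wadd wscale] by auto
  next
    fix u assume "u \<in> {u \<in> carrier ?M. lin_ext w u = \<zero>\<^bsub>?B\<^esub>}"
    then have u: "u \<in> carrier ?M" and 0: "(\<Sum>x | u x \<noteq> 0. u x *s w x) = 0"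
      by (auto simp: lin_ext_def)
    let ?S = "{x. u x \<noteq> 0}"
    have "(\<lambda>z. \<Sum>x\<in>?S. u x * (single_fun x z - (\<Sum>k\<in>UNIV. w x $ k * single_fun (e k) z))) \<in> tensor_kernel \<phi> A"
      using u generator by (intro tensor_kernel_sum K(4)) (auto simp: free_algebra_simps)
    moreover have "(\<Sum>x\<in>?S. u x * (single_fun x z - (\<Sum>k\<in>UNIV. w x $ k * single_fun (e k) z))) = u z" for z
    proof -
      have "(\<Sum>x\<in>?S. u x * (\<Sum>k\<in>UNIV. w x $ k * single_fun (e k) z)) =
          (\<Sum>k\<in>UNIV. (\<Sum>x\<in>?S. u x *s w x) $ k * single_fun (e k) z)"
        unfolding sum_distrib_left sum_component sum_distrib_right
        by (subst sum.swap) (simp add: mult.assoc)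
      moreover have "(\<Sum>x\<in>?S. u x * single_fun x z) = u z"
        using fin[OF u] by (simp add: single_fun_def if_distrib cong: if_cong)
      ultimately show ?thesis by (simp add: right_diff_distrib sum_subtractf 0)
    qed
    ultimately show "u \<in> tensor_kernel \<phi> A" by simp
  qed
  have hom: "algebra_hom ?M ?B (lin_ext w)"
  proof (rule algebra_homI)
    fix u v assume u: "u \<in> carrier ?M" and v: "v \<in> carrier ?M"
    show "lin_ext w (u \<oplus>\<^bsub>?M\<^esub> v) = lin_ext w u \<oplus>\<^bsub>?B\<^esub> lin_ext w v"
      using lin_ext_add[OF fin[OF u] fin[OF v]] by (simp add: free_algebra_simps(3))
    have "w (x \<otimes> y) = sc_mult (base_change \<phi> G) (w x) (w y)" if "u x \<noteq> 0" "v y \<noteq> 0" for x y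
    proof -
      have "x \<in> carrier A" "y \<in> carrier A" using u v that by (auto simp: free_algebra_simps)
      then show ?thesis using algebra_homD(4)[OF f] by (simp add: w_def \<phi>.map_vec_sc_mult)
    qed
    then have "lin_ext w (u \<otimes>\<^bsub>?M\<^esub> v) =
        (\<Sum>x | u x \<noteq> 0. \<Sum>y | v y \<noteq> 0. (u x * v y) *s sc_mult (base_change \<phi> G) (w x) (w y))"
      unfolding lin_ext_mult[OF fin[OF u] fin[OF v]] by (intro sum.cong refl) auto
    also have "\<dots> = sc_mult (base_change \<phi> G) (lin_ext w u) (lin_ext w v)"
      unfolding lin_ext_def sc_mult_sum sc_mult_scale vector_scale_scale scale_sum_right
      by (rule trans[OF sum.swap]) (simp add: mult.commute)
    finally show "lin_ext w (u \<otimes>\<^bsub>?M\<^esub> v) = lin_ext w u \<otimes>\<^bsub>?B\<^esub> lin_ext w v" by simp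
  next
    fix c u assume u: "u \<in> carrier ?M"
    show "lin_ext w (c \<odot>\<^bsub>?M\<^esub> u) = c \<odot>\<^bsub>?B\<^esub> lin_ext w u"
      using lin_ext_scale[OF fin[OF u]] by (simp add: free_algebra_simps(4))
  qed simp
  have surj: "lin_ext w ` carrier ?M = carrier ?B"
  proof -
    have "\<exists>u\<in>carrier ?M. lin_ext w u = (\<Sum>k\<in>S. (y $ k) *s axis k 1)" for y and S :: "'n set"
    proof (induct S rule: infinite_finite_induct)
      case (insert k S)
      then obtain u where u: "u \<in> carrier ?M" "lin_ext w u = (\<Sum>k\<in>S. (y $ k) *s axis k 1)" by blast
      have ek: "e k \<in> carrier A" by (simp add: e_def gmem)
      note m = single_fun_mem[OF ek, where 's = 's]
      note m2 = free_algebra_scale_closed[OF m, of "y $ k"]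
      show ?case
        using insert(1,2) free_algebra_add_closed[OF m2 u(1)]
        by (intro bexI[of _ "\<lambda>z. y $ k * single_fun (e k) z + u z"])
          (simp_all add: lin_ext_add[OF fin[OF m2] fin[OF u(1)]] lin_ext_scale[OF fin[OF m]] u(2) w_e)
    next
      case empty
      then show ?case by (intro bexI[of _ "\<lambda>z. 0"]) (simp_all add: lin_ext_def free_algebra_simps)
    qed auto
    from this[of _ UNIV] have "y \<in> lin_ext w ` carrier ?M" for y
      unfolding basis_expansion_ring by (metis imageI)
    then show ?thesis by auto
  qed
  from quotient_algebra_iso[OF abelian_group_free_algebra closed_free_algebra[OF cA] abelian_group_coord_algebra
      closed_coord_algebra hom surj kernel]
  show ?thesis by (simp add: scalar_extension_eq)
qed

section \<open>Bases indexed by finite types\<close>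

text \<open>
  A family of vectors is treated as the linear map that it defines; \<open>inj (lincomb b)\<close> says that the
  family is independent.
\<close>

definition lincomb :: "('m::finite => 'a::comm_ring_1^'n::finite) => 'a^'m => 'a^'n" where
  "lincomb b c = (\<Sum>k\<in>UNIV. (c $ k) *s b k)"

lemma lincomb_add: "lincomb b (c + d) = lincomb b c + lincomb b d"
  by (simp add: lincomb_def vector_sadd_rdistrib sum.distrib)

lemma lincomb_scale: "lincomb b (r *s c) = r *s lincomb b c"
  by (simp add: lincomb_def scale_sum_right vector_scale_scale)

lemma lincomb_zero [simp]: "lincomb b 0 = 0"
  by (simp add: lincomb_def)

lemma lincomb_axis [simp]: "lincomb b (axis k 1) = b k"
proof -
  have "lincomb b (axis k 1) = (\<Sum>j\<in>UNIV. if j = k then b j else 0)"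
    unfolding lincomb_def by (intro sum.cong refl) (auto simp: axis_def)
  then show ?thesis by simp
qed

lemma linear_lincomb: "Vector_Spaces.linear (*s) (*s) (lincomb (b :: 'm::finite => 'a::field^'n::finite))"
  by unfold_locales (auto simp: lincomb_add lincomb_scale)

lemma linear_eq_lincomb:
  fixes f :: "'a::field^'m::finite => 'a^'n::finite"
  assumes add: "\<And>x y. f (x + y) = f x + f y" and scale: "\<And>c x. f (c *s x) = c *s f x"
  shows "f = lincomb (\<lambda>k. f (axis k 1))"
proof
  fix c
  have z: "f 0 = 0" using scale[of 0 0] by simp
  have s: "f (\<Sum>k\<in>S. g k) = (\<Sum>k\<in>S. f (g k))" for S :: "'m set" and g
    by (induct S rule: infinite_finite_induct) (auto simp: add z)
  have "f c = f (\<Sum>k\<in>UNIV. (c $ k) *s axis k 1)" by (simp only: basis_expansion_ring)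
  also have "\<dots> = lincomb (\<lambda>k. f (axis k 1)) c" unfolding s scale lincomb_def ..
  finally show "f c = lincomb (\<lambda>k. f (axis k 1)) c" .
qed

lemma lincomb_inj:
  fixes b :: "'m::finite => 'a::field^'n::finite"
  assumes "inj b" "vec.independent (range b)"
  shows "inj (lincomb b)"
proof -
  have "c $ k = 0" if c: "lincomb b c = 0" for c :: "'a^'m" and k
  proof -
    have "(\<Sum>v\<in>range b. c $ inv_into UNIV b v *s v) = lincomb b c"
      using assms(1) unfolding lincomb_def by (subst sum.reindex) auto
    then have "c $ inv_into UNIV b (b k) = 0"
      using vec.independentD[OF assms(2), of "range b" "\<lambda>v. c $ inv_into UNIV b v" "b k"] c by simp
    then show ?thesis using assms(1) by simp
  qed
  then have "c = 0" if "lincomb b c = 0" for c using that by (simp add: vec_eq_iff)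
  moreover have "lincomb b (c - d) = lincomb b c - lincomb b d" for c d
    using lincomb_add[of b "c - d" d] by simp
  ultimately show ?thesis by (intro injI) (metis eq_iff_diff_eq_0)
qed

lemma range_lincomb:
  fixes b :: "'m::finite => 'a::field^'n::finite"
  shows "range (lincomb b) = vec.span (range b)"
proof
  show "range (lincomb b) \<subseteq> vec.span (range b)"
  proof
    fix x assume "x \<in> range (lincomb b)"
    then obtain c where "x = (\<Sum>k\<in>UNIV. (c $ k) *s b k)" by (auto simp: lincomb_def)
    then show "x \<in> vec.span (range b)" by (simp add: vec.span_sum vec.span_scale vec.span_base)
  qed
  have "vec.subspace (range (lincomb b))"
    using vec.subspace_UNIV vec.linear_subspace_image[OF linear_lincomb] by blast
  moreover have "range b \<subseteq> range (lincomb b)" using lincomb_axis[of b] by (metis image_subsetI rangeI)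
  ultimately show "vec.span (range b) \<subseteq> range (lincomb b)" by (rule vec.span_minimal[rotated])
qed

lemma dim_cart: "vec.dim (UNIV :: ('a::field^'n::finite) set) = CARD('n)"
  by (simp add: card_cart_basis)

lemma basis_family_from_spanning:
  fixes S :: "('a::field^'n::finite) set"
  assumes "vec.dim S = CARD('m::finite)"
  shows "\<exists>b::'m => 'a^'n. range b \<subseteq> S \<and> inj b \<and> vec.independent (range b) \<and> vec.span (range b) = vec.span S"
proof -
  obtain B where B: "B \<subseteq> S" "vec.independent B" "S \<subseteq> vec.span B" "card B = vec.dim S"
    using vec.basis_exists by blast
  have "finite B" by (rule vec.finiteI_independent[OF B(2)])
  then obtain b :: "'m => 'a^'n" where b: "bij_betw b UNIV B"
    using finite_same_card_bij[of "UNIV :: 'm set" B] B(4) assms by auto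
  have "vec.span B = vec.span S"
    using B by (meson subset_antisym vec.span_minimal vec.span_mono vec.subspace_span)
  then show ?thesis using b B by (intro exI[of _ b]) (auto simp: bij_betw_def)
qed

section \<open>Descent of finite dimensionality\<close>

text \<open>
  The vectors \<open>x \<otimes> 1\<close> span \<open>A \<otimes> K\<close>, so some
  \<open>e k \<otimes> 1\<close> form a basis of it. The elements \<open>e k\<close> are independent in
  \<open>A\<close>. If they did not span, a functional on \<open>A\<close> would vanish on all of them without
  being zero; its extension to \<open>A \<otimes> K\<close> vanishes on a basis, which is absurd.
\<close>

theorem scalar_extension_descent:
  fixes A :: "('a::field, 'v) module" (structure) and \<phi> :: "'a => 'k::field" and G :: "('k, 'n::finite) table"
  assumes \<phi>: "scalar_map \<phi>" and A: "nonassoc_algebra A"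
    and iso: "algebra_iso (scalar_extension \<phi> A) (coord_algebra G)"
  shows "\<exists>G0 :: ('a, 'n) table. algebra_iso (coord_algebra G0) A"
proof -
  interpret \<phi>: scalar_map \<phi> by fact
  note D = nonassoc_algebraD[OF A]
  interpret A: abelian_group A by (rule D(2))
  have cA: "closed_algebra A" by (rule nonassoc_algebra_closed[OF A])
  let ?M = "free_algebra A :: ('k, 'v => 'k) module"
  let ?N = "tensor_kernel \<phi> A"
  let ?c = "a_r_coset ?M ?N"
  let ?Q = "scalar_extension \<phi> A"
  note K = tensor_kernel_closed[where \<phi> = \<phi> and A = A]
  obtain h where h: "algebra_hom ?Q (coord_algebra G) h" and bij: "bij_betw h (carrier ?Q) UNIV"
    using iso by (auto elim!: algebra_isoE)
  have coset: "v \<in> ?c u \<longleftrightarrow> (\<exists>n\<in>?N. v = (\<lambda>z. n z + u z))" for u v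
    by (auto simp: a_r_coset_def r_coset_def free_algebra_simps)
  have car: "carrier ?Q = (\<lambda>u. ?c u) ` carrier ?M"
    by (auto simp: scalar_extension_eq quotient_algebra_def A_RCOSETS_def RCOSETS_def a_r_coset_def)
  have plusQ: "t \<in> S \<oplus>\<^bsub>?Q\<^esub> T \<longleftrightarrow> (\<exists>x\<in>S. \<exists>y\<in>T. t = (\<lambda>z. x z + y z))" for S T t
    by (simp add: scalar_extension_eq quotient_algebra_def set_add_iff free_algebra_simps(3))
  have scaleQ: "t \<in> c \<odot>\<^bsub>?Q\<^esub> S \<longleftrightarrow> (\<exists>x\<in>S. t \<in> ?c (\<lambda>z. c * x z))" for S t c
    by (simp add: scalar_extension_eq quotient_algebra_def free_algebra_simps(4))
  define \<Lambda> where "\<Lambda> u = h (?c u)" for u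
  have \<Lambda>_add: "\<Lambda> (\<lambda>z. u z + v z) = \<Lambda> u + \<Lambda> v" if "u \<in> carrier ?M" "v \<in> carrier ?M" for u v
  proof -
    have "(?c u) \<oplus>\<^bsub>?Q\<^esub> (?c v) = ?c (\<lambda>z. u z + v z)"
    proof (intro subset_antisym subsetI)
      fix t assume "t \<in> (?c u) \<oplus>\<^bsub>?Q\<^esub> (?c v)"
      then obtain x y where "x \<in> ?c u" "y \<in> ?c v" and t: "t = (\<lambda>z. x z + y z)"
        unfolding plusQ by (elim bexE)
      then obtain n m where "n \<in> ?N" "m \<in> ?N" "x = (\<lambda>z. n z + u z)" "y = (\<lambda>z. m z + v z)"
        unfolding coset by (elim bexE)
      with t have "n \<in> ?N" "m \<in> ?N" "t = (\<lambda>z. (n z + u z) + (m z + v z))" by simp_all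
      then show "t \<in> ?c (\<lambda>z. u z + v z)"
        unfolding coset using K(3) by (intro bexI[of _ "\<lambda>z. n z + m z"]) (auto simp: algebra_simps)
    next
      fix t assume "t \<in> ?c (\<lambda>z. u z + v z)"
      then obtain n where n: "n \<in> ?N" "t = (\<lambda>z. (n z + u z) + (0 + v z))"
        unfolding coset by (auto simp: algebra_simps)
      have "(\<lambda>z. n z + u z) \<in> ?c u" "(\<lambda>z. 0 + v z) \<in> ?c v"
        unfolding coset by (rule bexI[OF refl n(1)], rule bexI[OF refl K(2)])
      then show "t \<in> (?c u) \<oplus>\<^bsub>?Q\<^esub> (?c v)"
        unfolding plusQ n(2) by (intro bexI) (rule refl)
    qed
    moreover have "h ((?c u) \<oplus>\<^bsub>?Q\<^esub> (?c v)) = \<Lambda> u + \<Lambda> v"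
      using algebra_homD(2)[OF h] that by (simp add: car \<Lambda>_def)
    ultimately show ?thesis by (simp add: \<Lambda>_def)
  qed
  have \<Lambda>_scale: "\<Lambda> (\<lambda>z. c * u z) = c *s \<Lambda> u" if "u \<in> carrier ?M" for c u
  proof -
    have "c \<odot>\<^bsub>?Q\<^esub> (?c u) = ?c (\<lambda>z. c * u z)"
    proof (intro subset_antisym subsetI)
      fix t assume "t \<in> c \<odot>\<^bsub>?Q\<^esub> (?c u)"
      then obtain x where "x \<in> ?c u" and t: "t \<in> ?c (\<lambda>z. c * x z)"
        unfolding scaleQ by (elim bexE)
      then obtain m where m: "m \<in> ?N" "x = (\<lambda>z. m z + u z)"
        unfolding coset by (elim bexE)
      from t obtain n where "n \<in> ?N" "t = (\<lambda>z. n z + c * x z)"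
        unfolding coset by (elim bexE)
      with m have "n \<in> ?N" "m \<in> ?N" "t = (\<lambda>z. n z + c * (m z + u z))" by simp_all
      then show "t \<in> ?c (\<lambda>z. c * u z)"
        unfolding coset using K(3)[OF _ K(4)]
        by (intro bexI[of _ "\<lambda>z. n z + c * m z"]) (auto simp: algebra_simps)
    next
      fix t assume "t \<in> ?c (\<lambda>z. c * u z)"
      then obtain n where n: "n \<in> ?N" "t = (\<lambda>z. n z + c * (0 + u z))"
        unfolding coset by auto
      have "(\<lambda>z. 0 + u z) \<in> ?c u"
        unfolding coset by (rule bexI[OF refl K(2)])
      moreover have "t \<in> ?c (\<lambda>z. c * (0 + u z))"
        unfolding coset n(2) by (rule bexI[OF refl n(1)])
      ultimately show "t \<in> c \<odot>\<^bsub>?Q\<^esub> (?c u)"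
        unfolding scaleQ by (intro bexI[of _ "\<lambda>z. 0 + u z"])
    qed
    moreover have "h (c \<odot>\<^bsub>?Q\<^esub> (?c u)) = c *s \<Lambda> u"
      using algebra_homD(3)[OF h] that by (simp add: car \<Lambda>_def)
    ultimately show ?thesis by (simp add: \<Lambda>_def)
  qed
  have zM: "(\<lambda>z. 0) \<in> carrier ?M" by (simp add: free_algebra_simps)
  have \<Lambda>0: "\<Lambda> (\<lambda>z. 0) = 0" using \<Lambda>_scale[OF zM, of 0] by simp
  have kerN: "u \<in> ?N" if u: "u \<in> carrier ?M" "\<Lambda> u = 0" for u
  proof -
    have "?c u = ?c (\<lambda>z. 0)"
      by (rule inj_onD[OF bij_betw_imp_inj_on[OF bij]])
        (use u \<Lambda>0 zM in \<open>simp_all add: \<Lambda>_def car\<close>)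
    moreover have "u \<in> ?c u" unfolding coset using K(2) by (intro bexI[of _ "\<lambda>z. 0"]) auto
    ultimately have "u \<in> ?c (\<lambda>z. 0)" by simp
    then show ?thesis unfolding coset by auto
  qed
  have \<Lambda>N: "\<Lambda> r = 0" if r: "r \<in> ?N" for r
  proof -
    have "?c r = ?c (\<lambda>z. 0)"
    proof (intro subset_antisym subsetI)
      fix t assume "t \<in> ?c r"
      then show "t \<in> ?c (\<lambda>z. 0)" unfolding coset using K(3)[OF _ r] by auto
    next
      fix t assume "t \<in> ?c (\<lambda>z. 0)"
      then have "t \<in> ?N" unfolding coset by auto
      then have "(\<lambda>z. t z + - 1 * r z) \<in> ?N" using K(3)[OF _ K(4)[OF r, of "- 1"]] by blast
      then show "t \<in> ?c r" unfolding coset by (intro bexI) auto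
    qed
    then show ?thesis using \<Lambda>0 by (simp add: \<Lambda>_def)
  qed
  define \<iota> where "\<iota> x = \<Lambda> (single_fun x)" for x
  note sM = single_fun_mem[where 's = 'k]
  have \<iota>_add: "\<iota> (x \<oplus> y) = \<iota> x + \<iota> y" if x: "x \<in> carrier A" and y: "y \<in> carrier A" for x y
  proof -
    let ?r = "\<lambda>z. single_fun (x \<oplus> y) z - single_fun x z - (single_fun y z :: 'k)"
    have r: "?r \<in> ?N" using K(1) tensor_relations_memI(1)[OF x y, of \<phi>] by blast
    have rM: "?r \<in> carrier ?M"
      using free_algebra_add_closed[OF sM[of "x \<oplus> y"] free_algebra_scale_closed[OF free_algebra_add_closed[OF sM[OF x] sM[OF y]], of "- 1"]]
      using x y by (simp add: algebra_simps)
    have "\<Lambda> (\<lambda>z. ?r z + (single_fun x z + single_fun y z)) = \<Lambda> ?r + (\<iota> x + \<iota> y)"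
      using \<Lambda>_add[OF rM free_algebra_add_closed[OF sM[OF x] sM[OF y]]] \<Lambda>_add[OF sM[OF x] sM[OF y]]
      by (simp add: \<iota>_def)
    then show ?thesis using \<Lambda>N[OF r] by (simp add: \<iota>_def)
  qed
  have \<iota>_scale: "\<iota> (c \<odot> x) = \<phi> c *s \<iota> x" if x: "x \<in> carrier A" for c x
  proof -
    let ?r = "\<lambda>z. single_fun (c \<odot> x) z - \<phi> c * (single_fun x z :: 'k)"
    have r: "?r \<in> ?N" using K(1) tensor_relations_memI(2)[OF x, of c \<phi>] by blast
    note m = free_algebra_scale_closed[OF sM[OF x], of "\<phi> c"]
    have rM: "?r \<in> carrier ?M"
      using free_algebra_add_closed[OF sM[OF D(3)[OF x, of c]] free_algebra_scale_closed[OF m, of "- 1"]]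
      by (simp add: algebra_simps)
    have "\<Lambda> (\<lambda>z. ?r z + \<phi> c * single_fun x z) = \<Lambda> ?r + \<phi> c *s \<iota> x"
      using \<Lambda>_add[OF rM m] \<Lambda>_scale[OF sM[OF x]] by (simp add: \<iota>_def)
    then show ?thesis using \<Lambda>N[OF r] by (simp add: \<iota>_def)
  qed
  have comb: "(\<lambda>z. \<Sum>x\<in>S. c x * single_fun x z) \<in> carrier ?M \<and>
      \<Lambda> (\<lambda>z. \<Sum>x\<in>S. c x * single_fun x z) = (\<Sum>x\<in>S. c x *s \<iota> x)"
    if "finite S" "S \<subseteq> carrier A" for S c
    using that
  proof (induct S rule: finite_induct)
    case empty then show ?case using zM \<Lambda>0 by simp
  next
    case (insert x S)
    then have x: "x \<in> carrier A" by simp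
    note m = free_algebra_scale_closed[OF sM[OF x], of "c x"]
    have IH: "(\<lambda>z. \<Sum>x\<in>S. c x * single_fun x z) \<in> carrier ?M"
      "\<Lambda> (\<lambda>z. \<Sum>x\<in>S. c x * single_fun x z) = (\<Sum>x\<in>S. c x *s \<iota> x)"
      using insert by auto
    show ?case
      using insert(1,2) free_algebra_add_closed[OF m IH(1)] \<Lambda>_add[OF m IH(1)] \<Lambda>_scale[OF sM[OF x]] IH(2)
      by (simp add: \<iota>_def)
  qed
  have \<Lambda>_lin: "\<Lambda> u = lin_ext \<iota> u" if u: "u \<in> carrier ?M" for u
  proof -
    have "u z = (\<Sum>x | u x \<noteq> 0. u x * single_fun x z)" for z
      using u by (simp add: single_fun_def if_distrib free_algebra_simps cong: if_cong)
    then have "u = (\<lambda>z. \<Sum>x | u x \<noteq> 0. u x * single_fun x z)" by (rule ext)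
    from arg_cong[OF this, of \<Lambda>] have "\<Lambda> u = \<Lambda> (\<lambda>z. \<Sum>x | u x \<noteq> 0. u x * single_fun x z)" .
    then show ?thesis using comb[of "{x. u x \<noteq> 0}" u] u by (simp add: free_algebra_simps lin_ext_def)
  qed
  have "vec.span (\<iota> ` carrier A) = UNIV"
  proof -
    have "y \<in> vec.span (\<iota> ` carrier A)" for y
    proof -
      have "y \<in> h ` carrier ?Q" using bij by (simp add: bij_betw_def)
      then obtain u where u: "u \<in> carrier ?M" "y = \<Lambda> u" unfolding car \<Lambda>_def by blast
      then have "y = lin_ext \<iota> u" using \<Lambda>_lin by simp
      also have "\<dots> \<in> vec.span (\<iota> ` carrier A)"
        unfolding lin_ext_def using u(1)
        by (intro vec.span_sum vec.span_scale vec.span_base) (auto simp: free_algebra_simps)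
      finally show ?thesis .
    qed
    then show ?thesis by auto
  qed
  moreover from this have "vec.dim (\<iota> ` carrier A) = CARD('n)"
    using dim_cart vec.dim_span by metis
  ultimately obtain b :: "'n => 'k^'n" where b: "range b \<subseteq> \<iota> ` carrier A" "inj b"
    "vec.independent (range b)" "vec.span (range b) = UNIV"
    using basis_family_from_spanning[of "\<iota> ` carrier A", where 'm = 'n] by metis
  then have "\<forall>k. \<exists>x. x \<in> carrier A \<and> b k = \<iota> x" by blast
  then obtain e where e: "\<And>k. e k \<in> carrier A" "\<And>k. b k = \<iota> (e k)" by metis
  define g where "g = (\<lambda>c::'a^'n. \<Oplus>k\<in>UNIV. (c $ k) \<odot> e k)"
  have gmem: "g c \<in> carrier A" for c unfolding g_def using e D(3) by (intro A.finsum_closed) auto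
  have fin_lin: "f (g c) = (\<Sum>k\<in>UNIV. \<phi> (c $ k) *s f (e k))"
    if "\<And>x y. x \<in> carrier A ==> y \<in> carrier A ==> f (x \<oplus> y) = f x + f y"
      "\<And>c x. x \<in> carrier A ==> f (c \<odot> x) = \<phi> c *s f x" for f :: "'v => 'k^'p::finite" and c
    unfolding g_def using additive_finsum[OF A that(1), of UNIV "\<lambda>k. (c $ k) \<odot> e k"] that(2) e(1) D(3)
    by simp
  have \<iota>g: "\<iota> (g c) = lincomb b (map_vec \<phi> c)" for c
    using fin_lin[of \<iota> c] \<iota>_add \<iota>_scale e(2) by (simp add: lincomb_def)
  have inj: "inj g"
  proof (rule injI)
    fix c d assume "g c = g d"
    then have "map_vec \<phi> c = map_vec \<phi> d"
      using \<iota>g lincomb_inj[OF b(2,3)] by (metis injD)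
    then show "c = d" by (simp add: vec_eq_iff field_map_inj[OF \<phi>])
  qed
  have g_ops: "g (x + y) = g x \<oplus> g y" "g (c *s x) = c \<odot> g x" for x y c
    by (simp_all only: g_def finsum_coord_linear[OF A e(1)])
  \<comment> \<open>a functional vanishing on the span of the \<open>e k\<close> extends to \<open>A \<otimes> K\<close>, where it has to vanish\<close>
  have "x0 \<in> range g" if x0: "x0 \<in> carrier A" for x0
  proof (rule ccontr)
    assume "x0 \<notin> range g"
    have W: "range g \<subseteq> carrier A" "\<zero> \<in> range g"
      using g_ops(2)[of 0 0] D(8)[OF gmem] gmem by (auto simp: image_iff intro!: exI[of _ 0])
    have Wadd: "x \<oplus> y \<in> range g" if "x \<in> range g" "y \<in> range g" for x y
      using that by (auto simp: g_ops(1)[symmetric])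
    have Wscale: "c \<odot> x \<in> range g" if "x \<in> range g" for c x
      using that by (auto simp: g_ops(2)[symmetric])
    have "\<exists>f::'v => 'a. (\<forall>x\<in>carrier A. \<forall>y\<in>carrier A. f (x \<oplus> y) = f x + f y) \<and>
      (\<forall>c. \<forall>x\<in>carrier A. f (c \<odot> x) = c * f x) \<and> (\<forall>x\<in>range g. f x = 0) \<and> f x0 = 1"
      using Wadd Wscale by (intro exists_functional[OF A W _ _ x0 \<open>x0 \<notin> range g\<close>])
    then obtain f :: "'v => 'a" where "(\<forall>x\<in>carrier A. \<forall>y\<in>carrier A. f (x \<oplus> y) = f x + f y) \<and>
      (\<forall>c. \<forall>x\<in>carrier A. f (c \<odot> x) = c * f x) \<and> (\<forall>x\<in>range g. f x = 0) \<and> f x0 = 1"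
      by (elim exE)
    then have f: "\<And>x y. x \<in> carrier A ==> y \<in> carrier A ==> f (x \<oplus> y) = f x + f y"
      "\<And>c x. x \<in> carrier A ==> f (c \<odot> x) = c * f x" "\<And>x. x \<in> range g ==> f x = 0" "f x0 = 1"
      by blast+
    \<comment> \<open>one-dimensional coordinate vectors, so that the universal property applies\<close>
    define w :: "'v => 'k^1" where "w x = (\<chi> i. \<phi> (f x))" for x
    have w: "w (x \<oplus> y) = w x + w y" if "x \<in> carrier A" "y \<in> carrier A" for x y
      using f(1)[OF that] by (simp add: w_def vec_eq_iff \<phi>.add)
    have w2: "w (c \<odot> x) = \<phi> c *s w x" if "x \<in> carrier A" for c x
      using f(2)[OF that] by (simp add: w_def vec_eq_iff \<phi>.mult)
    have we: "w (e k) = 0" for k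
    proof -
      have "e k = g (axis k 1)"
      proof -
        have "g (axis k 1) = (\<Oplus>j\<in>UNIV. if k = j then e j else \<zero>)"
          unfolding g_def using e(1) D(7,8) by (intro A.finsum_cong') (auto simp: axis_def)
        also have "\<dots> = e k" using A.finsum_singleton[of k UNIV e] e(1) by auto
        finally show ?thesis by simp
      qed
      then show ?thesis using f(3)[of "e k"] by (simp add: w_def vec_eq_iff)
    qed
    have "\<iota> x0 \<in> range (lincomb b)" unfolding range_lincomb b(4) by simp
    then obtain d where d: "\<iota> x0 = lincomb b d" by blast
    have einj: "inj e" using b(2) e(2) by (metis injI inj_def)
    let ?v = "\<lambda>z. \<Sum>x\<in>range e. - d $ inv_into UNIV e x * single_fun x z"
    have v: "?v \<in> carrier ?M" "\<Lambda> ?v = - lincomb b d"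
    proof -
      have "range e \<subseteq> carrier A" using e by auto
      from comb[OF _ this, of "\<lambda>x. - d $ inv_into UNIV e x"] show "?v \<in> carrier ?M"
        and "\<Lambda> ?v = - lincomb b d"
        using einj by (simp_all add: sum.reindex lincomb_def e(2) vec_eq_iff sum_negf)
    qed
    \<comment> \<open>\<open>x0 \<otimes> 1\<close> minus its expansion in the basis: zero in \<open>A \<otimes> K\<close>, but the functional takes the value 1 on it\<close>
    let ?u = "\<lambda>z. single_fun x0 z + ?v z"
    have u: "?u \<in> carrier ?M" by (rule free_algebra_add_closed[OF sM[OF x0] v(1)])
    have "\<Lambda> ?u = 0" unfolding \<Lambda>_add[OF sM[OF x0] v(1)] v(2) using d by (simp add: \<iota>_def)
    then have "?u \<in> ?N" by (rule kerN[OF u])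
    then have 0: "lin_ext w ?u = 0" using lin_ext_tensor_kernel[OF cA w w2] by blast
    have fin: "finite {x. u x \<noteq> 0}" if "u \<in> carrier ?M" for u
      using that by (simp add: free_algebra_simps)
    have "lin_ext w ?v = (\<Sum>x\<in>range e. ?v x *s w x)"
      by (rule lin_ext_superset) (auto simp: single_fun_def intro!: sum.neutral)
    also have "\<dots> = 0" using we by (intro sum.neutral) auto
    finally have "lin_ext w ?u = w x0"
      using lin_ext_add[OF fin[OF sM[OF x0]] fin[OF v(1)], of w] by simp
    then show False using 0 f(4) by (simp add: w_def vec_eq_iff)
  qed
  then have bij: "bij_betw g UNIV (carrier A)" using inj gmem by (auto simp: bij_betw_def)
  from coord_algebra_basis[OF A e(1) g_def bij] obtain G0 where "algebra_hom (coord_algebra G0) A g" by blast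
  then show ?thesis using bij algebra_isoI[of "coord_algebra G0" A g] by auto
qed

section \<open>Linear algebra over a field extension\<close>

lemma lincomb_eqI:
  fixes f g :: "'a::field^'m::finite => 'a^'n::finite"
  assumes "\<And>x y. f (x + y) = f x + f y" "\<And>c x. f (c *s x) = c *s f x"
    and "\<And>x y. g (x + y) = g x + g y" "\<And>c x. g (c *s x) = c *s g x"
    and "\<And>k. f (axis k 1) = g (axis k 1)"
  shows "f = g"
  using linear_eq_lincomb[of f] linear_eq_lincomb[of g] assms by simp

lemma linear_iff_ops: "Vector_Spaces.linear (*s) (*s) f \<longleftrightarrow>
    (\<forall>x y. f (x + y) = f x + f y) \<and> (\<forall>c x. f (c *s x) = c *s f x)"
  for f :: "'a::field^'m::finite => 'a^'n::finite"
proof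
  assume "Vector_Spaces.linear (*s) (*s) f"
  then interpret Vector_Spaces.linear "(*s)" "(*s)" f .
  show "(\<forall>x y. f (x + y) = f x + f y) \<and> (\<forall>c x. f (c *s x) = c *s f x)"
    by (simp add: add scale)
qed (unfold_locales, auto)

lemma lincomb_left_inverse:
  fixes b :: "'m::finite => 'a::field^'n::finite"
  assumes "inj (lincomb b)"
  obtains g where "\<And>c. lincomb g (lincomb b c) = c"
proof -
  obtain g where g: "Vector_Spaces.linear (*s) (*s) g" "g \<circ> lincomb b = id"
    using vec.linear_injective_left_inverse[OF linear_lincomb assms] by blast
  have "g = lincomb (\<lambda>k. g (axis k 1))"
    using g(1) by (intro linear_eq_lincomb) (auto simp: linear_iff_ops)
  then show ?thesis using g(2) that[of "\<lambda>k. g (axis k 1)"] by (metis comp_apply id_apply)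
qed

lemma linear_inj_imp_surj_card:
  fixes f :: "'a::field^'m::finite => 'a^'n::finite"
  assumes f: "\<And>x y. f (x + y) = f x + f y" "\<And>c x. f (c *s x) = c *s f x" and "inj f"
    and card: "CARD('m) = CARD('n)"
  shows "surj f"
proof -
  have lin: "Vector_Spaces.linear (*s) (*s) f" using f by (simp add: linear_iff_ops)
  have "vec.dim (range f) = CARD('m)"
    using vec.dim_image_eq[OF lin, of UNIV] assms(3) dim_cart[where 'n = 'm and 'a = 'a] by simp
  then have "vec.dim (range f) = vec.dim (UNIV :: ('a^'n) set)"
    using card dim_cart[where 'n = 'n and 'a = 'a] by simp
  then have "vec.span (range f) = vec.span UNIV"
    by (intro vec.dim_eq_span) auto
  moreover have "vec.subspace (range f)"
    using vec.subspace_UNIV vec.linear_subspace_image[OF lin] by blast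
  ultimately show ?thesis by (simp add: vec.span_eq_iff[THEN iffD2])
qed

context scalar_map
begin

lemma map_vec_lincomb: "map_vec \<phi> (lincomb b c) = lincomb (\<lambda>k. map_vec \<phi> (b k)) (map_vec \<phi> c)"
  by (simp add: lincomb_def map_vec_sum map_vec_scale)

end

locale field_map = scalar_map \<phi> for \<phi> :: "'a::field => 'k::field"
begin

lemma eq_0_iff [simp]: "\<phi> x = 0 \<longleftrightarrow> x = 0"
  by (rule field_map_eq_0_iff) (rule scalar_map_axioms)

lemma inj_iff [simp]: "\<phi> x = \<phi> y \<longleftrightarrow> x = y"
  by (rule field_map_inj) (rule scalar_map_axioms)

lemma map_vec_inj_iff [simp]: "map_vec \<phi> x = map_vec \<phi> y \<longleftrightarrow> x = y"
  by (simp add: vec_eq_iff)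

lemma map_vec_eq_0_iff [simp]: "map_vec \<phi> x = 0 \<longleftrightarrow> x = 0"
  by (simp add: vec_eq_iff)

lemma lincomb_left_inverse_base_change:
  assumes "\<And>c. lincomb g (lincomb b c) = c"
  shows "lincomb (\<lambda>k. map_vec \<phi> (g k)) (lincomb (\<lambda>k. map_vec \<phi> (b k)) c) = c"
proof -
  have "(\<lambda>c. lincomb (\<lambda>k. map_vec \<phi> (g k)) (lincomb (\<lambda>k. map_vec \<phi> (b k)) c)) = (\<lambda>c. c)"
  proof (rule lincomb_eqI)
    fix k
    have "lincomb (\<lambda>k. map_vec \<phi> (g k)) (map_vec \<phi> (b k)) = map_vec \<phi> (axis k 1)"
      using assms[of "axis k 1"] by (simp only: map_vec_lincomb[symmetric] lincomb_axis)
    then show "lincomb (\<lambda>k. map_vec \<phi> (g k)) (lincomb (\<lambda>k. map_vec \<phi> (b k)) (axis k 1)) = axis k 1"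
      by simp
  qed (simp_all add: lincomb_add lincomb_scale)
  then show ?thesis by meson
qed

lemma inj_lincomb_base_change:
  assumes "inj (lincomb b)"
  shows "inj (lincomb (\<lambda>k. map_vec \<phi> (b k)))"
proof -
  obtain g where g: "\<And>c. lincomb g (lincomb b c) = c" using lincomb_left_inverse[OF assms] by blast
  show ?thesis
  proof (rule injI)
    fix x y assume "lincomb (\<lambda>k. map_vec \<phi> (b k)) x = lincomb (\<lambda>k. map_vec \<phi> (b k)) y"
    then have "lincomb (\<lambda>k. map_vec \<phi> (g k)) (lincomb (\<lambda>k. map_vec \<phi> (b k)) x) =
        lincomb (\<lambda>k. map_vec \<phi> (g k)) (lincomb (\<lambda>k. map_vec \<phi> (b k)) y)" by simp
    then show "x = y" unfolding lincomb_left_inverse_base_change[OF g] .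
  qed
qed

text \<open>
  Solution spaces of linear systems are compatible with field extension: if \<open>g\<close> is a generalised
  inverse of the system \<open>f\<close>, that is \<open>f g f = f\<close>, then \<open>1 - g f\<close> projects onto the solutions over
  the small field and, having coefficients there, also over the large one.
\<close>

lemma kernel_base_change:
  fixes b :: "'m::finite => 'a^'n::finite"
  assumes v: "lincomb (\<lambda>k. map_vec \<phi> (b k)) v = 0"
  shows "v \<in> vec.span (map_vec \<phi> ` {x. lincomb b x = 0})"
proof -
  obtain g where g: "Vector_Spaces.linear (*s) (*s) g" "\<And>x. lincomb b (g (lincomb b x)) = lincomb b x"
    using vec.linear_exists_right_inverse_on[OF linear_lincomb vec.subspace_UNIV, of b] by blast
  define h where "h k = g (axis k 1)" for k
  have gh: "g = lincomb h"
    unfolding h_def using g(1) by (intro linear_eq_lincomb) (auto simp: linear_iff_ops)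
  define p where "p k = axis k 1 - g (b k)" for k
  have ker: "lincomb b (p k) = 0" for k
  proof -
    have "lincomb b (p k + g (b k)) = lincomb b (axis k 1)" by (simp add: p_def)
    then show ?thesis using g(2)[of "axis k 1"] by (simp add: lincomb_add)
  qed
  have "(\<lambda>v. lincomb (\<lambda>k. map_vec \<phi> (p k)) v + lincomb (\<lambda>k. map_vec \<phi> (h k)) (lincomb (\<lambda>k. map_vec \<phi> (b k)) v)) = (\<lambda>v. v)"
  proof (rule lincomb_eqI)
    fix k
    show "lincomb (\<lambda>k. map_vec \<phi> (p k)) (axis k 1) +
        lincomb (\<lambda>k. map_vec \<phi> (h k)) (lincomb (\<lambda>k. map_vec \<phi> (b k)) (axis k 1)) = axis k 1"
      by (simp add: p_def gh map_vec_diff map_vec_lincomb)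
  qed (simp_all add: lincomb_add lincomb_scale vector_add_ldistrib)
  from fun_cong[OF this, of v]
  have "v = lincomb (\<lambda>k. map_vec \<phi> (p k)) v + lincomb (\<lambda>k. map_vec \<phi> (h k)) (lincomb (\<lambda>k. map_vec \<phi> (b k)) v)"
    by (rule sym)
  then have "v = lincomb (\<lambda>k. map_vec \<phi> (p k)) v" by (simp add: v)
  moreover have "lincomb (\<lambda>k. map_vec \<phi> (p k)) v \<in> vec.span (map_vec \<phi> ` {x. lincomb b x = 0})"
    unfolding lincomb_def using ker
    by (intro vec.span_sum vec.span_scale vec.span_base) (auto simp: lincomb_def)
  ultimately show ?thesis by simp
qed

text \<open>
  A linear system with coefficients in the small field has a basis of solutions there, and this remains a basis
  of the solutions over the large field. This is how subspaces given by linear equations, such as the radical of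
  the Killing form or a space of derivations, are brought down to the ground field.
\<close>

theorem kernel_basis_descent:
  fixes f :: "'n::finite => 'a^'p::finite" and d :: "'m::finite => 'k^'n"
  assumes d: "inj (lincomb d)" "range (lincomb d) = {v. lincomb (\<lambda>k. map_vec \<phi> (f k)) v = 0}"
  shows "\<exists>b::'m => 'a^'n. inj (lincomb b) \<and> range (lincomb b) = {x. lincomb f x = 0} \<and>
     range (lincomb (\<lambda>k. map_vec \<phi> (b k))) = {v. lincomb (\<lambda>k. map_vec \<phi> (f k)) v = 0}"
proof -
  let ?V = "{x. lincomb f x = 0}" and ?VK = "{v. lincomb (\<lambda>k. map_vec \<phi> (f k)) v = 0}"
  let ?S = "map_vec \<phi> ` ?V"
  have sub: "?S \<subseteq> ?VK" by (auto simp: map_vec_lincomb[symmetric])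
  have subsp: "vec.subspace ?VK"
    unfolding d(2)[symmetric] using vec.subspace_UNIV vec.linear_subspace_image[OF linear_lincomb] by blast
  have span: "vec.span ?S = ?VK"
    using vec.span_minimal[OF sub subsp] kernel_base_change[of f] by auto
  have "vec.dim (range (lincomb d)) = CARD('m)"
    using vec.dim_image_eq[OF linear_lincomb, of d UNIV] d(1) dim_cart[where 'n = 'm and 'a = 'k] by simp
  then have "vec.dim ?S = CARD('m)" using span d(2) vec.dim_span by metis
  then obtain c :: "'m => 'k^'n" where c: "range c \<subseteq> ?S" "inj c" "vec.independent (range c)"
      "vec.span (range c) = vec.span ?S"
    using basis_family_from_spanning[of ?S, where 'm = 'm] by blast
  then have "\<forall>k. \<exists>x. x \<in> ?V \<and> c k = map_vec \<phi> x" by blast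
  then obtain b where b: "\<And>k. b k \<in> ?V" "\<And>k. c k = map_vec \<phi> (b k)" by metis
  then have cb: "c = (\<lambda>k. map_vec \<phi> (b k))" by blast
  have injc: "inj (lincomb c)" by (rule lincomb_inj[OF c(2,3)])
  have injb: "inj (lincomb b)"
  proof (rule injI)
    fix x y assume "lincomb b x = lincomb b y"
    then have "lincomb c (map_vec \<phi> x) = lincomb c (map_vec \<phi> y)"
      by (simp add: cb map_vec_lincomb[symmetric])
    then show "x = y" using injc by (simp add: inj_eq)
  qed
  obtain g where g: "\<And>c. lincomb g (lincomb b c) = c" using lincomb_left_inverse[OF injb] by blast
  have rangec: "range (lincomb c) = ?VK" using range_lincomb[of c] c(4) span by simp
  have "range (lincomb b) = ?V"
  proof (intro subset_antisym subsetI)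
    fix v assume "v \<in> range (lincomb b)"
    then obtain x where x: "v = lincomb b x" by blast
    have "lincomb f (\<Sum>k\<in>S. (x $ k) *s b k) = 0" for S
    proof (induct S rule: infinite_finite_induct)
      case (insert k S)
      then show ?case using b(1)[of k] by (simp add: lincomb_add lincomb_scale)
    qed simp_all
    then show "v \<in> ?V" by (simp add: x lincomb_def[of b])
  next
    fix v assume v: "v \<in> ?V"
    then have "map_vec \<phi> v \<in> range (lincomb c)" unfolding rangec using sub by blast
    then obtain e where e: "map_vec \<phi> v = lincomb c e" by blast
    have "map_vec \<phi> (lincomb g v) = e"
      unfolding map_vec_lincomb e cb by (rule lincomb_left_inverse_base_change[OF g])
    then have "map_vec \<phi> v = map_vec \<phi> (lincomb b (lincomb g v))"
      by (simp add: e cb map_vec_lincomb)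
    then show "v \<in> range (lincomb b)" by simp
  qed
  then show ?thesis using injb rangec cb by blast
qed

end

section \<open>Cross products in characteristic 3\<close>

definition bform :: "('n::finite => 'n => 'a::comm_ring_1) => 'a^'n => 'a^'n => 'a" where
  "bform M x y = (\<Sum>i\<in>UNIV. \<Sum>j\<in>UNIV. x $ i * y $ j * M i j)"

lemma bform_add:
  "bform M (x + y) z = bform M x z + bform M y z"
  "bform M z (x + y) = bform M z x + bform M z y"
  by (simp_all add: bform_def distrib_left distrib_right sum.distrib)

lemma bform_scale:
  "bform M (c *s x) z = c * bform M x z"
  "bform M z (c *s x) = c * bform M z x"
  by (simp_all add: bform_def sum_distrib_left mult.assoc mult.left_commute)

lemma bform_zero [simp]: "bform M 0 z = 0" "bform M z 0 = 0"
  by (simp_all add: bform_def)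

lemma bform_minus:
  "bform M (- x) z = - bform M x z" "bform M z (- x) = - bform M z x"
  by (simp_all add: bform_def sum_negf)

lemma bform_diff:
  "bform M (x - y) z = bform M x z - bform M y z"
  "bform M z (x - y) = bform M z x - bform M z y"
  by (simp_all add: bform_def left_diff_distrib right_diff_distrib sum_subtractf)

lemma bform_axis [simp]: "bform M (axis i 1) (axis j 1) = M i j"
proof -
  have "bform M (axis i 1) (axis j 1) =
      (\<Sum>k\<in>UNIV. if k = i then (\<Sum>l\<in>UNIV. if l = j then M k l else 0) else 0)"
    unfolding bform_def by (intro sum.cong refl) (auto simp: axis_def if_distrib[of "\<lambda>t. t * _"] cong: if_cong intro!: sum.neutral)
  then show ?thesis by simp
qed

lemma bform_axis_right: "bform M x (axis j 1) = (\<Sum>i\<in>UNIV. x $ i * M i j)"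
proof -
  have "bform M x (axis j 1) = (\<Sum>k\<in>UNIV. \<Sum>l\<in>UNIV. if l = j then x $ k * M k l else 0)"
    unfolding bform_def by (intro sum.cong refl) (auto simp: axis_def)
  then show ?thesis by simp
qed

lemma (in scalar_map) map_bform: "\<phi> (bform M x y) = bform (\<lambda>i j. \<phi> (M i j)) (map_vec \<phi> x) (map_vec \<phi> y)"
  by (simp add: bform_def sum mult)

lemma bilinear_eq_bform:
  fixes b :: "'a::comm_ring_1^'n::finite => 'a^'n => 'a"
  assumes "\<And>x y z. b (x + y) z = b x z + b y z" "\<And>x y z. b z (x + y) = b z x + b z y"
    and "\<And>c x z. b (c *s x) z = c * b x z" "\<And>c x z. b z (c *s x) = c * b z x"
  shows "b = bform (\<lambda>i j. b (axis i 1) (axis j 1))"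
proof (intro ext)
  fix x y
  have z: "b 0 z = 0" "b z 0 = 0" for z
    using assms(3)[of 0 0 z] assms(4)[of z 0 0] by simp_all
  have s: "b (\<Sum>i\<in>I. f i) z = (\<Sum>i\<in>I. b (f i) z)" "b z (\<Sum>i\<in>I. f i) = (\<Sum>i\<in>I. b z (f i))"
    for I :: "'n set" and f z
    by (induct I rule: infinite_finite_induct) (simp_all add: assms z)
  have "b x y = b (\<Sum>i\<in>UNIV. (x $ i) *s axis i 1) (\<Sum>i\<in>UNIV. (y $ i) *s axis i 1)"
    by (simp only: basis_expansion_ring)
  also have "\<dots> = bform (\<lambda>i j. b (axis i 1) (axis j 1)) x y"
    unfolding s assms bform_def by (simp add: sum_distrib_left mult.assoc mult.left_commute) (rule sum.swap)
  finally show "b x y = bform (\<lambda>i j. b (axis i 1) (axis j 1)) x y" .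
qed

lemma char3:
  assumes "CHAR('a::field) = 3"
  shows "(3::'a) = 0" "(2::'a) = - 1" "(1::'a) + 1 = - 1" "(4::'a) = 1"
proof -
  have "of_nat 3 = (0::'a)" using assms of_nat_CHAR[where 'a = 'a] by simp
  then show 3: "(3::'a) = 0" by simp
  show 2: "(2::'a) = - 1" using 3 by (metis add.commute add_eq_0_iff one_plus_numeral semiring_norm(3))
  show "(1::'a) + 1 = - 1" using 2 by simp
  have "(4::'a) = 3 + 1" by simp
  then show "(4::'a) = 1" unfolding 3 by simp
qed

text \<open>
  The bracket of the trace zero octonions in characteristic 3. The last axiom is the
  linearisation of \<open>[x, [x, y]] = (x, x) y - (x, y) x\<close>, where \<open>( , )\<close> is the polar form of the norm.
\<close>

definition cross_product :: "('a::field, 'n::finite) table => ('n => 'n => 'a) => bool" where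
  "cross_product G M \<longleftrightarrow>
     (\<forall>x y. sc_mult G x y = - sc_mult G y x) \<and>
     (\<forall>x y. bform M x y = bform M y x) \<and>
     (\<forall>x. (\<forall>y. bform M x y = 0) --> x = 0) \<and>
     (\<forall>x y z. sc_mult G x (sc_mult G z y) + sc_mult G z (sc_mult G x y) =
        - (bform M x z *s y + bform M x y *s z + bform M z y *s x))"

text \<open>
  With three basis vectors at hand, a coefficient of the linearised identity is an entry of the form: the form
  is read off from the bracket.
\<close>

lemma cross_product_form:
  assumes G: "cross_product G M" and k: "k \<noteq> i" "k \<noteq> j"
  shows "M i j = - ((sc_mult G (axis i 1) (sc_mult G (axis j 1) (axis k 1)) +
    sc_mult G (axis j 1) (sc_mult G (axis i 1) (axis k 1))) $ k)"
proof -
  have "sc_mult G (axis i 1) (sc_mult G (axis j 1) (axis k 1)) +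
      sc_mult G (axis j 1) (sc_mult G (axis i 1) (axis k 1)) =
      - (M i j *s axis k 1 + M i k *s axis j 1 + M j k *s axis i 1)"
    using G unfolding cross_product_def by (metis bform_axis)
  then show ?thesis using k by (simp add: axis_def)
qed

lemma exists_other_index:
  fixes i j :: "'n::finite"
  assumes "CARD('n) > 2" obtains k where "k \<noteq> i" "k \<noteq> j"
proof -
  have "card {i, j} \<le> 2" by (simp add: card_insert_if)
  then have "{i, j} \<noteq> UNIV" using assms by auto
  then show ?thesis using that by blast
qed

lemma cross_product_form_unique:
  fixes G :: "('a::field, 'n::finite) table"
  assumes "cross_product G M" "cross_product G M'" and card: "CARD('n) > 2"
  shows "M = M'"
proof (intro ext)
  fix i j
  obtain k :: 'n where "k \<noteq> i" "k \<noteq> j" by (rule exists_other_index[OF card])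
  then show "M i j = M' i j"
    using cross_product_form[OF assms(1)] cross_product_form[OF assms(2)] by metis
qed

context field_map
begin

text \<open>
  The identities are multilinear, so they may be checked on basis vectors, which come from the small field.
  Nondegeneracy is injectivity of a matrix and survives by \<open>inj_lincomb_base_change\<close>.
\<close>

lemma cross_product_base_change:
  fixes G :: "('a, 'n::finite) table"
  assumes G: "cross_product G M"
  shows "cross_product (base_change \<phi> G) (\<lambda>i j. \<phi> (M i j))"
proof -
  let ?G = "base_change \<phi> G" and ?M = "\<lambda>i j. \<phi> (M i j)"
  note ops = sc_mult_add sc_mult_scale bform_add bform_scale
  have ax: "axis i 1 = map_vec \<phi> (axis i 1)" for i :: 'n by simp
  have anti: "sc_mult ?G x y = - sc_mult ?G y x" for x y
  proof -
    have 1: "sc_mult ?G (axis i 1) (axis j 1) = - sc_mult ?G (axis j 1) (axis i 1)" for i j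
      using G unfolding cross_product_def ax by (metis map_vec_sc_mult map_vec_minus)
    have "(\<lambda>y. sc_mult ?G (axis i 1) y) = (\<lambda>y. - sc_mult ?G y (axis i 1))" for i
    proof (rule lincomb_eqI)
      show "sc_mult ?G (axis i 1) (axis k 1) = - sc_mult ?G (axis k 1) (axis i 1)" for k by (rule 1)
    qed (simp_all add: ops vec_eq_iff)
    then have "(\<lambda>x. sc_mult ?G x y) = (\<lambda>x. - sc_mult ?G y x)" for y
      by (intro lincomb_eqI) (simp_all add: ops vec_eq_iff fun_eq_iff)
    then show ?thesis by meson
  qed
  have sym: "bform ?M x y = bform ?M y x" for x y
  proof -
    have "M i j = M j i" for i j using G unfolding cross_product_def by (metis bform_axis)
    then show ?thesis unfolding bform_def by (subst sum.swap) (simp add: mult.commute)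
  qed
  have nondeg: "x = 0" if "\<And>y. bform ?M x y = 0" for x
  proof -
    define b where "b i = (\<chi> j. M i j)" for i
    have *: "lincomb b x = 0 \<longleftrightarrow> (\<forall>j. bform M x (axis j 1) = 0)" for x
      by (simp add: lincomb_def bform_axis_right b_def vec_eq_iff)
    have "x = 0" if "lincomb b x = 0" for x
    proof -
      have "\<forall>j. bform M x (axis j 1) = 0" using that * by simp
      then have "bform M x (\<Sum>j\<in>S. (y $ j) *s axis j 1) = 0" for S :: "'n set" and y
        by (induct S rule: infinite_finite_induct) (simp_all add: bform_add bform_scale)
      from this[of _ UNIV] show ?thesis
        using G unfolding cross_product_def basis_expansion_ring by metis
    qed
    then have "inj (lincomb b)"
      using lincomb_add[of b] by (intro injI) (metis add_cancel_right_left diff_add_cancel eq_iff_diff_eq_0)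
    then have "inj (lincomb (\<lambda>k. map_vec \<phi> (b k)))" by (rule inj_lincomb_base_change)
    moreover have "lincomb (\<lambda>k. map_vec \<phi> (b k)) x = 0"
      using that[of "axis _ 1"] by (simp add: lincomb_def vec_eq_iff b_def bform_axis_right)
    ultimately show ?thesis by (metis injD lincomb_zero)
  qed
  define L where "L x z y = sc_mult ?G x (sc_mult ?G z y) + sc_mult ?G z (sc_mult ?G x y)" for x y z
  define R where "R x z y = - (bform ?M x z *s y + bform ?M x y *s z + bform ?M z y *s x)" for x y z
  have L: "L (x + x') z y = L x z y + L x' z y" "L x (z + z') y = L x z y + L x z' y" "L x z (y + y') = L x z y + L x z y'"
    "L (c *s x) z y = c *s L x z y" "L x (c *s z) y = c *s L x z y" "L x z (c *s y) = c *s L x z y" for x x' y y' z z' c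
    by (simp_all add: L_def ops vec_eq_iff algebra_simps)
  have R: "R (x + x') z y = R x z y + R x' z y" "R x (z + z') y = R x z y + R x z' y" "R x z (y + y') = R x z y + R x z y'"
    "R (c *s x) z y = c *s R x z y" "R x (c *s z) y = c *s R x z y" "R x z (c *s y) = c *s R x z y" for x x' y y' z z' c
    by (simp_all add: R_def ops vec_eq_iff algebra_simps)
  have "L (axis i 1) (axis j 1) (axis k 1) = R (axis i 1) (axis j 1) (axis k 1)" for i j k
  proof -
    have "map_vec \<phi> (sc_mult G (axis i 1) (sc_mult G (axis j 1) (axis k 1)) + sc_mult G (axis j 1) (sc_mult G (axis i 1) (axis k 1))) =
      map_vec \<phi> (- (M i j *s axis k 1 + M i k *s axis j 1 + M j k *s axis i 1))"
      using G unfolding cross_product_def by (metis bform_axis)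
    then show ?thesis
      unfolding L_def R_def ax map_vec_sc_mult[symmetric] map_bform[symmetric]
        map_vec_scale[symmetric] map_vec_add[symmetric] map_vec_minus[symmetric] by simp
  qed
  then have "(\<lambda>y. L (axis i 1) (axis j 1) y) = (\<lambda>y. R (axis i 1) (axis j 1) y)" for i j
    by (intro lincomb_eqI) (simp_all add: L R)
  then have "(\<lambda>z. L (axis i 1) z y) = (\<lambda>z. R (axis i 1) z y)" for i y
    by (intro lincomb_eqI) (simp_all add: L R fun_eq_iff)
  then have "(\<lambda>x. L x z y) = (\<lambda>x. R x z y)" for z y
    by (intro lincomb_eqI) (simp_all add: L R fun_eq_iff)
  then have "L x z y = R x z y" for x z y by meson
  then show ?thesis unfolding cross_product_def L_def R_def using anti sym nondeg by blast
qed

text \<open>The form is read off from structure constants, so it is defined over the small field.\<close>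

lemma cross_product_descent:
  fixes G :: "('a, 'n::finite) table"
  assumes G: "cross_product (base_change \<phi> G) N" and card: "CARD('n) > 2"
  shows "\<exists>M. cross_product G M"
proof -
  let ?G = "base_change \<phi> G"
  have ax: "axis i 1 = map_vec \<phi> (axis i 1)" for i :: 'n by simp
  have "\<exists>m. N i j = \<phi> m" for i j
  proof -
    obtain k :: 'n where k: "k \<noteq> i" "k \<noteq> j" by (rule exists_other_index[OF card])
    have "N i j = - (map_vec \<phi> (sc_mult G (axis i 1) (sc_mult G (axis j 1) (axis k 1)) +
      sc_mult G (axis j 1) (sc_mult G (axis i 1) (axis k 1))) $ k)"
      using cross_product_form[OF G k] by (simp add: map_vec_add map_vec_sc_mult del: sc_mult_axis)
    then show ?thesis by (metis map_vec_nth minus)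
  qed
  then obtain M where M: "N = (\<lambda>i j. \<phi> (M i j))" by metis
  have anti: "sc_mult G x y = - sc_mult G y x" for x y
  proof -
    have "map_vec \<phi> (sc_mult G x y) = map_vec \<phi> (- sc_mult G y x)"
      using G unfolding cross_product_def by (metis map_vec_sc_mult map_vec_minus)
    then show ?thesis by simp
  qed
  have sym: "bform M x y = bform M y x" for x y
  proof -
    have "\<phi> (bform M x y) = \<phi> (bform M y x)"
      using G unfolding cross_product_def M by (metis map_bform)
    then show ?thesis by simp
  qed
  have nd: "x = 0" if x: "\<forall>y. bform M x y = 0" for x
  proof -
    have "bform N (map_vec \<phi> x) (axis j 1) = 0" for j
      using x unfolding M ax map_bform[symmetric] by simp
    then have "bform N (map_vec \<phi> x) (\<Sum>j\<in>S. (y $ j) *s axis j 1) = 0" for S :: "'n set" and y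
      by (induct S rule: infinite_finite_induct) (simp_all add: bform_add bform_scale)
    from this[of _ UNIV] have "bform N (map_vec \<phi> x) y = 0" for y
      by (simp only: basis_expansion_ring)
    then have "map_vec \<phi> x = 0" using G unfolding cross_product_def by blast
    then show ?thesis by simp
  qed
  have lin: "sc_mult G x (sc_mult G z y) + sc_mult G z (sc_mult G x y) =
        - (bform M x z *s y + bform M x y *s z + bform M z y *s x)" for x y z
  proof -
    have "sc_mult ?G (map_vec \<phi> x) (sc_mult ?G (map_vec \<phi> z) (map_vec \<phi> y)) +
        sc_mult ?G (map_vec \<phi> z) (sc_mult ?G (map_vec \<phi> x) (map_vec \<phi> y)) =
        - (bform N (map_vec \<phi> x) (map_vec \<phi> z) *s map_vec \<phi> y + bform N (map_vec \<phi> x) (map_vec \<phi> y) *s map_vec \<phi> z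
           + bform N (map_vec \<phi> z) (map_vec \<phi> y) *s map_vec \<phi> x)"
      using G unfolding cross_product_def by blast
    then have "map_vec \<phi> (sc_mult G x (sc_mult G z y) + sc_mult G z (sc_mult G x y)) =
        map_vec \<phi> (- (bform M x z *s y + bform M x y *s z + bform M z y *s x))"
      unfolding M map_vec_add map_vec_minus map_vec_scale map_vec_sc_mult map_bform .
    then show ?thesis by simp
  qed
  have "cross_product G M"
    unfolding cross_product_def
  proof (intro conjI)
    show "\<forall>x y. sc_mult G x y = - sc_mult G y x" using anti by blast
    show "\<forall>x y. bform M x y = bform M y x" using sym by blast
    show "\<forall>x. (\<forall>y. bform M x y = 0) --> x = 0" using nd by blast
  qed (use lin in blast)
  then show ?thesis by blast
qed

end

locale char3_cross_product =
  fixes G :: "('a::field, 'n::finite) table" and M :: "'n => 'n => 'a"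
  assumes cross: "cross_product G M" and char: "CHAR('a) = 3"
begin

abbreviation bracket :: "'a^'n => 'a^'n => 'a^'n" where "bracket \<equiv> sc_mult G"
abbreviation form :: "'a^'n => 'a^'n => 'a" where "form \<equiv> bform M"

lemma antisym: "bracket x y = - bracket y x"
  using cross unfolding cross_product_def by blast

lemma form_sym: "form x y = form y x"
  using cross unfolding cross_product_def by blast

lemma nondegenerate: "(\<And>y. form x y = 0) ==> x = 0"
  using cross unfolding cross_product_def by blast

lemma double_lin: "bracket x (bracket z y) + bracket z (bracket x y) =
    - (form x z *s y + form x y *s z + form z y *s x)"
  using cross unfolding cross_product_def by blast

lemma three [simp]: "(3::'a) = 0"
  by (rule char3(1)[OF char])

lemma add_self: "t + t = - (t::'a)"
  using char3(2)[OF char] by (metis mult_2 mult_minus1)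

lemma add_self_vec: "v + v = - (v::'a^'n)"
  by (simp add: vec_eq_iff add_self)

lemma alternating [simp]: "bracket x x = 0"
proof -
  have "bracket x x + bracket x x = 0" using antisym[of x x] by (metis add.right_inverse)
  then show ?thesis by (simp add: add_self_vec)
qed

lemma double: "bracket x (bracket x y) = form x x *s y - form x y *s x"
proof -
  have "- bracket x (bracket x y) = - (form x x *s y + (form x y *s x + form x y *s x))"
    using double_lin[of x x y] by (simp only: add_self_vec add.assoc)
  also have "\<dots> = - (form x x *s y - form x y *s x)" by (simp only: add_self_vec uminus_add_conv_diff diff_conv_add_uminus)
  finally have "- bracket x (bracket x y) = - (form x x *s y - form x y *s x)" .
  then show ?thesis by (simp only: neg_equal_iff_equal)
qed

text \<open>
  By the linearised identity, successive terms differ by the same expression, symmetric in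
  \<open>x, y, z\<close>; so their sum is three times one of them.
\<close>

lemma jacobi: "bracket x (bracket y z) + bracket y (bracket z x) + bracket z (bracket x y) = 0"
proof -
  have "bracket x (bracket z y) + bracket z (bracket x y) = bracket x (bracket y z) + bracket y (bracket x z)"
    unfolding double_lin using form_sym[of z y] by (simp add: vec_eq_iff algebra_simps)
  then have "bracket z (bracket x y) + bracket y (bracket z x) = bracket x (bracket y z) + bracket x (bracket y z)"
    using antisym[of z y] antisym[of x z] by (simp add: sc_mult_minus algebra_simps)
  then have "bracket x (bracket y z) + bracket y (bracket z x) + bracket z (bracket x y) =
      bracket x (bracket y z) + bracket x (bracket y z) + bracket x (bracket y z)"
    by (simp add: algebra_simps)
  also have "\<dots> = (3::'a) *s bracket x (bracket y z)" by (simp add: vec_eq_iff)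
  finally show ?thesis by (simp add: char3(1)[OF char])
qed

lemma derivation: "bracket x (bracket y z) = bracket (bracket x y) z + bracket y (bracket x z)"
proof -
  have "bracket y (bracket z x) = - bracket y (bracket x z)" "bracket z (bracket x y) = - bracket (bracket x y) z"
    using antisym[of z x] antisym[of z "bracket x y"] by (simp_all add: sc_mult_minus)
  then have "bracket x (bracket y z) + - bracket y (bracket x z) + - bracket (bracket x y) z = 0"
    using jacobi[of x y z] by simp
  then show ?thesis by (simp add: diff_eq_eq)
qed

lemma form_bracket_self: "form x (bracket x y) = 0"
proof (cases "x = 0")
  case False
  have "bracket x (bracket x (bracket x y)) = form x x *s bracket x y"
    unfolding double[of x y] by (simp add: sc_mult_diff sc_mult_scale)
  then have "form x (bracket x y) *s x = 0" unfolding double[of x "bracket x y"] by simp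
  then show ?thesis using False by simp
qed simp

text \<open>Linearise \<open>b(x, [x, y]) = 0\<close>.\<close>

lemma invariant: "form (bracket x y) z = form x (bracket y z)"
proof -
  have "form (x + z) (bracket (x + z) y) = 0" by (rule form_bracket_self)
  then have "form x (bracket z y) + form z (bracket x y) = 0"
    by (simp add: sc_mult_add bform_add form_bracket_self add.commute)
  then show ?thesis
    using antisym[of y z] form_sym[of z "bracket x y"]
    by (simp add: bform_minus add_eq_0_iff)
qed

end

section \<open>Cayley algebras and cross products\<close>

subsection \<open>Composition algebras in coordinates\<close>

text \<open>
  Cayley algebras in coordinates, with the bilinearity of the polar form expressed by values of the quadratic
  form. The dimension is left open.
\<close>

locale composition =
  fixes m :: "'a::field^'n::finite => 'a^'n => 'a^'n" and u :: "'a^'n" and Q :: "'a^'n => 'a"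
  assumes char: "CHAR('a) = 3"
    and m_add: "m (x + y) z = m x z + m y z" "m z (x + y) = m z x + m z y"
    and m_scale: "m (c *s x) z = c *s m x z" "m z (c *s x) = c *s m z x"
    and unit: "m u x = x" "m x u = x"
    and Q_scale: "Q (c *s x) = c\<^sup>2 * Q x"
    and Q_polar_add: "Q (x + y + z) - Q (x + y) - Q z = (Q (x + z) - Q x - Q z) + (Q (y + z) - Q y - Q z)"
    and Q_polar_scale: "Q (c *s x + y) - Q (c *s x) - Q y = c * (Q (x + y) - Q x - Q y)"
    and Q_mult: "Q (m x y) = Q x * Q y"
    and nondeg: "(\<And>y. Q (x + y) - Q x - Q y = 0) ==> x = 0"
begin

definition b :: "'a^'n => 'a^'n => 'a" where "b x y = Q (x + y) - Q x - Q y"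

lemma b_sym: "b x y = b y x" by (simp add: b_def add.commute)

lemma b_add: "b (x + y) z = b x z + b y z" "b z (x + y) = b z x + b z y"
  using Q_polar_add[of x y z] b_sym by (simp_all add: b_def add.commute)

lemma b_scale: "b (c *s x) z = c * b x z" "b z (c *s x) = c * b z x"
proof -
  show 1: "b (c *s x) z = c * b x z" for x z using Q_polar_scale[of c x z] by (simp add: b_def)
  show "b z (c *s x) = c * b z x" using 1[of x z] by (simp only: b_sym[of z])
qed

lemma b_minus: "b (- x) z = - b x z" "b z (- x) = - b z x"
  using b_scale[where c = "- 1"] by (simp_all add: vector_sneg_minus1[symmetric])

lemma b_diff: "b (x - y) z = b x z - b y z" "b z (x - y) = b z x - b z y"
  using b_add(1)[of x "- y" z] b_add(2)[of z x "- y"] by (simp_all add: b_minus)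

lemma m_minus: "m (- x) z = - m x z" "m z (- x) = - m z x"
  using m_scale[where c = "- 1"] by (simp_all add: vector_sneg_minus1[symmetric])

lemma m_diff: "m (x - y) z = m x z - m y z" "m z (x - y) = m z x - m z y"
  using m_add(1)[of x "- y" z] m_add(2)[of z x "- y"] by (simp_all add: m_minus)

lemma b_nondeg: "(\<And>y. b x y = 0) ==> x = 0"
  using nondeg by (simp add: b_def)

lemma b_eqI: "(\<And>z. b x z = b y z) ==> x = y"
  using b_nondeg[of "x - y"] by (simp add: b_diff)

lemma Q_add: "Q (x + y) = Q x + Q y + b x y"
  by (simp add: b_def)

lemma b_self: "b x x = - Q x"
proof -
  have "Q (x + x) = Q ((1 + 1) *s x)" by (simp only: vector_sadd_rdistrib vector_smult_lid)
  also have "\<dots> = Q x" unfolding char3(3)[OF char] by (simp only: Q_scale) simp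
  finally show ?thesis by (simp add: b_def)
qed

lemma b_mult_left: "b (m x y) (m x z) = Q x * b y z"
  unfolding b_def m_add(2)[symmetric] Q_mult by (simp add: algebra_simps)

lemma b_mult_right: "b (m x y) (m z y) = b x z * Q y"
  unfolding b_def m_add(1)[symmetric] Q_mult by (simp add: algebra_simps)

text \<open>
  Polarising \<open>q(x y) = q(x) q(y)\<close> in both factors; the later identities of composition algebras are
  special cases of this one and of its variant.
\<close>

lemma b_exchange: "b (m x y) (m w z) + b (m w y) (m x z) = b x w * b y z"
proof -
  have "b (m (x + w) y) (m (x + w) z) = Q (x + w) * b y z" by (rule b_mult_left)
  then show ?thesis by (simp add: m_add b_add b_mult_left Q_add b_sym[of w x] algebra_simps)
qed

lemma b_exchange': "b (m x y) (m z w) + b (m x w) (m z y) = b x z * b y w"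
proof -
  have "b (m x (y + w)) (m z (y + w)) = b x z * Q (y + w)" by (rule b_mult_right)
  then show ?thesis by (simp add: m_add b_add b_mult_right Q_add b_sym[of w y] algebra_simps)
qed

lemma b_skew_left: "b x u = 0 ==> b (m x y) z = - b y (m x z)"
  using b_exchange[of x y u z] by (simp add: unit add_eq_0_iff2)

lemma b_skew_right: "b x u = 0 ==> b (m y x) z = - b y (m z x)"
  using b_exchange'[of y x z u] by (simp add: unit add_eq_0_iff2)

lemma left_square: "b x u = 0 ==> m x (m x y) = (- Q x) *s y"
  by (rule b_eqI) (simp add: b_skew_left b_mult_left b_scale b_minus)

lemma right_square: "b x u = 0 ==> m (m y x) x = (- Q x) *s y"
  by (rule b_eqI) (simp add: b_skew_right b_mult_right b_scale b_minus)

lemma square: "b x u = 0 ==> m x x = (- Q x) *s u"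
  using left_square[of x u] by (simp add: unit)

lemma anticommute: "b x u = 0 ==> b y u = 0 ==> m x y + m y x = (- b x y) *s u"
proof -
  assume x: "b x u = 0" and y: "b y u = 0"
  have "m (x + y) (x + y) = (- Q (x + y)) *s u" by (rule square) (simp add: b_add x y)
  then have "m x y + m y x + ((- Q x) *s u + (- Q y) *s u) = (- b x y) *s u + ((- Q x) *s u + (- Q y) *s u)"
    by (simp add: m_add square x y Q_add vec_eq_iff algebra_simps)
  then show ?thesis by (simp only: add_right_cancel)
qed

definition comm :: "'a^'n => 'a^'n => 'a^'n" where "comm x y = m x y - m y x"

lemma comm_add: "comm (x + y) z = comm x z + comm y z" "comm z (x + y) = comm z x + comm z y"
  by (simp_all add: comm_def m_add)

lemma comm_scale: "comm (c *s x) z = c *s comm x z" "comm z (c *s x) = c *s comm z x"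
  by (simp_all add: comm_def m_scale vector_ssub_ldistrib)

lemma three [simp]: "(3::'a) = 0" by (rule char3(1)[OF char])

lemma add_self: "t + t = - (t::'a)"
  using char3(2)[OF char] by (metis mult_2 mult_minus1)

lemma product: "b x u = 0 ==> b y u = 0 ==> m x y = b x y *s u - comm x y"
proof -
  assume xy: "b x u = 0" "b y u = 0"
  have "m x y - (b x y *s u - comm x y) = m x y + m x y + (m x y - (m x y + m y x)) - b x y *s u"
    by (simp add: comm_def)
  also have "\<dots> = (m x y + m x y + m x y) - (m x y + m y x) - b x y *s u" by simp
  also have "\<dots> = 0"
    unfolding anticommute[OF xy] by (simp add: vec_eq_iff)
  finally show ?thesis by simp
qed

lemma comm_trace_zero: "b x u = 0 ==> b y u = 0 ==> b (comm x y) u = 0"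
proof -
  assume x: "b x u = 0" and y: "b y u = 0"
  have "b (m x y) u = - b y x" "b (m y x) u = - b x y"
    using b_skew_left[OF x, of y u] b_skew_left[OF y, of x u] by (simp_all add: unit)
  then show ?thesis by (simp add: comm_def b_diff b_sym[of y x])
qed

text \<open>
  In characteristic 3 the product of trace zero elements is \<open>x y = b(x, y) - [x, y]\<close>, because
  \<open>x y + y x\<close> is a scalar and \<open>2 = -1\<close>. The identity follows from
  \<open>x (x y) = -q(x) y\<close>.
\<close>

lemma double_comm:
  assumes x: "b x u = 0" and y: "b y u = 0"
  shows "comm x (comm x y) = b x x *s y - b x y *s x"
proof -
  have yx: "m y x = (- b x y) *s u - m x y" using anticommute[OF x y] by (simp add: algebra_simps)
  have xy: "m x y = (- b x y) *s u - m y x" using anticommute[OF x y] by (simp add: algebra_simps)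
  have 1: "m x (m y x) = (- b x y) *s x + Q x *s y"
    unfolding yx m_diff m_scale unit left_square[OF x] by (simp add: vec_eq_iff)
  have 2: "m (m x y) x = (- b x y) *s x + Q x *s y"
    unfolding xy m_diff m_scale unit right_square[OF x] by (simp add: vec_eq_iff)
  have "comm x (comm x y) = m x (m x y) - m x (m y x) - m (m x y) x + m (m y x) x"
    by (simp add: comm_def m_diff)
  also have "\<dots> = b x x *s y - b x y *s x"
    unfolding left_square[OF x] right_square[OF x] 1 2 b_self
  proof -
    have "- q * t - (- d * s + q * t) - (- d * s + q * t) + - q * t = - q * t - d * s" for q t d s :: 'a
    proof -
      have "- q * t - (- d * s + q * t) - (- d * s + q * t) + - q * t - (- q * t - d * s) = 3 * (d * s - q * t)"
        by (simp add: algebra_simps del: three)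
      then show ?thesis by simp
    qed
    then show "(- Q x) *s y - ((- b x y) *s x + Q x *s y) - ((- b x y) *s x + Q x *s y) + (- Q x) *s y = (- Q x) *s y - b x y *s x"
      by (simp only: vec_eq_iff vector_add_component vector_minus_component vector_smult_component simp_thms)
  qed
  finally show ?thesis .
qed

lemma Q_unit: assumes "u \<noteq> 0" shows "Q u = 1"
proof -
  have "Q u * Q u = Q u" using Q_mult[of u u] by (simp add: unit)
  moreover have "Q u \<noteq> 0"
  proof
    assume "Q u = 0"
    then have "Q x = 0" for x using Q_mult[of u x] by (simp add: unit)
    then have "u = 0" by (intro nondeg) simp
    with assms show False by simp
  qed
  ultimately show ?thesis by simp
qed

lemma b_unit: "u \<noteq> 0 ==> b u u = - 1" by (simp add: b_self Q_unit)

lemma trace_zero_basis: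
  assumes u: "u \<noteq> 0" and card: "CARD('n) = CARD('p::finite) + 1"
  shows "\<exists>p::'p => 'a^'n. inj (lincomb p) \<and> range (lincomb p) = {x. b x u = 0}"
proof -
  let ?V = "{x. b x u = 0}"
  have sub: "vec.subspace ?V"
    by (rule vec.subspaceI) (use b_scale[of 0 0 u] in \<open>auto simp: b_add b_scale\<close>)
  have spV: "vec.span ?V = ?V" using sub by (simp add: vec.span_eq_iff)
  have nu: "u \<notin> vec.span ?V" unfolding spV using b_unit[OF u] by simp
  have "x \<in> vec.span (insert u ?V)" for x
  proof -
    have "x + b x u *s u \<in> ?V" using b_unit[OF u] by (simp add: b_add b_scale)
    then have "(x + b x u *s u) - b x u *s u \<in> vec.span (insert u ?V)"
      by (intro vec.span_diff vec.span_scale) (auto intro: vec.span_base)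
    then show ?thesis by simp
  qed
  then have "vec.dim (insert u ?V) = CARD('n)"
    using dim_cart[where 'a = 'a and 'n = 'n] vec.dim_span[of "insert u ?V"] by (metis UNIV_eq_I)
  then have "vec.dim ?V = CARD('p)" using vec.dim_insert[of u ?V] nu card by simp
  from basis_family_from_spanning[OF this] obtain p :: "'p => 'a^'n"
    where p: "inj p" "vec.independent (range p)" "vec.span (range p) = vec.span ?V" by blast
  then show ?thesis
    using lincomb_inj[OF p(1,2)] range_lincomb[of p] spV by auto
qed

text \<open>
  Trace zero elements form the hyperplane orthogonal to the unit; it is closed under commutators and the polar
  form stays nondegenerate on it because \<open>b(1, 1) = 2\<close> is invertible.
\<close>

theorem exists_cross_product:
  assumes u: "u \<noteq> 0" and card: "CARD('n) = CARD('p::finite) + 1"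
  shows "\<exists>(p::'p => 'a^'n) G M. cross_product G M \<and> inj (lincomb p) \<and> range (lincomb p) = {x. b x u = 0} \<and>
    (\<forall>x y. lincomb p (sc_mult G x y) = comm (lincomb p x) (lincomb p y)) \<and>
    (\<forall>x y. bform M x y = b (lincomb p x) (lincomb p y))"
proof -
  obtain p :: "'p => 'a^'n" where p: "inj (lincomb p)" "range (lincomb p) = {x. b x u = 0}"
    using trace_zero_basis[OF u card] by blast
  obtain r where r: "\<And>c. lincomb r (lincomb p c) = c" using lincomb_left_inverse[OF p(1)] by blast
  have tz: "b (lincomb p x) u = 0" for x using p(2) by blast
  have pr: "lincomb p (lincomb r x) = x" if "b x u = 0" for x
    using p(2) that r by (metis (mono_tags, lifting) imageE mem_Collect_eq)
  define k where "k x y = lincomb r (comm (lincomb p x) (lincomb p y))" for x y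
  have k: "k = sc_mult (\<lambda>i j. k (axis i 1) (axis j 1))" (is "_ = sc_mult ?G")
    by (rule bilinear_eq_sc_mult)
      (simp_all add: k_def comm_add comm_scale lincomb_add lincomb_scale)
  define f where "f x y = b (lincomb p x) (lincomb p y)" for x y
  have f: "f = bform (\<lambda>i j. f (axis i 1) (axis j 1))" (is "_ = bform ?M")
    by (rule bilinear_eq_bform) (simp_all add: f_def lincomb_add lincomb_scale b_add b_scale)
  have pk: "lincomb p (k x y) = comm (lincomb p x) (lincomb p y)" for x y
    unfolding k_def by (rule pr[OF comm_trace_zero[OF tz tz]])
  have pinj: "x = y" if "lincomb p x = lincomb p y" for x y using p(1) that by (simp add: inj_eq)
  have anti: "k x y = - k y x" for x y
  proof -
    have "comm x y = (- 1) *s comm y x" for x y by (simp add: comm_def vec_eq_iff)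
    then have "lincomb r (comm x y) = - lincomb r (comm y x)" for x y
      by (metis lincomb_scale vector_sneg_minus1)
    then show ?thesis unfolding k_def by blast
  qed
  have dbl: "k x (k x y) = f x x *s y - f x y *s x" for x y
  proof (rule pinj)
    have "lincomb p (k x (k x y)) = f x x *s lincomb p y - f x y *s lincomb p x"
      unfolding pk f_def by (rule double_comm[OF tz tz])
    then show "lincomb p (k x (k x y)) = lincomb p (f x x *s y - f x y *s x)"
      using lincomb_add[of p "f x x *s y - f x y *s x" "f x y *s x"]
      by (simp add: lincomb_scale lincomb_add diff_eq_eq)
  qed
  have fsym: "f x y = f y x" for x y unfolding f_def by (rule b_sym)
  have k_add: "k (x + y) z = k x z + k y z" "k z (x + y) = k z x + k z y" for x y z
    by (subst (1 2 3) k, rule sc_mult_add)+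
  have f_add: "f (x + y) z = f x z + f y z" "f z (x + y) = f z x + f z y" for x y z
    by (simp_all add: f_def lincomb_add b_add)
  have lin: "k x (k z y) + k z (k x y) = - (f x z *s y + f x y *s z + f z y *s x)" for x y z
  proof -
    have "k x (k z y) + k z (k x y) = k (x + z) (k (x + z) y) - k x (k x y) - k z (k z y)"
      by (simp add: k_add algebra_simps)
    also have "\<dots> = (f x z *s y + f x z *s y) - f x y *s z - f z y *s x"
      unfolding dbl by (simp add: f_add fsym[of z x] vec_eq_iff algebra_simps)
    also have "\<dots> = - (f x z *s y + f x y *s z + f z y *s x)"
    proof -
      have "f x z *s y + f x z *s y = - (f x z *s y)" by (simp add: vec_eq_iff add_self)
      then show ?thesis by simp
    qed
    finally show ?thesis .
  qed
  have nd: "x = 0" if h: "\<And>y. f x y = 0" for x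
  proof -
    have "b (lincomb p x) z = 0" for z
    proof -
      have "z + b z u *s u \<in> range (lincomb p)" unfolding p(2) using b_unit[OF u] by (simp add: b_add b_scale)
      then obtain y where y: "z + b z u *s u = lincomb p y" by blast
      have "b (lincomb p x) (z + b z u *s u) = 0" unfolding y using h by (simp add: f_def)
      then show ?thesis using tz by (simp add: b_add b_scale)
    qed
    then have "lincomb p x = lincomb p 0" using b_nondeg by simp
    then show ?thesis by (rule pinj)
  qed
  have "cross_product ?G ?M"
    unfolding cross_product_def k[symmetric] f[symmetric]
  proof (intro conjI)
    show "\<forall>x. (\<forall>y. f x y = 0) --> x = 0" using nd by blast
    show "\<forall>x y. k x y = - k y x" using anti by blast
    show "\<forall>x y. f x y = f y x" using fsym by blast
  qed (use lin in blast)
  moreover have "\<forall>x y. lincomb p (sc_mult ?G x y) = comm (lincomb p x) (lincomb p y)"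
    unfolding k[symmetric] using pk by blast
  moreover have "\<forall>x y. bform ?M x y = b (lincomb p x) (lincomb p y)"
    unfolding f[symmetric] by (simp add: f_def)
  ultimately show ?thesis using p by blast
qed

end

subsection \<open>Bases and linear parametrisations\<close>

lemma algebra_basis_coord:
  fixes A :: "('r::comm_ring_1, 'v) module" (structure) and idx :: "'n::finite => 'i"
  assumes A: "nonassoc_algebra A" and b: "algebra_basis A I b" and idx: "bij_betw idx UNIV I"
  obtains G and g :: "'r^'n => 'v" where "algebra_hom (coord_algebra G) A g" "bij_betw g UNIV (carrier A)"
    "\<And>k. g (axis k 1) = b (idx k)" "\<And>c. g c = (\<Oplus>k\<in>UNIV. (c $ k) \<odot> b (idx k))"
proof -
  note D = nonassoc_algebraD[OF A]
  interpret A: abelian_group A by (rule D(2))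
  define g where "g = (\<lambda>c::'r^'n. \<Oplus>k\<in>UNIV. (c $ k) \<odot> b (idx k))"
  have inj: "inj idx" and I: "I = range idx" using idx by (auto simp: bij_betw_def)
  have bc: "b i \<in> carrier A" if "i \<in> I" for i using b that by (auto simp: algebra_basis_def)
  then have bidx: "b (idx k) \<in> carrier A" for k using I by auto
  have gmem: "g c \<in> carrier A" for c unfolding g_def using bidx D(3) by (intro A.finsum_closed) auto
  have reindex: "(\<Oplus>i\<in>I. c i \<odot> b i) = g (\<chi> k. c (idx k))" for c
    unfolding g_def I using bc D(3) inj I by (subst A.finsum_reindex) auto
  have ex1: "\<exists>!c. c \<in> extensional I \<and> x = (\<Oplus>i\<in>I. c i \<odot> b i)" if "x \<in> carrier A" for x
    using b that by (auto simp: algebra_basis_def)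
  have "inj g"
  proof (rule injI)
    fix c d assume eq: "g c = g d"
    define e where "e c = (\<lambda>i\<in>I. (c::'r^'n) $ the_inv_into UNIV idx i)" for c
    have e: "(\<chi> k. e c (idx k)) = c" for c
      using inj I by (simp add: e_def vec_eq_iff the_inv_into_f_f)
    have "e c \<in> extensional I \<and> g c = (\<Oplus>i\<in>I. e c i \<odot> b i)" for c
      unfolding reindex e by (simp add: e_def)
    then have "e c = e d" using ex1[OF gmem[of c]] eq by metis
    then show "c = d" using e by metis
  qed
  moreover have "x \<in> range g" if "x \<in> carrier A" for x
    using ex1[OF that] unfolding reindex by blast
  ultimately have bij: "bij_betw g UNIV (carrier A)" using gmem by (auto simp: bij_betw_def)
  obtain G where G: "algebra_hom (coord_algebra G) A g"
    using coord_algebra_basis[OF A bidx g_def bij] by blast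
  have "g (axis k 1) = b (idx k)" for k
  proof -
    have "g (axis k 1) = (\<Oplus>j\<in>UNIV. if k = j then b (idx j) else \<zero>)"
      unfolding g_def using bidx D(7,8) by (intro A.finsum_cong') (auto simp: axis_def)
    also have "\<dots> = b (idx k)" using A.finsum_singleton[of k UNIV "\<lambda>j. b (idx j)"] bidx by auto
    finally show ?thesis .
  qed
  then show ?thesis using that[OF G bij] by (simp add: g_def)
qed

lemma algebra_basis_of_iso:
  fixes A :: "('r::comm_ring_1, 'v) module" (structure) and g :: "'r^'n::finite => 'v" and idx :: "'i => 'n"
  assumes A: "nonassoc_algebra A" and bij: "bij_betw g UNIV (carrier A)"
    and add: "\<And>x y. g (x + y) = g x \<oplus> g y" and scale: "\<And>c x. g (c *s x) = c \<odot> g x"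
    and idx: "bij_betw idx I UNIV" and b: "\<And>i. i \<in> I ==> b i = g (axis (idx i) 1)"
  shows "algebra_basis A I b"
proof -
  note D = nonassoc_algebraD[OF A]
  interpret A: abelian_group A by (rule D(2))
  have I: "finite I" using bij_betw_finite[OF idx] by simp
  define h where "h = the_inv_into UNIV g"
  have gmem: "g x \<in> carrier A" for x using bij by (auto simp: bij_betw_def)
  have hg: "h (g x) = x" for x
    unfolding h_def using bij by (simp add: bij_betw_def the_inv_into_f_f)
  have gh: "g (h y) = y" if "y \<in> carrier A" for y
    unfolding h_def using bij that by (simp add: bij_betw_def f_the_inv_into_f)
  have hadd: "h (x \<oplus> y) = h x + h y" if "x \<in> carrier A" "y \<in> carrier A" for x y
    using hg[of "h x + h y"] gh that by (simp add: add)
  have hscale: "h (c \<odot> x) = c *s h x" if "x \<in> carrier A" for c x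
    using hg[of "c *s h x"] gh that by (simp add: scale)
  have sum: "h (\<Oplus>i\<in>I. c i \<odot> b i) $ idx j = c j" if "j \<in> I" for c j
  proof -
    have "h (\<Oplus>i\<in>I. c i \<odot> b i) = (\<Sum>i\<in>I. h (c i \<odot> b i))"
      by (rule additive_finsum[OF A hadd I]) (auto simp: b gmem D(3))
    also have "\<dots> = (\<Sum>i\<in>I. c i *s axis (idx i) 1)"
      by (rule sum.cong) (simp_all add: hscale b gmem hg)
    finally have "h (\<Oplus>i\<in>I. c i \<odot> b i) $ idx j = (\<Sum>i\<in>I. if i = j then c i else 0)"
      using idx that by (auto simp: axis_def bij_betw_def inj_on_def intro!: sum.cong)
    then show ?thesis using that I by simp
  qed
  have fsmem: "(\<Oplus>i\<in>I. c i \<odot> b i) \<in> carrier A" for c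
    by (rule A.finsum_closed) (auto simp: b gmem D(3))
  show ?thesis
    unfolding algebra_basis_def
  proof (intro conjI ballI)
    show "finite I" by fact
    show "b \<in> I \<rightarrow> carrier A" by (auto simp: b gmem)
    fix x assume x: "x \<in> carrier A"
    show "\<exists>!c. c \<in> extensional I \<and> x = (\<Oplus>i\<in>I. c i \<odot> b i)"
    proof (rule ex1I[of _ "\<lambda>i\<in>I. h x $ idx i"], intro conjI)
      let ?c = "\<lambda>i\<in>I. h x $ idx i"
      have "h (\<Oplus>i\<in>I. ?c i \<odot> b i) = h x"
      proof (simp only: vec_eq_iff, rule allI)
        fix k :: 'n
        obtain i where i: "i \<in> I" "k = idx i" using idx unfolding bij_betw_def by (metis imageE UNIV_I)
        show "h (\<Oplus>i\<in>I. ?c i \<odot> b i) $ k = h x $ k"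
          using sum[OF i(1), of ?c] i by simp
      qed
      then show "x = (\<Oplus>i\<in>I. ?c i \<odot> b i)" using gh[OF x] gh[OF fsmem] by metis
    next
      fix c assume c: "c \<in> extensional I \<and> x = (\<Oplus>i\<in>I. c i \<odot> b i)"
      show "c = (\<lambda>i\<in>I. h x $ idx i)"
      proof (rule extensionalityI[of _ I])
        show "c j = (\<lambda>i\<in>I. h x $ idx i) j" if "j \<in> I" for j using sum[OF that, of c] c that by simp
      qed (use c in auto)
    qed simp
  qed
qed

subsection \<open>The Cayley algebra of a cross product\<close>

text \<open>
  The sign of the bracket and the form without a factor 2 are those of \<open>x y = b(x, y) - [x, y]\<close> in
  a Cayley algebra of characteristic 3.
\<close>

definition octonions ::
  "('a::field, 'n::finite) table => ('n => 'n => 'a) => ('a, 'a \<times> ('a^'n)) module" where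
  "octonions G M =
     \<lparr>carrier = UNIV,
      mult = (\<lambda>s t. (fst s * fst t + bform M (snd s) (snd t),
        fst s *s snd t + fst t *s snd s - sc_mult G (snd s) (snd t))),
      one = (1, 0), zero = 0, add = (+), smult = (\<lambda>c s. (c * fst s, c *s snd s))\<rparr>"

lemma octonions_simps [simp]:
  "carrier (octonions G M) = UNIV"
  "s \<otimes>\<^bsub>octonions G M\<^esub> t = (fst s * fst t + bform M (snd s) (snd t),
     fst s *s snd t + fst t *s snd s - sc_mult G (snd s) (snd t))"
  "\<one>\<^bsub>octonions G M\<^esub> = (1, 0)" "\<zero>\<^bsub>octonions G M\<^esub> = 0" "s \<oplus>\<^bsub>octonions G M\<^esub> t = s + t"
  "c \<odot>\<^bsub>octonions G M\<^esub> s = (c * fst s, c *s snd s)"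
  by (simp_all add: octonions_def)

definition octonion_norm :: "('n::finite => 'n => 'a::field) => 'a \<times> ('a^'n) => 'a" where
  "octonion_norm M s = (fst s)\<^sup>2 - bform M (snd s) (snd s)"

lemma nonassoc_octonions: "nonassoc_algebra (octonions G M)"
  unfolding nonassoc_algebra_def
proof (intro conjI)
  show "Module.module ring_of_type_algebra (octonions G M)"
  proof (rule module_ring_of_typeI)
    show "abelian_group (octonions G M)"
    proof (rule abelian_groupI)
      show "\<exists>y\<in>carrier (octonions G M). y \<oplus>\<^bsub>octonions G M\<^esub> x = \<zero>\<^bsub>octonions G M\<^esub>" for x
        by (intro bexI[of _ "- x"]) auto
    qed (auto simp: algebra_simps)
  qed (auto simp: prod_eq_iff algebra_simps vector_sadd_rdistrib vector_add_ldistrib vector_scale_scale)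
qed (auto simp: prod_eq_iff vec_eq_iff sc_mult_add sc_mult_scale bform_add bform_scale algebra_simps)

context char3_cross_product
begin

lemma polar_octonion_norm:
  "polar_form (octonions G M) (octonion_norm M) s t = form (snd s) (snd t) - fst s * fst t"
proof -
  have "polar_form (octonions G M) (octonion_norm M) s t =
      (fst s * fst t + fst s * fst t) - (form (snd s) (snd t) + form (snd s) (snd t))"
    by (simp add: polar_form_def octonion_norm_def bform_add form_sym[of "snd t" "snd s"] power2_eq_square algebra_simps
        del: add_self)
  then show ?thesis unfolding add_self by simp
qed

text \<open>
  The two sides agree because \<open>[x, y]\<close> is orthogonal to \<open>x\<close> and \<open>y\<close> and
  \<open>b([x, y], [x, y]) = b(x, y)\<^sup>2 - b(x, x) b(y, y)\<close>, which follows from invariance and the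
  defining identity.
\<close>

lemma octonion_norm_mult:
  "octonion_norm M (s \<otimes>\<^bsub>octonions G M\<^esub> t) = octonion_norm M s * octonion_norm M t"
proof -
  obtain a x where s: "s = (a, x)" by fastforce
  obtain c y where t: "t = (c, y)" by fastforce
  define nx where "nx = form x x"
  define ny where "ny = form y y"
  define r where "r = form x y"
  have yx: "form y x = r" by (simp add: r_def form_sym)
  have 1: "form y (bracket x y) = 0" "form (bracket x y) y = 0" "form x (bracket x y) = 0" "form (bracket x y) x = 0"
    using form_bracket_self[of y x] antisym[of x y] form_bracket_self[of x y] form_sym
    by (simp_all add: bform_minus)
  have "form (bracket x y) (bracket x y) = form x (bracket y (bracket x y))" by (rule invariant)
  also have "\<dots> = form x (- bracket y (bracket y x))"
    using antisym[of x y] by (simp add: sc_mult_minus)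
  also have "\<dots> = - (ny * nx - r * r)"
    unfolding double by (simp add: bform_minus bform_diff bform_scale nx_def ny_def yx r_def[symmetric])
  finally have "form (bracket x y) (bracket x y) = r * r - ny * nx" by simp
  then show ?thesis
    unfolding s t octonion_norm_def
    by (simp add: bform_add bform_scale bform_diff 1 nx_def[symmetric] ny_def[symmetric] r_def[symmetric] yx
        power2_eq_square algebra_simps)
qed

end

theorem cayley_octonions:
  fixes G :: "('a::field, 'n::finite) table"
  assumes "cross_product G M" and "CHAR('a) = 3" and card: "CARD('n) = 7"
  shows "cayley_algebra (octonions G M) (octonion_norm M)"
proof -
  interpret char3_cross_product G M by unfold_locales fact+
  define g :: "'a^('n option) => 'a \<times> ('a^'n)" where "g x = (x $ None, \<chi> k. x $ Some k)" for x
  have "bij g"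
  proof (rule bijI')
    show "g x = g y \<longleftrightarrow> x = y" for x y
      unfolding g_def prod_eq_iff by (simp add: vec_eq_iff split_option_all)
    show "\<exists>x. s = g x" for s
      by (rule exI[of _ "\<chi> k. case k of None => fst s | Some k => snd s $ k"]) (simp add: g_def prod_eq_iff vec_eq_iff)
  qed
  moreover obtain idx where idx: "bij_betw idx {..<8::nat} (UNIV :: 'n option set)"
    using finite_same_card_bij[of "{..<8::nat}" "UNIV :: 'n option set"] card by (auto simp: card_UNIV_option)
  ultimately have "algebra_basis (octonions G M) {..<8::nat} (\<lambda>i. g (axis (idx i) 1))"
    by (intro algebra_basis_of_iso[OF nonassoc_octonions, where g = g and idx = idx]) (auto simp: g_def vec_eq_iff)
  then have basis: "\<exists>b. algebra_basis (octonions G M) {..<8::nat} b" by blast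
  have "s = 0" if h: "\<And>t. form (snd s) (snd t) - fst s * fst t = 0" for s
  proof -
    have "fst s = 0" using h[of "(1, 0)"] by simp
    moreover have "form (snd s) y = 0" for y using h[of "(0, y)"] by simp
    then have "snd s = 0" by (rule nondegenerate)
    ultimately show ?thesis by (simp add: prod_eq_iff)
  qed
  then have "\<forall>s\<in>carrier (octonions G M). (\<forall>t\<in>carrier (octonions G M). polar_form (octonions G M) (octonion_norm M) s t = 0) -->
      s = \<zero>\<^bsub>octonions G M\<^esub>"
    unfolding polar_octonion_norm by simp
  moreover have "quadratic_form (octonions G M) (octonion_norm M)"
    unfolding quadratic_form_def polar_octonion_norm
    by (simp add: octonion_norm_def bform_scale bform_add power2_eq_square algebra_simps)
  ultimately show ?thesis
    unfolding cayley_algebra_def using basis octonion_norm_mult nonassoc_octonions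
    by (simp add: prod_eq_iff)
qed

theorem cayley_cross_product:
  fixes C :: "('a::field, 'v) module" (structure)
  assumes C: "cayley_algebra C q" and char: "CHAR('a) = 3"
  obtains G and M :: "7 => 7 => 'a" where "cross_product G M" "algebra_iso (octonions G M) C"
    "algebra_iso (coord_algebra G) (trace_zero_algebra C q)"
proof -
  have A: "nonassoc_algebra C" using C by (simp add: cayley_algebra_def)
  note D = nonassoc_algebraD[OF A]
  interpret A: abelian_group C by (rule D(2))
  obtain e where e: "algebra_basis C {..<8::nat} e" using C by (auto simp: cayley_algebra_def)
  obtain idx where idx: "bij_betw idx (UNIV :: 8 set) {..<8::nat}"
    using finite_same_card_bij[of "UNIV :: 8 set" "{..<8::nat}"] by auto
  obtain H and g :: "'a^8 => 'v" where g: "algebra_hom (coord_algebra H) C g" and bij: "bij_betw g UNIV (carrier C)"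
    using algebra_basis_coord[OF A e idx] by metis
  have gadd: "g (x + y) = g x \<oplus> g y" and gscale: "g (c *s x) = c \<odot> g x"
    and gmult: "g (sc_mult H x y) = g x \<otimes> g y" for x y c
    using algebra_homD[OF g] by auto
  have gmem: "g x \<in> carrier C" for x using bij by (auto simp: bij_betw_def)
  have ginj: "g x = g y \<longleftrightarrow> x = y" for x y using bij by (auto simp: bij_betw_def inj_on_def)
  have gsurj: "\<exists>x. y = g x" if "y \<in> carrier C" for y using bij that unfolding bij_betw_def by (metis imageE)
  have one: "\<one> \<in> carrier C" "\<And>x. x \<in> carrier C ==> \<one> \<otimes> x = x \<and> x \<otimes> \<one> = x"
    using C by (auto simp: cayley_algebra_def)
  obtain u where u: "\<one> = g u" using gsurj[OF one(1)] by blast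
  define Q where "Q x = q (g x)" for x
  have polar: "polar_form C q (g x) (g y) = Q (x + y) - Q x - Q y" for x y
    by (simp add: polar_form_def Q_def gadd)
  have qf: "quadratic_form C q" using C by (simp add: cayley_algebra_def)
  have g0: "g 0 = \<zero>" using gscale[of 0 0] D(8)[OF gmem] by simp
  interpret composition "sc_mult H" u Q
  proof
    show "CHAR('a) = 3" by fact
    show "sc_mult H u x = x" "sc_mult H x u = x" for x
      using one(2)[OF gmem[of x]] unfolding u by (simp_all add: gmult[symmetric] ginj)
    show "Q (c *s x) = c\<^sup>2 * Q x" for c x
      using qf gmem by (simp add: quadratic_form_def Q_def gscale)
    show "Q (sc_mult H x y) = Q x * Q y" for x y
      using C gmem by (simp add: cayley_algebra_def Q_def gmult)
    show "Q (x + y + z) - Q (x + y) - Q z = (Q (x + z) - Q x - Q z) + (Q (y + z) - Q y - Q z)" for x y z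
    proof -
      have "polar_form C q (g x \<oplus> g y) (g z) = polar_form C q (g x) (g z) + polar_form C q (g y) (g z)"
        using qf gmem unfolding quadratic_form_def by blast
      then show ?thesis by (simp only: gadd[symmetric] polar)
    qed
    show "Q (c *s x + y) - Q (c *s x) - Q y = c * (Q (x + y) - Q x - Q y)" for c x y
    proof -
      have "polar_form C q (c \<odot> g x) (g y) = c * polar_form C q (g x) (g y)"
        using qf gmem unfolding quadratic_form_def by blast
      then show ?thesis by (simp only: gscale[symmetric] polar)
    qed
    show "x = 0" if h: "\<And>y. Q (x + y) - Q x - Q y = 0" for x
    proof -
      have "\<forall>y\<in>carrier C. polar_form C q (g x) y = 0" using h gsurj polar by metis
      then have "g x = \<zero>" using C gmem unfolding cayley_algebra_def by blast
      then show ?thesis using ginj g0 by metis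
    qed
  qed (simp_all add: sc_mult_add sc_mult_scale)
  have b_polar: "polar_form C q (g x) (g y) = b x y" for x y by (simp add: polar b_def)
  have u0: "u \<noteq> 0"
  proof
    assume "u = 0"
    then have "x = 0" for x :: "'a^8" using unit(1)[of x] by simp
    then have "(axis 0 1 :: 'a^8) = 0" by blast
    then show False by (simp add: axis_eq_0_iff)
  qed
  obtain p :: "7 => 'a^8" and G M where G: "cross_product G M" and p: "inj (lincomb p)" "range (lincomb p) = {x. b x u = 0}"
    and pG: "\<And>x y. lincomb p (sc_mult G x y) = comm (lincomb p x) (lincomb p y)"
    and pM: "\<And>x y. bform M x y = b (lincomb p x) (lincomb p y)"
    using exists_cross_product[OF u0, where 'p = 7] by auto
  have tz: "b (lincomb p x) u = 0" for x using p(2) by blast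
  have gminus: "g (x - y) = g x \<ominus> g y" for x y
  proof -
    have "g (- 1 *s y) = \<ominus> g y" unfolding gscale by (rule D(10)[OF gmem])
    then show ?thesis using gadd[of x "- 1 *s y"] by (simp add: a_minus_def)
  qed
  have "algebra_hom (coord_algebra G) (trace_zero_algebra C q) (\<lambda>x. g (lincomb p x))"
    by (rule algebra_homI)
      (simp_all add: trace_zero_algebra_def gmem u b_polar tz lincomb_add gadd lincomb_scale gscale pG comm_def gminus gmult)
  moreover have "bij_betw (\<lambda>x. g (lincomb p x)) UNIV (carrier (trace_zero_algebra C q))"
  proof -
    have "inj (\<lambda>x. g (lincomb p x))" using p(1) ginj by (auto simp: inj_on_def)
    moreover have "y \<in> range (\<lambda>x. g (lincomb p x))" if y: "y \<in> carrier C" "polar_form C q y \<one> = 0" for y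
    proof -
      obtain x where x: "y = g x" using gsurj y by blast
      then have "x \<in> range (lincomb p)" using y unfolding p(2) u by (simp add: b_polar)
      then show ?thesis using x by blast
    qed
    ultimately show ?thesis by (auto simp: bij_betw_def trace_zero_algebra_def gmem u b_polar tz)
  qed
  ultimately have 1: "algebra_iso (coord_algebra G) (trace_zero_algebra C q)"
    by (intro algebra_isoI) auto
  define f where "f s = g (fst s *s u + lincomb p (snd s))" for s
  have mult: "sc_mult H (a *s u + lincomb p x) (c *s u + lincomb p y) =
      (a * c + bform M x y) *s u + lincomb p (a *s y + c *s x - sc_mult G x y)" for a c x y
  proof -
    have diff: "lincomb p (v - w) = lincomb p v - lincomb p w" for v w
      using lincomb_add[of p "v - w" w] by simp
    show ?thesis
      by (simp add: diff sc_mult_add sc_mult_scale unit product[OF tz tz] pM pG lincomb_add lincomb_scale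
          vector_scale_scale vector_sadd_rdistrib algebra_simps)
  qed
  have "algebra_hom (octonions G M) C f"
  proof (rule algebra_homI)
    show "f (s \<otimes>\<^bsub>octonions G M\<^esub> t) = f s \<otimes> f t" for s t
      unfolding f_def gmult[symmetric] mult by simp
  qed (simp_all add: f_def gmem gadd[symmetric] gscale[symmetric] lincomb_add lincomb_scale vector_sadd_rdistrib
      vector_add_ldistrib vector_scale_scale algebra_simps)
  moreover have "bij_betw f (carrier (octonions G M)) (carrier C)"
  proof -
    have "inj f"
    proof (rule injI)
      fix s t assume "f s = f t"
      then have eq: "fst s *s u + lincomb p (snd s) = fst t *s u + lincomb p (snd t)" by (simp add: f_def ginj)
      then have "b (fst s *s u + lincomb p (snd s)) u = b (fst t *s u + lincomb p (snd t)) u" by simp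
      then have "fst s = fst t" by (simp add: b_add b_scale tz b_unit[OF u0])
      moreover from this eq have "snd s = snd t" using p(1) by (simp add: inj_eq)
      ultimately show "s = t" by (simp add: prod_eq_iff)
    qed
    moreover have "y \<in> range f" if y: "y \<in> carrier C" for y
    proof -
      obtain x where x: "y = g x" using gsurj y by blast
      have "x + b x u *s u \<in> range (lincomb p)" unfolding p(2) by (simp add: b_add b_scale b_unit[OF u0])
      then obtain z where z: "x + b x u *s u = lincomb p z" by blast
      have "f (- b x u, z) = g x" unfolding f_def z[symmetric, simplified] by (simp add: z[symmetric] vec_eq_iff)
      then show ?thesis using x by (metis rangeI)
    qed
    ultimately show ?thesis by (auto simp: bij_betw_def f_def gmem)
  qed
  ultimately have "algebra_iso (octonions G M) C" by (rule algebra_isoI)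
  then show ?thesis using that G 1 by blast
qed

section \<open>The split cross product\<close>

text \<open>
  A weight basis for \<open>ad H\<close>: weight 0 for \<open>H\<close>, 1 for the \<open>E\<close>s, -1 for the
  \<open>F\<close>s.
\<close>

datatype split_index = H | E1 | E2 | E3 | F1 | F2 | F3

lemma UNIV_split_index: "UNIV = {H, E1, E2, E3, F1, F2, F3}"
  using split_index.exhaust by blast

instance split_index :: finite
  by standard (simp add: UNIV_split_index)

lemma card_split_index [simp]: "CARD(split_index) = 7"
  by (simp add: UNIV_split_index)

lemma sum_split_index: "(\<Sum>i\<in>UNIV. f i) = f H + (f E1 + (f E2 + (f E3 + (f F1 + (f F2 + f F3)))))"
  by (simp add: UNIV_split_index)

lemma all_split_index: "(\<forall>i. P i) \<longleftrightarrow> P H \<and> P E1 \<and> P E2 \<and> P E3 \<and> P F1 \<and> P F2 \<and> P F3"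
  by (metis split_index.exhaust)

definition split_bracket :: "'a::comm_ring_1^split_index => 'a^split_index => 'a^split_index" where
  "split_bracket x y = (\<chi> i. case i of
     H => x $ E1 * y $ F1 - x $ F1 * y $ E1 + (x $ E2 * y $ F2 - x $ F2 * y $ E2) + (x $ E3 * y $ F3 - x $ F3 * y $ E3)
   | E1 => x $ H * y $ E1 - x $ E1 * y $ H + (x $ F2 * y $ F3 - x $ F3 * y $ F2)
   | E2 => x $ H * y $ E2 - x $ E2 * y $ H + (x $ F3 * y $ F1 - x $ F1 * y $ F3)
   | E3 => x $ H * y $ E3 - x $ E3 * y $ H + (x $ F1 * y $ F2 - x $ F2 * y $ F1)
   | F1 => x $ F1 * y $ H - x $ H * y $ F1 + (x $ E2 * y $ E3 - x $ E3 * y $ E2)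
   | F2 => x $ F2 * y $ H - x $ H * y $ F2 + (x $ E3 * y $ E1 - x $ E1 * y $ E3)
   | F3 => x $ F3 * y $ H - x $ H * y $ F3 + (x $ E1 * y $ E2 - x $ E2 * y $ E1))"

definition split_form :: "'a::comm_ring_1^split_index => 'a^split_index => 'a" where
  "split_form x y = x $ H * y $ H + (x $ E1 * y $ F1 + x $ F1 * y $ E1) + (x $ E2 * y $ F2 + x $ F2 * y $ E2) +
     (x $ E3 * y $ F3 + x $ F3 * y $ E3)"

definition split_sc :: "('a::comm_ring_1, split_index) table" where
  "split_sc i j = split_bracket (axis i 1) (axis j 1)"

definition split_gram :: "split_index => split_index => 'a::comm_ring_1" where
  "split_gram i j = split_form (axis i 1) (axis j 1)"

lemma sc_mult_split_sc: "sc_mult split_sc = split_bracket"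
proof -
  have "split_bracket = sc_mult (\<lambda>i j. split_bracket (axis i 1) (axis j 1))"
    by (rule bilinear_eq_sc_mult)
      (simp_all add: vec_eq_iff all_split_index split_bracket_def algebra_simps)
  from this[symmetric] show ?thesis unfolding split_sc_def .
qed

lemma bform_split_gram: "bform split_gram = split_form"
proof -
  have "split_form = bform (\<lambda>i j. split_form (axis i 1) (axis j 1))"
    by (rule bilinear_eq_bform) (simp_all add: split_form_def algebra_simps)
  from this[symmetric] show ?thesis unfolding split_gram_def .
qed

lemma split_double:
  fixes x y :: "'a::field^split_index"
  assumes "CHAR('a) = 3"
  shows "split_bracket x (split_bracket x y) = split_form x x *s y - split_form x y *s x"
proof -
  note [simp] = char3(1)[OF assms]
  have "split_bracket x (split_bracket x y) - (split_form x x *s y - split_form x y *s x) = 0"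
    by (simp add: vec_eq_iff all_split_index split_bracket_def split_form_def) (simp add: algebra_simps)
  then show ?thesis by simp
qed

lemma cross_product_split:
  assumes char: "CHAR('a::field) = 3"
  shows "cross_product (split_sc :: ('a, split_index) table) split_gram"
  unfolding cross_product_def sc_mult_split_sc bform_split_gram
proof (intro conjI allI impI)
  fix x y z :: "'a^split_index"
  show "split_bracket x y = - split_bracket y x"
    by (simp add: vec_eq_iff all_split_index split_bracket_def algebra_simps)
  show sym: "split_form x y = split_form y x" for x y :: "'a^split_index"
    by (simp add: split_form_def algebra_simps)
  show "x = 0" if h: "\<forall>y. split_form x y = 0"
  proof -
    have "split_form x (axis i 1) = 0" for i using h by blast
    from this[of H] this[of E1] this[of E2] this[of E3] this[of F1] this[of F2] this[of F3]
    show ?thesis by (simp add: vec_eq_iff all_split_index split_form_def axis_def)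
  qed
  have add: "split_bracket (x + y) z = split_bracket x z + split_bracket y z"
    "split_bracket z (x + y) = split_bracket z x + split_bracket z y"
    "split_form (x + y) z = split_form x z + split_form y z"
    "split_form z (x + y) = split_form z x + split_form z y" for x y z :: "'a^split_index"
    unfolding sc_mult_split_sc[symmetric] bform_split_gram[symmetric]
    by (simp_all add: sc_mult_add bform_add)
  have "split_bracket x (split_bracket z y) + split_bracket z (split_bracket x y) =
      split_bracket (x + z) (split_bracket (x + z) y) - split_bracket x (split_bracket x y) - split_bracket z (split_bracket z y)"
    by (simp add: add)
  also have "\<dots> = (split_form x z + split_form x z) *s y - split_form x y *s z - split_form z y *s x"
    unfolding split_double[OF char] by (simp add: add sym[of z x] vec_eq_iff algebra_simps)
  also have "split_form x z + split_form x z = - split_form x z"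
    using char3(2)[OF char] by (metis mult_2 mult_minus1)
  finally show "split_bracket x (split_bracket z y) + split_bracket z (split_bracket x y) =
      - (split_form x z *s y + split_form x y *s z + split_form z y *s x)"
    by (simp add: vec_eq_iff)
qed

text \<open>
  The difference of two diagonal entries and the off-diagonal entries, sorted by cyclic position into
  \<open>21, 32, 13\<close> and \<open>12, 23, 31\<close>, are coordinates on \<open>sl\<^sub>3\<close> modulo
  scalars. The two cyclic triples are the weight spaces \<open>E\<close> and \<open>F\<close>.
\<close>

theorem psl3_split:
  assumes char: "CHAR('a::field) = 3"
  shows "algebra_iso (coord_algebra (split_sc :: ('a, split_index) table)) (psl3 :: ('a, ('a^3^3) set) module)"
proof -
  note [simp] = char3(1,2)[OF char]
  define f :: "'a^3^3 => 'a^split_index" where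
    "f A = (\<chi> i. case i of H => A $ 2 $ 2 - A $ 1 $ 1 | E1 => A $ 2 $ 1 | E2 => A $ 3 $ 2 | E3 => A $ 1 $ 3
      | F1 => - A $ 1 $ 2 | F2 => - A $ 2 $ 3 | F3 => - A $ 3 $ 1)" for A
  let ?S = "sl3 :: ('a, 'a^3^3) module"
  have tr: "trace A = A $ 1 $ 1 + A $ 2 $ 2 + A $ 3 $ 3" for A :: "'a^3^3"
    by (simp add: trace_def sum_3)
  have carS: "A \<in> carrier ?S \<longleftrightarrow> A $ 1 $ 1 + A $ 2 $ 2 + A $ 3 $ 3 = 0" for A
    by (simp add: sl3_def tr)
  have carT: "A \<in> carrier ?S \<longleftrightarrow> trace A = 0" for A
    by (simp add: sl3_def)
  have trace0: "trace (0::'a^3^3) = 0"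
    by (simp add: tr)
  have trace_minus: "trace (- A) = - trace A" for A :: "'a^3^3"
    by (simp add: tr)
  have opsS: "A \<oplus>\<^bsub>?S\<^esub> B = A + B" "c \<odot>\<^bsub>?S\<^esub> A = (\<chi> i j. c * A $ i $ j)" "A \<otimes>\<^bsub>?S\<^esub> B = A ** B - B ** A" "\<zero>\<^bsub>?S\<^esub> = 0" for A B c
    by (simp_all add: sl3_def)
  have "algebra_iso (coord_algebra (split_sc :: ('a, split_index) table)) (quotient_algebra ?S (range mat))"
  proof (rule quotient_algebra_iso[where f = f])
    show "abelian_group ?S"
    proof (rule abelian_groupI)
      show "\<exists>B\<in>carrier ?S. B \<oplus>\<^bsub>?S\<^esub> A = \<zero>\<^bsub>?S\<^esub>" if "A \<in> carrier ?S" for A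
        using that by (intro bexI[of _ "- A"]) (auto simp: opsS carT trace_minus)
    qed (auto simp: opsS carT trace_add trace0 algebra_simps)
    have "trace (\<chi> i j. c * A $ i $ j) = c * trace A" for c and A :: "'a^3^3"
      by (simp add: trace_def sum_distrib_left)
    moreover have "trace (A ** B - B ** A) = 0" for A B :: "'a^3^3"
      using trace_mul_sym[of A B] by (simp add: trace_sub)
    ultimately show "closed_algebra ?S"
      by (simp add: closed_algebra_def Ball_def carT opsS trace_add)
    show "abelian_group (coord_algebra (split_sc :: ('a, split_index) table))" by (rule abelian_group_coord_algebra)
    show "closed_algebra (coord_algebra (split_sc :: ('a, split_index) table))" by (rule closed_coord_algebra)
    show "algebra_hom ?S (coord_algebra split_sc) f"
    proof (rule algebra_homI)
      fix A B assume A: "A \<in> carrier ?S" and B: "B \<in> carrier ?S"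
      have A3: "A $ 3 $ 3 = - A $ 1 $ 1 - A $ 2 $ 2" and B3: "B $ 3 $ 3 = - B $ 1 $ 1 - B $ 2 $ 2"
        using A B unfolding carS by (simp_all add: eq_neg_iff_add_eq_0 algebra_simps)
      have "f (A ** B - B ** A) - split_bracket (f A) (f B) = 0"
        unfolding vec_eq_iff all_split_index
        by (simp add: f_def split_bracket_def matrix_matrix_mult_def sum_3 A3 B3 del: char3(2)[OF char]) (simp add: algebra_simps)
      then show "f (A \<otimes>\<^bsub>?S\<^esub> B) = f A \<otimes>\<^bsub>coord_algebra split_sc\<^esub> f B"
        by (simp add: opsS sc_mult_split_sc)
    qed (simp_all add: opsS f_def vec_eq_iff all_split_index algebra_simps)
    show "f ` carrier ?S = carrier (coord_algebra split_sc)"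
    proof -
      have "x \<in> f ` carrier ?S" for x
        by (rule image_eqI[of _ _ "vector [vector [0, - x $ F1, x $ E3], vector [x $ E1, x $ H, - x $ F2], vector [- x $ F3, x $ E2, - x $ H]]"])
          (simp_all add: f_def vec_eq_iff all_split_index carS)
      then show ?thesis by auto
    qed
    show "range mat = {A \<in> carrier ?S. f A = \<zero>\<^bsub>coord_algebra split_sc\<^esub>}"
    proof (intro subset_antisym subsetI)
      fix A :: "'a^3^3" assume "A \<in> range mat"
      then obtain c where "A = mat c" by blast
      then show "A \<in> {A \<in> carrier ?S. f A = \<zero>\<^bsub>coord_algebra split_sc\<^esub>}"
        by (simp add: carS f_def vec_eq_iff all_split_index mat_def)
    next
      fix A assume "A \<in> {A \<in> carrier ?S. f A = \<zero>\<^bsub>coord_algebra split_sc\<^esub>}"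
      then have A: "A $ 1 $ 1 + A $ 2 $ 2 + A $ 3 $ 3 = 0" and f: "f A = 0" by (auto simp: carS)
      have "A $ 2 $ 2 = A $ 1 $ 1" "A $ 2 $ 1 = 0" "A $ 3 $ 2 = 0" "A $ 1 $ 3 = 0" "A $ 1 $ 2 = 0" "A $ 2 $ 3 = 0" "A $ 3 $ 1 = 0"
        using f by (simp_all add: f_def vec_eq_iff all_split_index)
      moreover from this A have "A $ 3 $ 3 = A $ 1 $ 1"
        by (simp add: mult_2[symmetric] del: mult_2)
      ultimately have "A = mat (A $ 1 $ 1)" by (simp add: vec_eq_iff forall_3 mat_def)
      then show "A \<in> range mat" by blast
    qed
  qed
  then show ?thesis by (simp add: psl3_def)
qed

section \<open>Uniqueness over algebraically closed fields\<close>

lemma exists_kernel_vector: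
  fixes f :: "'a::field^'n::finite => 'a^'m::finite"
  assumes f: "\<And>x y. f (x + y) = f x + f y" "\<And>c x. f (c *s x) = c *s f x" and card: "CARD('m) < CARD('n)"
  obtains v where "v \<noteq> 0" "f v = 0"
proof -
  have lin: "Vector_Spaces.linear (*s) (*s) f" using f by (simp add: linear_iff_ops)
  have "\<not> inj f"
  proof
    assume "inj f"
    then have "vec.dim (range f) = CARD('n)"
      using vec.dim_image_eq[OF lin, of UNIV] dim_cart[where 'n = 'n and 'a = 'a] by simp
    then show False
      using vec.dim_subset[of "range f" UNIV] dim_cart[where 'n = 'm and 'a = 'a] card by simp
  qed
  then obtain x y where xy: "f x = f y" "x \<noteq> y" by (auto simp: inj_on_def)
  have "f (x - y) = 0" using f(1)[of "x - y" y] xy(1) by simp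
  then show ?thesis using that xy(2) by (metis right_minus_eq)
qed

context char3_cross_product
begin

lemma skew: "form (bracket h x) y = - form x (bracket h y)"
  using antisym[of h x] invariant[of x h y] by (simp add: bform_minus)

lemma self_neg_eq_0: "t = - t ==> t = (0::'a)"
  using add_self[of t] by (metis add.right_inverse neg_equal_0_iff_equal)

lemma form_same_weight:
  assumes "bracket h x = s *s x" "bracket h y = s *s y" "s \<noteq> 0"
  shows "form x y = 0"
proof -
  have "s * form x y = - (s * form x y)" using skew[of h x y] assms by (simp add: bform_scale)
  then have "s * form x y = 0" by (rule self_neg_eq_0)
  then show ?thesis using assms(3) by simp
qed

lemma bracket_opposite_weights:
  assumes h: "form h h = 1" and x: "bracket h x = x" and y: "bracket h y = - y"
  shows "bracket x y = form x y *s h"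
proof -
  have "bracket h (bracket x y) = 0"
    unfolding derivation[of h x y] x y by (simp add: sc_mult_minus)
  moreover have "form h (bracket x y) = form x y"
    using invariant[of h x y] x by simp
  ultimately show ?thesis using double[of h "bracket x y"] h by simp
qed

lemma bracket_same_weight:
  "bracket h x = x ==> bracket h y = y ==> bracket h (bracket x y) = - bracket x y"
  "bracket h x = - x ==> bracket h y = - y ==> bracket h (bracket x y) = bracket x y"
proof -
  show "bracket h x = x ==> bracket h y = y ==> bracket h (bracket x y) = - bracket x y"
    unfolding derivation[of h x y] by (simp add: add_self_vec)
  assume xy: "bracket h x = - x" "bracket h y = - y"
  have "bracket h (bracket x y) = - (bracket x y + bracket x y)"
    unfolding derivation[of h x y] xy by (simp add: sc_mult_minus)
  then show "bracket h (bracket x y) = bracket x y" unfolding add_self_vec by simp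
qed

lemma split_frame:
  assumes h: "form h h = 1"
    and e: "bracket h e1 = e1" "bracket h e2 = e2" and f: "bracket h f1 = - f1" "bracket h f2 = - f2"
    and dual: "form e1 f1 = 1" "form e2 f2 = 1" "form e1 f2 = 0" "form e2 f1 = 0"
  obtains b :: "split_index => 'a^'n" where "inj (lincomb b)"
    "\<And>x y. bracket (lincomb b x) (lincomb b y) = lincomb b (split_bracket x y)"
proof -
  define e3 where "e3 = bracket f1 f2"
  define f3 where "f3 = bracket e1 e2"
  have e3: "bracket h e3 = e3" unfolding e3_def by (rule bracket_same_weight(2)[OF f])
  have f3: "bracket h f3 = - f3" unfolding f3_def by (rule bracket_same_weight(1)[OF e])
  note opp = bracket_opposite_weights[OF h]
  have fe: "bracket y x = - (form x y *s h)" if "bracket h x = x" "bracket h y = - y" for x y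
    using antisym[of y x] opp[OF that] by simp
  have rev: "bracket x h = - x" if "bracket h x = x" for x using antisym[of x h] that by simp
  have rev': "bracket x h = x" if "bracket h x = - x" for x using antisym[of x h] that by simp
  have dual3: "form e1 f3 = 0" "form e2 f3 = 0" "form e3 f1 = 0" "form e3 f2 = 0"
  proof -
    show "form e1 f3 = 0" unfolding f3_def by (rule form_bracket_self)
    show "form e2 f3 = 0" unfolding f3_def using antisym[of e1 e2] form_bracket_self[of e2 e1] by (simp add: bform_minus)
    show "form e3 f1 = 0" unfolding e3_def using form_sym form_bracket_self by metis
    show "form e3 f2 = 0"
      unfolding e3_def form_sym[of _ f2] using antisym[of f1 f2] form_bracket_self[of f2 f1] by (simp add: bform_minus)
  qed
  have b2f: "bracket f2 f3 = e1"
    unfolding f3_def derivation[of f2 e1 e2] fe[OF e(1) f(2)] fe[OF e(2) f(2)] dual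
    by (simp add: sc_mult_minus rev[OF e(1)])
  have b3f: "bracket f3 f1 = e2"
    unfolding antisym[of f3 f1] unfolding f3_def derivation[of f1 e1 e2] fe[OF e(1) f(1)] fe[OF e(2) f(1)] dual
    by (simp add: sc_mult_minus e(2))
  have b2e: "bracket e2 e3 = f1"
    unfolding e3_def derivation[of e2 f1 f2] opp[OF e(2) f(1)] opp[OF e(2) f(2)] dual
    by (simp add: rev'[OF f(1)])
  have b3e: "bracket e3 e1 = f2"
    unfolding antisym[of e3 e1] unfolding e3_def derivation[of e1 f1 f2] opp[OF e(1) f(1)] opp[OF e(1) f(2)] dual
    by (simp add: f(2))
  have "form e3 f3 = form f1 (bracket f2 f3)" unfolding e3_def by (rule invariant)
  then have d33: "form e3 f3 = 1" unfolding b2f using dual form_sym by metis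
  note forms = dual dual3 d33
  have he: "form h x = 0" if "bracket h x = x" for x using form_bracket_self[of h x] that by simp
  have hf: "form h x = 0" if "bracket h x = - x" for x using form_bracket_self[of h x] that by (simp add: bform_minus)
  have ee: "form x y = 0" if "bracket h x = x" "bracket h y = y" for x y
    by (rule form_same_weight[of h x 1 y]) (simp_all add: that)
  have ff: "form x y = 0" if "bracket h x = - x" "bracket h y = - y" for x y
    by (rule form_same_weight[of h x "- 1" y]) (simp_all add: that vector_sneg_minus1[symmetric])
  define b where "b i = (case i of H => h | E1 => e1 | E2 => e2 | E3 => e3 | F1 => f1 | F2 => f2 | F3 => f3)" for i
  have comb: "lincomb b x = x $ H *s h + (x $ E1 *s e1 + (x $ E2 *s e2 + (x $ E3 *s e3 +
      (x $ F1 *s f1 + (x $ F2 *s f2 + x $ F3 *s f3)))))" for x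
    by (simp add: lincomb_def sum_split_index b_def)
  have table: "bracket e1 e2 = f3" "bracket e2 e1 = - f3" "bracket e2 e3 = f1" "bracket e3 e2 = - f1"
    "bracket e3 e1 = f2" "bracket e1 e3 = - f2" "bracket f1 f2 = e3" "bracket f2 f1 = - e3"
    "bracket f2 f3 = e1" "bracket f3 f2 = - e1" "bracket f3 f1 = e2" "bracket f1 f3 = - e2"
    using antisym[of e2 e1] antisym[of e3 e2] antisym[of e1 e3] antisym[of f2 f1] antisym[of f3 f2] antisym[of f1 f3]
    by (simp_all add: b2f b3f b2e b3e e3_def[symmetric] f3_def[symmetric])
  note tables = table e f e3 f3 rev[OF e(1)] rev[OF e(2)] rev[OF e3] rev'[OF f(1)] rev'[OF f(2)] rev'[OF f3]
    opp[OF e(1) f(1)] opp[OF e(1) f(2)] opp[OF e(1) f3] opp[OF e(2) f(1)] opp[OF e(2) f(2)] opp[OF e(2) f3]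
    opp[OF e3 f(1)] opp[OF e3 f(2)] opp[OF e3 f3]
    fe[OF e(1) f(1)] fe[OF e(1) f(2)] fe[OF e(1) f3] fe[OF e(2) f(1)] fe[OF e(2) f(2)] fe[OF e(2) f3]
    fe[OF e3 f(1)] fe[OF e3 f(2)] fe[OF e3 f3]
  have "bracket (lincomb b x) (lincomb b y) = lincomb b (split_bracket x y)" for x y
    unfolding comb sc_mult_add sc_mult_scale
    by (simp add: tables forms split_bracket_def) (simp add: vec_eq_iff algebra_simps)
  moreover have "inj (lincomb b)"
  proof -
    have "x = 0" if x0: "lincomb b x = 0" for x
    proof -
      have c: "form (lincomb b x) h = x $ H" "form (lincomb b x) f1 = x $ E1" "form (lincomb b x) f2 = x $ E2"
        "form (lincomb b x) f3 = x $ E3" "form (lincomb b x) e1 = x $ F1" "form (lincomb b x) e2 = x $ F2" "form (lincomb b x) e3 = x $ F3"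
        unfolding comb
        by (simp_all add: bform_add bform_scale forms h he[OF e(1)] he[OF e(2)] he[OF e3] hf[OF f(1)] hf[OF f(2)] hf[OF f3]
            form_sym[of e1 h] form_sym[of e2 h] form_sym[of e3 h] form_sym[of f1 h] form_sym[of f2 h] form_sym[of f3 h]
            form_sym[of f1 e1] form_sym[of f1 e2] form_sym[of f1 e3] form_sym[of f2 e1] form_sym[of f2 e2] form_sym[of f2 e3]
            form_sym[of f3 e1] form_sym[of f3 e2] form_sym[of f3 e3] ee[OF e(1) e(1)] ee[OF e(1) e(2)] ee[OF e(1) e3]
            ee[OF e(2) e(1)] ee[OF e(2) e(2)] ee[OF e(2) e3] ee[OF e3 e(1)] ee[OF e3 e(2)] ee[OF e3 e3]
            ff[OF f(1) f(1)] ff[OF f(1) f(2)] ff[OF f(1) f3] ff[OF f(2) f(1)] ff[OF f(2) f(2)] ff[OF f(2) f3]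
            ff[OF f3 f(1)] ff[OF f3 f(2)] ff[OF f3 f3])
      show "x = 0" using c unfolding x0 by (simp add: vec_eq_iff all_split_index)
    qed
    moreover have "lincomb b (x - y) = lincomb b x - lincomb b y" for x y
      using lincomb_add[of b "x - y" y] by simp
    ultimately show ?thesis by (intro injI) (metis right_minus_eq)
  qed
  ultimately show ?thesis using that by blast
qed

lemma dual_vector:
  assumes h: "form h h = 1" and s: "s \<in> {1, - 1}" and x: "bracket h x = s *s x" "x \<noteq> 0"
  obtains y where "bracket h y = - s *s y" "form x y = 1"
proof -
  have ss: "s * s = 1" using s by auto
  obtain z where z: "form x z \<noteq> 0" using nondegenerate x(2) by blast
  define y where "y = bracket h (bracket h z) - s *s bracket h z"
  have "bracket h (bracket h (bracket h z)) = bracket h z"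
    unfolding double[of h z] by (simp add: h sc_mult_diff sc_mult_scale)
  then have hy: "bracket h y = - s *s y"
    by (simp add: y_def sc_mult_diff sc_mult_scale vec_eq_iff algebra_simps mult.assoc[symmetric] ss)
  have "form x (bracket h w) = - s * form x w" for w
    using skew[of h x w] x(1) by (simp add: bform_scale)
  then have "form x y = s * (s * form x z) + s * (s * form x z)"
    by (simp add: y_def bform_diff bform_scale)
  then have "form x y = - form x z"
    by (simp add: mult.assoc[symmetric] ss add_self)
  then have nz: "form x y \<noteq> 0" using z by simp
  show ?thesis
  proof
    show "bracket h (inverse (form x y) *s y) = - s *s (inverse (form x y) *s y)"
      by (simp add: sc_mult_scale hy vector_scale_scale mult.commute)
    show "form x (inverse (form x y) *s y) = 1" using nz by (simp add: bform_scale)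
  qed
qed

text \<open>On the complement of \<open>h\<close>, \<open>ad h\<close> is an involution, so \<open>v + [h, v]\<close> and \<open>v - [h, v]\<close> are eigenvectors.\<close>

lemma weight_vector:
  assumes h: "form h h = 1" and v: "v \<noteq> 0" "form h v = 0"
  obtains s w where "s \<in> {1, - 1}" "w \<noteq> 0" "bracket h w = s *s w" "w = v + s *s bracket h v"
proof -
  have hv: "bracket h (bracket h v) = v" using double[of h v] h v by simp
  have "v + bracket h v \<noteq> 0 \<or> v - bracket h v \<noteq> 0"
  proof (rule ccontr)
    assume "\<not> (v + bracket h v \<noteq> 0 \<or> v - bracket h v \<noteq> 0)"
    then have 1: "v + bracket h v = 0" and "v - bracket h v = 0" by blast+
    from this(2) have 2: "bracket h v = v" by simp
    have "v = 0" using 1 unfolding 2 add_self_vec by (simp only: neg_equal_0_iff_equal)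
    then show False using v by simp
  qed
  then show ?thesis
  proof
    assume "v + bracket h v \<noteq> 0"
    then show ?thesis
      by (intro that[of 1 "v + bracket h v"]) (simp_all add: sc_mult_add hv add.commute)
  next
    assume "v - bracket h v \<noteq> 0"
    then show ?thesis
      by (intro that[of "- 1" "v - bracket h v"]) (simp_all add: sc_mult_diff hv vector_sneg_minus1[symmetric])
  qed
qed

text \<open>
  From \<open>[h, [h, v]] = v\<close> on the complement of \<open>h\<close>, weight vectors exist, and
  nondegeneracy pairs weights 1 and -1. Choosing two orthogonal dual pairs is enough: the third pair consists of
  their brackets, by \<open>split_frame\<close>.
\<close>

lemma exists_split_frame:
  assumes card: "CARD('n) > 3" and h: "form h h = 1"
  obtains b :: "split_index => 'a^'n" where "inj (lincomb b)"
    "\<And>x y. bracket (lincomb b x) (lincomb b y) = lincomb b (split_bracket x y)"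
proof -
  obtain v where v: "v \<noteq> 0" "form h v = 0"
  proof -
    obtain v where "v \<noteq> 0" "(\<chi> i::1. form h v) = 0"
      by (rule exists_kernel_vector[of "\<lambda>v. \<chi> i::1. form h v"]) (use card in \<open>auto simp: vec_eq_iff bform_add bform_scale\<close>)
    then show ?thesis using that by (simp add: vec_eq_iff)
  qed
  obtain s w where w: "s \<in> {1, - 1}" "w \<noteq> 0" "bracket h w = s *s w" by (rule weight_vector[OF h v])
  obtain y where y: "bracket h y = - s *s y" "form w y = 1" by (rule dual_vector[OF h w(1,3,2)])
  have "\<exists>e1 f1. bracket h e1 = e1 \<and> bracket h f1 = - f1 \<and> form e1 f1 = 1"
  proof (cases "s = 1")
    case True
    then show ?thesis using w y by (intro exI[of _ w] exI[of _ y]) (auto simp: vector_sneg_minus1[symmetric])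
  next
    case False
    then have "s = - 1" using w(1) by simp
    then show ?thesis using w y form_sym by (intro exI[of _ y] exI[of _ w]) (auto simp: vector_sneg_minus1[symmetric])
  qed
  then obtain e1 f1 where e1: "bracket h e1 = e1" and f1: "bracket h f1 = - f1" and ef1: "form e1 f1 = 1" by blast
  \<comment> \<open>three linear conditions leave a nonzero vector orthogonal to the first pair\<close>
  obtain v where v: "v \<noteq> 0" "form h v = 0" "form e1 v = 0" "form f1 v = 0"
  proof -
    let ?f = "\<lambda>v. vector [form h v, form e1 v, form f1 v] :: 'a^3"
    obtain v where "v \<noteq> 0" "?f v = 0"
      by (rule exists_kernel_vector[of ?f]) (use card in \<open>auto simp: vec_eq_iff forall_3 bform_add bform_scale\<close>)
    then show ?thesis using that by (simp add: vec_eq_iff forall_3)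
  qed
  obtain s w where w: "s \<in> {1, - 1}" "w \<noteq> 0" "bracket h w = s *s w" and weq: "w = v + s *s bracket h v"
    by (rule weight_vector[OF h v(1,2)])
  obtain y where y: "bracket h y = - s *s y" "form w y = 1" by (rule dual_vector[OF h w(1,3,2)])
  have ort: "form e1 w = 0" "form f1 w = 0"
    unfolding weq using skew[of h e1 v] skew[of h f1 v] e1 f1 v by (simp_all add: bform_add bform_scale bform_minus)
  have "\<exists>e2 f2. bracket h e2 = e2 \<and> bracket h f2 = - f2 \<and> form e2 f2 = 1 \<and> form e1 f2 = 0 \<and> form e2 f1 = 0"
  proof (cases "s = 1")
    case True
    have "bracket h (y - form e1 y *s f1) = - (y - form e1 y *s f1)"
      using y True f1 by (simp add: sc_mult_diff sc_mult_scale vec_eq_iff)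
    then show ?thesis using w y True ort ef1
      by (intro exI[of _ w] exI[of _ "y - form e1 y *s f1"]) (auto simp: bform_diff bform_scale form_sym[of w f1])
  next
    case False
    then have s: "s = - 1" using w(1) by simp
    have "bracket h (y - form f1 y *s e1) = y - form f1 y *s e1"
      using y s e1 by (simp add: sc_mult_diff sc_mult_scale)
    then show ?thesis using w y s ort ef1
      by (intro exI[of _ "y - form f1 y *s e1"] exI[of _ w])
        (auto simp: bform_diff bform_scale form_sym[of y w] form_sym[of y f1] form_sym[of f1 e1] vector_sneg_minus1[symmetric])
  qed
  then obtain e2 f2 where "bracket h e2 = e2" "bracket h f2 = - f2" "form e2 f2 = 1" "form e1 f2 = 0" "form e2 f1 = 0" by blast
  from split_frame[OF h e1 this(1) f1 this(2) ef1 this(3-5)] show ?thesis using that by metis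
qed

end

text \<open>
  A vector with nonzero square norm can be scaled to norm 1 over an algebraically closed field. The frame is
  then independent, and in dimension 7 it is a basis.
\<close>

theorem cross_product_unique:
  fixes G :: "('k::alg_closed_field, 'n::finite) table"
  assumes G: "cross_product G M" and char: "CHAR('k) = 3" and card: "CARD('n) = 7"
  shows "algebra_iso (coord_algebra (split_sc :: ('k, split_index) table)) (coord_algebra G)"
proof -
  interpret char3_cross_product G M by unfold_locales fact+
  obtain x where x: "form x x \<noteq> 0"
  proof (rule ccontr)
    assume "\<not> thesis"
    then have q: "form x x = 0" for x using that by blast
    have "form x y = 0" for x y
    proof -
      have "form x y + form x y = 0" using q[of "x + y"] by (simp add: bform_add q form_sym[of y x])
      then show ?thesis using add_self[of "form x y"] by simp
    qed
    then have "x = 0" for x :: "'k^'n" by (intro nondegenerate)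
    then have "axis undefined 1 = (0::'k^'n)" by blast
    then show False by (simp add: axis_eq_0_iff)
  qed
  obtain c where c: "c ^ 2 = inverse (form x x)" using nth_root_exists[of 2] by auto
  have "form (c *s x) (c *s x) = 1"
    using x c by (simp add: bform_scale power2_eq_square mult.assoc[symmetric])
  then obtain b :: "split_index => 'k^'n" where b: "inj (lincomb b)"
    "\<And>x y. bracket (lincomb b x) (lincomb b y) = lincomb b (split_bracket x y)"
    using exists_split_frame[of "c *s x"] card by auto
  have "surj (lincomb b)"
    by (rule linear_inj_imp_surj_card) (use b card in \<open>auto simp: lincomb_add lincomb_scale\<close>)
  then show ?thesis
    using b by (intro algebra_isoI[of _ _ "lincomb b"] algebra_homI)
      (auto simp: bij_betw_def lincomb_add lincomb_scale sc_mult_split_sc)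
qed

section \<open>Derivations\<close>

lemma coord_algebra_minus: "x \<ominus>\<^bsub>coord_algebra G\<^esub> y = x - y"
proof -
  interpret abelian_group "coord_algebra G" by (rule abelian_group_coord_algebra)
  have "\<ominus>\<^bsub>coord_algebra G\<^esub> y = - y" by (rule minus_equality) auto
  then show ?thesis by (simp add: a_minus_def)
qed

lemma nonassoc_coord_algebra: "nonassoc_algebra (coord_algebra G)"
  unfolding nonassoc_algebra_def
proof (intro conjI)
  show "Module.module ring_of_type_algebra (coord_algebra G)"
    by (rule module_ring_of_typeI)
      (auto simp: abelian_group_coord_algebra vector_sadd_rdistrib vector_add_ldistrib vector_scale_scale)
qed (auto simp: sc_mult_add sc_mult_scale)

lemma derivation_algebraD:
  fixes A (structure)
  assumes "d \<in> carrier (derivation_algebra A)"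
  shows "d \<in> carrier A \<rightarrow>\<^sub>E carrier A"
    and "x \<in> carrier A ==> d x \<in> carrier A"
    and "x \<in> carrier A ==> y \<in> carrier A ==> d (x \<oplus> y) = d x \<oplus> d y"
    and "x \<in> carrier A ==> d (c \<odot> x) = c \<odot> d x"
    and "x \<in> carrier A ==> y \<in> carrier A ==> d (x \<otimes> y) = d x \<otimes> y \<oplus> x \<otimes> d y"
  using assms by (auto simp: derivation_algebra_def)

text \<open>
  Conjugation with the isomorphism. Derivations are extensional functions, so they have to be restricted to the
  carriers.
\<close>

theorem derivation_algebra_cong:
  fixes A :: "('a::field, 'v) module" (structure) and B :: "('a, 'w) module"
  assumes A: "nonassoc_algebra A" and B: "nonassoc_algebra B" and iso: "algebra_iso A B"
  shows "algebra_iso (derivation_algebra A) (derivation_algebra B)"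
proof -
  interpret A: abelian_group A by (rule nonassoc_algebraD(2)[OF A])
  interpret B: abelian_group B by (rule nonassoc_algebraD(2)[OF B])
  have cA: "closed_algebra A" and cB: "closed_algebra B" using A B nonassoc_algebra_closed by blast+
  obtain f where f: "algebra_hom A B f" and bij: "bij_betw f (carrier A) (carrier B)" using iso by (rule algebra_isoE)
  define g where "g = the_inv_into (carrier A) f"
  have g: "algebra_hom B A g" unfolding g_def by (rule algebra_hom_inv[OF cA f bij])
  have gf: "x \<in> carrier A ==> g (f x) = x" for x
    unfolding g_def using bij by (simp add: bij_betw_def the_inv_into_f_f)
  have fg: "y \<in> carrier B ==> f (g y) = y" for y
    unfolding g_def using bij by (simp add: bij_betw_def f_the_inv_into_f)
  note fD = algebra_homD[OF f] and gD = algebra_homD[OF g]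
  have fminus: "f (x \<ominus> y) = f x \<ominus>\<^bsub>B\<^esub> f y" if x: "x \<in> carrier A" and y: "y \<in> carrier A" for x y
  proof -
    have "f ((- 1) \<odot> y) = (- 1) \<odot>\<^bsub>B\<^esub> f y" by (rule fD(3)[OF y])
    then have "f (\<ominus> y) = \<ominus>\<^bsub>B\<^esub> f y"
      using nonassoc_algebraD(10)[OF A y] nonassoc_algebraD(10)[OF B fD(1)[OF y]] by simp
    then show ?thesis using x y fD(2) by (simp add: a_minus_def)
  qed
  define \<Phi> where "\<Phi> d = (\<lambda>y\<in>carrier B. f (d (g y)))" for d
  define \<Psi> where "\<Psi> d = (\<lambda>x\<in>carrier A. g (d (f x)))" for d
  let ?DA = "derivation_algebra A" and ?DB = "derivation_algebra B"
  have clA: "x \<otimes> y \<in> carrier A" "c \<odot> x \<in> carrier A" if "x \<in> carrier A" "y \<in> carrier A" for x y c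
    using cA that by (auto simp: closed_algebra_def)
  have clB: "x \<otimes>\<^bsub>B\<^esub> y \<in> carrier B" "c \<odot>\<^bsub>B\<^esub> x \<in> carrier B" if "x \<in> carrier B" "y \<in> carrier B" for x y c
    using cB that by (auto simp: closed_algebra_def)
  have \<Phi>: "\<Phi> d \<in> carrier ?DB" if d: "d \<in> carrier ?DA" for d
    using derivation_algebraD[OF d] gD fD clA clB fg gf by (auto simp: derivation_algebra_def \<Phi>_def)
  have \<Psi>: "\<Psi> d \<in> carrier ?DA" if d: "d \<in> carrier ?DB" for d
    using derivation_algebraD[OF d] gD fD clA clB fg gf by (auto simp: derivation_algebra_def \<Psi>_def)
  have "\<Psi> (\<Phi> d) = d" if d: "d \<in> carrier ?DA" for d
    using derivation_algebraD(1,2)[OF d] gf fD(1) by (auto simp: \<Phi>_def \<Psi>_def fun_eq_iff PiE_def extensional_def)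
  moreover have "\<Phi> (\<Psi> d) = d" if d: "d \<in> carrier ?DB" for d
    using derivation_algebraD(1,2)[OF d] fg gD(1) by (auto simp: \<Phi>_def \<Psi>_def fun_eq_iff PiE_def extensional_def)
  ultimately have "bij_betw \<Phi> (carrier ?DA) (carrier ?DB)"
    using \<Phi> \<Psi> by (intro bij_betw_byWitness[where f' = \<Psi>]) auto
  moreover have "algebra_hom ?DA ?DB \<Phi>"
  proof (rule algebra_homI)
    fix d e assume d: "d \<in> carrier ?DA" and e: "e \<in> carrier ?DA"
    note dD = derivation_algebraD[OF d] and eD = derivation_algebraD[OF e]
    show "\<Phi> (d \<oplus>\<^bsub>?DA\<^esub> e) = \<Phi> d \<oplus>\<^bsub>?DB\<^esub> \<Phi> e"
      using dD(2) eD(2) gD(1) fD(2) by (auto simp: \<Phi>_def derivation_algebra_def fun_eq_iff)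
    show "\<Phi> (d \<otimes>\<^bsub>?DA\<^esub> e) = \<Phi> d \<otimes>\<^bsub>?DB\<^esub> \<Phi> e"
      using dD(2) eD(2) gD(1) fD(1) gf fminus by (auto simp: \<Phi>_def derivation_algebra_def fun_eq_iff)
  next
    fix c d assume d: "d \<in> carrier ?DA"
    show "\<Phi> (c \<odot>\<^bsub>?DA\<^esub> d) = c \<odot>\<^bsub>?DB\<^esub> \<Phi> d"
      using derivation_algebraD(2)[OF d] gD(1) fD(3) by (auto simp: \<Phi>_def derivation_algebra_def fun_eq_iff)
  qed (rule \<Phi>)
  ultimately show ?thesis by (intro algebra_isoI)
qed

abbreviation Der :: "('a::field, 'n::finite) table => ('a, 'a^'n => 'a^'n) module" where
  "Der G \<equiv> derivation_algebra (coord_algebra G)"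

lemma Der_iff:
  "d \<in> carrier (Der G) \<longleftrightarrow> (\<forall>x y. d (x + y) = d x + d y) \<and> (\<forall>c x. d (c *s x) = c *s d x) \<and>
     (\<forall>x y. d (sc_mult G x y) = sc_mult G (d x) y + sc_mult G x (d y))"
  by (auto simp: derivation_algebra_def)

lemma Der_ops:
  "d \<oplus>\<^bsub>Der G\<^esub> e = (\<lambda>x. d x + e x)" "c \<odot>\<^bsub>Der G\<^esub> d = (\<lambda>x. c *s d x)"
  "d \<otimes>\<^bsub>Der G\<^esub> e = (\<lambda>x. d (e x) - e (d x))"
  by (auto simp: derivation_algebra_def coord_algebra_minus fun_eq_iff)

lemma linear_zero_minus:
  fixes d :: "'a::field^'n => 'a^'m"
  assumes "\<forall>x y. d (x + y) = d x + d y" "\<forall>c x. d (c *s x) = c *s d x"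
  shows "d 0 = 0" "d (- x) = - d x" "d (x - y) = d x - d y"
proof -
  have s: "d (c *s x) = c *s d x" for c x using assms(2) by blast
  show "d 0 = 0" using s[of 0 0] by simp
  show m: "d (- x) = - d x" for x using s[of "- 1" x] by (simp add: vector_sneg_minus1[symmetric])
  show "d (x - y) = d x - d y" using assms(1) m[of y] by (metis diff_conv_add_uminus)
qed

lemma Der_bracket_closed: "d \<in> carrier (Der G) ==> e \<in> carrier (Der G) ==> (\<lambda>x. d (e x) - e (d x)) \<in> carrier (Der G)"
proof -
  assume d: "d \<in> carrier (Der G)" and e: "e \<in> carrier (Der G)"
  have dl: "d (x + y) = d x + d y" "d (c *s x) = c *s d x" "d (sc_mult G x y) = sc_mult G (d x) y + sc_mult G x (d y)"
    and el: "e (x + y) = e x + e y" "e (c *s x) = c *s e x" "e (sc_mult G x y) = sc_mult G (e x) y + sc_mult G x (e y)" for x y c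
    using d e unfolding Der_iff by blast+
  show ?thesis
    unfolding Der_iff by (simp add: dl el sc_mult_diff vector_ssub_ldistrib algebra_simps)
qed

subsection \<open>Derivations of a cross product and of its Cayley algebra\<close>

context char3_cross_product
begin

text \<open>
  Differentiating the linearised identity gives the same identity with
  \<open>\<beta>(x, y) = b(d x, y) + b(x, d y)\<close> in place of the form and 0 in place of the bracket. As
  with the form itself, reading off a third coefficient shows \<open>\<beta> = 0\<close>.
\<close>

lemma derivation_skew:
  assumes card: "CARD('n) > 2" and d: "d \<in> carrier (Der G)"
  shows "form (d x) y + form x (d y) = 0"
proof -
  have dl: "d (x + y) = d x + d y" "d (c *s x) = c *s d x" "d (bracket x y) = bracket (d x) y + bracket x (d y)" for x y c
    using d unfolding Der_iff by blast+
  have dm: "d (- x) = - d x" for x using dl(2)[of "- 1" x] by (simp add: vector_sneg_minus1[symmetric])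
  have dd: "d (x - y) = d x - d y" for x y using d linear_zero_minus(3) unfolding Der_iff by blast
  define \<beta> where "\<beta> x y = form (d x) y + form x (d y)" for x y
  have key: "\<beta> x z *s y + \<beta> x y *s z + \<beta> z y *s x = 0" for x y z
  proof -
    have "d (bracket x (bracket z y) + bracket z (bracket x y)) =
        (bracket (d x) (bracket z y) + bracket z (bracket (d x) y)) + (bracket x (bracket (d z) y) + bracket (d z) (bracket x y)) +
        (bracket x (bracket z (d y)) + bracket z (bracket x (d y)))"
      by (simp add: dl sc_mult_add algebra_simps)
    also have "\<dots> = - (form (d x) z *s y + form (d x) y *s z + form z y *s d x) - (form x (d z) *s y + form x y *s d z + form (d z) y *s x)
        - (form x z *s d y + form x (d y) *s z + form z (d y) *s x)"
      unfolding double_lin by simp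
    finally have "- (form x z *s d y + form x y *s d z + form z y *s d x) =
        - (form (d x) z *s y + form (d x) y *s z + form z y *s d x) - (form x (d z) *s y + form x y *s d z + form (d z) y *s x)
        - (form x z *s d y + form x (d y) *s z + form z (d y) *s x)"
      unfolding double_lin by (simp add: dl dm dd)
    then show ?thesis unfolding \<beta>_def by (simp add: vec_eq_iff algebra_simps)
  qed
  have "\<beta> = bform (\<lambda>i j. \<beta> (axis i 1) (axis j 1))"
    by (rule bilinear_eq_bform) (simp_all add: \<beta>_def dl bform_add bform_scale algebra_simps)
  moreover have "\<beta> (axis i 1) (axis j 1) = 0" for i j
  proof -
    obtain k :: 'n where k: "k \<noteq> i" "k \<noteq> j" by (rule exists_other_index[OF card])
    have "(\<beta> (axis i 1) (axis j 1) *s axis k 1 + \<beta> (axis i 1) (axis k 1) *s axis j 1 + \<beta> (axis j 1) (axis k 1) *s axis i (1::'a)) $ k = 0"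
      by (simp only: key zero_index)
    then show ?thesis using k by (simp add: axis_def)
  qed
  ultimately have "\<beta> = bform (\<lambda>i j. 0)" by simp
  then have "\<beta> x y = 0" by (simp add: bform_def)
  then show ?thesis by (simp add: \<beta>_def)
qed

text \<open>
  A derivation of the Cayley algebra kills the unit and preserves its orthogonal complement; conversely a
  derivation of the bracket is skew for the form by \<open>derivation_skew\<close>, hence extends by 0 on the
  unit.
\<close>

theorem Der_octonions:
  assumes card: "CARD('n) > 2"
  shows "algebra_iso (Der G) (derivation_algebra (octonions G M))"
proof -
  let ?O = "octonions G M" and ?DO = "derivation_algebra (octonions G M)"
  interpret A: abelian_group ?O using nonassoc_algebraD(2)[OF nonassoc_octonions] .
  have minusO: "s \<ominus>\<^bsub>?O\<^esub> t = s - t" for s t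
  proof -
    have "\<ominus>\<^bsub>?O\<^esub> t = - t" by (rule A.minus_equality) auto
    then show ?thesis by (simp add: a_minus_def)
  qed
  have DOops: "d \<oplus>\<^bsub>?DO\<^esub> e = (\<lambda>s. d s + e s)" "c \<odot>\<^bsub>?DO\<^esub> d = (\<lambda>s. (c * fst (d s), c *s snd (d s)))"
    "d \<otimes>\<^bsub>?DO\<^esub> e = (\<lambda>s. d (e s) - e (d s))" for d e c
    by (simp_all add: derivation_algebra_def minusO fun_eq_iff)
  define f where "f d = (\<lambda>s :: 'a \<times> ('a^'n). (0::'a, d (snd s) :: 'a^'n))" for d
  have fmem: "f d \<in> carrier ?DO" if d: "d \<in> carrier (Der G)" for d
  proof -
    have dl: "d (x + y) = d x + d y" "d (c *s x) = c *s d x" "d (bracket x y) = bracket (d x) y + bracket x (d y)" for x y c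
      using d unfolding Der_iff by blast+
    have dd: "d (x - y) = d x - d y" for x y using d linear_zero_minus(3) unfolding Der_iff by blast
    have sk: "form x (d y) = - form (d x) y" for x y
      using derivation_skew[OF card d, of x y] by (simp add: eq_neg_iff_add_eq_0 add.commute)
    show ?thesis
      by (auto simp: derivation_algebra_def f_def dl dd sk prod_eq_iff algebra_simps)
  qed
  have surj: "\<exists>d\<in>carrier (Der G). e = f d" if e: "e \<in> carrier ?DO" for e
  proof -
    have add: "e (s + t) = e s + e t" and scale: "e (c * fst s, c *s snd s) = (c * fst (e s), c *s snd (e s))" for s t c
      using derivation_algebraD(3,4)[OF e] by simp_all
    have leib: "e (s \<otimes>\<^bsub>?O\<^esub> t) = e s \<otimes>\<^bsub>?O\<^esub> t + s \<otimes>\<^bsub>?O\<^esub> e t" for s t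
      using derivation_algebraD(5)[OF e, of s t] by simp
    have "e (1, 0) = e (1, 0) + e (1, 0)" using leib[of "(1, 0)" "(1, 0)"] by (simp add: prod_eq_iff)
    then have e1: "e (1, 0) = 0" by simp
    have ea: "e (a, 0) = 0" for a using scale[of a "(1, 0)"] e1 by (simp add: prod_eq_iff)
    have e0: "fst (e (0, x)) = 0" for x
    proof (cases "x = 0")
      case False
      have "e ((0, x) \<otimes>\<^bsub>?O\<^esub> (0, x)) = 0" using ea by simp
      then have "fst (e (0, x)) *s x + fst (e (0, x)) *s x = bracket (snd (e (0, x))) x + bracket x (snd (e (0, x)))"
        unfolding leib by (simp add: prod_eq_iff algebra_simps)
      also have "\<dots> = 0" using antisym[of "snd (e (0, x))" x] by simp
      finally show ?thesis using False unfolding add_self_vec by simp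
    qed (use ea[of 0] in simp)
    define d where "d x = snd (e (0, x))" for x
    have ed: "e (0, x) = (0, d x)" for x using e0 by (simp add: d_def prod_eq_iff)
    have "e s = f d s" for s
      using add[of "(fst s, 0)" "(0, snd s)"] ea[of "fst s"] ed[of "snd s"] by (simp add: f_def)
    then have ef: "e = f d" by blast
    have dadd: "d (x + y) = d x + d y" and dscale: "d (c *s x) = c *s d x" for x y c
      using add[of "(0, x)" "(0, y)"] scale[of c "(0, x)"] by (simp_all add: ed)
    have "d (bracket x y) = bracket (d x) y + bracket x (d y)" for x y
    proof -
      have "e ((0, x) \<otimes>\<^bsub>?O\<^esub> (0, y)) = (0, d (- bracket x y))"
        using add[of "(form x y, 0)" "(0, - bracket x y)"] ea ed by simp
      moreover have "d (- bracket x y) = - d (bracket x y)" using dscale[of "- 1"] by (simp add: vector_sneg_minus1[symmetric])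
      ultimately show ?thesis unfolding leib by (simp add: ed algebra_simps prod_eq_iff)
    qed
    then have "d \<in> carrier (Der G)" unfolding Der_iff using dadd dscale by blast
    then show ?thesis using ef by blast
  qed
  have "algebra_hom (Der G) ?DO f"
  proof (rule algebra_homI)
    show "f d \<in> carrier ?DO" if "d \<in> carrier (Der G)" for d by (rule fmem[OF that])
  qed (simp_all add: Der_ops DOops f_def fun_eq_iff)
  moreover have "inj_on f (carrier (Der G))"
    by (rule inj_onI) (auto simp: f_def fun_eq_iff)
  ultimately show ?thesis using fmem surj by (intro algebra_isoI[of _ _ f]) (auto simp: bij_betw_def)
qed

subsection \<open>Inner derivations\<close>

lemma ad_Der: "bracket x \<in> carrier (Der G)"
  unfolding Der_iff by (intro conjI allI sc_mult_add sc_mult_scale derivation)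

text \<open>
  Take \<open>w\<close> with \<open>b(z, w) = 1\<close>. The linearised identity for \<open>z, w, y\<close> puts
  \<open>y + b(z, y) w\<close> into the ideal, for every \<open>y\<close>. With \<open>y = w\<close> this is
  \<open>2 w = -w\<close>, so the ideal contains \<open>w\<close> and then every \<open>y\<close>.
\<close>

lemma ideal_eq_UNIV:
  assumes add: "\<And>x y. x \<in> K ==> y \<in> K ==> x + y \<in> K" and scale: "\<And>c x. x \<in> K ==> c *s x \<in> K"
    and br: "\<And>x y. y \<in> K ==> bracket x y \<in> K" and z: "z \<in> K" "z \<noteq> 0"
  shows "x \<in> K"
proof -
  have neg: "- x \<in> K" if "x \<in> K" for x using scale[OF that, of "- 1"] by (simp add: vector_sneg_minus1[symmetric])
  have br': "bracket y x \<in> K" if "y \<in> K" for x y using br[OF that, of x] neg antisym[of y x] by simp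
  obtain w0 where "form z w0 \<noteq> 0" using nondegenerate z(2) by blast
  then obtain w where w: "form z w = 1" using bform_scale(2)[of M z "inverse (form z w0)" w0] by auto
  have key: "y + form z y *s w \<in> K" for y
  proof -
    have "bracket z (bracket w y) + bracket w (bracket z y) \<in> K" using br br' add z(1) by blast
    then have "- (bracket z (bracket w y) + bracket w (bracket z y)) + - (form w y *s z) \<in> K"
      using add neg scale z(1) by blast
    moreover have "- (bracket z (bracket w y) + bracket w (bracket z y)) + - (form w y *s z) = y + form z y *s w"
      unfolding double_lin w by simp
    ultimately show ?thesis by simp
  qed
  have "- w \<in> K" using key[of w] w add_self_vec[of w] by simp
  then have "- (form z x *s w) \<in> K" using scale[of "- w" "form z x"] by (simp add: vec_eq_iff)
  from add[OF key[of x] this] show ?thesis by simp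
qed

lemma centerless:
  assumes card: "CARD('n) > 2" and x: "\<And>y. bracket x y = 0"
  shows "x = 0"
proof (rule ccontr)
  assume nz: "x \<noteq> 0"
  have all: "bracket u v = 0" for u v
  proof -
    have "u \<in> {z. \<forall>y. bracket z y = 0}"
    proof (rule ideal_eq_UNIV[OF _ _ _ _ nz])
      fix u z assume z: "z \<in> {z. \<forall>y. bracket z y = 0}"
      have "bracket u z = 0" using antisym[of u z] z by simp
      then show "bracket u z \<in> {z. \<forall>y. bracket z y = 0}" by simp
    qed (use x in \<open>auto simp: sc_mult_add sc_mult_scale\<close>)
    then show ?thesis by blast
  qed
  have "M i j = 0" for i j
  proof -
    obtain k :: 'n where k: "k \<noteq> i" "k \<noteq> j" by (rule exists_other_index[OF card])
    show ?thesis using cross_product_form[OF cross k] all by simp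
  qed
  then have "form x y = 0" for y by (simp add: bform_def)
  then show False using nondegenerate nz by blast
qed

lemma ad_commutator: "d \<in> carrier (Der G) ==> (\<lambda>y. d (bracket x y) - bracket x (d y)) = bracket (d x)"
  unfolding Der_iff by simp

text \<open>If \<open>d\<close> is in the ideal then so is \<open>[d, ad w] = ad (d w)\<close>, which is not zero for some \<open>w\<close>; the vectors whose inner derivation is in the ideal form a nonzero ideal of the cross product.\<close>

lemma inner_derivation_in_ideal:
  assumes card: "CARD('n) > 2" and J: "J \<subseteq> carrier (Der G)" "d \<in> J" "d \<noteq> (\<lambda>x. 0)"
    and add: "\<And>d e. d \<in> J ==> e \<in> J ==> (\<lambda>x. d x + e x) \<in> J" and scale: "\<And>c d. d \<in> J ==> (\<lambda>x. c *s d x) \<in> J"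
    and br: "\<And>d e. d \<in> carrier (Der G) ==> e \<in> J ==> (\<lambda>x. d (e x) - e (d x)) \<in> J"
  shows "bracket x \<in> J"
proof -
  obtain w where w: "d w \<noteq> 0" using J(3) by auto
  have "(\<lambda>y. bracket w (d y) - d (bracket w y)) \<in> J" by (rule br[OF ad_Der J(2)])
  then have "(\<lambda>y. (- 1) *s (bracket w (d y) - d (bracket w y))) \<in> J" by (rule scale)
  moreover have "(\<lambda>y. (- 1) *s (bracket w (d y) - d (bracket w y))) = bracket (d w)"
    using ad_commutator[of d w] J by (auto simp: fun_eq_iff vector_sneg_minus1[symmetric])
  ultimately have dw: "bracket (d w) \<in> J" by simp
  have "x \<in> {z. bracket z \<in> J}"
  proof (rule ideal_eq_UNIV[OF _ _ _ _ w])
    show "x + y \<in> {z. bracket z \<in> J}" if "x \<in> {z. bracket z \<in> J}" "y \<in> {z. bracket z \<in> J}" for x y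
    proof -
      have "bracket (x + y) = (\<lambda>z. bracket x z + bracket y z)" by (simp add: fun_eq_iff sc_mult_add)
      then show ?thesis using add that by simp
    qed
    show "c *s x \<in> {z. bracket z \<in> J}" if "x \<in> {z. bracket z \<in> J}" for c x
    proof -
      have "bracket (c *s x) = (\<lambda>z. c *s bracket x z)" by (simp add: fun_eq_iff sc_mult_scale)
      then show ?thesis using scale that by simp
    qed
    show "bracket u z \<in> {z. bracket z \<in> J}" if "z \<in> {z. bracket z \<in> J}" for u z
      using br[OF ad_Der, of "bracket z" u] ad_commutator[OF ad_Der, of u z] that by simp
  qed (use dw in simp)
  then show ?thesis by simp
qed

end

subsection \<open>A cross product is determined by its derivation algebra\<close>

text \<open>
  Both spaces of inner derivations are characterised as the smallest nonzero ideal, so an isomorphism of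
  derivation algebras maps one onto the other; as the centres are trivial, this is an isomorphism of the cross
  products.
\<close>

theorem Der_iso_imp_iso:
  fixes G :: "('a::field, 'n::finite) table" and G' :: "('a, 'm::finite) table"
  assumes G: "cross_product G M" and G': "cross_product G' M'" and char: "CHAR('a) = 3"
    and card: "CARD('n) > 2" "CARD('n) = CARD('m)" and iso: "algebra_iso (Der G) (Der G')"
  shows "algebra_iso (coord_algebra G') (coord_algebra G)"
proof -
  interpret A: char3_cross_product G M by unfold_locales fact+
  interpret B: char3_cross_product G' M' by unfold_locales fact+
  have card': "CARD('m) > 2" using card by simp
  obtain \<Phi> where \<Phi>: "algebra_hom (Der G) (Der G') \<Phi>" and bij: "bij_betw \<Phi> (carrier (Der G)) (carrier (Der G'))"
    using iso by (rule algebra_isoE)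
  note \<Phi>D = algebra_homD[OF \<Phi>, unfolded Der_ops]
  have inj: "inj_on \<Phi> (carrier (Der G))" using bij by (simp add: bij_betw_def)
  have zeroD: "(\<lambda>x. 0) \<in> carrier (Der G)" by (simp add: Der_iff)
  have \<Phi>0: "\<Phi> (\<lambda>x. 0) = (\<lambda>x. 0)" using \<Phi>D(3)[OF zeroD, of 0] by simp
  have ad_inj: "A.bracket x = A.bracket y ==> x = y" for x y
    using A.centerless[OF card(1), of "x - y"] by (simp add: sc_mult_diff)
  have ad_inj': "B.bracket x = B.bracket y ==> x = y" for x y
    using B.centerless[OF card', of "x - y"] by (simp add: sc_mult_diff)
  have ad_add: "A.bracket (x + y) = (\<lambda>z. A.bracket x z + A.bracket y z)" "A.bracket (c *s x) = (\<lambda>z. c *s A.bracket x z)" for x y c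
    by (simp_all add: fun_eq_iff sc_mult_add sc_mult_scale)
  have ad_add': "B.bracket (x + y) = (\<lambda>z. B.bracket x z + B.bracket y z)" "B.bracket (c *s x) = (\<lambda>z. c *s B.bracket x z)" for x y c
    by (simp_all add: fun_eq_iff sc_mult_add sc_mult_scale)
  let ?J = "\<Phi> ` range A.bracket"
  have J: "B.bracket y \<in> ?J" for y
  proof -
    have "axis undefined 1 \<noteq> (0::'a^'n)" by (simp add: axis_eq_0_iff)
    then have "A.bracket (axis undefined 1) \<noteq> (\<lambda>x. 0)" using ad_inj[of "axis undefined 1" 0] by (auto simp: fun_eq_iff)
    then have nz: "\<Phi> (A.bracket (axis undefined 1)) \<noteq> (\<lambda>x. 0)"
      using inj_onD[OF inj _ A.ad_Der zeroD] \<Phi>0 by metis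
    show ?thesis
    proof (rule B.inner_derivation_in_ideal[OF card' _ _ nz])
      show "?J \<subseteq> carrier (Der G')" using \<Phi>D(1)[OF A.ad_Der] by auto
      show "\<Phi> (A.bracket (axis undefined 1)) \<in> ?J" by blast
      show "(\<lambda>x. d x + e x) \<in> ?J" if h: "d \<in> ?J" "e \<in> ?J" for d e
      proof -
        obtain x y where "d = \<Phi> (A.bracket x)" "e = \<Phi> (A.bracket y)" using h by blast
        then have "(\<lambda>x. d x + e x) = \<Phi> (A.bracket (x + y))"
          by (simp only: ad_add(1) \<Phi>D(2)[OF A.ad_Der A.ad_Der])
        then show ?thesis by blast
      qed
      show "(\<lambda>x. c *s d x) \<in> ?J" if h: "d \<in> ?J" for c d
      proof -
        obtain x where "d = \<Phi> (A.bracket x)" using h by blast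
        then have "(\<lambda>x. c *s d x) = \<Phi> (A.bracket (c *s x))"
          by (simp only: ad_add(2) \<Phi>D(3)[OF A.ad_Der])
        then show ?thesis by blast
      qed
      show "(\<lambda>x. d (e x) - e (d x)) \<in> ?J" if de: "d \<in> carrier (Der G')" "e \<in> ?J" for d e
      proof -
        obtain x where x: "e = \<Phi> (A.bracket x)" using de(2) by blast
        obtain d0 where d0: "d = \<Phi> d0" "d0 \<in> carrier (Der G)" using de(1) bij by (auto simp: bij_betw_def)
        have "(\<lambda>x. d (e x) - e (d x)) = \<Phi> (A.bracket (d0 x))"
          using \<Phi>D(4)[OF d0(2) A.ad_Der[of x]] unfolding A.ad_commutator[OF d0(2)] x d0(1) by simp
        then show ?thesis by blast
      qed
    qed
  qed
  then have "\<forall>y. \<exists>x. B.bracket y = \<Phi> (A.bracket x)" by blast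
  then obtain f where f: "\<And>y. B.bracket y = \<Phi> (A.bracket (f y))" by metis
  have feq: "x = f y" if "\<Phi> (A.bracket x) = B.bracket y" for x y
    using ad_inj inj_onD[OF inj _ A.ad_Der A.ad_Der] that f by metis
  have fadd: "f (x + y) = f x + f y" for x y
  proof (rule feq[symmetric])
    show "\<Phi> (A.bracket (f x + f y)) = B.bracket (x + y)"
      unfolding ad_add ad_add' \<Phi>D(2)[OF A.ad_Der A.ad_Der] f[symmetric] by (rule refl)
  qed
  have fscale: "f (c *s x) = c *s f x" for c x
  proof (rule feq[symmetric])
    show "\<Phi> (A.bracket (c *s f x)) = B.bracket (c *s x)"
      unfolding ad_add ad_add' \<Phi>D(3)[OF A.ad_Der] f[symmetric] by (rule refl)
  qed
  have fmult: "f (B.bracket x y) = A.bracket (f x) (f y)" for x y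
  proof (rule feq[symmetric])
    have "\<Phi> (A.bracket (A.bracket (f x) (f y))) = \<Phi> (\<lambda>z. A.bracket (f x) (A.bracket (f y) z) - A.bracket (f y) (A.bracket (f x) z))"
      by (simp only: A.ad_commutator[OF A.ad_Der])
    also have "\<dots> = (\<lambda>z. B.bracket x (B.bracket y z) - B.bracket y (B.bracket x z))"
      unfolding \<Phi>D(4)[OF A.ad_Der A.ad_Der] f[symmetric] by (rule refl)
    finally show "\<Phi> (A.bracket (A.bracket (f x) (f y))) = B.bracket (B.bracket x y)"
      by (simp only: B.ad_commutator[OF B.ad_Der])
  qed
  have "inj f"
    by (rule injI) (metis ad_inj' f)
  moreover from this have "surj f" by (rule linear_inj_imp_surj_card[OF fadd fscale]) (simp add: card)
  ultimately show ?thesis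
    by (intro algebra_isoI[of _ _ f] algebra_homI) (auto simp: fadd fscale fmult bij_betw_def)
qed

subsection \<open>Derivations and field extensions\<close>

lemma bilinear_eqI:
  fixes f g :: "'a::field^'m::finite => 'a^'l::finite => 'a^'n::finite"
  assumes f: "\<And>x y z. f (x + y) z = f x z + f y z" "\<And>c x z. f (c *s x) z = c *s f x z"
      "\<And>x y z. f x (y + z) = f x y + f x z" "\<And>c x z. f x (c *s z) = c *s f x z"
    and g: "\<And>x y z. g (x + y) z = g x z + g y z" "\<And>c x z. g (c *s x) z = c *s g x z"
      "\<And>x y z. g x (y + z) = g x y + g x z" "\<And>c x z. g x (c *s z) = c *s g x z"
    and eq: "\<And>i j. f (axis i 1) (axis j 1) = g (axis i 1) (axis j 1)"
  shows "f x y = g x y"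
proof -
  have "f (axis i 1) = g (axis i 1)" for i
    by (rule lincomb_eqI) (use f g eq in auto)
  then have "(\<lambda>x. f x y) = (\<lambda>x. g x y)"
    by (intro lincomb_eqI) (use f g in auto)
  then show ?thesis by meson
qed

definition mat_op :: "'a::comm_ring_1^('n::finite \<times> 'n) => 'a^'n => 'a^'n" where
  "mat_op v x = (\<chi> i. \<Sum>j\<in>UNIV. v $ (i, j) * x $ j)"

definition op_mat :: "('a::comm_ring_1^'n::finite => 'a^'n) => 'a^('n \<times> 'n)" where
  "op_mat d = (\<chi> p. d (axis (snd p) 1) $ fst p)"

lemma mat_op_linear:
  "mat_op v (x + y) = mat_op v x + mat_op v y" "mat_op v (c *s x) = c *s mat_op v x"
  "mat_op (v + w) x = mat_op v x + mat_op w x" "mat_op (c *s v) x = c *s mat_op v x"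
  by (simp_all add: mat_op_def vec_eq_iff distrib_left distrib_right sum.distrib sum_distrib_left mult.assoc mult.left_commute)

lemma mat_op_axis [simp]: "mat_op v (axis j 1) $ i = v $ (i, j)"
proof -
  have "mat_op v (axis j 1) $ i = (\<Sum>k\<in>UNIV. if k = j then v $ (i, k) else 0)"
    unfolding mat_op_def by (simp add: axis_def if_distrib cong: if_cong)
  then show ?thesis by simp
qed

lemma op_mat_mat_op [simp]: "op_mat (mat_op v) = v"
  by (simp add: op_mat_def vec_eq_iff)

lemma mat_op_op_mat:
  fixes d :: "'a::field^'n::finite => 'a^'n"
  assumes "\<And>x y. d (x + y) = d x + d y" "\<And>c x. d (c *s x) = c *s d x"
  shows "mat_op (op_mat d) = d"
proof (rule lincomb_eqI)
  show "mat_op (op_mat d) (axis k 1) = d (axis k 1)" for k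
    by (simp add: vec_eq_iff op_mat_def)
qed (simp_all add: mat_op_linear assms)

lemma (in scalar_map) map_vec_mat_op: "map_vec \<phi> (mat_op v x) = mat_op (map_vec \<phi> v) (map_vec \<phi> x)"
  by (simp add: mat_op_def vec_eq_iff sum mult)

text \<open>
  Matrices are flattened to vectors, so that the Leibniz rule becomes one linear system and
  \<open>kernel_basis_descent\<close> applies to derivations.
\<close>

definition leibniz_defect :: "('a::comm_ring_1, 'n::finite) table => 'a^('n \<times> 'n) => 'a^('n \<times> 'n \<times> 'n)" where
  "leibniz_defect G v = (\<chi> t. case t of (i, j, k) => (mat_op v (G i j) -
     (sc_mult G (mat_op v (axis i 1)) (axis j 1) + sc_mult G (axis i 1) (mat_op v (axis j 1)))) $ k)"

lemma leibniz_defect_linear: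
  "leibniz_defect G (v + w) = leibniz_defect G v + leibniz_defect G w"
  "leibniz_defect G (c *s v) = c *s leibniz_defect G v"
  by (simp_all add: leibniz_defect_def vec_eq_iff mat_op_linear sc_mult_add sc_mult_scale algebra_simps)

lemma (in scalar_map) map_vec_leibniz_defect:
  fixes G :: "('r, 'n::finite) table"
  shows "map_vec \<phi> (leibniz_defect G v) = leibniz_defect (base_change \<phi> G) (map_vec \<phi> v)"
proof -
  have "map_vec \<phi> (mat_op v (G i j) - (sc_mult G (mat_op v (axis i 1)) (axis j 1) + sc_mult G (axis i 1) (mat_op v (axis j 1)))) =
      mat_op (map_vec \<phi> v) (base_change \<phi> G i j) - (sc_mult (base_change \<phi> G) (mat_op (map_vec \<phi> v) (axis i 1)) (axis j 1) +
        sc_mult (base_change \<phi> G) (axis i 1) (mat_op (map_vec \<phi> v) (axis j 1)))" for i j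
    by (simp add: map_vec_diff map_vec_add map_vec_mat_op map_vec_sc_mult base_change_def)
  then show ?thesis
    unfolding leibniz_defect_def vec_eq_iff by (simp add: split_def)
qed

lemma mat_op_Der_iff:
  fixes G :: "('a::field, 'n::finite) table"
  shows "mat_op v \<in> carrier (Der G) \<longleftrightarrow> leibniz_defect G v = 0"
proof
  assume "mat_op v \<in> carrier (Der G)"
  then have "mat_op v (sc_mult G x y) = sc_mult G (mat_op v x) y + sc_mult G x (mat_op v y)" for x y
    unfolding Der_iff by blast
  from this[of "axis _ 1" "axis _ 1"] show "leibniz_defect G v = 0"
    by (simp add: leibniz_defect_def vec_eq_iff)
next
  assume h: "leibniz_defect G v = 0"
  have "mat_op v (sc_mult G x y) = sc_mult G (mat_op v x) y + sc_mult G x (mat_op v y)" for x y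
  proof (rule bilinear_eqI[where f = "\<lambda>x y. mat_op v (sc_mult G x y)"
        and g = "\<lambda>x y. sc_mult G (mat_op v x) y + sc_mult G x (mat_op v y)"])
    fix i j
    have "leibniz_defect G v $ (i, j, k) = 0" for k by (simp add: h)
    then show "mat_op v (sc_mult G (axis i 1) (axis j 1)) =
        sc_mult G (mat_op v (axis i 1)) (axis j 1) + sc_mult G (axis i 1) (mat_op v (axis j 1))"
      by (simp add: leibniz_defect_def vec_eq_iff)
  qed (simp_all add: mat_op_linear sc_mult_add sc_mult_scale vector_add_ldistrib algebra_simps)
  then show "mat_op v \<in> carrier (Der G)" unfolding Der_iff by (simp add: mat_op_linear)
qed

definition commutator_mat :: "'a::comm_ring_1^('n::finite \<times> 'n) => 'a^('n \<times> 'n) => 'a^('n \<times> 'n)" where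
  "commutator_mat v w = (\<chi> p. (\<Sum>k\<in>UNIV. v $ (fst p, k) * w $ (k, snd p)) - (\<Sum>k\<in>UNIV. w $ (fst p, k) * v $ (k, snd p)))"

lemma commutator_mat_linear:
  "commutator_mat (v + w) u = commutator_mat v u + commutator_mat w u"
  "commutator_mat (c *s v) u = c *s commutator_mat v u"
  "commutator_mat u (v + w) = commutator_mat u v + commutator_mat u w"
  "commutator_mat u (c *s v) = c *s commutator_mat u v"
  by (simp_all add: commutator_mat_def vec_eq_iff distrib_left distrib_right sum.distrib sum_distrib_left
      right_diff_distrib mult.assoc mult.left_commute)

lemma (in scalar_map) map_vec_commutator_mat:
  "map_vec \<phi> (commutator_mat v w) = commutator_mat (map_vec \<phi> v) (map_vec \<phi> w)"
  by (simp add: commutator_mat_def vec_eq_iff sum mult diff)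

lemma mat_op_commutator_mat:
  fixes v w :: "'a::field^('n::finite \<times> 'n)"
  shows "mat_op (commutator_mat v w) x = mat_op v (mat_op w x) - mat_op w (mat_op v x)"
proof -
  have "mat_op (commutator_mat v w) = (\<lambda>x. mat_op v (mat_op w x) - mat_op w (mat_op v x))"
  proof (rule lincomb_eqI)
    show "mat_op (commutator_mat v w) (axis k 1) = mat_op v (mat_op w (axis k 1)) - mat_op w (mat_op v (axis k 1))" for k
      unfolding vec_eq_iff by (simp add: commutator_mat_def) (simp add: mat_op_def[of v "mat_op _ _"] mat_op_def[of w "mat_op _ _"])
  qed (simp_all add: mat_op_linear vector_ssub_ldistrib)
  then show ?thesis by meson
qed

context field_map
begin

text \<open>
  A table for the derivations over the large field is not assumed to come from the small one. Only its index
  type, that is the dimension, is used to find a table over the small field.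
\<close>

theorem Der_descent:
  fixes G :: "('a, 'n::finite) table" and D :: "('k, 'p::finite) table"
  assumes iso: "algebra_iso (coord_algebra D) (Der (base_change \<phi> G))"
  shows "\<exists>\<Delta> :: ('a, 'p) table. algebra_iso (coord_algebra \<Delta>) (Der G) \<and>
    algebra_iso (coord_algebra (base_change \<phi> \<Delta>)) (Der (base_change \<phi> G))"
proof -
  let ?G = "base_change \<phi> G"
  define F where "F p = leibniz_defect G (axis p 1)" for p
  have F: "leibniz_defect G = lincomb F"
    unfolding F_def by (rule linear_eq_lincomb) (simp_all add: leibniz_defect_linear)
  have FK: "leibniz_defect ?G = lincomb (\<lambda>p. map_vec \<phi> (F p))"
    unfolding F_def map_vec_leibniz_defect map_vec_axis
    by (rule linear_eq_lincomb) (simp_all add: leibniz_defect_linear)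
  obtain g where g: "algebra_hom (coord_algebra D) (Der ?G) g" and bij: "bij_betw g UNIV (carrier (Der ?G))"
    using iso by (auto elim: algebra_isoE)
  have gl: "g (x + y) = (\<lambda>z. g x z + g y z)" "g (c *s x) = (\<lambda>z. c *s g x z)" for x y c
    using algebra_homD(2,3)[OF g] by (simp_all add: Der_ops)
  have gD: "g x \<in> carrier (Der ?G)" for x using bij by (auto simp: bij_betw_def)
  have mg: "mat_op (op_mat (g x)) = g x" for x
    using gD[of x] by (intro mat_op_op_mat) (auto simp: Der_iff)
  define d where "d k = op_mat (g (axis k 1))" for k
  have d: "(\<lambda>x. op_mat (g x)) = lincomb d"
    unfolding d_def by (rule linear_eq_lincomb) (simp_all add: gl op_mat_def vec_eq_iff)
  have "inj (lincomb d)"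
    unfolding d[symmetric] using mg bij by (intro injI) (metis bij_betw_def injD)
  moreover have "range (lincomb d) = {v. lincomb (\<lambda>p. map_vec \<phi> (F p)) v = 0}"
  proof (intro subset_antisym subsetI)
    fix v assume "v \<in> range (lincomb d)"
    then obtain x where "v = op_mat (g x)" unfolding d[symmetric] by blast
    then have "mat_op v \<in> carrier (Der ?G)" using mg gD by simp
    then show "v \<in> {v. lincomb (\<lambda>p. map_vec \<phi> (F p)) v = 0}" by (simp add: mat_op_Der_iff FK)
  next
    fix v assume "v \<in> {v. lincomb (\<lambda>p. map_vec \<phi> (F p)) v = 0}"
    then have "mat_op v \<in> carrier (Der ?G)" by (simp add: mat_op_Der_iff FK)
    then obtain x where "mat_op v = g x" using bij unfolding bij_betw_def by (metis imageE)
    then have "v = lincomb d x" unfolding d[symmetric] by (metis op_mat_mat_op)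
    then show "v \<in> range (lincomb d)" by blast
  qed
  ultimately obtain b :: "'p => 'a^('n \<times> 'n)" where b: "inj (lincomb b)" "range (lincomb b) = {x. lincomb F x = 0}"
    "range (lincomb (\<lambda>k. map_vec \<phi> (b k))) = {v. lincomb (\<lambda>p. map_vec \<phi> (F p)) v = 0}"
    using kernel_basis_descent[of d F] by blast
  let ?b = "\<lambda>k. map_vec \<phi> (b k)"
  have injK: "inj (lincomb ?b)" by (rule inj_lincomb_base_change[OF b(1)])
  obtain r where r: "\<And>c. lincomb r (lincomb b c) = c" using lincomb_left_inverse[OF b(1)] by blast
  define m where "m x y = lincomb r (commutator_mat (lincomb b x) (lincomb b y))" for x y
  have m: "m = sc_mult (\<lambda>i j. m (axis i 1) (axis j 1))" (is "_ = sc_mult ?D")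
    by (rule bilinear_eq_sc_mult) (simp_all add: m_def commutator_mat_linear lincomb_add lincomb_scale)
  have bm: "lincomb b (m x y) = commutator_mat (lincomb b x) (lincomb b y)" for x y
  proof -
    have "mat_op (lincomb b z) \<in> carrier (Der G)" for z using b(2) by (auto simp: mat_op_Der_iff F)
    from Der_bracket_closed[OF this[of x] this[of y]]
    have "mat_op (commutator_mat (lincomb b x) (lincomb b y)) \<in> carrier (Der G)"
      by (simp add: mat_op_commutator_mat[symmetric])
    then have "commutator_mat (lincomb b x) (lincomb b y) \<in> range (lincomb b)"
      unfolding b(2) by (simp add: mat_op_Der_iff F)
    then show ?thesis unfolding m_def using r by (metis imageE)
  qed
  have bmK: "lincomb ?b (sc_mult (base_change \<phi> ?D) x y) = commutator_mat (lincomb ?b x) (lincomb ?b y)" for x y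
  proof (rule bilinear_eqI[where f = "\<lambda>x y. lincomb ?b (sc_mult (base_change \<phi> ?D) x y)"
        and g = "\<lambda>x y. commutator_mat (lincomb ?b x) (lincomb ?b y)"])
    fix i j
    have "map_vec \<phi> (lincomb b (m (axis i 1) (axis j 1))) = map_vec \<phi> (commutator_mat (b i) (b j))"
      by (simp add: bm)
    then show "lincomb ?b (sc_mult (base_change \<phi> ?D) (axis i 1) (axis j 1)) = commutator_mat (lincomb ?b (axis i 1)) (lincomb ?b (axis j 1))"
      by (simp add: map_vec_lincomb map_vec_commutator_mat base_change_def)
  qed (simp_all add: sc_mult_add sc_mult_scale lincomb_add lincomb_scale commutator_mat_linear)
  have *: "algebra_iso (coord_algebra E) (Der H)"
    if inj: "inj (lincomb e)" and range: "range (lincomb e) = {v. leibniz_defect H v = 0}"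
      and hom: "\<And>x y. lincomb e (sc_mult E x y) = commutator_mat (lincomb e x) (lincomb e y)"
    for E :: "('f::field, 'p) table" and H :: "('f, 'n) table" and e
  proof (intro algebra_isoI[of _ _ "\<lambda>x. mat_op (lincomb e x)"] algebra_homI)
    show mem: "mat_op (lincomb e x) \<in> carrier (Der H)" for x using range by (auto simp: mat_op_Der_iff)
    show "bij_betw (\<lambda>x. mat_op (lincomb e x)) (carrier (coord_algebra E)) (carrier (Der H))"
    proof -
      have "inj (\<lambda>x. mat_op (lincomb e x))" using inj by (intro injI) (metis injD op_mat_mat_op)
      moreover have "d \<in> range (\<lambda>x. mat_op (lincomb e x))" if d: "d \<in> carrier (Der H)" for d
      proof -
        have eq: "mat_op (op_mat d) = d" using d by (intro mat_op_op_mat) (auto simp: Der_iff)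
        then have "op_mat d \<in> range (lincomb e)" using d unfolding range by (simp add: mat_op_Der_iff[symmetric])
        then show ?thesis using eq by (metis imageE rangeI)
      qed
      ultimately show ?thesis using mem by (auto simp: bij_betw_def)
    qed
  qed (simp_all add: Der_ops lincomb_add lincomb_scale mat_op_linear hom mat_op_commutator_mat fun_eq_iff)
  have 1: "algebra_iso (coord_algebra ?D) (Der G)"
    by (rule *[OF b(1)]) (simp_all only: b(2) F m[symmetric] bm)
  have 2: "algebra_iso (coord_algebra (base_change \<phi> ?D)) (Der ?G)"
    by (rule *[OF injK]) (simp_all only: b(3) FK bmK)
  show ?thesis using 1 2 by blast
qed

end

subsection \<open>The split derivation algebra has dimension at most 14\<close>

lemma split_bracket_axis:
  "split_bracket (axis H 1) x = (\<chi> i. case i of H => 0 | E1 => x $ E1 | E2 => x $ E2 | E3 => x $ E3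
     | F1 => - x $ F1 | F2 => - x $ F2 | F3 => - x $ F3)"
  "split_bracket (axis E1 1) (axis E2 1) = axis F3 1"
  by (simp_all add: vec_eq_iff all_split_index split_bracket_def axis_def)

text \<open>
  If \<open>d H = 0\<close>, then \<open>d\<close> commutes with \<open>ad H\<close>, so it preserves the weight
  spaces, and skewness makes its block on the \<open>F\<close>s the negative transpose of that on the
  \<open>E\<close>s. The only entry not assumed to vanish, \<open>E3 E3\<close>, does so because
  \<open>[E1, E2] = F3\<close>.
\<close>

lemma split_derivation_eq_0:
  fixes d :: "'a::field^split_index => 'a^split_index"
  assumes char: "CHAR('a) = 3" and d: "d \<in> carrier (Der split_sc)"
    and h: "\<And>i. i \<noteq> H ==> d (axis H 1) $ i = 0"
    and e1: "\<And>i. i \<in> {E1, E2, E3} ==> d (axis E1 1) $ i = 0"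
    and e2: "\<And>i. i \<in> {E1, E2, E3} ==> d (axis E2 1) $ i = 0"
    and e3: "d (axis E3 1) $ E1 = 0" "d (axis E3 1) $ E2 = 0"
  shows "d = (\<lambda>x. 0)"
proof -
  interpret char3_cross_product "split_sc :: ('a, split_index) table" split_gram
    by unfold_locales (rule cross_product_split[OF char], fact)
  have skew: "split_form (d x) y + split_form x (d y) = 0" for x y
    using derivation_skew[OF _ d, of x y] by (simp add: bform_split_gram)
  have leib: "d (split_bracket x y) = split_bracket (d x) y + split_bracket x (d y)" for x y
    using d by (simp add: Der_iff sc_mult_split_sc)
  have dl: "d (x + y) = d x + d y" "d (c *s x) = c *s d x" for x y c using d unfolding Der_iff by blast+
  have d0: "d 0 = 0" "d (- x) = - d x" for x using d linear_zero_minus(1,2) unfolding Der_iff by blast+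
  have dd: "d (axis i 1) $ split_dual j + d (axis j 1) $ split_dual i = 0"
    if "split_dual = (\<lambda>i. case i of H => H | E1 => F1 | E2 => F2 | E3 => F3 | F1 => E1 | F2 => E2 | F3 => E3)" for i j split_dual
    using skew[of "axis i 1" "axis j 1"] that
    by (cases i; cases j) (simp_all add: split_form_def axis_def)
  note dual = dd[OF refl]
  have hH: "d (axis H 1) $ H = 0" using dual[of H H] self_neg_eq_0[of "d (axis H 1) $ H"] by (simp add: eq_neg_iff_add_eq_0)
  have dh: "d (axis H 1) = 0" unfolding vec_eq_iff all_split_index using h hH by simp
  have iH: "d (axis i 1) $ H = 0" for i using dual[of i H] dh by simp
  have neg0: "t = 0" if "- t = t" for t :: 'a using self_neg_eq_0[of t] that by simp
  have zero_l: "split_bracket 0 x = 0" "split_bracket x 0 = 0" for x :: "'a^split_index"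
    using sc_mult_zero[of split_sc x] by (simp_all only: sc_mult_split_sc)
  have wE: "split_bracket (axis H 1) (d (axis i 1)) = d (axis i 1)" if "i \<in> {E1, E2, E3}" for i
  proof -
    have "split_bracket (axis H 1) (axis i 1) = (axis i 1 :: 'a^split_index)"
      using that by (auto simp: split_bracket_def vec_eq_iff all_split_index axis_def)
    then show ?thesis using leib[of "axis H 1" "axis i 1"] by (simp add: dh zero_l)
  qed
  have wF: "split_bracket (axis H 1) (d (axis i 1)) = - d (axis i 1)" if "i \<in> {F1, F2, F3}" for i
  proof -
    have "split_bracket (axis H 1) (axis i 1) = (- axis i 1 :: 'a^split_index)"
      using that by (auto simp: split_bracket_def vec_eq_iff all_split_index axis_def)
    then show ?thesis using leib[of "axis H 1" "axis i 1"] by (simp add: dh zero_l d0)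
  qed
  have EF: "d (axis i 1) $ j = 0" if "i \<in> {E1, E2, E3}" "j \<in> {F1, F2, F3}" for i j
    using wE[OF that(1)] that(2) unfolding split_bracket_axis vec_eq_iff all_split_index by (auto intro: neg0)
  have FE: "d (axis i 1) $ j = 0" if "i \<in> {F1, F2, F3}" "j \<in> {E1, E2, E3}" for i j
    using wF[OF that(1)] that(2) unfolding split_bracket_axis vec_eq_iff all_split_index by (auto intro: neg0 sym)
  have dE1: "d (axis E1 1) = 0" "d (axis E2 1) = 0"
    unfolding vec_eq_iff all_split_index using EF iH e1 e2 by auto
  have dF3: "d (axis F3 1) = 0"
    using leib[of "axis E1 1" "axis E2 1"] unfolding split_bracket_axis(2) dE1 zero_l by simp
  have "d (axis E3 1) $ E3 = 0" using dual[of E3 F3] dF3 by simp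
  then have dE3: "d (axis E3 1) = 0"
    unfolding vec_eq_iff all_split_index using EF iH e3 by auto
  have "d (axis F1 1) = 0" "d (axis F2 1) = 0"
    unfolding vec_eq_iff all_split_index using FE iH dual[of F1 E1] dual[of F1 E2] dual[of F1 E3]
      dual[of F2 E1] dual[of F2 E2] dual[of F2 E3] dE1 dE3 by simp_all
  then have "d (axis i 1) = 0" for i using dh dE1 dE3 dF3 by (cases i) auto
  then show ?thesis by (intro lincomb_eqI) (simp_all add: dl)
qed

text \<open>
  Fourteen matrix entries determine a derivation, so a faithful 14-dimensional family of derivations is
  everything.
\<close>

theorem Der_split_surj:
  fixes \<rho> :: "'a::field^'g::finite => 'a^split_index => 'a^split_index"
  assumes char: "CHAR('a) = 3" and mem: "\<And>g. \<rho> g \<in> carrier (Der split_sc)"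
    and add: "\<And>g h. \<rho> (g + h) = (\<lambda>x. \<rho> g x + \<rho> h x)" and scale: "\<And>c g. \<rho> (c *s g) = (\<lambda>x. c *s \<rho> g x)"
    and inj: "\<And>g. \<rho> g = (\<lambda>x. 0) ==> g = 0" and card: "CARD('g) = 14"
  shows "range \<rho> = carrier (Der split_sc)"
proof -
  \<comment> \<open>fourteen matrix entries that determine a derivation\<close>
  define \<delta> :: "('a^split_index => 'a^split_index) => 'a^(bool \<times> split_index)" where
    "\<delta> d = (\<chi> p. case p of
       (False, i) => (if i = H then d (axis E1 1) $ E1 else d (axis H 1) $ i)
     | (True, i) => (case i of H => d (axis E1 1) $ E2 | E1 => d (axis E1 1) $ E3 | E2 => d (axis E2 1) $ E1
         | E3 => d (axis E2 1) $ E2 | F1 => d (axis E2 1) $ E3 | F2 => d (axis E3 1) $ E1 | F3 => d (axis E3 1) $ E2))" for d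
  have \<delta>_add: "\<delta> (\<lambda>x. d x + e x) = \<delta> d + \<delta> e" and \<delta>_scale: "\<delta> (\<lambda>x. c *s d x) = c *s \<delta> d" for d e c
    by (auto simp: \<delta>_def vec_eq_iff split: bool.splits split_index.splits)
  have \<delta>0: "d = (\<lambda>x. 0)" if d: "d \<in> carrier (Der split_sc)" and 0: "\<delta> d = 0" for d
  proof -
    have z: "\<delta> d $ p = 0" for p by (simp add: 0)
    show ?thesis
    proof (rule split_derivation_eq_0[OF char d])
      show "d (axis H 1) $ i = 0" if "i \<noteq> H" for i using z[of "(False, i)"] that by (simp add: \<delta>_def)
      show "d (axis E1 1) $ i = 0" if "i \<in> {E1, E2, E3}" for i
        using that z[of "(False, H)"] z[of "(True, H)"] z[of "(True, E1)"] by (auto simp: \<delta>_def)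
      show "d (axis E2 1) $ i = 0" if "i \<in> {E1, E2, E3}" for i
        using that z[of "(True, E2)"] z[of "(True, E3)"] z[of "(True, F1)"] by (auto simp: \<delta>_def)
      show "d (axis E3 1) $ E1 = 0" "d (axis E3 1) $ E2 = 0"
        using z[of "(True, F2)"] z[of "(True, F3)"] by (auto simp: \<delta>_def)
    qed
  qed
  define f where "f g = \<delta> (\<rho> g)" for g
  have fl: "f (x + y) = f x + f y" "f (c *s x) = c *s f x" for x y c
    by (simp_all add: f_def add scale \<delta>_add \<delta>_scale)
  have f0: "x = 0" if "f x = 0" for x using \<delta>0[OF mem] that inj by (simp add: f_def)
  have "inj f"
  proof (rule injI)
    fix x y assume "f x = f y"
    then have "f (x - y) = 0" using fl(1)[of "x - y" y] by simp
    then show "x = y" using f0 by force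
  qed
  then have surj: "surj f" by (rule linear_inj_imp_surj_card[OF fl]) (simp add: card)
  have "d \<in> range \<rho>" if d: "d \<in> carrier (Der split_sc)" for d
  proof -
    obtain g where g: "\<delta> d = \<delta> (\<rho> g)" using surj unfolding f_def by (metis surjD)
    have md: "(\<lambda>x. d x + (- 1) *s \<rho> g x) \<in> carrier (Der split_sc)"
      using d mem[of g] unfolding Der_iff
      by (simp add: sc_mult_add sc_mult_diff sc_mult_scale vector_ssub_ldistrib vector_scale_scale algebra_simps)
    have "\<delta> (\<lambda>x. d x + (- 1) *s \<rho> g x) = 0" unfolding \<delta>_add \<delta>_scale g by (simp add: vec_eq_iff)
    then have "(\<lambda>x. d x + (- 1) *s \<rho> g x) = (\<lambda>x. 0)" by (rule \<delta>0[OF md])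
    then have "d x = \<rho> g x" for x by (metis (no_types) add_eq_0_iff minus_minus vector_sneg_minus1)
    then show ?thesis by blast
  qed
  then show ?thesis using mem by blast
qed

section \<open>The root system of type \<open>G\<^sub>2\<close>\<close>

lemma G2_roots_explicit: "G2_roots = {(1, 0), (0, 1), (1, 1), (2, 1), (3, 1), (3, 2),
    (- 1, 0), (0, - 1), (- 1, - 1), (- 2, - 1), (- 3, - 1), (- 3, - 2)}"
  by (auto simp: G2_roots_def G2_positive_roots_def)

definition G2_short_roots :: "(int \<times> int) set" where
  "G2_short_roots = {\<alpha> \<in> G2_roots. G2_inner \<alpha> \<alpha> = 2}"

definition G2_long_roots :: "(int \<times> int) set" where
  "G2_long_roots = {\<alpha> \<in> G2_roots. G2_inner \<alpha> \<alpha> = 6}"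

lemma G2_short_roots_explicit: "G2_short_roots = {(1, 0), (1, 1), (2, 1), (- 1, 0), (- 1, - 1), (- 2, - 1)}"
  by (auto simp: G2_short_roots_def G2_roots_explicit)

lemma G2_long_roots_explicit: "G2_long_roots = {(0, 1), (3, 1), (3, 2), (0, - 1), (- 3, - 1), (- 3, - 2)}"
  by (auto simp: G2_long_roots_def G2_roots_explicit)

lemma G2_roots_short_long: "\<alpha> \<in> G2_roots \<longleftrightarrow> \<alpha> \<in> G2_short_roots \<or> \<alpha> \<in> G2_long_roots"
  by (auto simp: G2_roots_explicit G2_short_roots_explicit G2_long_roots_explicit)

lemma G2_root_basics:
  assumes "\<alpha> \<in> G2_roots"
  shows "\<alpha> \<noteq> 0" "- \<alpha> \<in> G2_roots"
  using assms by (auto simp: G2_roots_explicit zero_prod_def)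

lemma G2_short_neg: "\<alpha> \<in> G2_short_roots ==> - \<alpha> \<in> G2_short_roots"
  by (auto simp: G2_short_roots_explicit)

text \<open>The string length as the maximum of an explicit list, so that it can be evaluated.\<close>

definition G2_string_list :: "int \<times> int => int \<times> int => nat list" where
  "G2_string_list \<alpha> \<beta> =
     filter (\<lambda>r. (fst \<beta> - int r * fst \<alpha>, snd \<beta> - int r * snd \<alpha>) \<in> G2_roots) [0..<7]"

lemma G2_string_eq_Max:
  assumes "\<alpha> \<in> G2_roots" "\<beta> \<in> G2_roots"
  shows "G2_string \<alpha> \<beta> = Max (set (G2_string_list \<alpha> \<beta>))"
proof -
  have "r < 7" if r: "(fst \<beta> - int r * fst \<alpha>, snd \<beta> - int r * snd \<alpha>) \<in> G2_roots" for r
  proof -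
    have b: "\<bar>fst \<gamma>\<bar> \<le> 3 \<and> \<bar>snd \<gamma>\<bar> \<le> 3" if "\<gamma> \<in> G2_roots" for \<gamma>
      using that unfolding G2_roots_explicit by auto
    have bound: "int r < 7" if "a \<noteq> 0" "\<bar>c - int r * a\<bar> \<le> 3" "\<bar>c\<bar> \<le> 3" for a c
    proof -
      have "int r * 1 \<le> int r * \<bar>a\<bar>" using that(1) by (intro mult_left_mono) auto
      also have "\<dots> = \<bar>int r * a\<bar>" by (simp add: abs_mult)
      finally show ?thesis using that(2,3) by linarith
    qed
    have "fst \<alpha> \<noteq> 0 \<or> snd \<alpha> \<noteq> 0" using assms(1) unfolding G2_roots_explicit by auto
    then have "int r < 7"
      using bound[of "fst \<alpha>" "fst \<beta>"] bound[of "snd \<alpha>" "snd \<beta>"] b[OF r] b[OF assms(2)] by auto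
    then show ?thesis by simp
  qed
  then show ?thesis by (auto simp: G2_string_def G2_string_list_def intro!: arg_cong[of _ _ Max])
qed

text \<open>
  The coordinates of the coroot of \<open>\<alpha>\<close> in terms of the simple coroots: the inverse of the
  Cartan matrix has rows \<open>(2, 1)\<close> and \<open>(3, 2)\<close>.
\<close>

definition coroot_coeff :: "int \<times> int => int \<times> int" where
  "coroot_coeff \<alpha> = (2 * G2_cartan (1, 0) \<alpha> + G2_cartan (0, 1) \<alpha>, 3 * G2_cartan (1, 0) \<alpha> + 2 * G2_cartan (0, 1) \<alpha>)"

text \<open>
  Modulo 3, the coroot of the short simple root acts on long root vectors by 0, and the coroots of short roots
  have no component along the long simple coroot. The other two separate the components of a vector and decide
  where the Killing form vanishes.
\<close>

lemma G2_facts: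
  "\<alpha> \<in> G2_long_roots ==> 3 dvd G2_cartan \<alpha> (1, 0)"
  "\<alpha> \<in> G2_short_roots ==> \<not> 3 dvd G2_cartan \<alpha> (1, 0)"
  "\<alpha> \<in> G2_short_roots ==> 3 dvd snd (coroot_coeff \<alpha>)"
  "\<alpha> \<in> G2_long_roots ==> \<not> 3 dvd snd (coroot_coeff \<alpha>)"
  by (auto simp: G2_short_roots_explicit G2_long_roots_explicit G2_cartan_def coroot_coeff_def)

lemma G2_string_to_long:
  assumes "\<alpha> \<in> G2_roots" "\<beta> \<in> G2_short_roots" "\<alpha> + \<beta> \<in> G2_long_roots"
  shows "G2_string \<alpha> \<beta> = 2"
proof -
  have "\<forall>\<alpha>\<in>G2_roots. \<forall>\<beta>\<in>G2_short_roots. \<alpha> + \<beta> \<in> G2_long_roots --> G2_string_list \<alpha> \<beta> = [0, 1, 2]"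
    by code_simp
  then show ?thesis using assms G2_string_eq_Max[of \<alpha> \<beta>] by (simp add: G2_roots_short_long)
qed

lemma G2_string_short_short:
  assumes "\<alpha> \<in> G2_short_roots" "\<beta> \<in> G2_short_roots" "\<alpha> + \<beta> \<in> G2_short_roots"
  shows "G2_string \<alpha> \<beta> = 1"
proof -
  have "\<forall>\<alpha>\<in>G2_short_roots. \<forall>\<beta>\<in>G2_short_roots. \<alpha> + \<beta> \<in> G2_short_roots --> G2_string_list \<alpha> \<beta> = [0, 1]"
    by code_simp
  then show ?thesis using assms G2_string_eq_Max[of \<alpha> \<beta>] by (simp add: G2_roots_short_long)
qed

lemma G2_long_to_short:
  assumes "\<beta> \<in> G2_long_roots"
  shows "\<exists>\<gamma>\<in>G2_short_roots. \<beta> + \<gamma> \<in> G2_short_roots \<and> G2_string \<beta> \<gamma> = 0"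
proof -
  have "\<forall>\<beta>\<in>G2_long_roots. \<exists>\<gamma>\<in>G2_short_roots. \<beta> + \<gamma> \<in> G2_short_roots \<and> G2_string_list \<beta> \<gamma> = [0]"
    by code_simp
  then obtain \<gamma> where "\<gamma> \<in> G2_short_roots" "\<beta> + \<gamma> \<in> G2_short_roots" "G2_string_list \<beta> \<gamma> = [0]"
    using assms by blast
  then show ?thesis using assms G2_string_eq_Max[of \<beta> \<gamma>] by (intro bexI[of _ \<gamma>]) (simp_all add: G2_roots_short_long)
qed

section \<open>Chevalley algebras in coordinates\<close>

lemma G2_chevalley_indices_eq: "G2_chevalley_indices = insert (Inl (1, 0)) (insert (Inl (0, 1)) (Inr ` G2_roots))"
  by (auto simp: G2_chevalley_indices_def G2_simple_roots_def)

text \<open>A type with 14 elements, so that Chevalley bases can index coordinate vectors.\<close>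

typedef chevalley_index = G2_chevalley_indices
  by (rule exI[of _ "Inl (1, 0)"]) (simp add: G2_chevalley_indices_eq)

definition cartan_index :: "int \<times> int => chevalley_index" where "cartan_index \<alpha> = Abs_chevalley_index (Inl \<alpha>)"
definition root_index :: "int \<times> int => chevalley_index" where "root_index \<alpha> = Abs_chevalley_index (Inr \<alpha>)"

lemma Rep_root_index: "\<alpha> \<in> G2_roots ==> Rep_chevalley_index (root_index \<alpha>) = Inr \<alpha>"
  by (simp add: root_index_def Abs_chevalley_index_inverse G2_chevalley_indices_eq)

lemma Rep_cartan_index: "\<alpha> \<in> G2_simple_roots ==> Rep_chevalley_index (cartan_index \<alpha>) = Inl \<alpha>"
  by (auto simp: cartan_index_def Abs_chevalley_index_inverse G2_chevalley_indices_eq G2_simple_roots_def)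

lemma chevalley_index_cases:
  obtains \<alpha> where "\<alpha> \<in> G2_simple_roots" "k = cartan_index \<alpha>" | \<alpha> where "\<alpha> \<in> G2_roots" "k = root_index \<alpha>"
proof -
  have "Rep_chevalley_index k \<in> G2_chevalley_indices" by (rule Rep_chevalley_index)
  then consider \<alpha> where "\<alpha> \<in> G2_simple_roots" "Rep_chevalley_index k = Inl \<alpha>"
    | \<alpha> where "\<alpha> \<in> G2_roots" "Rep_chevalley_index k = Inr \<alpha>"
    by (auto simp: G2_chevalley_indices_def)
  then show ?thesis
    using that Rep_chevalley_index_inverse[of k] by cases (auto simp: cartan_index_def root_index_def)
qed

lemma index_eq_iff [simp]:
  "\<alpha> \<in> G2_roots ==> \<beta> \<in> G2_roots ==> root_index \<alpha> = root_index \<beta> \<longleftrightarrow> \<alpha> = \<beta>"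
  "\<alpha> \<in> G2_simple_roots ==> \<beta> \<in> G2_simple_roots ==> cartan_index \<alpha> = cartan_index \<beta> \<longleftrightarrow> \<alpha> = \<beta>"
  "\<alpha> \<in> G2_simple_roots ==> \<beta> \<in> G2_roots ==> cartan_index \<alpha> \<noteq> root_index \<beta>"
  "\<alpha> \<in> G2_simple_roots ==> \<beta> \<in> G2_roots ==> root_index \<beta> \<noteq> cartan_index \<alpha>"
  by (metis Rep_root_index Rep_cartan_index sum.inject sum.distinct(1))+

lemma UNIV_chevalley_index:
  "UNIV = insert (cartan_index (1, 0)) (insert (cartan_index (0, 1)) (root_index ` G2_roots))"
proof -
  have "k \<in> insert (cartan_index (1, 0)) (insert (cartan_index (0, 1)) (root_index ` G2_roots))" for k
    by (cases k rule: chevalley_index_cases) (auto simp: G2_simple_roots_def)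
  then show ?thesis by blast
qed

lemma finite_G2_roots [simp]: "finite G2_roots"
  by (simp add: G2_roots_explicit)

instance chevalley_index :: finite
  by standard (simp add: UNIV_chevalley_index)

lemma simple_mem [simp]: "(1, 0) \<in> G2_simple_roots" "(0, 1) \<in> G2_simple_roots"
  by (simp_all add: G2_simple_roots_def)

lemma sum_chevalley_index:
  "(\<Sum>k\<in>UNIV. f k) = f (cartan_index (1, 0)) + f (cartan_index (0, 1)) + (\<Sum>\<alpha>\<in>G2_roots. f (root_index \<alpha>))"
proof -
  have "inj_on root_index G2_roots" by (rule inj_onI) simp
  moreover have "cartan_index (1, 0) \<noteq> cartan_index (0, 1)" by simp
  moreover have "cartan_index (1, 0) \<notin> root_index ` G2_roots" "cartan_index (0, 1) \<notin> root_index ` G2_roots"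
    by auto
  ultimately show ?thesis
    unfolding UNIV_chevalley_index by (simp add: sum.reindex add.assoc)
qed

lemma card_chevalley_index [simp]: "CARD(chevalley_index) = 14"
proof -
  have "CARD(chevalley_index) = (\<Sum>k\<in>(UNIV :: chevalley_index set). 1)" by simp
  also have "\<dots> = 2 + card G2_roots" unfolding sum_chevalley_index by simp
  finally show ?thesis by (simp add: G2_roots_explicit)
qed

abbreviation cartan_vec :: "int \<times> int => 'r::comm_ring_1^chevalley_index" where
  "cartan_vec \<alpha> \<equiv> axis (cartan_index \<alpha>) 1"

abbreviation root_vec :: "int \<times> int => 'r::comm_ring_1^chevalley_index" where
  "root_vec \<alpha> \<equiv> axis (root_index \<alpha>) 1"

abbreviation coroot_vec :: "int \<times> int => 'r::comm_ring_1^chevalley_index" where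
  "coroot_vec \<alpha> \<equiv> of_int (fst (coroot_coeff \<alpha>)) *s cartan_vec (1, 0) + of_int (snd (coroot_coeff \<alpha>)) *s cartan_vec (0, 1)"

text \<open>
  Over a general ring antisymmetry does not imply the alternating law, so the latter is the one required.
\<close>

definition lie_sc :: "('r::comm_ring_1, 'n::finite) table => bool" where
  "lie_sc G \<longleftrightarrow> (\<forall>x. sc_mult G x x = 0) \<and>
     (\<forall>x y z. sc_mult G x (sc_mult G y z) + sc_mult G y (sc_mult G z x) + sc_mult G z (sc_mult G x y) = 0)"

lemma lie_sc_antisym: "lie_sc G ==> sc_mult G x y = - sc_mult G y x"
proof -
  assume G: "lie_sc G"
  have "sc_mult G (x + y) (x + y) = 0" using G by (simp only: lie_sc_def)
  then have "sc_mult G x y + sc_mult G y x = 0" using G by (simp add: lie_sc_def sc_mult_add add.commute)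
  then show ?thesis by (simp add: eq_neg_iff_add_eq_0)
qed

lemma lie_sc_derivation:
  "lie_sc G ==> sc_mult G x (sc_mult G y z) = sc_mult G (sc_mult G x y) z + sc_mult G y (sc_mult G x z)"
proof -
  assume G: "lie_sc G"
  have 1: "sc_mult G y (sc_mult G z x) = - sc_mult G y (sc_mult G x z)" "sc_mult G z (sc_mult G x y) = - sc_mult G (sc_mult G x y) z"
    using lie_sc_antisym[OF G, of z x] lie_sc_antisym[OF G, of z "sc_mult G x y"] by (simp_all add: sc_mult_minus)
  have "sc_mult G x (sc_mult G y z) + sc_mult G y (sc_mult G z x) + sc_mult G z (sc_mult G x y) = 0"
    using G unfolding lie_sc_def by blast
  then show ?thesis unfolding 1 by (simp add: diff_eq_eq)
qed

text \<open>
  The Jacobi identity is trilinear and may be checked on basis vectors. The alternating law is quadratic; it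
  needs the values on basis vectors and antisymmetry.
\<close>

lemma lie_sc_base_change:
  fixes G :: "('r::comm_ring_1, 'n::finite) table" and \<phi> :: "'r => 'k::field"
  assumes \<phi>: "scalar_map \<phi>" and G: "lie_sc G"
  shows "lie_sc (base_change \<phi> G)"
proof -
  interpret \<phi>: scalar_map \<phi> by fact
  let ?G = "base_change \<phi> G"
  have Gd: "?G i j = - ?G j i" "?G i i = 0" for i j
  proof -
    have "sc_mult G (axis i 1) (axis i 1) = 0" for i using G unfolding lie_sc_def by blast
    then show "?G i i = 0" by (simp add: base_change_def)
    have "G i j = - G j i" using lie_sc_antisym[OF G, of "axis i 1" "axis j 1"] by simp
    then show "?G i j = - ?G j i" by (simp add: base_change_def \<phi>.map_vec_minus)
  qed
  have "sc_mult ?G x y = - sc_mult ?G y x" for x y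
  proof -
    have "sc_mult ?G y x = (\<Sum>i\<in>UNIV. \<Sum>j\<in>UNIV. (x $ i * y $ j) *s ?G j i)"
      unfolding sc_mult_def by (subst sum.swap) (simp add: mult.commute)
    also have "\<dots> = - sc_mult ?G x y"
      unfolding sc_mult_def sum_negf[symmetric] by (subst Gd(1)) (simp add: vec_eq_iff)
    finally show ?thesis by simp
  qed
  have alt: "sc_mult ?G x x = 0" for x
  proof -
    have part: "sc_mult ?G (\<Sum>i\<in>S. (x $ i) *s axis i 1) (\<Sum>i\<in>S. (x $ i) *s axis i 1) = 0" for S :: "'n set"
    proof (induct S rule: infinite_finite_induct)
      case (insert i S)
      let ?s = "\<Sum>i\<in>S. (x $ i) *s axis i (1::'k)" and ?t = "(x $ i) *s axis i (1::'k)"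
      have "sc_mult ?G ?t ?s + sc_mult ?G ?s ?t = 0" using \<open>\<And>x y. sc_mult ?G x y = - sc_mult ?G y x\<close>[of ?t ?s] by simp
      then show ?case using insert Gd(2)[of i] by (simp add: sc_mult_add sc_mult_scale add.commute)
    qed simp_all
    show ?thesis using part[of UNIV] by (simp only: basis_expansion_ring)
  qed
  define J where "J x y z = sc_mult ?G x (sc_mult ?G y z) + sc_mult ?G y (sc_mult ?G z x) + sc_mult ?G z (sc_mult ?G x y)" for x y z
  have Jl: "J (x + x') y z = J x y z + J x' y z" "J x (y + y') z = J x y z + J x y' z" "J x y (z + z') = J x y z + J x y z'"
    "J (c *s x) y z = c *s J x y z" "J x (c *s y) z = c *s J x y z" "J x y (c *s z) = c *s J x y z" for x x' y y' z z' c
    by (simp_all add: J_def sc_mult_add sc_mult_scale vector_add_ldistrib algebra_simps)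
  have J0: "J (axis i 1) (axis j 1) (axis k 1) = 0" for i j k
  proof -
    have "map_vec \<phi> (sc_mult G (axis i 1) (sc_mult G (axis j 1) (axis k 1)) + sc_mult G (axis j 1) (sc_mult G (axis k 1) (axis i 1)) +
        sc_mult G (axis k 1) (sc_mult G (axis i 1) (axis j 1))) = map_vec \<phi> 0"
      using G unfolding lie_sc_def by metis
    then show ?thesis
      by (simp add: J_def \<phi>.map_vec_add \<phi>.map_vec_sc_mult base_change_def)
  qed
  have "J (axis i 1) y z = 0" for i y z
    by (rule bilinear_eqI[where f = "J (axis i 1)" and g = "\<lambda>y z. 0"]) (simp_all add: Jl J0)
  then have "(\<lambda>x. J x y z) = (\<lambda>x. 0)" for y z
    by (intro lincomb_eqI) (simp_all add: Jl)
  then have "J x y z = 0" for x y z by meson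
  then show ?thesis unfolding lie_sc_def J_def using alt by blast
qed

text \<open>
  The relations of a Chevalley basis over any ring. The signs stay unspecified, so no particular normalisation
  has to be matched.
\<close>

definition chevalley_relations :: "('r::comm_ring_1, chevalley_index) table => bool" where
  "chevalley_relations G \<longleftrightarrow> lie_sc G \<and>
     (\<forall>\<alpha>\<in>G2_simple_roots. \<forall>\<beta>\<in>G2_simple_roots. G (cartan_index \<alpha>) (cartan_index \<beta>) = 0) \<and>
     (\<forall>\<alpha>\<in>G2_simple_roots. \<forall>\<beta>\<in>G2_roots.
        G (cartan_index \<alpha>) (root_index \<beta>) = of_int (G2_cartan \<beta> \<alpha>) *s root_vec \<beta>) \<and>
     (\<forall>\<alpha>\<in>G2_roots. G (root_index \<alpha>) (root_index (- \<alpha>)) =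
        coroot_vec \<alpha>) \<and>
     (\<forall>\<alpha>\<in>G2_roots. \<forall>\<beta>\<in>G2_roots. \<alpha> + \<beta> \<in> G2_roots -->
        (\<exists>s\<in>{1, - 1}. G (root_index \<alpha>) (root_index \<beta>) = of_int (s * int (G2_string \<alpha> \<beta> + 1)) *s root_vec (\<alpha> + \<beta>))) \<and>
     (\<forall>\<alpha>\<in>G2_roots. \<forall>\<beta>\<in>G2_roots. \<alpha> + \<beta> \<noteq> 0 \<and> \<alpha> + \<beta> \<notin> G2_roots --> G (root_index \<alpha>) (root_index \<beta>) = 0)"

lemma scalar_map_of_int: "scalar_map (of_int :: int => 'r::comm_ring_1)"
  by unfold_locales simp_all

lemma chevalley_relations_base_change:
  fixes \<phi> :: "int => 'k::field"
  assumes \<phi>: "scalar_map \<phi>" and G: "chevalley_relations G"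
  shows "chevalley_relations (base_change \<phi> G)"
proof -
  interpret \<phi>: scalar_map \<phi> by fact
  have \<phi>_int: "\<phi> n = of_int n" for n
  proof -
    have nat: "\<phi> (int m) = of_nat m" for m by (induct m) (simp_all add: \<phi>.add)
    show ?thesis using nat[of "nat n"] nat[of "nat (- n)"] \<phi>.minus[of n] by (cases "n \<ge> 0") auto
  qed
  note simps = base_change_def \<phi>.map_vec_scale \<phi>.map_vec_add \<phi>_int
  show ?thesis
    unfolding chevalley_relations_def
  proof (intro conjI ballI impI)
    have "lie_sc G" using G unfolding chevalley_relations_def by blast
    then show "lie_sc (base_change \<phi> G)" by (rule lie_sc_base_change[OF \<phi>])
  next
    fix \<alpha> \<beta> assume \<alpha>: "\<alpha> \<in> G2_roots" and \<beta>: "\<beta> \<in> G2_roots" and "\<alpha> + \<beta> \<in> G2_roots"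
    then obtain s where s: "s \<in> {1, - 1}" "G (root_index \<alpha>) (root_index \<beta>) = of_int (s * int (G2_string \<alpha> \<beta> + 1)) *s root_vec (\<alpha> + \<beta>)"
      using G unfolding chevalley_relations_def by blast
    show "\<exists>s\<in>{1, - 1}. base_change \<phi> G (root_index \<alpha>) (root_index \<beta>) = of_int (s * int (G2_string \<alpha> \<beta> + 1)) *s root_vec (\<alpha> + \<beta>)"
      by (rule bexI[OF _ s(1)]) (simp add: simps s(2))
  qed (use G in \<open>auto simp: chevalley_relations_def simps\<close>)
qed

text \<open>
  The degree of a basis vector for the grading of the Chevalley algebra by the root lattice; Cartan elements
  have degree 0.
\<close>

definition weight :: "chevalley_index => int \<times> int" where
  "weight k = case_sum (\<lambda>_. 0) id (Rep_chevalley_index k)"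

lemma weight_simps [simp]:
  "\<alpha> \<in> G2_simple_roots ==> weight (cartan_index \<alpha>) = 0" "\<alpha> \<in> G2_roots ==> weight (root_index \<alpha>) = \<alpha>"
  by (simp_all add: weight_def Rep_cartan_index Rep_root_index)

lemma diagonal_action:
  fixes G :: "('r::comm_ring_1, 'n::finite) table"
  assumes "\<And>k. G i k = c k *s axis k 1"
  shows "sc_mult G (axis i 1) v = (\<chi> k. c k * v $ k)"
proof -
  have "sc_mult G (axis i 1) (\<Sum>k\<in>UNIV. (v $ k) *s axis k 1) = (\<Sum>k\<in>UNIV. (v $ k) *s (c k *s axis k 1))"
    by (simp only: sc_mult_sum sc_mult_scale sc_mult_axis assms)
  also have "\<dots> = (\<chi> k. c k * v $ k)"
    by (simp add: vec_eq_iff axis_def if_distrib[of "\<lambda>t. _ * t"] mult.commute cong: if_cong)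
  finally show ?thesis by (simp only: basis_expansion_ring)
qed

lemma cartan_action_weight:
  assumes "chevalley_relations G" "\<alpha> \<in> G2_simple_roots"
  shows "G (cartan_index \<alpha>) k = of_int (G2_cartan (weight k) \<alpha>) *s axis k 1"
proof (cases k rule: chevalley_index_cases)
  case (1 \<beta>)
  have "G (cartan_index \<alpha>) (cartan_index \<beta>) = 0" using assms 1(1) unfolding chevalley_relations_def by blast
  moreover have "G2_cartan 0 \<alpha> = 0" by (cases \<alpha>) (simp add: G2_cartan_def zero_prod_def)
  ultimately show ?thesis using 1 by simp
next
  case (2 \<beta>)
  have "G (cartan_index \<alpha>) (root_index \<beta>) = of_int (G2_cartan \<beta> \<alpha>) *s root_vec \<beta>"
    using assms 2(1) unfolding chevalley_relations_def by blast
  then show ?thesis using 2 by simp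
qed

lemma chevalley_product_cases:
  assumes G: "chevalley_relations G"
  obtains (multiple) n k where "G i j = of_int n *s axis k 1" "n = 0 \<or> weight k = weight i + weight j"
    | (coroot) \<alpha> where "G i j = coroot_vec \<alpha>" "weight i + weight j = 0"
proof -
  have lie: "lie_sc G" using G unfolding chevalley_relations_def by blast
  have anti: "G i j = - G j i" using lie_sc_antisym[OF lie, of "axis i 1" "axis j 1"] by simp
  show ?thesis
  proof (cases i rule: chevalley_index_cases)
    case (1 \<alpha>)
    then show ?thesis using cartan_action_weight[OF G 1(1), of j] by (intro multiple) auto
  next
    case i: (2 \<alpha>)
    show ?thesis
    proof (cases j rule: chevalley_index_cases)
      case (1 \<beta>)
      have "G i j = - G (cartan_index \<beta>) i" using anti 1(2) by simp
      also have "\<dots> = of_int (- G2_cartan (weight i) \<beta>) *s axis i 1"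
        unfolding cartan_action_weight[OF G 1(1)] by (simp add: vec_eq_iff)
      finally show ?thesis by (rule multiple) (simp add: 1)
    next
      case j: (2 \<beta>)
      consider "\<alpha> + \<beta> \<in> G2_roots" | "\<alpha> + \<beta> = 0" | "\<alpha> + \<beta> \<noteq> 0" "\<alpha> + \<beta> \<notin> G2_roots" by blast
      then show ?thesis
      proof cases
        case 1
        then obtain s where "G i j = of_int (s * int (G2_string \<alpha> \<beta> + 1)) *s root_vec (\<alpha> + \<beta>)"
          using G i j unfolding chevalley_relations_def by blast
        then show ?thesis by (rule multiple) (use i j 1 in simp)
      next
        case 2
        then have "\<beta> = - \<alpha>" by (simp add: eq_neg_iff_add_eq_0 add.commute)
        then have "G i j = coroot_vec \<alpha>"
          using G i j unfolding chevalley_relations_def by blast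
        then show ?thesis using i j 2 by (intro coroot) auto
      next
        case 3
        then have "G i j = 0" using G i j unfolding chevalley_relations_def by blast
        then show ?thesis using multiple[of 0] by simp
      qed
    qed
  qed
qed

lemma cartan_action:
  assumes "chevalley_relations G" "\<alpha> \<in> G2_simple_roots"
  shows "sc_mult G (cartan_vec \<alpha>) v = (\<chi> k. of_int (G2_cartan (weight k) \<alpha>) * v $ k)"
  by (rule diagonal_action, rule cartan_action_weight[OF assms])

lemma weight_separating:
  assumes "\<beta> \<in> G2_roots"
  shows "G2_cartan \<beta> (1, 0) \<noteq> 0 \<or> G2_cartan \<beta> (0, 1) \<noteq> 0"
proof -
  have "\<forall>\<beta>\<in>G2_roots. G2_cartan \<beta> (1, 0) \<noteq> 0 \<or> G2_cartan \<beta> (0, 1) \<noteq> 0" by code_simp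
  then show ?thesis using assms by blast
qed

lemma bij_Rep_chevalley_index: "bij_betw Rep_chevalley_index UNIV G2_chevalley_indices"
  unfolding bij_betw_def inj_on_def
  using type_definition.Rep_range[OF type_definition_chevalley_index] by (simp add: Rep_chevalley_index_inject)

lemma lie_sc_iso:
  fixes L (structure)
  assumes hom: "algebra_hom (coord_algebra G) L g" and bij: "bij_betw g UNIV (carrier L)" and L: "lie_algebra L"
  shows "lie_sc G"
proof -
  note hD = algebra_homD(2-4)[OF hom, simplified]
  have A: "nonassoc_algebra L" using L by (simp add: lie_algebra_def)
  interpret A: abelian_group L by (rule nonassoc_algebraD(2)[OF A])
  have mem: "g v \<in> carrier L" for v using algebra_homD(1)[OF hom] by simp
  have "g 0 \<oplus> g 0 = g 0" using hD(1)[of 0 0] by simp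
  then have g0: "g 0 = \<zero>" using mem A.add.r_cancel_one by blast
  have inj: "v = 0" if "g v = \<zero>" for v
    using bij that g0 unfolding bij_betw_def by (metis injD)
  have "sc_mult G v v = 0" for v
    using L mem by (intro inj) (simp add: hD lie_algebra_def)
  moreover have "sc_mult G u (sc_mult G v w) + sc_mult G v (sc_mult G w u) + sc_mult G w (sc_mult G u v) = 0" for u v w
    using L mem by (intro inj) (simp add: hD lie_algebra_def)
  ultimately show ?thesis by (simp add: lie_sc_def)
qed

lemma G2_simple_roots_subset: "\<alpha> \<in> G2_simple_roots ==> \<alpha> \<in> G2_roots"
  by (auto simp: G2_simple_roots_def G2_roots_explicit)

text \<open>
  The one relation that a Chevalley basis does not give directly is the expansion of
  \<open>[x \<alpha>, x (- \<alpha>)]\<close>. It commutes with the Cartan elements, hence has no root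
  components, and its action on the two simple root vectors determines the two coefficients.
\<close>

lemma chevalley_basis_coordinates:
  fixes L (structure)
  assumes basis: "G2_chevalley_basis L h e"
  obtains G g where "chevalley_relations (G :: (complex, chevalley_index) table)"
    "algebra_hom (coord_algebra G) L g" "bij_betw g UNIV (carrier L)"
    "\<And>c. g c = (\<Oplus>k\<in>UNIV. (c $ k) \<odot> case_sum h e (Rep_chevalley_index k))"
proof -
  have L: "lie_algebra L" and A: "nonassoc_algebra L"
    and b: "algebra_basis L G2_chevalley_indices (case_sum h e)"
    and hh: "\<And>\<alpha> \<beta>. \<alpha> \<in> G2_roots ==> \<beta> \<in> G2_roots ==> h \<alpha> \<otimes> h \<beta> = \<zero>"
    and he: "\<And>\<alpha> \<beta>. \<alpha> \<in> G2_roots ==> \<beta> \<in> G2_roots ==> h \<alpha> \<otimes> e \<beta> = of_int (G2_cartan \<beta> \<alpha>) \<odot> e \<beta>"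
    and ee: "\<And>\<alpha>. \<alpha> \<in> G2_roots ==> e \<alpha> \<otimes> e (- \<alpha>) = h \<alpha>"
    and es: "\<And>\<alpha> \<beta>. \<alpha> \<in> G2_roots ==> \<beta> \<in> G2_roots ==> \<alpha> + \<beta> \<in> G2_roots ==>
        (\<exists>s\<in>{1, - 1}. e \<alpha> \<otimes> e \<beta> = (s * of_nat (G2_string \<alpha> \<beta> + 1)) \<odot> e (\<alpha> + \<beta>))"
    and e0: "\<And>\<alpha> \<beta>. \<alpha> \<in> G2_roots ==> \<beta> \<in> G2_roots ==> \<alpha> + \<beta> \<noteq> 0 ==> \<alpha> + \<beta> \<notin> G2_roots ==> e \<alpha> \<otimes> e \<beta> = \<zero>"
    using basis unfolding G2_chevalley_basis_def lie_algebra_def by blast+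
  obtain G and g :: "complex^chevalley_index => _" where hom: "algebra_hom (coord_algebra G) L g" and bij: "bij_betw g UNIV (carrier L)"
    and gb: "\<And>k. g (axis k 1) = case_sum h e (Rep_chevalley_index k)"
    and gs: "\<And>c. g c = (\<Oplus>k\<in>UNIV. (c $ k) \<odot> case_sum h e (Rep_chevalley_index k))"
    using algebra_basis_coord[OF A b bij_Rep_chevalley_index] by blast
  note hD = algebra_homD(2-4)[OF hom, simplified]
  interpret A: abelian_group L by (rule nonassoc_algebraD(2)[OF A])
  have mem: "g v \<in> carrier L" for v using algebra_homD(1)[OF hom] by simp
  have "g 0 \<oplus> g 0 = g 0" using hD(1)[of 0 0] by simp
  then have g0: "g 0 = \<zero>" using mem A.add.r_cancel_one by blast
  have inj: "v = w" if "g v = g w" for v w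
    using bij that unfolding bij_betw_def by (metis injD)
  have gX: "g (root_vec \<alpha>) = e \<alpha>" if "\<alpha> \<in> G2_roots" for \<alpha>
    using that by (simp add: gb Rep_root_index)
  have gH: "g (cartan_vec \<alpha>) = h \<alpha>" if "\<alpha> \<in> G2_simple_roots" for \<alpha>
    using that by (simp add: gb Rep_cartan_index)
  have gG: "g (G i j) = g (axis i 1) \<otimes> g (axis j 1)" for i j
    using hD(3)[of "axis i 1" "axis j 1"] by simp
  have G1: "G (cartan_index \<alpha>) (cartan_index \<beta>) = 0" if "\<alpha> \<in> G2_simple_roots" "\<beta> \<in> G2_simple_roots" for \<alpha> \<beta>
    using that by (intro inj) (simp add: gG gH g0 hh G2_simple_roots_subset)
  have G2: "G (cartan_index \<alpha>) (root_index \<beta>) = of_int (G2_cartan \<beta> \<alpha>) *s root_vec \<beta>"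
    if "\<alpha> \<in> G2_simple_roots" "\<beta> \<in> G2_roots" for \<alpha> \<beta>
    using that by (intro inj) (simp add: gG gH gX hD he G2_simple_roots_subset)
  have G12: "G (cartan_index \<alpha>) k = of_int (G2_cartan (weight k) \<alpha>) *s axis k 1" if \<alpha>: "\<alpha> \<in> G2_simple_roots" for \<alpha> k
  proof (cases k rule: chevalley_index_cases)
    case (1 \<beta>)
    moreover have "G2_cartan 0 \<alpha> = 0" by (cases \<alpha>) (simp add: G2_cartan_def zero_prod_def)
    ultimately show ?thesis using G1 \<alpha> by simp
  qed (use G2 \<alpha> in simp)
  have G3: "G (root_index \<alpha>) (root_index (- \<alpha>)) =
        coroot_vec \<alpha>"
    if \<alpha>: "\<alpha> \<in> G2_roots" for \<alpha>
  proof -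
    define v where "v = G (root_index \<alpha>) (root_index (- \<alpha>))"
    have gv: "g v = h \<alpha>" using \<alpha> G2_root_basics(2)[OF \<alpha>] by (simp add: v_def gG gX ee)
    have "sc_mult G (cartan_vec \<gamma>) v = 0" if "\<gamma> \<in> G2_simple_roots" for \<gamma>
      using that \<alpha> by (intro inj) (simp add: hD gv gH g0 hh G2_simple_roots_subset)
    moreover have "sc_mult G (cartan_vec \<gamma>) v = (\<chi> k. of_int (G2_cartan (weight k) \<gamma>) * v $ k)"
      if "\<gamma> \<in> G2_simple_roots" for \<gamma>
      by (rule diagonal_action, rule G12[OF that])
    ultimately have "of_int (G2_cartan (weight k) \<gamma>) * v $ k = 0" if "\<gamma> \<in> G2_simple_roots" for \<gamma> k
      using that by (simp add: vec_eq_iff)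
    from this[of "(1, 0)"] this[of "(0, 1)"] have vroot: "v $ root_index \<beta> = 0" if "\<beta> \<in> G2_roots" for \<beta>
      using weight_separating[OF that] that by (metis mult_eq_0_iff of_int_eq_0_iff simple_mem weight_simps(2))
    let ?a = "v $ cartan_index (1, 0)" and ?b = "v $ cartan_index (0, 1)"
    have veq: "v = ?a *s cartan_vec (1, 0) + ?b *s cartan_vec (0, 1)"
    proof -
      have "v = (\<Sum>k\<in>UNIV. (v $ k) *s axis k 1)" by (simp only: basis_expansion_ring)
      also have "\<dots> = ?a *s cartan_vec (1, 0) + ?b *s cartan_vec (0, 1)"
        unfolding sum_chevalley_index by (simp add: vroot)
      finally show ?thesis .
    qed
    \<comment> \<open>the eigenvalue of \<open>v\<close> on the root vector of \<open>\<beta>\<close>, computed in two ways\<close>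
    have act: "of_int (G2_cartan \<beta> \<alpha>) = of_int (G2_cartan \<beta> (1, 0)) * ?a + of_int (G2_cartan \<beta> (0, 1)) * ?b" if \<beta>: "\<beta> \<in> G2_roots" for \<beta>
    proof -
      have "sc_mult G v (root_vec \<beta>) = of_int (G2_cartan \<beta> \<alpha>) *s root_vec \<beta>"
        using \<alpha> \<beta> by (intro inj) (simp add: hD gv gX he)
      moreover have "sc_mult G v (root_vec \<beta>) =
          (of_int (G2_cartan \<beta> (1, 0)) * ?a + of_int (G2_cartan \<beta> (0, 1)) * ?b) *s root_vec \<beta>"
        by (subst veq) (simp add: sc_mult_add sc_mult_scale G2[OF _ \<beta>] vector_scale_scale vector_sadd_rdistrib mult.commute)
      ultimately have "(of_int (G2_cartan \<beta> \<alpha>) *s axis (root_index \<beta>) (1::complex)) $ root_index \<beta> =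
          ((of_int (G2_cartan \<beta> (1, 0)) * ?a + of_int (G2_cartan \<beta> (0, 1)) * ?b) *s root_vec \<beta>) $ root_index \<beta>" by metis
      then show ?thesis by simp
    qed
    have c: "G2_cartan (1, 0) (1, 0) = 2" "G2_cartan (1, 0) (0, 1) = - 1" "G2_cartan (0, 1) (1, 0) = - 3" "G2_cartan (0, 1) (0, 1) = 2"
      by (simp_all add: G2_cartan_def)
    have pq: "of_int (G2_cartan (1, 0) \<alpha>) = 2 * ?a - ?b" "of_int (G2_cartan (0, 1) \<alpha>) = - 3 * ?a + 2 * ?b"
      using act[of "(1, 0)"] act[of "(0, 1)"] by (simp_all add: c G2_simple_roots_subset)
    have "?a = of_int (fst (coroot_coeff \<alpha>))" "?b = of_int (snd (coroot_coeff \<alpha>))"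
      unfolding coroot_coeff_def fst_conv snd_conv of_int_add of_int_mult pq by (simp_all add: algebra_simps)
    then show ?thesis using veq by (simp add: v_def)
  qed
  have G4: "\<exists>s\<in>{1, - 1}. G (root_index \<alpha>) (root_index \<beta>) = of_int (s * int (G2_string \<alpha> \<beta> + 1)) *s root_vec (\<alpha> + \<beta>)"
    if "\<alpha> \<in> G2_roots" "\<beta> \<in> G2_roots" "\<alpha> + \<beta> \<in> G2_roots" for \<alpha> \<beta>
  proof -
    have hit: "G (root_index \<alpha>) (root_index \<beta>) = (s * of_nat (G2_string \<alpha> \<beta> + 1)) *s root_vec (\<alpha> + \<beta>)"
      if "e \<alpha> \<otimes> e \<beta> = (s * of_nat (G2_string \<alpha> \<beta> + 1)) \<odot> e (\<alpha> + \<beta>)" for s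
      using that \<open>\<alpha> \<in> G2_roots\<close> \<open>\<beta> \<in> G2_roots\<close> \<open>\<alpha> + \<beta> \<in> G2_roots\<close> by (intro inj) (simp only: gG gX hD)
    obtain s where "s \<in> {1, - 1}" "e \<alpha> \<otimes> e \<beta> = (s * of_nat (G2_string \<alpha> \<beta> + 1)) \<odot> e (\<alpha> + \<beta>)"
      using es \<open>\<alpha> \<in> G2_roots\<close> \<open>\<beta> \<in> G2_roots\<close> \<open>\<alpha> + \<beta> \<in> G2_roots\<close> by blast
    then have "s = 1 \<or> s = - 1" "G (root_index \<alpha>) (root_index \<beta>) = (s * of_nat (G2_string \<alpha> \<beta> + 1)) *s root_vec (\<alpha> + \<beta>)"
      using hit by auto
    then show ?thesis by (elim disjE) simp_all
  qed
  have G5: "G (root_index \<alpha>) (root_index \<beta>) = 0"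
    if "\<alpha> \<in> G2_roots" "\<beta> \<in> G2_roots" "\<alpha> + \<beta> \<noteq> 0" "\<alpha> + \<beta> \<notin> G2_roots" for \<alpha> \<beta>
    using that by (intro inj) (simp add: gG gX g0 e0)
  have "chevalley_relations G"
    unfolding chevalley_relations_def using lie_sc_iso[OF hom bij L] G1 G2 G3 G4 G5 by blast
  then show ?thesis using that hom bij gs by blast
qed

text \<open>
  All structure constants are integers, and the relations hold over the integers because these embed into the
  complex numbers.
\<close>

lemma chevalley_relations_integral:
  assumes G: "chevalley_relations (G :: (complex, chevalley_index) table)"
  obtains \<Gamma> where "chevalley_relations (\<Gamma> :: (int, chevalley_index) table)" "G = base_change of_int \<Gamma>"
proof -
  interpret \<phi>: scalar_map "of_int :: int => complex" by (rule scalar_map_of_int)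
  let ?m = "map_vec (of_int :: int => complex) :: int^chevalley_index => _"
  define integral where "integral v \<longleftrightarrow> (\<exists>z. v = ?m z)" for v
  have intI: "integral 0" "integral (of_int n *s axis k 1)" "integral v ==> integral w ==> integral (v + w)"
    "integral v ==> integral (- v)" for n k v w
    unfolding integral_def
    by (metis \<phi>.map_vec_0, metis \<phi>.map_vec_scale \<phi>.map_vec_axis, metis \<phi>.map_vec_add, metis \<phi>.map_vec_minus)
  have lie: "lie_sc G" using G unfolding chevalley_relations_def by blast
  have "integral (G i j)" for i j
    by (cases rule: chevalley_product_cases[OF G, of i j]) (simp_all only: intI)
  then obtain \<Gamma> where \<Gamma>: "\<And>i j. G i j = ?m (\<Gamma> i j)" unfolding integral_def by metis
  then have GG: "G = base_change of_int \<Gamma>" by (simp add: base_change_def fun_eq_iff)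
  have inj: "v = w" if "?m v = ?m w" for v w using that by (simp add: vec_eq_iff)
  note simps = \<phi>.map_vec_scale \<phi>.map_vec_add
  have lie\<Gamma>: "lie_sc \<Gamma>"
  proof -
    have "?m (sc_mult \<Gamma> v v) = 0" for v using lie by (simp add: \<phi>.map_vec_sc_mult lie_sc_def GG)
    moreover have "?m (sc_mult \<Gamma> u (sc_mult \<Gamma> v w) + sc_mult \<Gamma> v (sc_mult \<Gamma> w u) + sc_mult \<Gamma> w (sc_mult \<Gamma> u v)) = 0" for u v w
      using lie unfolding \<phi>.map_vec_sc_mult \<phi>.map_vec_add lie_sc_def GG by blast
    ultimately show ?thesis unfolding lie_sc_def by (metis inj \<phi>.map_vec_0)
  qed
  have "chevalley_relations \<Gamma>"
    unfolding chevalley_relations_def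
  proof (intro conjI ballI impI)
    fix \<alpha> \<beta> assume ab: "\<alpha> \<in> G2_roots" "\<beta> \<in> G2_roots" "\<alpha> + \<beta> \<in> G2_roots"
    obtain s where s: "s \<in> {1, - 1}" "G (root_index \<alpha>) (root_index \<beta>) = of_int (s * int (G2_string \<alpha> \<beta> + 1)) *s root_vec (\<alpha> + \<beta>)"
      using G ab unfolding chevalley_relations_def by blast
    show "\<exists>s\<in>{1, - 1}. \<Gamma> (root_index \<alpha>) (root_index \<beta>) = of_int (s * int (G2_string \<alpha> \<beta> + 1)) *s root_vec (\<alpha> + \<beta>)"
      by (rule bexI[OF inj s(1)]) (simp add: \<Gamma>[symmetric] simps s(2))
  qed (rule lie\<Gamma>, use G in \<open>auto intro!: inj simp: \<Gamma>[symmetric] chevalley_relations_def simps\<close>)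
  then show ?thesis using that GG by blast
qed

theorem chevalley_basis_integral:
  fixes L (structure)
  assumes basis: "G2_chevalley_basis L h e"
  shows "\<exists>\<Gamma>. chevalley_relations \<Gamma> \<and>
    algebra_iso (coord_algebra \<Gamma>) (integral_span L G2_chevalley_indices (case_sum h e))"
proof -
  obtain G g where G: "chevalley_relations (G :: (complex, chevalley_index) table)"
    and hom: "algebra_hom (coord_algebra G) L g" and bij: "bij_betw g UNIV (carrier L)"
    and gs: "\<And>c. g c = (\<Oplus>k\<in>UNIV. (c $ k) \<odot> case_sum h e (Rep_chevalley_index k))"
    using chevalley_basis_coordinates[OF basis] by blast
  obtain \<Gamma> where \<Gamma>: "chevalley_relations (\<Gamma> :: (int, chevalley_index) table)" "G = base_change of_int \<Gamma>"
    by (rule chevalley_relations_integral[OF G])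
  interpret \<phi>: scalar_map "of_int :: int => complex" by (rule scalar_map_of_int)
  let ?S = "integral_span L G2_chevalley_indices (case_sum h e)" and ?m = "map_vec (of_int :: int => complex)"
  have A: "nonassoc_algebra L" and b: "algebra_basis L G2_chevalley_indices (case_sum h e)"
    using basis unfolding G2_chevalley_basis_def lie_algebra_def by blast+
  interpret A: abelian_group L by (rule nonassoc_algebraD(2)[OF A])
  have bc: "case_sum h e i \<in> carrier L" if "i \<in> G2_chevalley_indices" for i
    using b that unfolding algebra_basis_def by blast
  have span: "(\<Oplus>i\<in>G2_chevalley_indices. of_int (c i) \<odot> case_sum h e i) = g (?m (\<chi> k. c (Rep_chevalley_index k)))" for c
  proof -
    have R: "Rep_chevalley_index ` UNIV = G2_chevalley_indices" "inj_on Rep_chevalley_index UNIV"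
      using bij_Rep_chevalley_index by (simp_all add: bij_betw_def)
    have "(\<Oplus>i\<in>Rep_chevalley_index ` UNIV. of_int (c i) \<odot> case_sum h e i) =
        (\<Oplus>k\<in>UNIV. of_int (c (Rep_chevalley_index k)) \<odot> case_sum h e (Rep_chevalley_index k))"
      using bc R by (intro A.finsum_reindex) (auto intro!: nonassoc_algebraD(3)[OF A])
    then show ?thesis unfolding gs R(1) by simp
  qed
  have car: "carrier ?S = (\<lambda>z. g (?m z)) ` UNIV"
  proof (intro subset_antisym subsetI)
    fix y assume "y \<in> carrier ?S"
    then obtain c where "y = (\<Oplus>i\<in>G2_chevalley_indices. of_int (c i) \<odot> case_sum h e i)"
      by (auto simp: integral_span_def)
    then show "y \<in> (\<lambda>z. g (?m z)) ` UNIV" unfolding span by blast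
  next
    fix y assume "y \<in> (\<lambda>z. g (?m z)) ` UNIV"
    then obtain z where z: "y = g (?m z)" by blast
    have "(\<chi> k. z $ Abs_chevalley_index (Rep_chevalley_index k)) = z" by (simp add: Rep_chevalley_index_inverse)
    then have "y = (\<Oplus>i\<in>G2_chevalley_indices. of_int (z $ Abs_chevalley_index i) \<odot> case_sum h e i)"
      unfolding span z by simp
    then show "y \<in> carrier ?S" unfolding integral_span_def
      by (simp only: partial_object.simps mem_Collect_eq simp_thms) (rule exI[of _ "\<lambda>i. z $ Abs_chevalley_index i"], rule refl)
  qed
  have "inj (\<lambda>z. g (?m z))"
  proof (rule injI)
    fix z w assume "g (?m z) = g (?m w)"
    then have "?m z = ?m w" using bij unfolding bij_betw_def by (metis injD)
    then show "z = w" by (simp add: vec_eq_iff)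
  qed
  then have "bij_betw (\<lambda>z. g (?m z)) UNIV (carrier ?S)" unfolding car bij_betw_def by blast
  moreover have "algebra_hom (coord_algebra \<Gamma>) ?S (\<lambda>z. g (?m z))"
  proof (rule algebra_homI)
    show "g (?m z) \<in> carrier ?S" for z unfolding car by blast
  qed (use algebra_homD(2-4)[OF hom] in \<open>simp_all add: integral_span_def \<phi>.map_vec_add \<phi>.map_vec_scale \<phi>.map_vec_sc_mult \<Gamma>(2)\<close>)
  ultimately have "algebra_iso (coord_algebra \<Gamma>) ?S" by (intro algebra_isoI) simp_all
  then show ?thesis using \<Gamma>(1) by blast
qed

theorem chevalley_algebra_coordinates:
  fixes L :: "(complex, 'v) module"
  assumes basis: "G2_chevalley_basis L h e"
  obtains \<Gamma> :: "(int, chevalley_index) table" where "chevalley_relations \<Gamma>"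
    "algebra_iso (coord_algebra (base_change of_int \<Gamma>)) (G2_chevalley_algebra L h e :: ('a::field, ('v => 'a) set) module)"
  using chevalley_basis_integral[OF basis] scalar_extension_coord[OF scalar_map_of_int]
  unfolding G2_chevalley_algebra_def by blast

section \<open>Algebras acting on an ideal\<close>

text \<open>
  \<open>b\<close> is a basis, with table \<open>J\<close>, of an ideal of a Lie algebra on which the algebra
  acts faithfully. This is what remains of the pair of the Chevalley algebra and its short ideal after twisting.
\<close>

definition ideal_embedding ::
  "('a::field, 'n::finite) table => ('a, 'm::finite) table => ('m => 'a^'n) => bool" where
  "ideal_embedding G J b \<longleftrightarrow> lie_sc G \<and> inj (lincomb b) \<and>
     (\<forall>x y. lincomb b (sc_mult J x y) = sc_mult G (lincomb b x) (lincomb b y)) \<and>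
     (\<forall>g x. sc_mult G g (lincomb b x) \<in> range (lincomb b)) \<and>
     (\<forall>g. (\<forall>x. sc_mult G g (lincomb b x) = 0) --> g = 0)"

lemma ideal_embedding_action:
  assumes "ideal_embedding G J b"
  obtains \<rho> where "\<And>g. \<rho> g \<in> carrier (Der J)" "\<And>g x. lincomb b (\<rho> g x) = sc_mult G g (lincomb b x)"
    "\<And>g h. \<rho> (g + h) = (\<lambda>x. \<rho> g x + \<rho> h x)" "\<And>c g. \<rho> (c *s g) = (\<lambda>x. c *s \<rho> g x)"
    "\<And>g h. \<rho> (sc_mult G g h) = (\<lambda>x. \<rho> g (\<rho> h x) - \<rho> h (\<rho> g x))" "\<And>g. \<rho> g = (\<lambda>x. 0) ==> g = 0"
proof -
  have lie: "lie_sc G" and inj: "inj (lincomb b)"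
    and hom: "\<And>x y. lincomb b (sc_mult J x y) = sc_mult G (lincomb b x) (lincomb b y)"
    and ideal: "\<And>g x. sc_mult G g (lincomb b x) \<in> range (lincomb b)"
    and faithful: "\<And>g. (\<And>x. sc_mult G g (lincomb b x) = 0) ==> g = 0"
    using assms unfolding ideal_embedding_def by blast+
  have "\<exists>y. lincomb b y = sc_mult G g (lincomb b x)" for g x using ideal[of g x] by (metis imageE)
  then obtain \<rho> where \<rho>: "\<And>g x. lincomb b (\<rho> g x) = sc_mult G g (lincomb b x)" by metis
  have eq: "x = y" if "lincomb b x = lincomb b y" for x y using inj that by (rule injD)
  have diff: "lincomb b (x - y) = lincomb b x - lincomb b y" for x y
    using lincomb_add[of b "x - y" y] by (simp add: algebra_simps)
  note lin = \<rho> hom lincomb_add lincomb_scale sc_mult_add sc_mult_scale diff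
  show ?thesis
  proof (rule that[of \<rho>])
    show "\<rho> g \<in> carrier (Der J)" for g
      unfolding Der_iff
    proof (intro conjI allI)
      show "\<rho> g (sc_mult J x y) = sc_mult J (\<rho> g x) y + sc_mult J x (\<rho> g y)" for x y
        by (rule eq) (simp add: lin lie_sc_derivation[OF lie, of g "lincomb b x"])
    qed (auto intro!: eq simp: lin)
    show "\<rho> (sc_mult G g h) = (\<lambda>x. \<rho> g (\<rho> h x) - \<rho> h (\<rho> g x))" for g h
      using lie_sc_derivation[OF lie, of g h] by (auto intro!: ext eq simp: lin)
    show "g = 0" if "\<rho> g = (\<lambda>x. 0)" for g
      by (rule faithful) (use that \<rho>[of g] in simp)
  qed (auto intro!: ext eq simp: lin)
qed

theorem ideal_embedding_iso_Der_split:
  fixes G :: "('a::field, 'n::finite) table"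
  assumes char: "CHAR('a) = 3" and emb: "ideal_embedding G split_sc b" and card: "CARD('n) = 14"
  shows "algebra_iso (coord_algebra G) (Der (split_sc :: ('a, split_index) table))"
proof -
  obtain \<rho> where \<rho>1: "\<And>g. \<rho> g \<in> carrier (Der (split_sc :: ('a, split_index) table))"
    and "\<And>g x. lincomb b (\<rho> g x) = sc_mult G g (lincomb b x)" and \<rho>:
    "\<And>g h. \<rho> (g + h) = (\<lambda>x. \<rho> g x + \<rho> h x)" "\<And>c g. \<rho> (c *s g) = (\<lambda>x. c *s \<rho> g x)"
    "\<And>g h. \<rho> (sc_mult G g h) = (\<lambda>x. \<rho> g (\<rho> h x) - \<rho> h (\<rho> g x))" "\<And>g. \<rho> g = (\<lambda>x. 0) ==> g = 0"
    using ideal_embedding_action[OF emb] by blast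
  have "range \<rho> = carrier (Der split_sc)" by (rule Der_split_surj[OF char \<rho>1 \<rho>(1,2,4) card])
  moreover have "inj \<rho>"
  proof (rule injI)
    fix g h assume "\<rho> g = \<rho> h"
    then have "\<rho> (g + (- 1) *s h) = (\<lambda>x. 0)" unfolding \<rho>(1,2) by simp
    then have "g + (- 1) *s h = 0" by (rule \<rho>(4))
    then show "g = h" by simp
  qed
  ultimately have "bij_betw \<rho> (carrier (coord_algebra G)) (carrier (Der split_sc))" by (simp add: bij_betw_def)
  moreover have "algebra_hom (coord_algebra G) (Der split_sc) \<rho>"
    by (rule algebra_homI) (simp_all add: \<rho>1 \<rho>(1-3) Der_ops)
  ultimately show ?thesis by (rule algebra_isoI[rotated])
qed

text \<open>
  The action on the ideal is a faithful map into \<open>Der J\<close>; it is onto as soon as the dimensions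
  agree. Over the ground field this dimension comes from \<open>Der_descent\<close>.
\<close>

theorem ideal_embedding_iso_Der:
  fixes G :: "('a::field, 'n::finite) table" and D :: "('a, 'p::finite) table"
  assumes emb: "ideal_embedding G J b" and D: "algebra_iso (coord_algebra D) (Der J)" and card: "CARD('n) = CARD('p)"
  shows "algebra_iso (coord_algebra G) (Der J)"
proof -
  obtain \<rho> where \<rho>1: "\<And>g. \<rho> g \<in> carrier (Der J)"
    and "\<And>g x. lincomb b (\<rho> g x) = sc_mult G g (lincomb b x)" and \<rho>:
    "\<And>g h. \<rho> (g + h) = (\<lambda>x. \<rho> g x + \<rho> h x)" "\<And>c g. \<rho> (c *s g) = (\<lambda>x. c *s \<rho> g x)"
    "\<And>g h. \<rho> (sc_mult G g h) = (\<lambda>x. \<rho> g (\<rho> h x) - \<rho> h (\<rho> g x))" "\<And>g. \<rho> g = (\<lambda>x. 0) ==> g = 0"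
    using ideal_embedding_action[OF emb] by blast
  have "algebra_iso (Der J) (coord_algebra D)" by (rule algebra_iso_sym[OF closed_coord_algebra D])
  then obtain k where k: "algebra_hom (Der J) (coord_algebra D) k" "bij_betw k (carrier (Der J)) UNIV"
    by (auto elim: algebra_isoE)
  have kinj: "inj_on k (carrier (Der J))" using k(2) by (simp add: bij_betw_def)
  have kl: "k (\<rho> (g + h)) = k (\<rho> g) + k (\<rho> h)" "k (\<rho> (c *s g)) = c *s k (\<rho> g)" for g h c
    using algebra_homD(2,3)[OF k(1)] \<rho>1 by (simp_all add: Der_ops \<rho>(1,2))
  have inj: "inj \<rho>"
  proof (rule injI)
    fix g h assume "\<rho> g = \<rho> h"
    then have "\<rho> (g + (- 1) *s h) = (\<lambda>x. 0)" unfolding \<rho>(1,2) by simp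
    then have "g + (- 1) *s h = 0" by (rule \<rho>(4))
    then show "g = h" by simp
  qed
  have "inj (\<lambda>g. k (\<rho> g))"
  proof (rule injI)
    fix g h assume "k (\<rho> g) = k (\<rho> h)"
    then have "\<rho> g = \<rho> h" using kinj \<rho>1 by (simp add: inj_on_def)
    then show "g = h" using inj by (simp add: inj_def)
  qed
  then have surj: "surj (\<lambda>g. k (\<rho> g))" by (rule linear_inj_imp_surj_card[OF kl]) (rule card)
  have "d \<in> range \<rho>" if d: "d \<in> carrier (Der J)" for d
  proof -
    obtain g where "k d = k (\<rho> g)" using surj by (metis surjD)
    then have "d = \<rho> g" using kinj \<rho>1 d by (simp add: inj_on_def)
    then show ?thesis by blast
  qed
  then have "bij_betw \<rho> (carrier (coord_algebra G)) (carrier (Der J))"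
    using inj \<rho>1 by (auto simp: bij_betw_def)
  moreover have "algebra_hom (coord_algebra G) (Der J) \<rho>"
    by (rule algebra_homI) (simp_all add: \<rho>1 \<rho>(1-3) Der_ops)
  ultimately show ?thesis by (rule algebra_isoI[rotated])
qed

section \<open>The Killing form\<close>

definition killing :: "('r::field, 'n::finite) table => 'r^'n => 'r^'n => 'r" where
  "killing G x y = (\<Sum>j\<in>UNIV. sc_mult G x (sc_mult G y (axis j 1)) $ j)"

lemma killing_linear:
  "killing G (x + y) z = killing G x z + killing G y z" "killing G z (x + y) = killing G z x + killing G z y"
  "killing G (c *s x) z = c * killing G x z" "killing G z (c *s x) = c * killing G z x"
  "killing G (- x) z = - killing G x z" "killing G z (- x) = - killing G z x"
  "killing G 0 z = 0" "killing G z 0 = 0"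
  by (simp_all add: killing_def sc_mult_add sc_mult_scale sc_mult_minus sum.distrib sum_distrib_left sum_negf)

lemma (in field_map) map_killing: "\<phi> (killing G x y) = killing (base_change \<phi> G) (map_vec \<phi> x) (map_vec \<phi> y)"
proof -
  have "\<phi> (sc_mult G x (sc_mult G y (axis j 1)) $ j) =
      sc_mult (base_change \<phi> G) (map_vec \<phi> x) (sc_mult (base_change \<phi> G) (map_vec \<phi> y) (axis j 1)) $ j" for j
    by (simp only: map_vec_nth[of \<phi>, symmetric] map_vec_sc_mult map_vec_axis)
  then show ?thesis by (simp add: killing_def sum)
qed

lemma trace_comp_commute:
  fixes f g :: "'r::field^'n::finite => 'r^'n"
  assumes f: "\<And>x y. f (x + y) = f x + f y" "\<And>c x. f (c *s x) = c *s f x"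
    and g: "\<And>x y. g (x + y) = g x + g y" "\<And>c x. g (c *s x) = c *s g x"
  shows "(\<Sum>j\<in>UNIV. f (g (axis j 1)) $ j) = (\<Sum>j\<in>UNIV. g (f (axis j 1)) $ j)"
proof -
  have expand: "h x $ j = (\<Sum>k\<in>UNIV. x $ k * h (axis k 1) $ j)"
    if "\<And>x y. h (x + y) = h x + h y" "\<And>c x. h (c *s x) = c *s h x" for h :: "'r^'n => 'r^'n" and x j
  proof -
    have "h = lincomb (\<lambda>k. h (axis k 1))" by (rule linear_eq_lincomb) (rule that)+
    then have "h x = (\<Sum>k\<in>UNIV. (x $ k) *s h (axis k 1))" unfolding lincomb_def by metis
    then show ?thesis by simp
  qed
  have "(\<Sum>j\<in>UNIV. f (g (axis j 1)) $ j) = (\<Sum>j\<in>UNIV. \<Sum>k\<in>UNIV. g (axis j 1) $ k * f (axis k 1) $ j)"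
    by (subst expand[OF f]) (rule refl)
  also have "\<dots> = (\<Sum>k\<in>UNIV. \<Sum>j\<in>UNIV. f (axis k 1) $ j * g (axis j 1) $ k)"
    by (subst sum.swap) (simp add: mult.commute)
  also have "\<dots> = (\<Sum>j\<in>UNIV. g (f (axis j 1)) $ j)"
    by (subst (2) expand[OF g]) (rule refl)
  finally show ?thesis .
qed

lemma killing_commute: "killing G x y = killing G y x"
  unfolding killing_def by (rule trace_comp_commute) (simp_all add: sc_mult_add sc_mult_scale)

text \<open>\<open>ad [x, y]\<close> is a commutator and traces of products are cyclic.\<close>

lemma killing_invariant:
  assumes G: "lie_sc G"
  shows "killing G (sc_mult G x y) z = killing G x (sc_mult G y z)"
proof -
  have e: "sc_mult G (sc_mult G x y) v = sc_mult G x (sc_mult G y v) - sc_mult G y (sc_mult G x v)" for x y v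
    using lie_sc_derivation[OF G, of x y v] by (simp add: algebra_simps)
  have "(\<Sum>j\<in>UNIV. sc_mult G y (sc_mult G x (sc_mult G z (axis j 1))) $ j) =
      (\<Sum>j\<in>UNIV. sc_mult G x (sc_mult G z (sc_mult G y (axis j 1))) $ j)"
    using trace_comp_commute[of "sc_mult G y" "\<lambda>v. sc_mult G x (sc_mult G z v)"]
    by (simp add: sc_mult_add sc_mult_scale)
  then show ?thesis unfolding killing_def e by (simp add: sc_mult_diff sum_subtractf)
qed

text \<open>
  The Gram matrix of the Killing form as a family of vectors: its kernel is the radical, in the form that
  \<open>kernel_basis_descent\<close> needs.
\<close>

definition killing_map :: "('r::field, 'n::finite) table => 'n => 'r^'n" where
  "killing_map G i = (\<chi> j. killing G (axis i 1) (axis j 1))"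

lemma lincomb_killing_map: "lincomb (killing_map G) x = (\<chi> j. killing G x (axis j 1))"
proof -
  have "(\<lambda>x. \<chi> j. killing G x (axis j 1)) = lincomb (\<lambda>i. \<chi> j. killing G (axis i 1) (axis j 1))"
    by (rule linear_eq_lincomb) (simp_all add: killing_linear vec_eq_iff)
  then show ?thesis unfolding killing_map_def by metis
qed

lemma killing_map_kernel: "lincomb (killing_map G) x = 0 \<longleftrightarrow> (\<forall>y. killing G x y = 0)"
proof
  assume h: "lincomb (killing_map G) x = 0"
  have "killing G x (\<Sum>j\<in>S. (y $ j) *s axis j 1) = 0" for y S
    using h by (induct S rule: infinite_finite_induct) (simp_all add: killing_linear lincomb_killing_map vec_eq_iff)
  from this[of _ UNIV] show "\<forall>y. killing G x y = 0" by (simp only: basis_expansion_ring simp_thms)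
qed (simp add: lincomb_killing_map vec_eq_iff)

lemma (in field_map) map_killing_map: "map_vec \<phi> (killing_map G i) = killing_map (base_change \<phi> G) i"
  by (simp add: killing_map_def vec_eq_iff map_killing)

section \<open>The Chevalley algebra in characteristic 3\<close>

lemma chevalley_grading:
  assumes G: "chevalley_relations G" and nz: "G i j $ k \<noteq> 0"
  shows "weight k = weight i + weight j"
using G
proof (cases rule: chevalley_product_cases[where i = i and j = j])
  case (multiple n l)
  then show ?thesis using nz by (cases "k = l") (auto simp: axis_def)
next
  case (coroot \<alpha>)
  then have "k = cartan_index (1, 0) \<or> k = cartan_index (0, 1)" using nz by (auto simp: axis_def split: if_splits)
  then show ?thesis using coroot(2) by auto
qed

lemma weight_eq_root: "\<alpha> \<in> G2_roots ==> weight k = \<alpha> ==> k = root_index \<alpha>"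
  using G2_root_basics(1) by (cases k rule: chevalley_index_cases) auto

lemma weight_eq_0: "weight k = 0 ==> k = cartan_index (1, 0) \<or> k = cartan_index (0, 1)"
  using G2_root_basics(1) by (cases k rule: chevalley_index_cases) (auto simp: G2_simple_roots_def)

lemma sc_mult_nth: "sc_mult G x y $ k = (\<Sum>i\<in>UNIV. \<Sum>j\<in>UNIV. x $ i * y $ j * G i j $ k)"
  by (simp add: sc_mult_def)

lemma of_int_char3:
  assumes "CHAR('k::field) = 3"
  shows "of_int n = (0 :: 'k) \<longleftrightarrow> 3 dvd n"
  using of_int_eq_0_iff_char_dvd[where ?'a = 'k, of n] assms by simp

definition short_index :: "chevalley_index => bool" where
  "short_index k \<longleftrightarrow> k = cartan_index (1, 0) \<or> weight k \<in> G2_short_roots"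

lemma not_short_index:
  assumes "\<not> short_index k"
  shows "k = cartan_index (0, 1) \<or> (\<exists>\<beta>\<in>G2_long_roots. k = root_index \<beta>)"
proof (cases k rule: chevalley_index_cases)
  case (1 \<alpha>)
  then show ?thesis using assms by (auto simp: short_index_def G2_simple_roots_def)
next
  case (2 \<alpha>)
  then show ?thesis using assms by (auto simp: short_index_def G2_roots_short_long)
qed

lemma short_index_simps:
  "short_index (cartan_index (1, 0))" "\<not> short_index (cartan_index (0, 1))"
  "\<alpha> \<in> G2_short_roots ==> short_index (root_index \<alpha>)" "\<alpha> \<in> G2_long_roots ==> \<not> short_index (root_index \<alpha>)"
proof -
  have 0: "0 \<notin> G2_short_roots" by (simp add: G2_short_roots_def zero_prod_def)
  have d: "\<alpha> \<notin> G2_short_roots" if "\<alpha> \<in> G2_long_roots" for \<alpha>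
    using that by (simp add: G2_short_roots_def G2_long_roots_def)
  show "short_index (cartan_index (1, 0))" "\<not> short_index (cartan_index (0, 1))"
    by (simp_all add: short_index_def 0)
  show "\<alpha> \<in> G2_short_roots ==> short_index (root_index \<alpha>)"
    by (simp add: short_index_def G2_roots_short_long)
  assume \<alpha>: "\<alpha> \<in> G2_long_roots"
  then have "\<alpha> \<in> G2_roots" by (simp add: G2_roots_short_long)
  then show "\<not> short_index (root_index \<alpha>)" using d[OF \<alpha>] by (simp add: short_index_def)
qed

locale chevalley_char3 =
  fixes G :: "('k::field, chevalley_index) table"
  assumes relations: "chevalley_relations G" and char: "CHAR('k) = 3"
begin

lemma lie: "lie_sc G" using relations unfolding chevalley_relations_def by blast

lemmas grading = chevalley_grading[OF relations]
lemmas act = cartan_action[OF relations]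
lemmas of_int_0 = of_int_char3[OF char]

lemma skew: "G i j = - G j i"
  using lie_sc_antisym[OF lie, of "axis i 1" "axis j 1"] by simp

lemma bracket_root:
  assumes "\<alpha> \<in> G2_roots" "\<beta> \<in> G2_roots" "\<alpha> + \<beta> \<in> G2_roots"
  shows "\<exists>s\<in>{1, - 1}. G (root_index \<alpha>) (root_index \<beta>) = of_int (s * int (G2_string \<alpha> \<beta> + 1)) *s root_vec (\<alpha> + \<beta>)"
  using relations assms unfolding chevalley_relations_def by blast

lemma bracket_opposite:
  assumes "\<alpha> \<in> G2_roots"
  shows "G (root_index \<alpha>) (root_index (- \<alpha>)) =
    coroot_vec \<alpha>"
  using relations assms unfolding chevalley_relations_def by blast

text \<open>
  By the grading, leaving the span is only possible in three ways: towards a long root from a Cartan element,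
  where the eigenvalue is divisible by 3; from a short root to the long coroot, whose coefficient is divisible
  by 3; or from a short root to a long one, where the string has length 2 and the structure constant is
  \<open>\<plusminus>3\<close>.
\<close>

lemma short_index_ideal_basis:
  assumes j: "short_index j" and k: "\<not> short_index k"
  shows "G i j $ k = 0"
proof (rule ccontr)
  assume nz: "G i j $ k \<noteq> 0"
  have wt: "weight k = weight i + weight j" by (rule grading[OF nz])
  show False
  proof (cases "j = cartan_index (1, 0)")
    case True
    have "G j i $ k \<noteq> 0" using nz skew[of i j] by simp
    then have "of_int (G2_cartan (weight i) (1, 0)) * axis i 1 $ k \<noteq> (0 :: 'k)"
      unfolding True using cartan_action_weight[OF relations, of "(1, 0)" i] by simp
    then have ik: "i = k" "of_int (G2_cartan (weight i) (1, 0)) \<noteq> (0 :: 'k)" by (auto simp: axis_def split: if_splits)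
    have "3 dvd G2_cartan (weight k) (1, 0)"
      using not_short_index[OF k] G2_facts(1) by (auto simp: G2_roots_short_long G2_cartan_def zero_prod_def)
    then show False using ik by (simp add: of_int_0)
  next
    case False
    then have j': "weight j \<in> G2_short_roots" using j by (simp add: short_index_def)
    define \<gamma> where "\<gamma> = weight j"
    have \<gamma>s: "\<gamma> \<in> G2_short_roots" using j' unfolding \<gamma>_def .
    then have \<gamma>r: "\<gamma> \<in> G2_roots" by (simp add: G2_roots_short_long)
    have "j = root_index \<gamma>" by (rule weight_eq_root[OF \<gamma>r]) (simp add: \<gamma>_def)
    note \<gamma> = \<gamma>s \<gamma>r this
    show False
    proof (cases "k = cartan_index (0, 1)")
      case True
      then have "weight i = - \<gamma>" using wt by (simp add: \<gamma>_def eq_neg_iff_add_eq_0)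
      then have i: "i = root_index (- \<gamma>)" using weight_eq_root[of "- \<gamma>" i] G2_root_basics(2)[OF \<gamma>(2)] by simp
      have "G i j $ k = of_int (snd (coroot_coeff (- \<gamma>)))"
        unfolding i \<gamma>(3) True using bracket_opposite[of "- \<gamma>"] G2_root_basics(2)[OF \<gamma>(2)] by (simp add: axis_def)
      then show False using nz G2_facts(3)[OF G2_short_neg[OF \<gamma>(1)]] by (simp add: of_int_0)
    next
      case False
      then obtain \<beta> where \<beta>: "\<beta> \<in> G2_long_roots" "\<beta> \<in> G2_roots" "k = root_index \<beta>"
        using not_short_index[OF k] by (auto simp: G2_roots_short_long)
      then have wi: "weight i + \<gamma> = \<beta>" using wt by (simp add: \<gamma>_def)
      have "\<gamma> \<noteq> \<beta>" using \<gamma>(1) \<beta>(1) by (auto simp: G2_short_roots_def G2_long_roots_def)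
      then have "weight i \<noteq> 0" using wi by auto
      then obtain \<alpha> where \<alpha>: "\<alpha> \<in> G2_roots" "i = root_index \<alpha>"
        by (cases i rule: chevalley_index_cases) auto
      then have ab: "\<alpha> + \<gamma> = \<beta>" using wi by simp
      have str: "G2_string \<alpha> \<gamma> = 2" using G2_string_to_long[OF \<alpha>(1) \<gamma>(1)] ab \<beta>(1) by simp
      have "\<alpha> + \<gamma> \<in> G2_roots" unfolding ab by (rule \<beta>(2))
      then obtain s where "G i j = of_int (s * int (G2_string \<alpha> \<gamma> + 1)) *s root_vec (\<alpha> + \<gamma>)"
        using bracket_root[OF \<alpha>(1) \<gamma>(2)] unfolding \<alpha>(2) \<gamma>(3) by blast
      moreover have "of_int (s * int (G2_string \<alpha> \<gamma> + 1)) = (0 :: 'k)" by (simp only: of_int_0) (simp add: str)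
      ultimately show False using nz by simp
    qed
  qed
qed

lemma short_index_ideal:
  assumes w: "\<And>k. \<not> short_index k ==> w $ k = 0" and k: "\<not> short_index k"
  shows "sc_mult G g w $ k = 0"
proof -
  have z: "g $ i * w $ j * G i j $ k = 0" for i j
    using w[of j] short_index_ideal_basis[of j k i] k by (cases "short_index j") auto
  show ?thesis by (simp only: sc_mult_nth z sum.neutral_const)
qed

text \<open>
  Bracketing with the Cartan element removes the short components of \<open>g\<close>. A long root vector moves
  some short root vector to a short one with coefficient \<open>\<plusminus>1\<close>, so the long components
  vanish too. The Cartan part is detected by two short roots that are independent modulo 3.
\<close>

lemma short_index_faithful:
  assumes z: "\<And>j. short_index j ==> sc_mult G g (axis j 1) = 0"
  shows "g = 0"
proof -
  have "sc_mult G (cartan_vec (1, 0)) g = 0"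
    using z[OF short_index_simps(1)] lie_sc_antisym[OF lie, of "cartan_vec (1, 0)" g] by simp
  then have "of_int (G2_cartan (weight k) (1, 0)) * g $ k = 0" for k
    unfolding act[OF simple_mem(1)] by (simp add: vec_eq_iff)
  note weights = this
  have short: "g $ root_index \<beta> = 0" if "\<beta> \<in> G2_short_roots" for \<beta>
    using weights[of "root_index \<beta>"] G2_facts(2)[OF that] that by (simp add: of_int_0 G2_roots_short_long)
  have long: "g $ root_index \<beta> = 0" if \<beta>: "\<beta> \<in> G2_long_roots" for \<beta>
  proof -
    obtain \<gamma> where \<gamma>: "\<gamma> \<in> G2_short_roots" "\<beta> + \<gamma> \<in> G2_short_roots" "G2_string \<beta> \<gamma> = 0"
      using G2_long_to_short[OF \<beta>] by blast
    have r: "\<beta> \<in> G2_roots" "\<gamma> \<in> G2_roots" "\<beta> + \<gamma> \<in> G2_roots" using \<beta> \<gamma> by (auto simp: G2_roots_short_long)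
    let ?k = "root_index (\<beta> + \<gamma>)"
    have off: "G i (root_index \<gamma>) $ ?k = 0" if "i \<noteq> root_index \<beta>" for i
    proof (rule ccontr)
      assume "G i (root_index \<gamma>) $ ?k \<noteq> 0"
      from grading[OF this] have "weight i = \<beta>" using r by simp
      then show False using weight_eq_root[OF r(1)] that by blast
    qed
    have "(\<Sum>i\<in>UNIV. g $ i * G i (root_index \<gamma>) $ ?k) =
        (\<Sum>i\<in>UNIV. if i = root_index \<beta> then g $ root_index \<beta> * G (root_index \<beta>) (root_index \<gamma>) $ ?k else 0)"
      by (rule sum.cong) (simp_all add: off)
    then have "(\<Sum>i\<in>UNIV. g $ i * G i (root_index \<gamma>) $ ?k) = g $ root_index \<beta> * G (root_index \<beta>) (root_index \<gamma>) $ ?k"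
      by simp
    moreover have "(\<Sum>i\<in>UNIV. g $ i * G i (root_index \<gamma>) $ ?k) = sc_mult G g (root_vec \<gamma>) $ ?k"
      by (simp add: sc_mult_nth axis_def if_distrib[of "\<lambda>t. _ * t"] if_distrib[of "\<lambda>t. t * _"] cong: if_cong)
    ultimately have "g $ root_index \<beta> * G (root_index \<beta>) (root_index \<gamma>) $ ?k = 0"
      using z[OF short_index_simps(3)[OF \<gamma>(1)]] by simp
    moreover have "G (root_index \<beta>) (root_index \<gamma>) $ ?k \<noteq> 0" using bracket_root[OF r] \<gamma>(3) by auto
    ultimately show ?thesis by simp
  qed
  let ?a = "g $ cartan_index (1, 0)" and ?b = "g $ cartan_index (0, 1)"
  have geq: "g = ?a *s cartan_vec (1, 0) + ?b *s cartan_vec (0, 1)"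
  proof -
    have "g = (\<Sum>k\<in>UNIV. (g $ k) *s axis k 1)" by (simp only: basis_expansion_ring)
    also have "\<dots> = ?a *s cartan_vec (1, 0) + ?b *s cartan_vec (0, 1)"
    proof -
      have "(\<Sum>\<alpha>\<in>G2_roots. (g $ root_index \<alpha>) *s axis (root_index \<alpha>) (1 :: 'k)) = 0"
        by (rule sum.neutral) (use short long G2_roots_short_long in auto)
      then show ?thesis unfolding sum_chevalley_index by simp
    qed
    finally show ?thesis .
  qed
  have lin: "of_int (G2_cartan \<beta> (1, 0)) * ?a + of_int (G2_cartan \<beta> (0, 1)) * ?b = 0" if \<beta>: "\<beta> \<in> G2_short_roots" for \<beta>
  proof -
    have r: "\<beta> \<in> G2_roots" using \<beta> by (simp add: G2_roots_short_long)
    have "sc_mult G g (root_vec \<beta>) $ root_index \<beta> = of_int (G2_cartan \<beta> (1, 0)) * ?a + of_int (G2_cartan \<beta> (0, 1)) * ?b"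
      by (subst geq) (simp add: sc_mult_add sc_mult_scale cartan_action_weight[OF relations] r)
    then show ?thesis using z[OF short_index_simps(3)[OF \<beta>]] by simp
  qed
  have "2 * ?a - ?b = 0" using lin[of "(1, 0)"] by (simp add: G2_short_roots_explicit G2_cartan_def)
  moreover have "- ?a + ?b = 0" using lin[of "(1, 1)"] by (simp add: G2_short_roots_explicit G2_cartan_def)
  moreover have "?a = (2 * ?a - ?b) + (- ?a + ?b)" "?b = (- ?a + ?b) + ?a" by (simp_all add: algebra_simps)
  ultimately have "?a = 0" "?b = 0" by simp_all
  then show ?thesis using geq by simp
qed

end

lemma lincomb_split_sc:
  "lincomb b (split_sc i j) = (case i of
     H => (case j of H => 0 | E1 => b E1 | E2 => b E2 | E3 => b E3 | F1 => - b F1 | F2 => - b F2 | F3 => - b F3)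
   | E1 => (case j of H => - b E1 | E1 => 0 | E2 => b F3 | E3 => - b F2 | F1 => b H | F2 => 0 | F3 => 0)
   | E2 => (case j of H => - b E2 | E1 => - b F3 | E2 => 0 | E3 => b F1 | F1 => 0 | F2 => b H | F3 => 0)
   | E3 => (case j of H => - b E3 | E1 => b F2 | E2 => - b F1 | E3 => 0 | F1 => 0 | F2 => 0 | F3 => b H)
   | F1 => (case j of H => b F1 | E1 => - b H | E2 => 0 | E3 => 0 | F1 => 0 | F2 => b E3 | F3 => - b E2)
   | F2 => (case j of H => b F2 | E1 => 0 | E2 => - b H | E3 => 0 | F1 => - b E3 | F2 => 0 | F3 => b E1)
   | F3 => (case j of H => b F3 | E1 => 0 | E2 => 0 | E3 => - b H | F1 => b E2 | F2 => - b E1 | F3 => 0))"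
  by (cases i; cases j) (simp_all add: lincomb_def sum_split_index split_sc_def split_bracket_def axis_def vector_sneg_minus1[symmetric])

context chevalley_char3
begin

lemma three: "(3 :: 'k) = 0" using of_int_0[of 3] by simp

lemma of_int_cong: "3 dvd m - n ==> of_int m = (of_int n :: 'k)"
  using of_int_0[of "m - n"] by simp

lemma bracket_short:
  assumes "\<alpha> \<in> G2_short_roots" "\<beta> \<in> G2_short_roots" "\<alpha> + \<beta> \<in> G2_short_roots"
  obtains s where "s = 1 \<or> s = - 1" "G (root_index \<alpha>) (root_index \<beta>) = s *s root_vec (\<alpha> + \<beta>)"
proof -
  obtain s where s: "s \<in> {1, - 1 :: int}"
    "G (root_index \<alpha>) (root_index \<beta>) = of_int (s * int (G2_string \<alpha> \<beta> + 1)) *s root_vec (\<alpha> + \<beta>)"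
    using bracket_root[of \<alpha> \<beta>] assms unfolding G2_roots_short_long by blast
  have "of_int (s * int (G2_string \<alpha> \<beta> + 1)) = (of_int (- s) :: 'k)"
    unfolding G2_string_short_short[OF assms] by (rule of_int_cong) simp
  then show ?thesis using that[of "of_int (- s)"] s by auto
qed

lemma bracket_long:
  assumes "\<alpha> \<in> G2_short_roots" "\<beta> \<in> G2_short_roots" "\<alpha> + \<beta> \<in> G2_long_roots"
  shows "G (root_index \<alpha>) (root_index \<beta>) = 0"
proof -
  have r: "\<alpha> \<in> G2_roots" "\<beta> \<in> G2_roots" "\<alpha> + \<beta> \<in> G2_roots" using assms by (simp_all add: G2_roots_short_long)
  obtain s where s: "G (root_index \<alpha>) (root_index \<beta>) = of_int (s * int (G2_string \<alpha> \<beta> + 1)) *s root_vec (\<alpha> + \<beta>)"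
    using bracket_root[OF r] by blast
  have "of_int (s * int (G2_string \<alpha> \<beta> + 1)) = (of_int 0 :: 'k)"
    unfolding G2_string_to_long[OF r(1) assms(2,3)] by (rule of_int_cong) simp
  then show ?thesis unfolding s by simp
qed

lemma bracket_self: "G i i = 0"
  using lie sc_mult_axis[of G i i] unfolding lie_sc_def by metis

lemma bracket_cartan_root:
  assumes "\<alpha> \<in> {(1, 0), (1, 1), (- 2, - 1)}"
  shows "G (cartan_index (1, 0)) (root_index \<alpha>) = - root_vec \<alpha>"
    "G (cartan_index (1, 0)) (root_index (- \<alpha>)) = root_vec (- \<alpha>)"
    "G (root_index \<alpha>) (root_index (- \<alpha>)) = cartan_vec (1, 0)"
proof -
  have r: "\<alpha> \<in> G2_roots" "- \<alpha> \<in> G2_roots" using assms by (auto simp: G2_roots_explicit)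
  have c: "3 dvd G2_cartan \<alpha> (1, 0) - (- 1)" "3 dvd G2_cartan (- \<alpha>) (1, 0) - 1"
    "3 dvd fst (coroot_coeff \<alpha>) - 1" "3 dvd snd (coroot_coeff \<alpha>) - 0"
    using assms by (auto simp: G2_cartan_def coroot_coeff_def)
  have "of_int (G2_cartan \<alpha> (1, 0)) = (of_int (- 1) :: 'k)" "of_int (G2_cartan (- \<alpha>) (1, 0)) = (of_int 1 :: 'k)"
    "of_int (fst (coroot_coeff \<alpha>)) = (of_int 1 :: 'k)" "of_int (snd (coroot_coeff \<alpha>)) = (of_int 0 :: 'k)"
    by (rule of_int_cong[OF c(1)], rule of_int_cong[OF c(2)], rule of_int_cong[OF c(3)], rule of_int_cong[OF c(4)])
  then show "G (cartan_index (1, 0)) (root_index \<alpha>) = - root_vec \<alpha>"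
    "G (cartan_index (1, 0)) (root_index (- \<alpha>)) = root_vec (- \<alpha>)"
    "G (root_index \<alpha>) (root_index (- \<alpha>)) = cartan_vec (1, 0)"
    using bracket_opposite[OF r(1)] cartan_action_weight[OF relations simple_mem(1)] r by simp_all
qed

lemma jacobi_root:
  "sc_mult G (axis i 1) (G j k) + sc_mult G (axis j 1) (G k i) + sc_mult G (axis k 1) (G i j) = 0"
  using lie unfolding lie_sc_def by (metis sc_mult_axis)

text \<open>
  The short roots \<open>(1, 0), (1, 1), (-2, -1)\<close> add up to 0. Their root vectors play the role of
  \<open>E1, E2, E3\<close> and the opposite ones, negated, that of \<open>F1, F2, F3\<close>. The unknown signs
  are all controlled by one: three signs whose sum vanishes in characteristic 3 are equal, and the Jacobi
  identity ties the \<open>F\<close>s to the \<open>E\<close>s. A common factor \<open>\<sigma>\<close> absorbs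
  the last sign.
\<close>

theorem split_embedding:
  obtains b where "\<And>i j. lincomb b (split_sc i j) = sc_mult G (b i) (b j)"
    "inj (lincomb b)" "range (lincomb b) = {w. \<forall>k. \<not> short_index k --> w $ k = 0}"
proof -
  define xv where "xv \<alpha> = axis (root_index \<alpha>) (1 :: 'k)" for \<alpha>
  define T where "T = axis (cartan_index (1, 0)) (1 :: 'k)"
  let ?r = root_index
  note short = G2_short_roots_explicit
  obtain s1 where s1: "s1 = 1 \<or> s1 = - 1" "G (?r (1, 1)) (?r (- 2, - 1)) = s1 *s xv (- 1, 0)"
    by (rule bracket_short[of "(1, 1)" "(- 2, - 1)"]) (simp_all add: short xv_def)
  obtain s2 where s2: "s2 = 1 \<or> s2 = - 1" "G (?r (- 2, - 1)) (?r (1, 0)) = s2 *s xv (- 1, - 1)"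
    by (rule bracket_short[of "(- 2, - 1)" "(1, 0)"]) (simp_all add: short xv_def)
  obtain s3 where s3: "s3 = 1 \<or> s3 = - 1" "G (?r (1, 0)) (?r (1, 1)) = s3 *s xv (2, 1)"
    by (rule bracket_short[of "(1, 0)" "(1, 1)"]) (simp_all add: short xv_def)
  obtain t1 where t1: "G (?r (- 1, - 1)) (?r (2, 1)) = t1 *s xv (1, 0)"
    by (rule bracket_short[of "(- 1, - 1)" "(2, 1)"]) (simp_all add: short xv_def)
  obtain t2 where t2: "G (?r (2, 1)) (?r (- 1, 0)) = t2 *s xv (1, 1)"
    by (rule bracket_short[of "(2, 1)" "(- 1, 0)"]) (simp_all add: short xv_def)
  obtain t3 where t3: "G (?r (- 1, 0)) (?r (- 1, - 1)) = t3 *s xv (- 2, - 1)"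
    by (rule bracket_short[of "(- 1, 0)" "(- 1, - 1)"]) (simp_all add: short xv_def)
  have long: "G (?r (1, 0)) (?r (- 1, - 1)) = 0" "G (?r (1, 0)) (?r (2, 1)) = 0" "G (?r (1, 1)) (?r (- 1, 0)) = 0"
    "G (?r (1, 1)) (?r (2, 1)) = 0" "G (?r (- 2, - 1)) (?r (- 1, 0)) = 0" "G (?r (- 2, - 1)) (?r (- 1, - 1)) = 0"
    by (rule bracket_long; simp add: short G2_long_roots_explicit)+
  have cr: "G (cartan_index (1, 0)) (?r (1, 0)) = - xv (1, 0)" "G (cartan_index (1, 0)) (?r (1, 1)) = - xv (1, 1)"
    "G (cartan_index (1, 0)) (?r (- 2, - 1)) = - xv (- 2, - 1)" "G (cartan_index (1, 0)) (?r (- 1, 0)) = xv (- 1, 0)"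
    "G (cartan_index (1, 0)) (?r (- 1, - 1)) = xv (- 1, - 1)" "G (cartan_index (1, 0)) (?r (2, 1)) = xv (2, 1)"
    "G (?r (1, 0)) (?r (- 1, 0)) = T" "G (?r (1, 1)) (?r (- 1, - 1)) = T" "G (?r (- 2, - 1)) (?r (2, 1)) = T"
    using bracket_cartan_root[of "(1, 0)"] bracket_cartan_root[of "(1, 1)"] bracket_cartan_root[of "(- 2, - 1)"]
    by (simp_all add: xv_def T_def)
  note table = s1(2) s2(2) s3(2) t1 t2 t3 long cr
  have table': "G (?r (- 2, - 1)) (?r (1, 1)) = - (s1 *s xv (- 1, 0))" "G (?r (1, 0)) (?r (- 2, - 1)) = - (s2 *s xv (- 1, - 1))"
    "G (?r (1, 1)) (?r (1, 0)) = - (s3 *s xv (2, 1))" "G (?r (2, 1)) (?r (- 1, - 1)) = - (t1 *s xv (1, 0))"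
    "G (?r (- 1, 0)) (?r (2, 1)) = - (t2 *s xv (1, 1))" "G (?r (- 1, - 1)) (?r (- 1, 0)) = - (t3 *s xv (- 2, - 1))"
    "G (?r (- 1, - 1)) (?r (1, 0)) = 0" "G (?r (2, 1)) (?r (1, 0)) = 0" "G (?r (- 1, 0)) (?r (1, 1)) = 0"
    "G (?r (2, 1)) (?r (1, 1)) = 0" "G (?r (- 1, 0)) (?r (- 2, - 1)) = 0" "G (?r (- 1, - 1)) (?r (- 2, - 1)) = 0"
    "G (?r (1, 0)) (cartan_index (1, 0)) = xv (1, 0)" "G (?r (1, 1)) (cartan_index (1, 0)) = xv (1, 1)"
    "G (?r (- 2, - 1)) (cartan_index (1, 0)) = xv (- 2, - 1)" "G (?r (- 1, 0)) (cartan_index (1, 0)) = - xv (- 1, 0)"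
    "G (?r (- 1, - 1)) (cartan_index (1, 0)) = - xv (- 1, - 1)" "G (?r (2, 1)) (cartan_index (1, 0)) = - xv (2, 1)"
    "G (?r (- 1, 0)) (?r (1, 0)) = - T" "G (?r (- 1, - 1)) (?r (1, 1)) = - T" "G (?r (2, 1)) (?r (- 2, - 1)) = - T"
    using table by (subst skew, simp)+
  have fold: "root_vec \<alpha> = xv \<alpha>" "cartan_vec (1, 0) = T" for \<alpha> by (simp_all add: xv_def T_def)
  have sc: "sc_mult G (xv \<alpha>) (xv \<beta>) = G (?r \<alpha>) (?r \<beta>)" "sc_mult G T (xv \<beta>) = G (cartan_index (1, 0)) (?r \<beta>)"
    "sc_mult G (xv \<alpha>) T = G (?r \<alpha>) (cartan_index (1, 0))" "sc_mult G T T = G (cartan_index (1, 0)) (cartan_index (1, 0))" for \<alpha> \<beta>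
    by (simp_all add: xv_def T_def)
  note jac = jacobi_root[of "?r _" "?r _" "?r _", unfolded fold]
  have xv_nth: "xv \<alpha> $ ?r \<alpha> = 1" "T $ cartan_index (1, 0) = 1" for \<alpha> by (simp_all add: xv_def T_def)
  have "s1 *s T + s2 *s T + s3 *s T = 0"
    using jac[of "(1, 0)" "(1, 1)" "(- 2, - 1)"] by (simp add: table sc_mult_scale sc)
  then have "(s1 *s T + s2 *s T + s3 *s T) $ cartan_index (1, 0) = 0" by (simp only: zero_index)
  then have "s1 + s2 + s3 = 0" by (simp add: xv_nth)
  then have s: "s2 = s1" "s3 = s1" using s1(1) s2(1) s3(1) three by auto
  have "(s3 * t2) *s xv (1, 1) + xv (1, 1) = 0"
    using jac[of "(- 1, 0)" "(1, 0)" "(1, 1)"] by (simp add: table table' sc_mult_scale sc_mult_minus sc vector_scale_scale) (simp add: vec_eq_iff, metis add.right_inverse)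
  then have "((s3 * t2) *s xv (1, 1) + xv (1, 1)) $ ?r (1, 1) = 0" by (simp only: zero_index)
  then have t2': "s3 * t2 = - 1" by (simp add: xv_nth eq_neg_iff_add_eq_0)
  have "(s1 * t3) *s xv (- 2, - 1) + xv (- 2, - 1) = 0"
    using jac[of "(- 1, - 1)" "(1, 1)" "(- 2, - 1)"] by (simp add: table table' sc_mult_scale sc_mult_minus sc vector_scale_scale) (simp add: vec_eq_iff, metis add.right_inverse)
  then have "((s1 * t3) *s xv (- 2, - 1) + xv (- 2, - 1)) $ ?r (- 2, - 1) = 0" by (simp only: zero_index)
  then have t3': "s1 * t3 = - 1" by (simp add: xv_nth eq_neg_iff_add_eq_0)
  have "(s2 * t1) *s xv (1, 0) + xv (1, 0) = 0"
    using jac[of "(2, 1)" "(- 2, - 1)" "(1, 0)"] by (simp add: table table' sc_mult_scale sc_mult_minus sc vector_scale_scale) (simp add: vec_eq_iff, metis add.right_inverse)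
  then have "((s2 * t1) *s xv (1, 0) + xv (1, 0)) $ ?r (1, 0) = 0" by (simp only: zero_index)
  then have t1': "s2 * t1 = - 1" by (simp add: xv_nth eq_neg_iff_add_eq_0)
  \<comment> \<open>\<open>s1 = s2 = s3 = - \<sigma>\<close> and \<open>t1 = t2 = t3 = \<sigma>\<close> by the Jacobi identities above\<close>
  define \<sigma> where "\<sigma> = - s1"
  have sq: "\<sigma> * \<sigma> = 1" "\<sigma> * (\<sigma> * c) = c" for c using s1(1) by (auto simp: \<sigma>_def)
  have st: "s1 = - \<sigma>" "s2 = - \<sigma>" "s3 = - \<sigma>" "t1 = \<sigma>" "t2 = \<sigma>" "t3 = \<sigma>"
    using s t1' t2' t3' s1(1) by (auto simp: \<sigma>_def)
  define b where "b i = (case i of H => - T | E1 => \<sigma> *s xv (1, 0) | E2 => \<sigma> *s xv (1, 1) | E3 => \<sigma> *s xv (- 2, - 1)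
    | F1 => - (\<sigma> *s xv (- 1, 0)) | F2 => - (\<sigma> *s xv (- 1, - 1)) | F3 => - (\<sigma> *s xv (2, 1)))" for i
  have hom: "lincomb b (split_sc i j) = sc_mult G (b i) (b j)" for i j
    by (cases i; cases j)
      (simp_all add: lincomb_split_sc b_def sc_mult_scale sc_mult_minus sc table table' st bracket_self vector_scale_scale sq)
  have coord: "lincomb b c = - (c $ H) *s T + (\<sigma> * c $ E1) *s xv (1, 0) + (\<sigma> * c $ E2) *s xv (1, 1) + (\<sigma> * c $ E3) *s xv (- 2, - 1)
      + (- \<sigma> * c $ F1) *s xv (- 1, 0) + (- \<sigma> * c $ F2) *s xv (- 1, - 1) + (- \<sigma> * c $ F3) *s xv (2, 1)" for c
    by (simp add: lincomb_def sum_split_index b_def vector_scale_scale mult.commute add.assoc vec_eq_iff)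
  have ax: "xv \<alpha> $ ?r \<beta> = (if \<beta> = \<alpha> then 1 else 0)" if "\<alpha> \<in> G2_roots" "\<beta> \<in> G2_roots" for \<alpha> \<beta>
    using that by (simp add: xv_def axis_def)
  have ax_cartan: "xv \<alpha> $ cartan_index (1, 0) = 0" "T $ ?r \<alpha> = 0" "xv \<alpha> $ cartan_index (0, 1) = 0" "T $ cartan_index (0, 1) = 0"
    if "\<alpha> \<in> G2_roots" for \<alpha>
    using that by (simp_all add: xv_def T_def axis_def)
  have rt: "(1, 0) \<in> G2_roots" "(1, 1) \<in> G2_roots" "(- 2, - 1) \<in> G2_roots" "(- 1, 0) \<in> G2_roots" "(- 1, - 1) \<in> G2_roots" "(2, 1) \<in> G2_roots"
    by (simp_all add: G2_roots_explicit)
  have entries: "lincomb b c $ cartan_index (1, 0) = - (c $ H)" "lincomb b c $ ?r (1, 0) = \<sigma> * c $ E1"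
    "lincomb b c $ ?r (1, 1) = \<sigma> * c $ E2" "lincomb b c $ ?r (- 2, - 1) = \<sigma> * c $ E3" "lincomb b c $ ?r (- 1, 0) = - \<sigma> * c $ F1"
    "lincomb b c $ ?r (- 1, - 1) = - \<sigma> * c $ F2" "lincomb b c $ ?r (2, 1) = - \<sigma> * c $ F3" for c
    by (simp_all add: coord ax ax_cartan rt xv_nth)
  have "\<sigma> \<noteq> 0" using sq(1) by auto
  have inj: "inj (lincomb b)"
  proof (rule injI)
    fix c d assume "lincomb b c = lincomb b d"
    then have "lincomb b c $ k = lincomb b d $ k" for k by simp
    note k = this
    show "c = d"
      unfolding vec_eq_iff all_split_index
      using k[of "cartan_index (1, 0)"] k[of "?r (1, 0)"] k[of "?r (1, 1)"] k[of "?r (- 2, - 1)"] k[of "?r (- 1, 0)"]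
        k[of "?r (- 1, - 1)"] k[of "?r (2, 1)"] \<open>\<sigma> \<noteq> 0\<close>
      by (simp add: entries)
  qed
  have range: "range (lincomb b) = {w. \<forall>k. \<not> short_index k --> w $ k = 0}"
  proof (intro subset_antisym subsetI)
    fix w assume "w \<in> range (lincomb b)"
    then obtain c where w: "w = lincomb b c" by blast
    have "w $ k = 0" if k: "\<not> short_index k" for k
    proof -
      have "w $ root_index \<beta> = 0" if \<beta>: "\<beta> \<in> G2_long_roots" for \<beta>
      proof -
        have "\<beta> \<in> G2_roots" using \<beta> by (simp add: G2_roots_short_long)
        moreover have "\<beta> \<notin> {(1, 0), (1, 1), (- 2, - 1), (- 1, 0), (- 1, - 1), (2, 1)}" using \<beta> by (auto simp: G2_long_roots_def)
        ultimately show ?thesis unfolding w coord using rt by (simp add: ax ax_cartan)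
      qed
      moreover have "w $ cartan_index (0, 1) = 0" unfolding w coord using rt by (simp add: ax ax_cartan)
      ultimately show ?thesis using not_short_index[OF k] by blast
    qed
    then show "w \<in> {w. \<forall>k. \<not> short_index k --> w $ k = 0}" by blast
  next
    fix w :: "'k^chevalley_index" assume w: "w \<in> {w. \<forall>k. \<not> short_index k --> w $ k = 0}"
    define c where "c = (\<chi> i. case i of H => - w $ cartan_index (1, 0) | E1 => \<sigma> * w $ ?r (1, 0) | E2 => \<sigma> * w $ ?r (1, 1)
      | E3 => \<sigma> * w $ ?r (- 2, - 1) | F1 => - \<sigma> * w $ ?r (- 1, 0) | F2 => - \<sigma> * w $ ?r (- 1, - 1) | F3 => - \<sigma> * w $ ?r (2, 1))"
    have "w $ k = lincomb b c $ k" for k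
    proof (cases k rule: chevalley_index_cases)
      case (1 \<alpha>)
      have "w $ cartan_index (0, 1) = 0" using w short_index_simps(2) by blast
      moreover have "lincomb b c $ cartan_index (0, 1) = 0" unfolding coord using rt by (simp add: ax ax_cartan)
      moreover have "w $ cartan_index (1, 0) = lincomb b c $ cartan_index (1, 0)" by (simp add: entries c_def)
      ultimately show ?thesis using 1 by (auto simp: G2_simple_roots_def)
    next
      case (2 \<alpha>)
      show ?thesis
      proof (cases "\<alpha> \<in> G2_short_roots")
        case True
        then show ?thesis unfolding 2(2) G2_short_roots_explicit by (auto simp: entries c_def sq)
      next
        case False
        then have l: "\<alpha> \<in> G2_long_roots" using 2 by (simp add: G2_roots_short_long)
        then have "\<alpha> \<notin> {(1, 0), (1, 1), (- 2, - 1), (- 1, 0), (- 1, - 1), (2, 1)}" by (auto simp: G2_long_roots_def)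
        then have "lincomb b c $ root_index \<alpha> = 0" unfolding coord using rt 2(1) by (simp add: ax ax_cartan)
        moreover have "w $ root_index \<alpha> = 0" using w short_index_simps(4)[OF l] by blast
        ultimately show ?thesis using 2(2) by simp
      qed
    qed
    then have "w = lincomb b c" by (simp add: vec_eq_iff)
    then show "w \<in> range (lincomb b)" by blast
  qed
  show ?thesis by (rule that[OF hom inj range])
qed

subsection \<open>The radical of the Killing form\<close>

lemma killing_axis: "killing G (axis i 1) (axis j 1) = (\<Sum>l\<in>UNIV. \<Sum>k\<in>UNIV. G j l $ k * G i k $ l)"
proof -
  have "sc_mult G (axis i 1) (sc_mult G (axis j 1) (axis l 1)) $ l = (\<Sum>k\<in>UNIV. G j l $ k * G i k $ l)" for l
  proof -
    have "sc_mult G (axis i 1) (\<Sum>k\<in>UNIV. (G j l $ k) *s axis k 1) = (\<Sum>k\<in>UNIV. (G j l $ k) *s G i k)"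
      by (simp only: sc_mult_sum sc_mult_scale sc_mult_axis)
    then show ?thesis by (simp add: basis_expansion_ring)
  qed
  then show ?thesis by (simp add: killing_def)
qed

lemma killing_grading:
  assumes "weight i + weight j \<noteq> 0"
  shows "killing G (axis i 1) (axis j 1) = 0"
proof -
  have z: "G j l $ k * G i k $ l = 0" for k l
  proof (rule ccontr)
    assume "G j l $ k * G i k $ l \<noteq> 0"
    then have "weight k = weight j + weight l" "weight l = weight i + weight k" using grading by auto
    then have "weight l = (weight i + weight j) + weight l" by (metis add.assoc)
    then have "weight i + weight j = 0" by (metis add_cancel_left_left)
    then show False using assms by blast
  qed
  show ?thesis unfolding killing_axis by (simp only: z sum.neutral_const)
qed

lemma killing_cartan:
  assumes "\<alpha> \<in> G2_simple_roots" "\<beta> \<in> G2_simple_roots"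
  shows "killing G (cartan_vec \<alpha>) (cartan_vec \<beta>) = of_int (\<Sum>\<gamma>\<in>G2_roots. G2_cartan \<gamma> \<alpha> * G2_cartan \<gamma> \<beta>)"
proof -
  have 0: "G2_cartan 0 \<alpha> = 0" by (cases \<alpha>) (simp add: G2_cartan_def zero_prod_def)
  have "killing G (cartan_vec \<alpha>) (cartan_vec \<beta>) = (\<Sum>j\<in>UNIV. of_int (G2_cartan (weight j) \<alpha> * G2_cartan (weight j) \<beta>))"
    by (simp add: killing_def act[OF assms(1)] cartan_action_weight[OF relations assms(2)])
  also have "\<dots> = (\<Sum>\<gamma>\<in>G2_roots. of_int (G2_cartan \<gamma> \<alpha> * G2_cartan \<gamma> \<beta>))"
    unfolding sum_chevalley_index by (simp add: 0)
  finally show ?thesis by simp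
qed

text \<open>The sums over all roots are 48, -24 and 16.\<close>

lemma killing_cartan_values:
  "killing G (cartan_vec (1, 0)) (cartan_vec (1, 0)) = 0"
  "killing G (cartan_vec (1, 0)) (cartan_vec (0, 1)) = 0"
  "killing G (cartan_vec (0, 1)) (cartan_vec (1, 0)) = 0"
  "killing G (cartan_vec (0, 1)) (cartan_vec (0, 1)) = 1"
proof -
  have c: "(\<Sum>\<gamma>\<in>G2_roots. G2_cartan \<gamma> (1, 0) * G2_cartan \<gamma> (1, 0)) = 48"
    "(\<Sum>\<gamma>\<in>G2_roots. G2_cartan \<gamma> (1, 0) * G2_cartan \<gamma> (0, 1)) = - 24"
    "(\<Sum>\<gamma>\<in>G2_roots. G2_cartan \<gamma> (0, 1) * G2_cartan \<gamma> (0, 1)) = 16"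
    by (simp_all add: G2_roots_explicit G2_cartan_def)
  have v: "of_int 48 = (of_int 0 :: 'k)" "of_int (- 24) = (of_int 0 :: 'k)" "of_int 16 = (of_int 1 :: 'k)"
    by (rule of_int_cong; simp)+
  show "killing G (cartan_vec (1, 0)) (cartan_vec (1, 0)) = 0"
    "killing G (cartan_vec (0, 1)) (cartan_vec (0, 1)) = 1"
    "killing G (cartan_vec (1, 0)) (cartan_vec (0, 1)) = 0"
    unfolding killing_cartan[OF simple_mem(1) simple_mem(1)] killing_cartan[OF simple_mem(1) simple_mem(2)]
      killing_cartan[OF simple_mem(2) simple_mem(2)] c v by simp_all
  then show "killing G (cartan_vec (0, 1)) (cartan_vec (1, 0)) = 0"
    using killing_commute by metis
qed

text \<open>
  Invariance of the Killing form under the Cartan element, followed by the expansion of the coroot.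
\<close>

lemma killing_root:
  assumes \<alpha>: "\<alpha> \<in> G2_roots" and \<gamma>: "\<gamma> \<in> G2_simple_roots"
  shows "of_int (G2_cartan \<alpha> \<gamma>) * killing G (root_vec \<alpha>) (root_vec (- \<alpha>)) =
    (if \<gamma> = (0, 1) then of_int (snd (coroot_coeff \<alpha>)) else 0)"
proof -
  have "killing G (G (cartan_index \<gamma>) (root_index \<alpha>)) (root_vec (- \<alpha>)) =
      killing G (cartan_vec \<gamma>) (G (root_index \<alpha>) (root_index (- \<alpha>)))"
    using killing_invariant[OF lie, of "cartan_vec \<gamma>" "root_vec \<alpha>" "root_vec (- \<alpha>)"] by simp
  then show ?thesis
    using \<gamma> \<alpha> unfolding cartan_action_weight[OF relations \<gamma>] bracket_opposite[OF \<alpha>]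
    by (auto simp: killing_linear killing_cartan_values G2_simple_roots_def)
qed

lemma killing_short: "\<alpha> \<in> G2_short_roots ==> killing G (root_vec \<alpha>) (root_vec (- \<alpha>)) = 0"
  using killing_root[of \<alpha> "(1, 0)"] G2_facts(2)[of \<alpha>] by (simp add: of_int_0 G2_roots_short_long)

lemma killing_long: "\<alpha> \<in> G2_long_roots ==> killing G (root_vec \<alpha>) (root_vec (- \<alpha>)) \<noteq> 0"
  using killing_root[of \<alpha> "(0, 1)"] G2_facts(4)[of \<alpha>] by (auto simp: of_int_0 G2_roots_short_long)

lemma killing_short_index:
  assumes "short_index i"
  shows "killing G (axis i 1) (axis j 1) = 0"
proof (cases "weight i + weight j = 0")
  case True
  show ?thesis
  proof (cases "i = cartan_index (1, 0)")
    case i: True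
    then have "weight j = 0" using True by simp
    then show ?thesis using weight_eq_0[of j] killing_cartan_values i by auto
  next
    case False
    define \<alpha> where "\<alpha> = weight i"
    have \<alpha>: "\<alpha> \<in> G2_short_roots" using assms False by (simp add: short_index_def \<alpha>_def)
    then have r: "\<alpha> \<in> G2_roots" by (simp add: G2_roots_short_long)
    have i: "i = root_index \<alpha>" by (rule weight_eq_root[OF r]) (simp add: \<alpha>_def)
    have "weight j = - \<alpha>" using True by (simp add: \<alpha>_def eq_neg_iff_add_eq_0 add.commute)
    then have "j = root_index (- \<alpha>)" by (rule weight_eq_root[OF G2_root_basics(2)[OF r]])
    then show ?thesis using killing_short[OF \<alpha>] i by simp
  qed
qed (rule killing_grading)

text \<open>The Killing form pairs opposite degrees, so the radical can be found degree by degree.\<close>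

theorem killing_radical: "(\<forall>y. killing G x y = 0) \<longleftrightarrow> (\<forall>k. \<not> short_index k --> x $ k = 0)"
proof -
  have expand: "killing G x y = (\<Sum>i\<in>UNIV. x $ i * killing G (axis i 1) y)" for y
  proof -
    have s: "killing G (\<Sum>i\<in>S. f i) y = (\<Sum>i\<in>S. killing G (f i) y)" for f :: "chevalley_index => 'k^chevalley_index" and S
      by (induct S rule: infinite_finite_induct) (simp_all add: killing_linear)
    have "killing G (\<Sum>i\<in>UNIV. (x $ i) *s axis i 1) y = (\<Sum>i\<in>UNIV. x $ i * killing G (axis i 1) y)"
      by (simp only: s killing_linear)
    then show ?thesis by (simp only: basis_expansion_ring)
  qed
  show ?thesis
  proof (intro iffI allI impI)
    fix k assume h: "\<forall>y. killing G x y = 0" and k: "\<not> short_index k"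
    obtain j where j: "killing G (axis k 1) (axis j 1) \<noteq> 0" "\<And>i. weight i + weight j = 0 ==> i \<noteq> k ==> killing G (axis i 1) (axis j 1) = 0"
    proof (cases "k = cartan_index (0, 1)")
      case True
      show ?thesis
      proof (rule that[of "cartan_index (0, 1)"])
        show "killing G (axis i 1) (cartan_vec (0, 1)) = 0" if "weight i + weight (cartan_index (0, 1)) = 0" "i \<noteq> k" for i
          using weight_eq_0[of i] that True killing_cartan_values by auto
      qed (simp add: True killing_cartan_values)
    next
      case False
      then obtain \<beta> where \<beta>: "\<beta> \<in> G2_long_roots" "k = root_index \<beta>" using not_short_index[OF k] by blast
      then have r: "\<beta> \<in> G2_roots" "- \<beta> \<in> G2_roots" using G2_root_basics(2) by (simp_all add: G2_roots_short_long)
      show ?thesis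
      proof (rule that[of "root_index (- \<beta>)"])
        show "killing G (axis i 1) (root_vec (- \<beta>)) = 0" if "weight i + weight (root_index (- \<beta>)) = 0" "i \<noteq> k" for i
          using weight_eq_root[OF r(1), of i] that \<beta>(2) r by simp
      qed (use killing_long[OF \<beta>(1)] \<beta>(2) in simp)
    qed
    have single: "x $ i * killing G (axis i 1) (axis j 1) = (if i = k then x $ k * killing G (axis k 1) (axis j 1) else 0)" for i
      using j(2)[of i] killing_grading[of i j] by auto
    have "killing G x (axis j 1) = (\<Sum>i\<in>UNIV. if i = k then x $ k * killing G (axis k 1) (axis j 1) else 0)"
      unfolding expand by (rule sum.cong[OF refl single])
    then have "killing G x (axis j 1) = x $ k * killing G (axis k 1) (axis j 1)" by simp
    then show "x $ k = 0" using h j(1) by simp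
  next
    fix y assume h: "\<forall>k. \<not> short_index k --> x $ k = 0"
    have zero: "x $ i * killing G (axis i 1) (axis j 1) = 0" for i j
      using h killing_short_index[of i j] by (cases "short_index i") auto
    have "killing G x (axis j 1) = 0" for j by (simp only: expand zero sum.neutral_const)
    then have "lincomb (killing_map G) x = 0" by (simp add: lincomb_killing_map vec_eq_iff)
    then show "killing G x y = 0" by (simp add: killing_map_kernel)
  qed
qed

theorem split_ideal_embedding:
  obtains b where "ideal_embedding G split_sc b" "range (lincomb b) = {x. lincomb (killing_map G) x = 0}"
proof -
  obtain b where b: "\<And>i j. lincomb b (split_sc i j) = sc_mult G (b i) (b j)"
    "inj (lincomb b)" "range (lincomb b) = {w. \<forall>k. \<not> short_index k --> w $ k = 0}"
    using split_embedding by blast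
  have "lincomb b (sc_mult split_sc x y) = sc_mult G (lincomb b x) (lincomb b y)" for x y
    by (rule bilinear_eqI[where f = "\<lambda>x y. lincomb b (sc_mult split_sc x y)" and g = "\<lambda>x y. sc_mult G (lincomb b x) (lincomb b y)"])
      (simp_all add: sc_mult_add sc_mult_scale lincomb_add lincomb_scale b(1))
  moreover have "sc_mult G g (lincomb b x) \<in> range (lincomb b)" for g x
  proof -
    have "lincomb b x \<in> range (lincomb b)" by blast
    then have "lincomb b x $ k = 0" if "\<not> short_index k" for k using that unfolding b(3) by blast
    then have "sc_mult G g (lincomb b x) $ k = 0" if "\<not> short_index k" for k using short_index_ideal that by blast
    then show ?thesis unfolding b(3) by blast
  qed
  moreover have "g = 0" if z: "\<And>x. sc_mult G g (lincomb b x) = 0" for g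
  proof (rule short_index_faithful)
    fix j assume "short_index j"
    then have "axis j 1 \<in> range (lincomb b)" unfolding b(3) by (auto simp: axis_def)
    then obtain x where "axis j 1 = lincomb b x" by blast
    then show "sc_mult G g (axis j 1) = 0" using z by simp
  qed
  ultimately have "ideal_embedding G split_sc b" unfolding ideal_embedding_def using lie b(2) by blast
  then show ?thesis using that b(3) killing_radical by (simp add: killing_map_kernel)
qed

end

section \<open>Cross products along isomorphisms\<close>

lemma cross_product_transport:
  assumes G: "cross_product G M" and f: "algebra_hom (coord_algebra G) (coord_algebra G') f" and bij: "bij f"
  obtains M' where "cross_product G' M'" "\<And>x y. bform M' (f x) (f y) = bform M x y"
proof -
  note fD = algebra_homD(2-4)[OF f, simplified]
  define h where "h = the_inv_into UNIV f"
  have hf: "h (f x) = x" for x unfolding h_def using bij by (simp add: bij_def the_inv_into_f_f)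
  have fh: "f (h y) = y" for y unfolding h_def using bij by (simp add: bij_def f_the_inv_into_f)
  have hl: "h (x + y) = h x + h y" "h (c *s x) = c *s h x" "h (sc_mult G' x y) = sc_mult G (h x) (h y)" for x y c
    using hf[of "h x + h y"] hf[of "c *s h x"] hf[of "sc_mult G (h x) (h y)"] by (simp_all add: fD fh)
  have h0: "h 0 = 0" "h (- x) = - h x" for x
    using hl(2)[of 0 0] hl(2)[of "- 1" x] by (simp_all add: vector_sneg_minus1[symmetric])
  have hinj: "x = y" if "h x = h y" for x y using fh that by metis
  let ?M = "\<lambda>i j. bform M (h (axis i 1)) (h (axis j 1))"
  have "(\<lambda>x y. bform M (h x) (h y)) = bform ?M"
    by (rule bilinear_eq_bform) (simp_all add: hl bform_add bform_scale)
  then have M': "bform ?M x y = bform M (h x) (h y)" for x y by metis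
  have "cross_product G' ?M"
    unfolding cross_product_def M'
  proof (intro conjI allI impI)
    fix x y z
    have "sc_mult G (h x) (h y) = - sc_mult G (h y) (h x)" using G unfolding cross_product_def by blast
    then have "h (sc_mult G' x y) = h (- sc_mult G' y x)" unfolding hl h0 .
    then show "sc_mult G' x y = - sc_mult G' y x" by (rule hinj)
    show "bform M (h x) (h y) = bform M (h y) (h x)" using G unfolding cross_product_def by blast
    have "sc_mult G (h x) (sc_mult G (h z) (h y)) + sc_mult G (h z) (sc_mult G (h x) (h y)) =
        - (bform M (h x) (h z) *s h y + bform M (h x) (h y) *s h z + bform M (h z) (h y) *s h x)"
      using G unfolding cross_product_def by blast
    then show "sc_mult G' x (sc_mult G' z y) + sc_mult G' z (sc_mult G' x y) =
        - (bform M (h x) (h z) *s y + bform M (h x) (h y) *s z + bform M (h z) (h y) *s x)"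
      by (intro hinj) (simp only: hl h0)
  next
    fix x assume z: "\<forall>y. bform M (h x) (h y) = 0"
    have "bform M (h x) y = 0" for y using z hf by metis
    then have "h x = 0" using G unfolding cross_product_def by blast
    then show "x = 0" using hinj h0(1) by metis
  qed
  then show ?thesis using that M' hf by metis
qed

text \<open>
  The transported form and the given form are both compatible with the second bracket, so they are equal.
\<close>

theorem octonions_iso:
  fixes G :: "('a::field, 'n::finite) table" and G' :: "('a, 'm::finite) table"
  assumes G: "cross_product G M" and G': "cross_product G' M'" and card: "CARD('m) > 2"
    and iso: "algebra_iso (coord_algebra G) (coord_algebra G')"
  shows "algebra_iso (octonions G M) (octonions G' M')"
proof -
  obtain f where f: "algebra_hom (coord_algebra G) (coord_algebra G') f" and bij: "bij f"
    using iso by (auto elim: algebra_isoE)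
  note fD = algebra_homD(2-4)[OF f, simplified]
  obtain M'' where M'': "cross_product G' M''" "\<And>x y. bform M'' (f x) (f y) = bform M x y"
    by (rule cross_product_transport[OF G f bij]) blast
  have "M'' = M'" by (rule cross_product_form_unique[OF M''(1) G' card])
  then have form: "bform M' (f x) (f y) = bform M x y" for x y using M''(2) by simp
  have diff: "f (x - y) = f x - f y" for x y
  proof -
    have "f (x - y) + f y = f x" by (simp add: fD(1)[symmetric])
    then show ?thesis by (simp add: eq_diff_eq)
  qed
  have "bij (\<lambda>s :: 'a \<times> ('a^'n). (fst s, f (snd s)))"
  proof (rule bijI')
    show "(fst s, f (snd s)) = (fst t, f (snd t)) \<longleftrightarrow> s = t" for s t :: "'a \<times> ('a^'n)"
      using bij by (auto simp: prod_eq_iff bij_def inj_eq)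
    show "\<exists>s. t = (fst s, f (snd s))" for t :: "'a \<times> ('a^'m)"
      using bij by (intro exI[of _ "(fst t, inv_into UNIV f (snd t))"]) (simp add: bij_def surj_f_inv_f)
  qed
  then show ?thesis
    by (intro algebra_isoI[of _ _ "\<lambda>s. (fst s, f (snd s))"] algebra_homI) (auto simp: fD diff form)
qed

section \<open>Forms of the Chevalley algebra are derivation algebras\<close>

lemma lie_sc_coord_iso:
  assumes G: "lie_sc G" and f: "algebra_hom (coord_algebra G) (coord_algebra G') f" and bij: "bij f"
  shows "lie_sc G'"
proof -
  note fD = algebra_homD(2-4)[OF f, simplified]
  have f0: "f 0 = 0" using fD(2)[of 0 0] by simp
  have surj: "\<exists>x. y = f x" for y using bij by (metis bij_def surj_def)
  have 1: "sc_mult G' y y = 0" for y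
  proof -
    obtain x where "y = f x" using surj by blast
    then show ?thesis using G by (simp add: fD(3)[symmetric] lie_sc_def f0)
  qed
  have 2: "sc_mult G' x (sc_mult G' y z) + sc_mult G' y (sc_mult G' z x) + sc_mult G' z (sc_mult G' x y) = 0" for x y z
  proof -
    obtain u v w where "x = f u" "y = f v" "z = f w" using surj by metis
    then show ?thesis using G by (simp add: fD(1,3)[symmetric] lie_sc_def f0)
  qed
  show ?thesis unfolding lie_sc_def using 1 2 by blast
qed

lemma killing_coord_iso:
  fixes G G' :: "('a::field, 'n::finite) table"
  assumes f: "algebra_hom (coord_algebra G) (coord_algebra G') f" and bij: "bij f"
  shows "killing G' (f x) (f y) = killing G x y"
proof -
  note fD = algebra_homD(2-4)[OF f, simplified]
  define h where "h = the_inv_into UNIV f"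
  have hf: "h (f x) = x" for x unfolding h_def using bij by (simp add: bij_def the_inv_into_f_f)
  have fh: "f (h y) = y" for y unfolding h_def using bij by (simp add: bij_def f_the_inv_into_f)
  have hl: "h (x + y) = h x + h y" "h (c *s x) = c *s h x" for x y c
    using hf[of "h x + h y"] hf[of "c *s h x"] by (simp_all add: fD fh)
  have "sc_mult G' (f x) (sc_mult G' (f y) v) = f (sc_mult G x (sc_mult G y (h v)))" for v
    by (simp add: fD fh)
  then have "killing G' (f x) (f y) = (\<Sum>j\<in>UNIV. f (sc_mult G x (sc_mult G y (h (axis j 1)))) $ j)"
    by (simp add: killing_def)
  also have "\<dots> = (\<Sum>j\<in>UNIV. sc_mult G x (sc_mult G y (h (f (axis j 1)))) $ j)"
    by (rule trace_comp_commute[of f "\<lambda>v. sc_mult G x (sc_mult G y (h v))"]) (simp_all add: fD hl sc_mult_add sc_mult_scale)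
  finally show ?thesis by (simp add: hf killing_def)
qed

lemma ideal_embedding_coord_iso:
  assumes emb: "ideal_embedding G J b" and f: "algebra_hom (coord_algebra G) (coord_algebra G') f" and bij: "bij f"
  shows "ideal_embedding G' J (\<lambda>k. f (b k))" and "lincomb (\<lambda>k. f (b k)) = (\<lambda>x. f (lincomb b x))"
proof -
  note fD = algebra_homD(2-4)[OF f, simplified]
  have lie: "lie_sc G" and inj: "inj (lincomb b)"
    and hom: "\<And>x y. lincomb b (sc_mult J x y) = sc_mult G (lincomb b x) (lincomb b y)"
    and ideal: "\<And>g x. sc_mult G g (lincomb b x) \<in> range (lincomb b)"
    and faithful: "\<And>g. (\<And>x. sc_mult G g (lincomb b x) = 0) ==> g = 0"
    using emb unfolding ideal_embedding_def by blast+
  have f0: "f 0 = 0" using fD(2)[of 0 0] by simp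
  have finj: "x = y" if "f x = f y" for x y using bij that by (simp add: bij_def inj_eq)
  have surj: "\<exists>x. y = f x" for y using bij by (metis bij_def surj_def)
  have "(\<lambda>x. f (lincomb b x)) = lincomb (\<lambda>k. f (lincomb b (axis k 1)))"
    by (rule linear_eq_lincomb) (simp_all add: fD lincomb_add lincomb_scale)
  then show lf: "lincomb (\<lambda>k. f (b k)) = (\<lambda>x. f (lincomb b x))" by simp
  show "ideal_embedding G' J (\<lambda>k. f (b k))"
    unfolding ideal_embedding_def lf
  proof (intro conjI allI impI)
    show "lie_sc G'" by (rule lie_sc_coord_iso[OF lie f bij])
    show "inj (\<lambda>x. f (lincomb b x))" using inj finj by (auto simp: inj_def)
    show "f (lincomb b (sc_mult J x y)) = sc_mult G' (f (lincomb b x)) (f (lincomb b y))" for x y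
      by (simp add: hom fD)
  next
    fix g x
    obtain g0 where g0: "g = f g0" using surj by blast
    obtain z where "sc_mult G g0 (lincomb b x) = lincomb b z" using ideal by blast
    then have "sc_mult G' g (f (lincomb b x)) = f (lincomb b z)" by (simp add: g0 fD(3)[symmetric])
    then show "sc_mult G' g (f (lincomb b x)) \<in> range (\<lambda>x. f (lincomb b x))" by blast
  next
    fix g assume z: "\<forall>x. sc_mult G' g (f (lincomb b x)) = 0"
    obtain g0 where g0: "g = f g0" using surj by blast
    have "f (sc_mult G g0 (lincomb b x)) = f 0" for x using z by (simp add: g0 fD(3) f0)
    then have "sc_mult G g0 (lincomb b x) = 0" for x by (rule finj)
    then have "g0 = 0" by (rule faithful)
    then show "g = 0" by (simp add: g0 f0)
  qed
qed

lemma killing_kernel_ideal: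
  assumes G: "lie_sc G" and x: "lincomb (killing_map G) x = 0"
  shows "lincomb (killing_map G) (sc_mult G g x) = 0"
proof -
  have "killing G (sc_mult G x g) y = 0" for y
    using x killing_invariant[OF G, of x g y] by (simp add: killing_map_kernel)
  then have "killing G (sc_mult G g x) y = 0" for y
    by (subst lie_sc_antisym[OF G]) (simp add: killing_linear)
  then show ?thesis by (simp add: killing_map_kernel)
qed

context field_map
begin

lemma lie_sc_descent:
  assumes G: "lie_sc (base_change \<phi> G)"
  shows "lie_sc G"
proof -
  have "map_vec \<phi> (sc_mult G v v) = 0" for v using G by (simp add: map_vec_sc_mult lie_sc_def)
  moreover have "map_vec \<phi> (sc_mult G u (sc_mult G v w) + sc_mult G v (sc_mult G w u) + sc_mult G w (sc_mult G u v)) = 0" for u v w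
    using G unfolding map_vec_sc_mult map_vec_add lie_sc_def by blast
  ultimately show ?thesis unfolding lie_sc_def by simp
qed

text \<open>
  The radical of the Killing form is defined over the small field by \<open>kernel_basis_descent\<close>. It is
  an ideal there because the form is invariant, and faithfulness is inherited since a basis of the radical over
  the small field is one over the large field.
\<close>

theorem ideal_embedding_descent:
  fixes \<Delta> :: "('a, 'n::finite) table" and S :: "('k, 'm::finite) table"
  assumes emb: "ideal_embedding (base_change \<phi> \<Delta>) S d"
    and range: "range (lincomb d) = {x. lincomb (killing_map (base_change \<phi> \<Delta>)) x = 0}"
  obtains J b where "ideal_embedding \<Delta> J b" "algebra_iso (coord_algebra S) (coord_algebra (base_change \<phi> (J :: ('a, 'm) table)))"
proof -
  let ?\<Delta> = "base_change \<phi> \<Delta>"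
  have lieK: "lie_sc ?\<Delta>" and injd: "inj (lincomb d)"
    and homd: "\<And>x y. lincomb d (sc_mult S x y) = sc_mult ?\<Delta> (lincomb d x) (lincomb d y)"
    and faithful: "\<And>g. (\<And>x. sc_mult ?\<Delta> g (lincomb d x) = 0) ==> g = 0"
    using emb unfolding ideal_embedding_def by blast+
  have lie: "lie_sc \<Delta>" by (rule lie_sc_descent[OF lieK])
  have range': "range (lincomb d) = {v. lincomb (\<lambda>k. map_vec \<phi> (killing_map \<Delta> k)) v = 0}"
    unfolding range map_killing_map ..
  obtain b :: "'m => 'a^'n" where b: "inj (lincomb b)" "range (lincomb b) = {x. lincomb (killing_map \<Delta>) x = 0}"
    "range (lincomb (\<lambda>k. map_vec \<phi> (b k))) = range (lincomb d)"
    using kernel_basis_descent[OF injd range'] unfolding range' by blast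
  let ?b = "\<lambda>k. map_vec \<phi> (b k)"
  have injb: "inj (lincomb ?b)" by (rule inj_lincomb_base_change[OF b(1)])
  have ideal: "sc_mult \<Delta> g (lincomb b x) \<in> range (lincomb b)" for g x
  proof -
    have "lincomb b x \<in> range (lincomb b)" by blast
    then have "lincomb (killing_map \<Delta>) (sc_mult \<Delta> g (lincomb b x)) = 0"
      unfolding b(2) by (intro killing_kernel_ideal[OF lie]) blast
    then show ?thesis unfolding b(2) by blast
  qed
  obtain r where r: "\<And>c. lincomb r (lincomb b c) = c" using lincomb_left_inverse[OF b(1)] by blast
  define m where "m x y = lincomb r (sc_mult \<Delta> (lincomb b x) (lincomb b y))" for x y
  have m: "m = sc_mult (\<lambda>i j. m (axis i 1) (axis j 1))" (is "_ = sc_mult ?J")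
    by (rule bilinear_eq_sc_mult) (simp_all add: m_def sc_mult_add sc_mult_scale lincomb_add lincomb_scale)
  have bm: "lincomb b (m x y) = sc_mult \<Delta> (lincomb b x) (lincomb b y)" for x y
  proof -
    obtain z where "sc_mult \<Delta> (lincomb b x) (lincomb b y) = lincomb b z" using ideal by blast
    then show ?thesis unfolding m_def by (simp add: r)
  qed
  have hom: "lincomb b (sc_mult ?J x y) = sc_mult \<Delta> (lincomb b x) (lincomb b y)" for x y
    by (simp only: m[symmetric] bm)
  have homK: "lincomb ?b (sc_mult (base_change \<phi> ?J) x y) = sc_mult ?\<Delta> (lincomb ?b x) (lincomb ?b y)" for x y
  proof (rule bilinear_eqI[where f = "\<lambda>x y. lincomb ?b (sc_mult (base_change \<phi> ?J) x y)"
        and g = "\<lambda>x y. sc_mult ?\<Delta> (lincomb ?b x) (lincomb ?b y)"])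
    fix i j
    have "map_vec \<phi> (lincomb b (m (axis i 1) (axis j 1))) = map_vec \<phi> (sc_mult \<Delta> (b i) (b j))"
      by (simp add: bm)
    then show "lincomb ?b (sc_mult (base_change \<phi> ?J) (axis i 1) (axis j 1)) = sc_mult ?\<Delta> (lincomb ?b (axis i 1)) (lincomb ?b (axis j 1))"
      by (simp add: map_vec_lincomb map_vec_sc_mult base_change_def)
  qed (simp_all add: sc_mult_add sc_mult_scale lincomb_add lincomb_scale)
  have faith: "g = 0" if z: "\<forall>x. sc_mult \<Delta> g (lincomb b x) = 0" for g
  proof -
    have zk: "sc_mult ?\<Delta> (map_vec \<phi> g) (?b k) = 0" for k
      using z[rule_format, of "axis k 1"] by (simp add: map_vec_sc_mult[symmetric])
    have "(\<lambda>x. sc_mult ?\<Delta> (map_vec \<phi> g) (lincomb ?b x)) = (\<lambda>x. 0)"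
      by (rule lincomb_eqI) (simp_all add: zk sc_mult_add sc_mult_scale lincomb_add lincomb_scale)
    then have zv: "sc_mult ?\<Delta> (map_vec \<phi> g) (lincomb ?b x) = 0" for x by (rule fun_cong)
    have "sc_mult ?\<Delta> (map_vec \<phi> g) (lincomb d x) = 0" for x
    proof -
      have "lincomb d x \<in> range (lincomb ?b)" unfolding b(3) by blast
      then obtain y where "lincomb d x = lincomb ?b y" by blast
      then show ?thesis using zv[of y] by simp
    qed
    then have "map_vec \<phi> g = 0" by (rule faithful)
    then show "g = 0" by simp
  qed
  have 1: "ideal_embedding \<Delta> ?J b"
    unfolding ideal_embedding_def using lie b(1) hom ideal faith by blast
  have "\<exists>y. lincomb ?b y = lincomb d x" for x
  proof -
    have "lincomb d x \<in> range (lincomb ?b)" unfolding b(3) by blast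
    then show ?thesis by (metis imageE)
  qed
  then obtain t where t: "\<And>x. lincomb ?b (t x) = lincomb d x" by metis
  have binj: "x = y" if "lincomb ?b x = lincomb ?b y" for x y using injb that by (rule injD)
  have "bij t"
  proof (rule bijI')
    show "t x = t y \<longleftrightarrow> x = y" for x y using t injd by (metis injD)
    show "\<exists>x. y = t x" for y
    proof -
      have "lincomb ?b y \<in> range (lincomb d)" unfolding b(3)[symmetric] by blast
      then obtain x where "lincomb ?b y = lincomb d x" by blast
      then have "y = t x" by (intro binj) (simp add: t)
      then show ?thesis by blast
    qed
  qed
  moreover have "algebra_hom (coord_algebra S) (coord_algebra (base_change \<phi> ?J)) t"
    by (rule algebra_homI) (auto intro!: binj simp: t lincomb_add lincomb_scale homd homK)
  ultimately have 2: "algebra_iso (coord_algebra S) (coord_algebra (base_change \<phi> ?J))" by (intro algebra_isoI) simp_all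
  show ?thesis by (rule that[OF 1 2])
qed

theorem chevalley_form_is_Der:
  fixes A :: "('a, 'v) module" and \<Gamma> :: "('k, chevalley_index) table"
  assumes char: "CHAR('k) = 3" and A: "nonassoc_algebra A" and \<Gamma>: "chevalley_relations \<Gamma>"
    and iso: "algebra_iso (scalar_extension \<phi> A) (coord_algebra \<Gamma>)"
  obtains J and M :: "split_index => split_index => 'a" where "cross_product J M" "algebra_iso (Der J) A"
proof -
  interpret \<Gamma>: chevalley_char3 \<Gamma> by unfold_locales fact+
  obtain \<Delta> :: "('a, chevalley_index) table" where \<Delta>: "algebra_iso (coord_algebra \<Delta>) A"
    using scalar_extension_descent[OF scalar_map_axioms A iso] by blast
  have "algebra_iso (coord_algebra (base_change \<phi> \<Delta>)) (coord_algebra \<Gamma>)"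
    by (rule algebra_iso_trans[OF scalar_extension_coord[OF scalar_map_axioms \<Delta>] iso])
  then have "algebra_iso (coord_algebra \<Gamma>) (coord_algebra (base_change \<phi> \<Delta>))"
    by (rule algebra_iso_sym[OF closed_coord_algebra])
  then obtain f where f: "algebra_hom (coord_algebra \<Gamma>) (coord_algebra (base_change \<phi> \<Delta>)) f" and bij: "bij f"
    by (auto elim: algebra_isoE)
  obtain b where b: "ideal_embedding \<Gamma> split_sc b" "range (lincomb b) = {x. lincomb (killing_map \<Gamma>) x = 0}"
    by (rule \<Gamma>.split_ideal_embedding)
  note emb = ideal_embedding_coord_iso[OF b(1) f bij]
  have "range (\<lambda>x. f (lincomb b x)) = {x. lincomb (killing_map (base_change \<phi> \<Delta>)) x = 0}"
  proof -
    have surj: "\<exists>x. y = f x" for y using bij by (metis bij_def surj_def)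
    have kf: "lincomb (killing_map (base_change \<phi> \<Delta>)) (f x) = 0 \<longleftrightarrow> lincomb (killing_map \<Gamma>) x = 0" for x
      unfolding killing_map_kernel using killing_coord_iso[OF f bij] surj by metis
    have "y \<in> range (\<lambda>x. f (lincomb b x)) \<longleftrightarrow> lincomb (killing_map (base_change \<phi> \<Delta>)) y = 0" for y
    proof -
      obtain x where y: "y = f x" using surj by blast
      have "y \<in> range (\<lambda>x. f (lincomb b x)) \<longleftrightarrow> x \<in> range (lincomb b)"
        unfolding y using bij by (auto simp: bij_def inj_eq)
      then show ?thesis unfolding b(2) y kf by simp
    qed
    then show ?thesis by blast
  qed
  then have rg: "range (lincomb (\<lambda>k. f (b k))) = {x. lincomb (killing_map (base_change \<phi> \<Delta>)) x = 0}"
    unfolding emb(2) .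
  obtain J e where J: "ideal_embedding \<Delta> J e" "algebra_iso (coord_algebra split_sc) (coord_algebra (base_change \<phi> (J :: ('a, split_index) table)))"
    by (rule ideal_embedding_descent[OF emb(1) rg])
  obtain t where t: "algebra_hom (coord_algebra split_sc) (coord_algebra (base_change \<phi> J)) t" "bij t"
    using J(2) by (auto elim: algebra_isoE)
  obtain N where N: "cross_product (base_change \<phi> J) N"
    by (rule cross_product_transport[OF cross_product_split[OF char] t]) blast
  have "CARD(split_index) > 2" by simp
  from cross_product_descent[OF N this] obtain M where M: "cross_product J M" by blast
  have "algebra_iso (coord_algebra \<Gamma>) (Der (split_sc :: ('k, split_index) table))"
    by (rule ideal_embedding_iso_Der_split[OF char b(1) card_chevalley_index])
  also have "algebra_iso (Der (split_sc :: ('k, split_index) table)) (Der (base_change \<phi> J))"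
    by (rule derivation_algebra_cong[OF nonassoc_coord_algebra nonassoc_coord_algebra J(2)])
  finally (algebra_iso_trans) have "algebra_iso (coord_algebra \<Gamma>) (Der (base_change \<phi> J))" .
  then obtain D :: "('a, chevalley_index) table" where D: "algebra_iso (coord_algebra D) (Der J)"
    using Der_descent by blast
  have "algebra_iso (coord_algebra \<Delta>) (Der J)" by (rule ideal_embedding_iso_Der[OF J(1) D]) simp
  then have "algebra_iso (Der J) (coord_algebra \<Delta>)" by (rule algebra_iso_sym[OF closed_coord_algebra])
  then show ?thesis using that M algebra_iso_trans[OF _ \<Delta>] by blast
qed

end

section \<open>Existence of a Chevalley basis\<close>

subsection \<open>Sparse integer matrices\<close>

text \<open>
  Lists of entries (coefficient, row, column). The matrices below have at most six nonzero entries, so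
  commutators of lists are small enough to be evaluated by rewriting.
\<close>

type_synonym sparse = "(int \<times> split_index \<times> split_index) list"

definition sparse_coeff :: "sparse => split_index \<times> split_index => int" where
  "sparse_coeff A p = sum_list (map (\<lambda>t. if snd t = p then fst t else 0) A)"

definition sparse_scale :: "int => sparse => sparse" where
  "sparse_scale n A = map (\<lambda>t. (n * fst t, snd t)) A"

definition sparse_eq :: "sparse => sparse => bool" where
  "sparse_eq A B \<longleftrightarrow> list_all (\<lambda>t. sparse_coeff A (snd t) = sparse_coeff B (snd t)) (A @ B)"

fun entry_commutator :: "int \<times> split_index \<times> split_index => int \<times> split_index \<times> split_index => sparse" where
  "entry_commutator (c, i, j) (d, k, l) =
     (if j = k then [(c * d, i, l)] else []) @ (if l = i then [(- (c * d), k, j)] else [])"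

definition sparse_commutator :: "sparse => sparse => sparse" where
  "sparse_commutator A B = concat (map (\<lambda>s. concat (map (entry_commutator s) B)) A)"

definition sparse_mat :: "sparse => complex^(split_index \<times> split_index)" where
  "sparse_mat A = (\<chi> p. of_int (sparse_coeff A p))"

lemma sparse_mat_simps:
  "sparse_mat [] = 0" "sparse_mat (A @ B) = sparse_mat A + sparse_mat B"
  "sparse_mat (t # A) = of_int (fst t) *s axis (snd t) 1 + sparse_mat A"
  "sparse_mat (sparse_scale n A) = of_int n *s sparse_mat A"
proof -
  show "sparse_mat [] = 0" "sparse_mat (A @ B) = sparse_mat A + sparse_mat B"
    "sparse_mat (t # A) = of_int (fst t) *s axis (snd t) 1 + sparse_mat A"
    by (auto simp: sparse_mat_def sparse_coeff_def vec_eq_iff axis_def)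
  have "sparse_coeff (sparse_scale n A) p = n * sparse_coeff A p" for p
    by (induct A) (auto simp: sparse_coeff_def sparse_scale_def distrib_left)
  then show "sparse_mat (sparse_scale n A) = of_int n *s sparse_mat A"
    by (simp add: sparse_mat_def vec_eq_iff)
qed

lemma sparse_eqD:
  assumes "sparse_eq A B"
  shows "sparse_mat A = sparse_mat B"
proof -
  have 0: "sparse_coeff C p = 0" if "p \<notin> snd ` set C" for C p
    using that by (induct C) (auto simp: sparse_coeff_def)
  have "sparse_coeff A p = sparse_coeff B p" for p
  proof (cases "p \<in> snd ` set (A @ B)")
    case True
    then show ?thesis using assms unfolding sparse_eq_def list_all_iff by blast
  next
    case False
    then have n: "p \<notin> snd ` set A" "p \<notin> snd ` set B" by auto
    show ?thesis using 0[OF n(1)] 0[OF n(2)] by simp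
  qed
  then show ?thesis by (simp add: sparse_mat_def)
qed

lemma commutator_axis:
  "commutator_mat (axis (i, j) 1) (axis (k, l) 1 :: complex^(split_index \<times> split_index)) =
     (if j = k then axis (i, l) 1 else 0) - (if l = i then axis (k, j) 1 else 0)"
proof -
  have s: "(\<Sum>m\<in>UNIV. axis (i, j) (1::complex) $ (a, m) * axis (k, l) 1 $ (m, b)) = (if j = k then axis (i, l) 1 else 0) $ (a, b)"
    for i j k l a b :: split_index
  proof -
    have "(\<Sum>m\<in>UNIV. axis (i, j) (1::complex) $ (a, m) * axis (k, l) 1 $ (m, b)) =
        (\<Sum>m\<in>UNIV. if m = j then (if j = k \<and> i = a \<and> l = b then 1 else 0) else 0)"
      by (rule sum.cong) (auto simp: axis_def)
    then show ?thesis by (auto simp: axis_def)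
  qed
  show ?thesis unfolding commutator_mat_def s by (simp add: vec_eq_iff)
qed

lemma commutator_sparse: "commutator_mat (sparse_mat A) (sparse_mat B) = sparse_mat (sparse_commutator A B)"
proof (induct A)
  case Nil
  have "commutator_mat (0 *s 0) v = 0" for v :: "complex^(split_index \<times> split_index)" unfolding commutator_mat_linear by simp
  then show ?case by (simp add: sparse_commutator_def sparse_mat_simps)
next
  case (Cons s A)
  have "commutator_mat (of_int (fst s) *s axis (snd s) 1) (sparse_mat B) = sparse_mat (concat (map (entry_commutator s) B))"
  proof (induct B)
    case Nil
    have "commutator_mat v (0 *s 0) = 0" for v :: "complex^(split_index \<times> split_index)" unfolding commutator_mat_linear by simp
    then show ?case by (simp add: sparse_mat_simps)
  next
    case (Cons t B)
    obtain c i j d k l where s: "s = (c, i, j)" and t: "t = (d, k, l)" by (metis prod_cases3)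
    show ?case
      using Cons by (simp add: sparse_mat_simps commutator_mat_linear s t commutator_axis vector_scale_scale
          vector_sneg_minus1[symmetric] vector_ssub_ldistrib mult.commute)
  qed
  then show ?case using Cons by (simp add: sparse_commutator_def sparse_mat_simps commutator_mat_linear)
qed

subsection \<open>The seven-dimensional representation\<close>

text \<open>
  The action of the split Lie algebra of type \<open>G\<^sub>2\<close> on the trace zero octonions, in a basis
  of weight vectors. Long root vectors permute weights within \<open>E\<close> and within \<open>F\<close>,
  short ones also pass through \<open>H\<close>. The coefficients 2 make all entries integral with structure
  constants of the required absolute values.
\<close>

definition root_matrix :: "int \<times> int => sparse" where
  "root_matrix \<alpha> =
    (if \<alpha> = (1, 0) then [(2, E1, H), (1, H, F1), (1, F2, E3), (- 1, F3, E2)]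
     else if \<alpha> = (1, 1) then [(2, E2, H), (1, H, F2), (1, F3, E1), (- 1, F1, E3)]
     else if \<alpha> = (- 2, - 1) then [(2, E3, H), (1, H, F3), (1, F1, E2), (- 1, F2, E1)]
     else if \<alpha> = (- 1, 0) then [(2, F1, H), (1, H, E1), (- 1, E2, F3), (1, E3, F2)]
     else if \<alpha> = (- 1, - 1) then [(2, F2, H), (1, H, E2), (- 1, E3, F1), (1, E1, F3)]
     else if \<alpha> = (2, 1) then [(2, F3, H), (1, H, E3), (- 1, E1, F2), (1, E2, F1)]
     else if \<alpha> = (0, 1) then [(1, E2, E1), (- 1, F1, F2)]
     else if \<alpha> = (3, 1) then [(1, E1, E3), (- 1, F3, F1)]
     else if \<alpha> = (3, 2) then [(1, E2, E3), (- 1, F3, F2)]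
     else if \<alpha> = (0, - 1) then [(1, E1, E2), (- 1, F2, F1)]
     else if \<alpha> = (- 3, - 1) then [(1, E3, E1), (- 1, F1, F3)]
     else [(1, E3, E2), (- 1, F2, F3)])"

definition cartan_matrix :: "int \<times> int => sparse" where
  "cartan_matrix \<alpha> =
    (if \<alpha> = (1, 0) then [(2, E1, E1), (- 1, E2, E2), (- 1, E3, E3), (- 2, F1, F1), (1, F2, F2), (1, F3, F3)]
     else [(- 1, E1, E1), (1, E2, E2), (1, F1, F1), (- 1, F2, F2)])"

lemma matrix_cartan_cartan:
  "\<forall>\<alpha>\<in>G2_simple_roots. \<forall>\<beta>\<in>G2_simple_roots. sparse_eq (sparse_commutator (cartan_matrix \<alpha>) (cartan_matrix \<beta>)) []"
  by code_simp

lemma matrix_cartan_root: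
  "\<forall>\<alpha>\<in>G2_simple_roots. \<forall>\<beta>\<in>G2_roots.
     sparse_eq (sparse_commutator (cartan_matrix \<alpha>) (root_matrix \<beta>)) (sparse_scale (G2_cartan \<beta> \<alpha>) (root_matrix \<beta>))"
  by code_simp

lemma matrix_opposite:
  "\<forall>\<alpha>\<in>G2_roots. sparse_eq (sparse_commutator (root_matrix \<alpha>) (root_matrix (- \<alpha>)))
     (sparse_scale (fst (coroot_coeff \<alpha>)) (cartan_matrix (1, 0)) @ sparse_scale (snd (coroot_coeff \<alpha>)) (cartan_matrix (0, 1)))"
  by code_simp

lemma matrix_root_root:
  "\<forall>\<alpha>\<in>G2_roots. \<forall>\<beta>\<in>G2_roots. \<alpha> + \<beta> \<in> G2_roots -->
     (\<exists>s\<in>{1, - 1}. sparse_eq (sparse_commutator (root_matrix \<alpha>) (root_matrix \<beta>))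
        (sparse_scale (s * int (Max (set (G2_string_list \<alpha> \<beta>)) + 1)) (root_matrix (\<alpha> + \<beta>))))"
  by code_simp

lemma matrix_root_other:
  "\<forall>\<alpha>\<in>G2_roots. \<forall>\<beta>\<in>G2_roots. \<alpha> + \<beta> \<noteq> 0 \<and> \<alpha> + \<beta> \<notin> G2_roots -->
     sparse_eq (sparse_commutator (root_matrix \<alpha>) (root_matrix \<beta>)) []"
  by code_simp

text \<open>
  The first listed entry of a root matrix occurs in no other basis matrix, which gives linear independence.
\<close>

lemma matrix_coeff_root:
  "\<forall>\<alpha>\<in>G2_roots. fst (hd (root_matrix \<alpha>)) \<noteq> 0 \<and>
     (\<forall>\<beta>\<in>G2_roots. sparse_coeff (root_matrix \<beta>) (snd (hd (root_matrix \<alpha>))) = (if \<beta> = \<alpha> then fst (hd (root_matrix \<alpha>)) else 0)) \<and>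
     (\<forall>\<beta>\<in>G2_simple_roots. sparse_coeff (cartan_matrix \<beta>) (snd (hd (root_matrix \<alpha>))) = 0)"
  by code_simp

lemma matrix_coeff_diagonal:
  "sparse_coeff (cartan_matrix (1, 0)) (E1, E1) = 2" "sparse_coeff (cartan_matrix (1, 0)) (E2, E2) = - 1"
  "sparse_coeff (cartan_matrix (0, 1)) (E1, E1) = - 1" "sparse_coeff (cartan_matrix (0, 1)) (E2, E2) = 1"
  by code_simp+

definition chevalley_matrix :: "chevalley_index => complex^(split_index \<times> split_index)" where
  "chevalley_matrix k = sparse_mat (case_sum cartan_matrix root_matrix (Rep_chevalley_index k))"

lemma chevalley_matrix_simps [simp]:
  "\<alpha> \<in> G2_simple_roots ==> chevalley_matrix (cartan_index \<alpha>) = sparse_mat (cartan_matrix \<alpha>)"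
  "\<alpha> \<in> G2_roots ==> chevalley_matrix (root_index \<alpha>) = sparse_mat (root_matrix \<alpha>)"
  by (simp_all add: chevalley_matrix_def Rep_root_index Rep_cartan_index)

lemma inj_chevalley_matrix: "inj (lincomb chevalley_matrix)"
proof -
  have zero: "x = 0" if x: "lincomb chevalley_matrix x = 0" for x
  proof -
    have entry: "x $ cartan_index (1, 0) * of_int (sparse_coeff (cartan_matrix (1, 0)) p) +
        x $ cartan_index (0, 1) * of_int (sparse_coeff (cartan_matrix (0, 1)) p) +
        (\<Sum>\<beta>\<in>G2_roots. x $ root_index \<beta> * of_int (sparse_coeff (root_matrix \<beta>) p)) = 0" for p
    proof -
      have "lincomb chevalley_matrix x $ p = 0" by (simp add: x)
      then show ?thesis unfolding lincomb_def sum_chevalley_index by (simp add: sparse_mat_def)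
    qed
    have root: "x $ root_index \<alpha> = 0" if \<alpha>: "\<alpha> \<in> G2_roots" for \<alpha>
    proof -
      note c = matrix_coeff_root[rule_format, OF \<alpha>]
      let ?p = "snd (hd (root_matrix \<alpha>))" and ?c = "fst (hd (root_matrix \<alpha>))"
      have "(\<Sum>\<beta>\<in>G2_roots. x $ root_index \<beta> * of_int (sparse_coeff (root_matrix \<beta>) ?p)) =
          (\<Sum>\<beta>\<in>G2_roots. if \<beta> = \<alpha> then x $ root_index \<alpha> * of_int ?c else 0)"
        using c by (intro sum.cong) auto
      also have "\<dots> = x $ root_index \<alpha> * of_int ?c" using \<alpha> by simp
      finally show ?thesis using entry[of ?p] c by simp
    qed
    then have "2 * x $ cartan_index (1, 0) - x $ cartan_index (0, 1) = 0" "- x $ cartan_index (1, 0) + x $ cartan_index (0, 1) = 0"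
      using entry[of "(E1, E1)"] entry[of "(E2, E2)"] by (simp_all add: matrix_coeff_diagonal)
    then have cartan: "x $ cartan_index (1, 0) = 0" "x $ cartan_index (0, 1) = 0" by simp_all
    have "x $ k = 0" for k
      by (cases k rule: chevalley_index_cases) (use root cartan in \<open>auto simp: G2_simple_roots_def\<close>)
    then show ?thesis by (simp add: vec_eq_iff)
  qed
  show ?thesis
  proof (rule injI)
    fix x y assume "lincomb chevalley_matrix x = lincomb chevalley_matrix y"
    then have "lincomb chevalley_matrix (x + (- 1) *s y) = 0" unfolding lincomb_add lincomb_scale by simp
    from zero[OF this] show "x = y" by simp
  qed
qed

text \<open>
  Commutators of matrices satisfy the Jacobi identity, so an independent family of matrices closed under
  commutators yields a Lie table. Every value of the commutators is an instance of the evaluated matrix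
  identities.
\<close>

theorem exists_chevalley_relations:
  "\<exists>G :: (complex, chevalley_index) table. chevalley_relations G"
proof -
  let ?b = "lincomb chevalley_matrix"
  obtain r where r: "\<And>c. lincomb r (?b c) = c" using lincomb_left_inverse[OF inj_chevalley_matrix] by blast
  define m where "m x y = lincomb r (commutator_mat (?b x) (?b y))" for x y
  have m: "m = sc_mult (\<lambda>i j. m (axis i 1) (axis j 1))" (is "_ = sc_mult ?G")
    by (rule bilinear_eq_sc_mult) (simp_all add: m_def commutator_mat_linear lincomb_add lincomb_scale)
  have G: "?G i j = v" if "commutator_mat (chevalley_matrix i) (chevalley_matrix j) = ?b v" for i j v
    using that by (simp add: m_def r)
  let ?M = chevalley_matrix
  note simps = commutator_sparse sparse_mat_simps lincomb_scale lincomb_add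
  have C1: "commutator_mat (?M (cartan_index \<alpha>)) (?M (cartan_index \<beta>)) = ?b 0"
    if "\<alpha> \<in> G2_simple_roots" "\<beta> \<in> G2_simple_roots" for \<alpha> \<beta>
    using that sparse_eqD[OF matrix_cartan_cartan[rule_format, OF that]] by (simp add: simps)
  have C2: "commutator_mat (?M (cartan_index \<alpha>)) (?M (root_index \<beta>)) = ?b (of_int (G2_cartan \<beta> \<alpha>) *s root_vec \<beta>)"
    if "\<alpha> \<in> G2_simple_roots" "\<beta> \<in> G2_roots" for \<alpha> \<beta>
    using that sparse_eqD[OF matrix_cartan_root[rule_format, OF that]] by (simp add: simps)
  have C3: "commutator_mat (?M (root_index \<alpha>)) (?M (root_index (- \<alpha>))) = ?b (coroot_vec \<alpha>)" if "\<alpha> \<in> G2_roots" for \<alpha>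
    using that G2_root_basics(2)[OF that] sparse_eqD[OF matrix_opposite[rule_format, OF that]] by (simp add: simps)
  have C4: "\<exists>s\<in>{1, - 1}. commutator_mat (?M (root_index \<alpha>)) (?M (root_index \<beta>)) =
      ?b (of_int (s * int (G2_string \<alpha> \<beta> + 1)) *s root_vec (\<alpha> + \<beta>))"
    if h: "\<alpha> \<in> G2_roots" "\<beta> \<in> G2_roots" "\<alpha> + \<beta> \<in> G2_roots" for \<alpha> \<beta>
  proof -
    obtain s where s: "s \<in> {1, - 1}" "sparse_eq (sparse_commutator (root_matrix \<alpha>) (root_matrix \<beta>))
        (sparse_scale (s * int (G2_string \<alpha> \<beta> + 1)) (root_matrix (\<alpha> + \<beta>)))"
      using matrix_root_root h unfolding G2_string_eq_Max[OF h(1,2)] by blast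
    show ?thesis
      by (rule bexI[OF _ s(1)]) (use h sparse_eqD[OF s(2)] in \<open>simp only: simps chevalley_matrix_simps lincomb_axis\<close>)
  qed
  have C5: "commutator_mat (?M (root_index \<alpha>)) (?M (root_index \<beta>)) = ?b 0"
    if "\<alpha> \<in> G2_roots" "\<beta> \<in> G2_roots" "\<alpha> + \<beta> \<noteq> 0" "\<alpha> + \<beta> \<notin> G2_roots" for \<alpha> \<beta>
    using that sparse_eqD[of "sparse_commutator (root_matrix \<alpha>) (root_matrix \<beta>)" "[]"] matrix_root_other by (simp add: simps)
  have basis: "\<exists>v. commutator_mat (?M i) (?M j) = ?b v" for i j
  proof -
    have neg: "commutator_mat v w = - commutator_mat w v" for v w :: "complex^(split_index \<times> split_index)"
      by (simp add: commutator_mat_def vec_eq_iff)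
    have bneg: "- ?b v = ?b (- v)" for v using lincomb_scale[of ?M "- 1" v] by (simp add: vector_sneg_minus1[symmetric])
    have cart: "\<exists>v. commutator_mat (?M (cartan_index \<alpha>)) (?M j) = ?b v" if "\<alpha> \<in> G2_simple_roots" for j \<alpha>
      by (cases j rule: chevalley_index_cases) (use C1[OF that] C2[OF that] in blast)+
    show ?thesis
    proof (cases i rule: chevalley_index_cases)
      case (1 \<alpha>) then show ?thesis using cart by blast
    next
      case i: (2 \<alpha>)
      show ?thesis
      proof (cases j rule: chevalley_index_cases)
        case (1 \<beta>)
        then obtain v where "commutator_mat (?M j) (?M i) = ?b v" using cart by blast
        then show ?thesis using neg bneg by metis
      next
        case j: (2 \<beta>)
        consider "\<alpha> + \<beta> \<in> G2_roots" | "\<beta> = - \<alpha>" | "\<alpha> + \<beta> \<noteq> 0" "\<alpha> + \<beta> \<notin> G2_roots"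
          by (metis add_eq_0_iff)
        then show ?thesis using C3 C4 C5 i j by cases blast+
      qed
    qed
  qed
  have bm: "?b (m x y) = commutator_mat (?b x) (?b y)" for x y
  proof (rule bilinear_eqI[where f = "\<lambda>x y. ?b (m x y)" and g = "\<lambda>x y. commutator_mat (?b x) (?b y)"])
    fix i j
    obtain v where "commutator_mat (chevalley_matrix i) (chevalley_matrix j) = ?b v" using basis by blast
    then show "?b (m (axis i 1) (axis j 1)) = commutator_mat (?b (axis i 1)) (?b (axis j 1))" by (simp add: m_def r)
  qed (simp_all add: m_def commutator_mat_linear lincomb_add lincomb_scale)
  have inj: "x = y" if "?b x = ?b y" for x y using r that by metis
  have jac: "commutator_mat u (commutator_mat v w) + commutator_mat v (commutator_mat w u) + commutator_mat w (commutator_mat u v) = 0"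
    for u v w :: "complex^(split_index \<times> split_index)"
  proof -
    have "op_mat (mat_op (commutator_mat u (commutator_mat v w))) + op_mat (mat_op (commutator_mat v (commutator_mat w u)))
        + op_mat (mat_op (commutator_mat w (commutator_mat u v))) = 0"
    proof -
      have d: "mat_op z (x - y) = mat_op z x - mat_op z y" for z :: "complex^(split_index \<times> split_index)" and x y
        using mat_op_linear(1)[of z "x - y" y] by (simp add: algebra_simps)
      show ?thesis by (simp add: op_mat_def vec_eq_iff mat_op_commutator_mat d)
    qed
    then show ?thesis by (simp only: op_mat_mat_op)
  qed
  have self: "commutator_mat v v = 0" for v :: "complex^(split_index \<times> split_index)"
    by (simp add: commutator_mat_def vec_eq_iff)
  have "lie_sc ?G"
    unfolding lie_sc_def m[symmetric]
    by (intro conjI allI inj) (simp_all add: bm lincomb_add self jac)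
  moreover have "\<exists>s\<in>{1, - 1}. ?G (root_index \<alpha>) (root_index \<beta>) = of_int (s * int (G2_string \<alpha> \<beta> + 1)) *s root_vec (\<alpha> + \<beta>)"
    if "\<alpha> \<in> G2_roots" "\<beta> \<in> G2_roots" "\<alpha> + \<beta> \<in> G2_roots" for \<alpha> \<beta>
    using C4[OF that] G by blast
  ultimately have "chevalley_relations ?G"
    unfolding chevalley_relations_def using G[OF C1] G[OF C2] G[OF C3] G[OF C5] by blast
  then show ?thesis by blast
qed

lemma cartan_coroot: "\<forall>\<alpha>\<in>G2_roots. \<forall>\<beta>\<in>G2_roots.
    fst (coroot_coeff \<alpha>) * G2_cartan \<beta> (1, 0) + snd (coroot_coeff \<alpha>) * G2_cartan \<beta> (0, 1) = G2_cartan \<beta> \<alpha>"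
  by code_simp

lemma coroot_simple: "coroot_coeff (1, 0) = (1, 0)" "coroot_coeff (0, 1) = (0, 1)"
  by (simp_all add: coroot_coeff_def G2_cartan_def)

text \<open>
  The elements \<open>h \<alpha>\<close> for nonsimple \<open>\<alpha>\<close> are defined from the coroot
  coefficients.
\<close>

theorem chevalley_basis_of_relations:
  fixes L (structure) and G :: "(complex, chevalley_index) table"
  assumes G: "chevalley_relations G" and A: "nonassoc_algebra L"
    and hom: "algebra_hom (coord_algebra G) L g" and bij: "bij_betw g UNIV (carrier L)"
  obtains h e where "G2_chevalley_basis L h e"
proof -
  note hD = algebra_homD(2-4)[OF hom, simplified]
  interpret A: abelian_group L by (rule nonassoc_algebraD(2)[OF A])
  have lie: "lie_sc G" using G unfolding chevalley_relations_def by blast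
  have mem: "g v \<in> carrier L" for v using algebra_homD(1)[OF hom] by simp
  have "g 0 \<oplus> g 0 = g 0" using hD(1)[of 0 0] by simp
  then have g0: "g 0 = \<zero>" using mem A.add.r_cancel_one by blast
  have surj: "\<exists>v. x = g v" if "x \<in> carrier L" for x using that bij unfolding bij_betw_def by blast
  have L: "lie_algebra L"
    unfolding lie_algebra_def
  proof (intro conjI ballI)
    fix x assume "x \<in> carrier L"
    then obtain u where "x = g u" using surj by blast
    then show "x \<otimes> x = \<zero>" using lie by (simp add: hD(3)[symmetric] lie_sc_def g0)
  next
    fix x y z assume "x \<in> carrier L" "y \<in> carrier L" "z \<in> carrier L"
    then obtain u v w where "x = g u" "y = g v" "z = g w" using surj by meson
    then show "x \<otimes> (y \<otimes> z) \<oplus> y \<otimes> (z \<otimes> x) \<oplus> z \<otimes> (x \<otimes> y) = \<zero>"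
      using lie by (simp add: hD(1,3)[symmetric] lie_sc_def g0)
  qed (rule A)
  define T where "T \<alpha> = of_int (fst (coroot_coeff \<alpha>)) *s axis (cartan_index (1, 0)) (1 :: complex)
      + of_int (snd (coroot_coeff \<alpha>)) *s cartan_vec (0, 1)" for \<alpha>
  define h where "h \<alpha> = g (T \<alpha>)" for \<alpha>
  define e where "e \<alpha> = g (root_vec \<alpha>)" for \<alpha>
  have T: "T \<alpha> = cartan_vec \<alpha>" if "\<alpha> \<in> G2_simple_roots" for \<alpha>
    using that by (auto simp: T_def G2_simple_roots_def coroot_simple)
  have Tact: "sc_mult G (T \<alpha>) v = (\<chi> k. of_int (fst (coroot_coeff \<alpha>) * G2_cartan (weight k) (1, 0) +
      snd (coroot_coeff \<alpha>) * G2_cartan (weight k) (0, 1)) * v $ k)" for \<alpha> v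
    by (simp add: T_def sc_mult_add sc_mult_scale cartan_action[OF G] vec_eq_iff algebra_simps)
  have "algebra_basis L G2_chevalley_indices (case_sum h e)"
  proof (rule algebra_basis_of_iso[OF A bij hD(1,2)])
    have "bij_betw (the_inv_into UNIV Rep_chevalley_index) G2_chevalley_indices UNIV"
      by (rule bij_betw_the_inv_into[OF bij_Rep_chevalley_index])
    then show "bij_betw Abs_chevalley_index G2_chevalley_indices UNIV"
      by (rule bij_betw_cong[THEN iffD1, rotated])
        (metis Abs_chevalley_index_inverse Rep_chevalley_index_inject injI the_inv_into_f_f UNIV_I)
    show "case_sum h e i = g (axis (Abs_chevalley_index i) 1)" if "i \<in> G2_chevalley_indices" for i
      using that T by (auto simp: G2_chevalley_indices_def h_def e_def cartan_index_def root_index_def)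
  qed
  moreover have "h \<alpha> \<otimes> h \<beta> = \<zero>" if "\<alpha> \<in> G2_roots" "\<beta> \<in> G2_roots" for \<alpha> \<beta>
  proof -
    have "T \<beta> $ k = 0 \<or> weight k = 0" for k
      by (cases k rule: chevalley_index_cases) (auto simp: T_def axis_def)
    moreover have "G2_cartan 0 \<gamma> = 0" for \<gamma> by (cases \<gamma>) (simp add: G2_cartan_def zero_prod_def)
    ultimately have z: "T \<beta> $ k = 0 \<or> G2_cartan (weight k) (1, 0) = 0 \<and> G2_cartan (weight k) (0, 1) = 0" for k by metis
    have "sc_mult G (T \<alpha>) (T \<beta>) $ k = 0" for k using z[of k] unfolding Tact by (elim disjE conjE) simp_all
    then have "sc_mult G (T \<alpha>) (T \<beta>) = 0" by (simp add: vec_eq_iff)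
    then show ?thesis by (simp add: h_def hD(3)[symmetric] g0)
  qed
  moreover have "h \<alpha> \<otimes> e \<beta> = of_int (G2_cartan \<beta> \<alpha>) \<odot> e \<beta>" if "\<alpha> \<in> G2_roots" "\<beta> \<in> G2_roots" for \<alpha> \<beta>
  proof -
    have "sc_mult G (T \<alpha>) (root_vec \<beta>) = of_int (G2_cartan \<beta> \<alpha>) *s root_vec \<beta>"
      using cartan_coroot[rule_format, OF that] that unfolding Tact
      by (auto simp: vec_eq_iff axis_def of_int_mult[symmetric] of_int_add[symmetric] simp del: of_int_mult of_int_add)
    then show ?thesis by (simp add: h_def e_def hD(2,3)[symmetric])
  qed
  moreover have "e \<alpha> \<otimes> e (- \<alpha>) = h \<alpha>" if "\<alpha> \<in> G2_roots" for \<alpha>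
  proof -
    have "G (root_index \<alpha>) (root_index (- \<alpha>)) = T \<alpha>" using G that unfolding chevalley_relations_def T_def by blast
    then show ?thesis by (simp add: h_def e_def hD(3)[symmetric])
  qed
  moreover have "\<exists>s\<in>{1, - 1}. e \<alpha> \<otimes> e \<beta> = (s * of_nat (G2_string \<alpha> \<beta> + 1)) \<odot> e (\<alpha> + \<beta>)"
    if ab: "\<alpha> \<in> G2_roots" "\<beta> \<in> G2_roots" "\<alpha> + \<beta> \<in> G2_roots" for \<alpha> \<beta>
  proof -
    obtain s where s: "s \<in> {1, - 1}" "G (root_index \<alpha>) (root_index \<beta>) = of_int (s * int (G2_string \<alpha> \<beta> + 1)) *s root_vec (\<alpha> + \<beta>)"
      using G ab unfolding chevalley_relations_def by blast
    have "e \<alpha> \<otimes> e \<beta> = (of_int s * of_nat (G2_string \<alpha> \<beta> + 1)) \<odot> e (\<alpha> + \<beta>)"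
      by (simp add: e_def hD(2,3)[symmetric] s(2))
    moreover have "(of_int s :: complex) \<in> {1, - 1}" using s(1) by auto
    ultimately show ?thesis by blast
  qed
  moreover have "e \<alpha> \<otimes> e \<beta> = \<zero>" if "\<alpha> \<in> G2_roots" "\<beta> \<in> G2_roots" "\<alpha> + \<beta> \<noteq> 0" "\<alpha> + \<beta> \<notin> G2_roots" for \<alpha> \<beta>
  proof -
    have "G (root_index \<alpha>) (root_index \<beta>) = 0" using G that unfolding chevalley_relations_def by blast
    then show ?thesis by (simp add: e_def hD(3)[symmetric] g0)
  qed
  ultimately have "G2_chevalley_basis L h e" unfolding G2_chevalley_basis_def using L by blast
  then show ?thesis by (rule that)
qed

section \<open>Copies on another carrier type\<close>

text \<open>
  The copy of an algebra under an injection. Isomorphism classes only contain algebras on functions from the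
  natural numbers, so tables and octonions are moved there.
\<close>

definition transport :: "('r, 'v) module => ('v => 'w) => ('r, 'w) module" where
  "transport A f =
     \<lparr>carrier = f ` carrier A,
      mult = (\<lambda>x y. f (the_inv_into (carrier A) f x \<otimes>\<^bsub>A\<^esub> the_inv_into (carrier A) f y)), one = f \<one>\<^bsub>A\<^esub>,
      zero = f \<zero>\<^bsub>A\<^esub>, add = (\<lambda>x y. f (the_inv_into (carrier A) f x \<oplus>\<^bsub>A\<^esub> the_inv_into (carrier A) f y)),
      smult = (\<lambda>c x. f (c \<odot>\<^bsub>A\<^esub> the_inv_into (carrier A) f x))\<rparr>"

lemma transport_iso:
  assumes "inj_on f (carrier A)"
  shows "algebra_hom A (transport A f) f" and "bij_betw f (carrier A) (carrier (transport A f))"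
  using assms by (auto simp: transport_def bij_betw_def the_inv_into_f_f intro!: algebra_homI)

lemma nonassoc_algebra_image:
  fixes A :: "('r::comm_ring_1, 'v) module" (structure) and B :: "('r, 'w) module"
  assumes A: "nonassoc_algebra A" and hom: "algebra_hom A B f" and bij: "bij_betw f (carrier A) (carrier B)"
    and zero: "f \<zero> = \<zero>\<^bsub>B\<^esub>"
  shows "nonassoc_algebra B"
proof -
  note D = nonassoc_algebraD[OF A]
  interpret A: abelian_group A by (rule D(2))
  have car: "carrier B = f ` carrier A" using bij by (simp add: bij_betw_def)
  note fD = algebra_homD(2-4)[OF hom, symmetric]
  have mult: "x \<otimes> y \<in> carrier A"
    "(x \<oplus> y) \<otimes> z = x \<otimes> z \<oplus> y \<otimes> z" "z \<otimes> (x \<oplus> y) = z \<otimes> x \<oplus> z \<otimes> y"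
    "(c \<odot> x) \<otimes> y = c \<odot> (x \<otimes> y)" "x \<otimes> (c \<odot> y) = c \<odot> (x \<otimes> y)"
    if "x \<in> carrier A" "y \<in> carrier A" "z \<in> carrier A" for x y z c
    using A that unfolding nonassoc_algebra_def by blast+
  show ?thesis
    unfolding nonassoc_algebra_def
  proof (intro conjI)
    show "Module.module (ring_of_type_algebra :: 'r ring) B"
    proof (rule module_ring_of_typeI)
      show "abelian_group B"
      proof (rule abelian_groupI)
        fix x assume "x \<in> carrier B"
        then obtain u where u: "x = f u" "u \<in> carrier A" unfolding car by blast
        show "\<exists>y\<in>carrier B. y \<oplus>\<^bsub>B\<^esub> x = \<zero>\<^bsub>B\<^esub>"
          by (rule bexI[of _ "f (\<ominus> u)"]) (simp_all add: u fD car A.l_neg zero)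
      qed (auto simp: car fD zero[symmetric] A.a_ac)
    qed (auto simp: car fD D(3-7))
  qed (auto simp: car fD D(3) mult)
qed

lemma nonassoc_transport:
  assumes "nonassoc_algebra A" "inj_on f (carrier A)"
  shows "nonassoc_algebra (transport A f)"
  by (rule nonassoc_algebra_image[OF assms(1) transport_iso[OF assms(2)]]) (simp add: transport_def)

lemma cayley_transport:
  fixes C :: "('a::field, 'v) module" (structure)
  assumes C: "cayley_algebra C q" and inj: "inj_on f (carrier C)"
  shows "cayley_algebra (transport C f) (\<lambda>x. q (the_inv_into (carrier C) f x))"
proof -
  let ?T = "transport C f" and ?q = "\<lambda>x. q (the_inv_into (carrier C) f x)"
  have A: "nonassoc_algebra C" using C by (simp add: cayley_algebra_def)
  note D = nonassoc_algebraD[OF A]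
  interpret A: abelian_group C by (rule D(2))
  have T: "nonassoc_algebra ?T" by (rule nonassoc_transport[OF A inj])
  note tr = transport_iso[OF inj]
  note fD = algebra_homD(2-4)[OF tr(1), symmetric]
  have car: "carrier ?T = f ` carrier C" by (simp add: transport_def)
  have q: "?q (f x) = q x" if "x \<in> carrier C" for x using that by (simp add: the_inv_into_f_f[OF inj])
  have polar: "polar_form ?T ?q (f x) (f y) = polar_form C q x y" if "x \<in> carrier C" "y \<in> carrier C" for x y
    using that by (simp add: polar_form_def fD q)
  have one: "\<one>\<^bsub>?T\<^esub> = f \<one>" and zero: "\<zero>\<^bsub>?T\<^esub> = f \<zero>" by (simp_all add: transport_def)
  have mult: "x \<otimes> y \<in> carrier C" if "x \<in> carrier C" "y \<in> carrier C" for x y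
    using A that unfolding nonassoc_algebra_def by blast
  obtain b where b: "algebra_basis C {..<8::nat} b" using C unfolding cayley_algebra_def by blast
  obtain idx where idx: "bij_betw idx (UNIV :: split_index option set) {..<8::nat}"
    using finite_same_card_bij[of "UNIV :: split_index option set" "{..<8::nat}"] by (auto simp: card_UNIV_option)
  have "\<exists>G (g :: 'a^(split_index option) => 'v). algebra_hom (coord_algebra G) C g \<and> bij_betw g UNIV (carrier C)"
    by (rule algebra_basis_coord[OF A b idx]) blast
  then obtain G and g :: "'a^(split_index option) => 'v" where g: "algebra_hom (coord_algebra G) C g" "bij_betw g UNIV (carrier C)"
    by blast
  have gm: "g x \<in> carrier C" for x using algebra_homD(1)[OF g(1)] by simp
  have "algebra_basis ?T {..<8::nat} (\<lambda>i. f (g (axis (the_inv_into UNIV idx i) 1)))"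
  proof (rule algebra_basis_of_iso[OF T, where g = "\<lambda>x. f (g x)" and idx = "the_inv_into UNIV idx"])
    show "bij_betw (\<lambda>x. f (g x)) UNIV (carrier ?T)" using bij_betw_trans[OF g(2) tr(2)] by (simp add: o_def)
    show "bij_betw (the_inv_into UNIV idx) {..<8} UNIV" by (rule bij_betw_the_inv_into[OF idx])
  qed (use algebra_homD(2,3)[OF g(1)] gm in \<open>simp_all add: fD\<close>)
  then have "\<exists>b. algebra_basis ?T {..<8::nat} b" by blast
  moreover have "\<forall>x\<in>carrier ?T. \<one>\<^bsub>?T\<^esub> \<otimes>\<^bsub>?T\<^esub> x = x \<and> x \<otimes>\<^bsub>?T\<^esub> \<one>\<^bsub>?T\<^esub> = x" "\<one>\<^bsub>?T\<^esub> \<in> carrier ?T"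
    using C unfolding cayley_algebra_def by (auto simp: car one fD)
  moreover have "quadratic_form ?T ?q"
  proof -
    have "quadratic_form C q" using C unfolding cayley_algebra_def by blast
    then show ?thesis unfolding quadratic_form_def by (auto simp: car fD polar q D(3))
  qed
  moreover have "\<forall>x\<in>carrier ?T. \<forall>y\<in>carrier ?T. ?q (x \<otimes>\<^bsub>?T\<^esub> y) = ?q x * ?q y"
    using C unfolding cayley_algebra_def by (auto simp: car fD q mult)
  moreover have "\<forall>x\<in>carrier ?T. (\<forall>y\<in>carrier ?T. polar_form ?T ?q x y = 0) --> x = \<zero>\<^bsub>?T\<^esub>"
    using C unfolding cayley_algebra_def by (auto simp: car polar zero)
  ultimately show ?thesis unfolding cayley_algebra_def using T by blast
qed

lemma exists_embedding_coordinates: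
  "\<exists>f :: 'a::zero^'n::finite => nat => 'a. inj f"
proof -
  obtain e :: "'n => nat" where e: "inj e" using finite_imp_inj_to_nat_seg[OF finite[of "UNIV :: 'n set"]] by blast
  have "inj (\<lambda>x :: 'a^'n. \<lambda>k. if k \<in> range e then x $ inv_into UNIV e k else 0)"
  proof (rule injI)
    fix x y :: "'a^'n"
    assume h: "(\<lambda>k. if k \<in> range e then x $ inv_into UNIV e k else 0) = (\<lambda>k. if k \<in> range e then y $ inv_into UNIV e k else 0)"
    have "x $ i = y $ i" for i using fun_cong[OF h, of "e i"] e by simp
    then show "x = y" by (simp add: vec_eq_iff)
  qed
  then show ?thesis by blast
qed

lemma exists_embedding_octonions:
  "\<exists>f :: 'a::zero \<times> ('a^'n::finite) => nat => 'a. inj f"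
proof -
  obtain f :: "'a^'n => nat => 'a" where f: "inj f" using exists_embedding_coordinates by blast
  have "inj (\<lambda>s :: 'a \<times> ('a^'n). case_nat (fst s) (f (snd s)))"
  proof (rule injI)
    fix s t :: "'a \<times> ('a^'n)" assume h: "case_nat (fst s) (f (snd s)) = case_nat (fst t) (f (snd t))"
    have "f (snd s) k = f (snd t) k" for k using fun_cong[OF h, of "Suc k"] by simp
    then have "snd s = snd t" using f by (metis ext injD)
    moreover have "fst s = fst t" using fun_cong[OF h, of 0] by simp
    ultimately show "s = t" by (simp add: prod_eq_iff)
  qed
  then show ?thesis by blast
qed

lemma coord_algebra_copy:
  fixes G :: "('a::field, 'n::finite) table"
  obtains A :: "('a, nat => 'a) module" and f where "nonassoc_algebra A" "algebra_hom (coord_algebra G) A f"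
    "bij_betw f UNIV (carrier A)" "algebra_iso (coord_algebra G) A"
proof -
  obtain f :: "'a^'n => nat => 'a" where f: "inj f" using exists_embedding_coordinates by blast
  have inj: "inj_on f (carrier (coord_algebra G))" using f by simp
  note t = transport_iso[OF inj] nonassoc_transport[OF nonassoc_coord_algebra inj]
  show ?thesis using that[OF t(3,1)] t(2) algebra_isoI[OF t(1,2)] by simp
qed

section \<open>Twisted forms and scalar extension to the algebraic closure\<close>

lemma field_map_to_ac: "field_map (to_ac :: 'a::field => 'a alg_closure)"
  by unfold_locales simp_all

lemma base_change_split_sc:
  assumes "scalar_map \<phi>"
  shows "base_change \<phi> split_sc = split_sc"
proof -
  interpret scalar_map \<phi> by fact
  have "map_vec \<phi> (split_bracket (axis i 1) (axis j 1)) = split_bracket (axis i 1) (axis j 1)" for i j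
  proof -
    have "map_vec \<phi> (split_bracket x y) = split_bracket (map_vec \<phi> x) (map_vec \<phi> y)" for x y
      by (simp add: vec_eq_iff all_split_index split_bracket_def add mult diff)
    then show ?thesis by simp
  qed
  then show ?thesis by (simp add: fun_eq_iff base_change_def split_sc_def)
qed

lemma psl3_extension:
  assumes char: "CHAR('a::field) = 3"
  shows "algebra_iso (coord_algebra (split_sc :: ('a alg_closure, split_index) table))
    (scalar_extension to_ac (psl3 :: ('a, ('a^3^3) set) module))"
proof -
  interpret field_map "to_ac :: 'a => 'a alg_closure" by (rule field_map_to_ac)
  show ?thesis
    using scalar_extension_coord[OF scalar_map_axioms psl3_split[OF char]]
    unfolding base_change_split_sc[OF scalar_map_axioms] .
qed

text \<open>
  After extension to the algebraic closure, the cross product and \<open>psl\<^sub>3\<close> have the same split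
  table.
\<close>

theorem cross_product_twisted_psl3:
  fixes G :: "('a::field, 'n::finite) table"
  assumes G: "cross_product G M" and char: "CHAR('a) = 3" and card: "CARD('n) = 7"
    and A: "nonassoc_algebra A" and iso: "algebra_iso (coord_algebra G) A"
  shows "twisted_form A (psl3 :: ('a, ('a^3^3) set) module)"
proof -
  interpret field_map "to_ac :: 'a => 'a alg_closure" by (rule field_map_to_ac)
  have "algebra_iso (coord_algebra split_sc) (coord_algebra (base_change to_ac G))"
    by (rule cross_product_unique[OF cross_product_base_change[OF G]]) (simp_all add: char card)
  then have "algebra_iso (coord_algebra split_sc) (scalar_extension to_ac A)"
    by (rule algebra_iso_trans) (rule scalar_extension_coord[OF scalar_map_axioms iso])
  then have "algebra_iso (scalar_extension to_ac A) (coord_algebra split_sc)"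
    by (rule algebra_iso_sym[OF closed_coord_algebra])
  then show ?thesis unfolding twisted_form_def using A algebra_iso_trans psl3_extension[OF char] by blast
qed

text \<open>
  A twisted form is finite-dimensional by descent. Its extension is split, hence carries a form compatible with
  the bracket, and that form is defined over the ground field.
\<close>

theorem twisted_psl3_cross_product:
  fixes A :: "('a::field, 'v) module"
  assumes char: "CHAR('a) = 3" and A: "twisted_form A (psl3 :: ('a, ('a^3^3) set) module)"
  obtains J and M :: "split_index => split_index => 'a" where "cross_product J M" "algebra_iso (coord_algebra J) A"
proof -
  interpret field_map "to_ac :: 'a => 'a alg_closure" by (rule field_map_to_ac)
  have na: "nonassoc_algebra A" and iso: "algebra_iso (scalar_extension to_ac A) (scalar_extension to_ac (psl3 :: ('a, ('a^3^3) set) module))"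
    using A by (auto simp: twisted_form_def)
  have ext: "algebra_iso (scalar_extension to_ac A) (coord_algebra (split_sc :: ('a alg_closure, split_index) table))"
    by (rule algebra_iso_trans[OF iso algebra_iso_sym[OF closed_coord_algebra psl3_extension[OF char]]])
  obtain J :: "('a, split_index) table" where J: "algebra_iso (coord_algebra J) A"
    using scalar_extension_descent[OF scalar_map_axioms na ext] by blast
  have "algebra_iso (coord_algebra (base_change to_ac J)) (coord_algebra (split_sc :: ('a alg_closure, split_index) table))"
    by (rule algebra_iso_trans[OF scalar_extension_coord[OF scalar_map_axioms J] ext])
  then have "algebra_iso (coord_algebra split_sc) (coord_algebra (base_change to_ac J))"
    by (rule algebra_iso_sym[OF closed_coord_algebra])
  then obtain t where t: "algebra_hom (coord_algebra split_sc) (coord_algebra (base_change to_ac J)) t" "bij t"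
    by (auto elim: algebra_isoE)
  have charK: "CHAR('a alg_closure) = 3" using char by simp
  obtain N where N: "cross_product (base_change to_ac J) N"
    by (rule cross_product_transport[OF cross_product_split[OF charK] t]) blast
  have "CARD(split_index) > 2" by simp
  from cross_product_descent[OF N this] obtain M where "cross_product J M" by blast
  then show ?thesis using that J by blast
qed

lemma chevalley_algebra_extension:
  fixes L :: "(complex, 'v) module"
  assumes basis: "G2_chevalley_basis L h e"
  obtains \<Gamma> where "chevalley_relations (\<Gamma> :: ('a::field alg_closure, chevalley_index) table)"
    "algebra_iso (coord_algebra \<Gamma>) (scalar_extension to_ac (G2_chevalley_algebra L h e :: ('a, ('v => 'a) set) module))"
proof -
  interpret field_map "to_ac :: 'a => 'a alg_closure" by (rule field_map_to_ac)
  obtain \<Gamma> :: "(int, chevalley_index) table" where \<Gamma>: "chevalley_relations \<Gamma>"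
    "algebra_iso (coord_algebra (base_change of_int \<Gamma>)) (G2_chevalley_algebra L h e :: ('a, ('v => 'a) set) module)"
    by (rule chevalley_algebra_coordinates[OF basis])
  have "scalar_map ((to_ac :: 'a => 'a alg_closure) \<circ> of_int)" by unfold_locales simp_all
  then have "chevalley_relations (base_change ((to_ac :: 'a => 'a alg_closure) \<circ> of_int) \<Gamma>)"
    by (rule chevalley_relations_base_change[OF _ \<Gamma>(1)])
  then show ?thesis
    using that scalar_extension_coord[OF scalar_map_axioms \<Gamma>(2)] unfolding base_change_base_change by blast
qed

lemma closed_Der: "closed_algebra (Der G)"
  unfolding closed_algebra_def
proof (intro conjI ballI allI)
  show "d \<oplus>\<^bsub>Der G\<^esub> e \<in> carrier (Der G)" if "d \<in> carrier (Der G)" "e \<in> carrier (Der G)" for d e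
    using that unfolding Der_ops Der_iff by (simp add: sc_mult_add vector_add_ldistrib)
  show "d \<otimes>\<^bsub>Der G\<^esub> e \<in> carrier (Der G)" if "d \<in> carrier (Der G)" "e \<in> carrier (Der G)" for d e
    using Der_bracket_closed[OF that] by (simp only: Der_ops)
  show "c \<odot>\<^bsub>Der G\<^esub> d \<in> carrier (Der G)" if "d \<in> carrier (Der G)" for c d
    using that unfolding Der_ops Der_iff by (simp add: sc_mult_scale vector_add_ldistrib vector_scale_scale mult.commute)
qed

text \<open>
  Over the algebraic closure, \<open>Der G\<close> becomes \<open>Der\<close> of the split cross product, which
  is the Chevalley algebra. A form of type \<open>G\<^sub>2\<close> refers to a complex Chevalley basis; the
  matrices above provide one.
\<close>

theorem Der_G2_twisted:
  fixes G :: "('a::field, 'n::finite) table"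
  assumes G: "cross_product G M" and char: "CHAR('a) = 3" and card: "CARD('n) = 7"
  obtains A :: "('a, nat => 'a) module" where "nonassoc_algebra A" "G2_twisted_form A" "algebra_iso (Der G) A"
proof -
  interpret field_map "to_ac :: 'a => 'a alg_closure" by (rule field_map_to_ac)
  have charK: "CHAR('a alg_closure) = 3" using char by simp
  obtain G0 :: "(complex, chevalley_index) table" where G0: "chevalley_relations G0"
    using exists_chevalley_relations by blast
  obtain L :: "(complex, nat => complex) module" and g where L: "nonassoc_algebra L" "algebra_hom (coord_algebra G0) L g" "bij_betw g UNIV (carrier L)"
    by (rule coord_algebra_copy[of G0])
  obtain h e where basis: "G2_chevalley_basis L h e" by (rule chevalley_basis_of_relations[OF G0 L])
  obtain \<Gamma> where \<Gamma>: "chevalley_relations (\<Gamma> :: ('a alg_closure, chevalley_index) table)"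
    "algebra_iso (coord_algebra \<Gamma>) (scalar_extension to_ac (G2_chevalley_algebra L h e :: ('a, ((nat => complex) => 'a) set) module))"
    by (rule chevalley_algebra_extension[OF basis])
  interpret \<Gamma>: chevalley_char3 \<Gamma> by unfold_locales fact+
  obtain b where b: "ideal_embedding \<Gamma> split_sc b" by (rule \<Gamma>.split_ideal_embedding)
  have "algebra_iso (coord_algebra \<Gamma>) (Der (split_sc :: ('a alg_closure, split_index) table))"
    by (rule ideal_embedding_iso_Der_split[OF charK b card_chevalley_index])
  also have "algebra_iso (Der (split_sc :: ('a alg_closure, split_index) table)) (Der (base_change to_ac G))"
    by (rule derivation_algebra_cong[OF nonassoc_coord_algebra nonassoc_coord_algebra])
      (rule cross_product_unique[OF cross_product_base_change[OF G] charK card])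
  finally (algebra_iso_trans) have \<Gamma>G: "algebra_iso (coord_algebra \<Gamma>) (Der (base_change to_ac G))" .
  obtain \<Delta> :: "('a, chevalley_index) table" where \<Delta>: "algebra_iso (coord_algebra \<Delta>) (Der G)"
    "algebra_iso (coord_algebra (base_change to_ac \<Delta>)) (Der (base_change to_ac G))"
    using Der_descent[OF \<Gamma>G] by blast
  obtain A :: "('a, nat => 'a) module" where A: "nonassoc_algebra A" "algebra_iso (coord_algebra \<Delta>) A"
    by (rule coord_algebra_copy[of \<Delta>])
  have "algebra_iso (coord_algebra (base_change to_ac \<Delta>)) (coord_algebra \<Gamma>)"
    by (rule algebra_iso_trans[OF \<Delta>(2) algebra_iso_sym[OF closed_coord_algebra \<Gamma>G]])
  moreover have "algebra_iso (scalar_extension to_ac A) (coord_algebra (base_change to_ac \<Delta>))"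
    by (rule algebra_iso_sym[OF closed_coord_algebra scalar_extension_coord[OF scalar_map_axioms A(2)]])
  ultimately have "algebra_iso (scalar_extension to_ac A) (coord_algebra \<Gamma>)" using algebra_iso_trans by blast
  from algebra_iso_trans[OF this \<Gamma>(2)]
  have "twisted_form A (G2_chevalley_algebra L h e :: ('a, ((nat => complex) => 'a) set) module)"
    unfolding twisted_form_def using A(1) by (rule conjI[rotated])
  then have "G2_twisted_form A" unfolding G2_twisted_form_def using basis by blast
  moreover have "algebra_iso (Der G) A"
    by (rule algebra_iso_trans[OF algebra_iso_sym[OF closed_coord_algebra \<Delta>(1)] A(2)])
  ultimately show ?thesis using that A(1) by blast
qed

theorem G2_twisted_Der:
  fixes A :: "('a::field, 'v) module"
  assumes char: "CHAR('a) = 3" and A: "G2_twisted_form A"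
  obtains J and M :: "split_index => split_index => 'a" where "cross_product J M" "algebra_iso (Der J) A"
proof -
  interpret field_map "to_ac :: 'a => 'a alg_closure" by (rule field_map_to_ac)
  have charK: "CHAR('a alg_closure) = 3" using char by simp
  obtain L :: "(complex, nat => complex) module" and h e where basis: "G2_chevalley_basis L h e"
    and A': "twisted_form A (G2_chevalley_algebra L h e :: ('a, ((nat => complex) => 'a) set) module)"
    using A unfolding G2_twisted_form_def by blast
  obtain \<Gamma> where \<Gamma>: "chevalley_relations (\<Gamma> :: ('a alg_closure, chevalley_index) table)"
    "algebra_iso (coord_algebra \<Gamma>) (scalar_extension to_ac (G2_chevalley_algebra L h e :: ('a, ((nat => complex) => 'a) set) module))"
    by (rule chevalley_algebra_extension[OF basis])
  have "algebra_iso (scalar_extension to_ac A) (coord_algebra \<Gamma>)"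
    using A' algebra_iso_sym[OF closed_coord_algebra \<Gamma>(2)] algebra_iso_trans unfolding twisted_form_def by blast
  moreover have "nonassoc_algebra A" using A' by (simp add: twisted_form_def)
  ultimately show ?thesis using chevalley_form_is_Der[OF charK _ \<Gamma>(1)] that by blast
qed

section \<open>The two bijections\<close>

lemma cayley_coordinates:
  fixes C :: "('a::field, 'v) module"
  assumes C: "cayley_algebra C q" and char: "CHAR('a) = 3"
  obtains G and M :: "7 => 7 => 'a" where "cross_product G M" "algebra_iso (octonions G M) C"
    "algebra_iso (coord_algebra G) (trace_zero_algebra C q)" "algebra_iso (Der G) (derivation_algebra C)"
proof -
  have A: "nonassoc_algebra C" using C by (simp add: cayley_algebra_def)
  obtain G and M :: "7 => 7 => 'a" where G: "cross_product G M" "algebra_iso (octonions G M) C"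
    "algebra_iso (coord_algebra G) (trace_zero_algebra C q)"
    by (rule cayley_cross_product[OF C char])
  interpret char3_cross_product G M by unfold_locales fact+
  have "algebra_iso (Der G) (derivation_algebra (octonions G M))" by (rule Der_octonions) simp
  then have "algebra_iso (Der G) (derivation_algebra C)"
    by (rule algebra_iso_trans) (rule derivation_algebra_cong[OF nonassoc_octonions A G(2)])
  then show ?thesis using that G by blast
qed

text \<open>
  The trace zero algebra of the new Cayley algebra is compared with \<open>J\<close> through derivations, where
  both have the same algebra by \<open>Der_octonions\<close>.
\<close>

theorem cross_product_cayley:
  fixes J :: "('a::field, 'n::finite) table"
  assumes J: "cross_product J M" and char: "CHAR('a) = 3" and card: "CARD('n) = 7"
  obtains C :: "('a, nat => 'a) module" and q where "cayley_algebra C q"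
    "algebra_iso (coord_algebra J) (trace_zero_algebra C q)" "algebra_iso (Der J) (derivation_algebra C)"
proof -
  interpret char3_cross_product J M by unfold_locales fact+
  obtain f :: "'a \<times> ('a^'n) => nat => 'a" where f: "inj f" using exists_embedding_octonions by blast
  have inj: "inj_on f (carrier (octonions J M))" using f by simp
  let ?C = "transport (octonions J M) f"
  obtain q where C: "cayley_algebra ?C q" using cayley_transport[OF cayley_octonions[OF J char card] inj] by blast
  have iso: "algebra_iso (octonions J M) ?C" by (rule algebra_isoI[OF transport_iso[OF inj]])
  have "algebra_iso (Der J) (derivation_algebra (octonions J M))" by (rule Der_octonions) (simp add: card)
  moreover have "nonassoc_algebra ?C" using C by (simp add: cayley_algebra_def)
  ultimately have Der: "algebra_iso (Der J) (derivation_algebra ?C)"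
    using algebra_iso_trans derivation_algebra_cong[OF nonassoc_octonions _ iso] by blast
  obtain G and N :: "7 => 7 => 'a" where G: "cross_product G N" "algebra_iso (coord_algebra G) (trace_zero_algebra ?C q)"
    "algebra_iso (Der G) (derivation_algebra ?C)"
    by (rule cayley_coordinates[OF C char]) blast
  have "algebra_iso (Der G) (Der J)" by (rule algebra_iso_trans[OF G(3) algebra_iso_sym[OF closed_Der Der]])
  then have "algebra_iso (coord_algebra J) (coord_algebra G)" by (intro Der_iso_imp_iso[OF G(1) J char]) (simp_all add: card)
  from algebra_iso_trans[OF this G(2)] show ?thesis by (rule that[OF C _ Der])
qed

lemma nonassoc_trace_zero:
  fixes C :: "('a::field, 'v) module" (structure)
  assumes C: "cayley_algebra C q" and char: "CHAR('a) = 3"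
  shows "nonassoc_algebra (trace_zero_algebra C q)"
proof -
  let ?T = "trace_zero_algebra C q"
  obtain G :: "('a, 7) table" where "algebra_iso (coord_algebra G) ?T"
    by (rule cayley_coordinates[OF C char]) blast
  then obtain f where f: "algebra_hom (coord_algebra G) ?T f" "bij_betw f UNIV (carrier ?T)" by (auto elim: algebra_isoE)
  have A: "nonassoc_algebra C" using C by (simp add: cayley_algebra_def)
  interpret A: abelian_group C by (rule nonassoc_algebraD(2)[OF A])
  have "f 0 \<in> carrier C" using algebra_homD(1)[OF f(1), of 0] by (simp add: trace_zero_algebra_def)
  moreover have "f 0 \<oplus> f 0 = f 0" using algebra_homD(2)[OF f(1), of 0 0] by (simp add: trace_zero_algebra_def)
  ultimately have "f 0 = \<zero>" using A.add.r_cancel_one by blast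
  then show ?thesis
    using f by (intro nonassoc_algebra_image[OF nonassoc_coord_algebra f(1)]) (simp_all add: trace_zero_algebra_def)
qed

text \<open>
  The three algebras determine each other, in a cycle: \<open>C\<close> gives \<open>Der C\<close>, which gives
  \<open>C\<^sup>0\<close>, which gives \<open>C\<close>.
\<close>

theorem cayley_iso_iff:
  fixes C :: "('a::field, 'v) module" and C' :: "('a, 'w) module"
  assumes char: "CHAR('a) = 3" and C: "cayley_algebra C q" and C': "cayley_algebra C' q'"
  shows "algebra_iso C C' ==> algebra_iso (derivation_algebra C) (derivation_algebra C')"
    and "algebra_iso (derivation_algebra C) (derivation_algebra C') ==> algebra_iso (trace_zero_algebra C q) (trace_zero_algebra C' q')"
    and "algebra_iso (trace_zero_algebra C q) (trace_zero_algebra C' q') ==> algebra_iso C C'"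
proof -
  have A: "nonassoc_algebra C" "nonassoc_algebra C'" using C C' by (simp_all add: cayley_algebra_def)
  obtain G and M :: "7 => 7 => 'a" where G: "cross_product G M" "algebra_iso (octonions G M) C"
    "algebra_iso (coord_algebra G) (trace_zero_algebra C q)" "algebra_iso (Der G) (derivation_algebra C)"
    by (rule cayley_coordinates[OF C char])
  obtain G' and M' :: "7 => 7 => 'a" where G': "cross_product G' M'" "algebra_iso (octonions G' M') C'"
    "algebra_iso (coord_algebra G') (trace_zero_algebra C' q')" "algebra_iso (Der G') (derivation_algebra C')"
    by (rule cayley_coordinates[OF C' char])
  note sym = algebra_iso_sym[OF closed_coord_algebra] algebra_iso_sym[OF closed_Der]
    algebra_iso_sym[OF nonassoc_algebra_closed[OF nonassoc_octonions]]
  show "algebra_iso C C' ==> algebra_iso (derivation_algebra C) (derivation_algebra C')"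
    by (rule derivation_algebra_cong[OF A])
  show "algebra_iso (trace_zero_algebra C q) (trace_zero_algebra C' q')" if "algebra_iso (derivation_algebra C) (derivation_algebra C')"
  proof -
    have "algebra_iso (Der G) (Der G')"
      by (rule algebra_iso_trans[OF G(4) algebra_iso_trans[OF that sym(2)[OF G'(4)]]])
    then have "algebra_iso (coord_algebra G') (coord_algebra G)"
      by (intro Der_iso_imp_iso[OF G(1) G'(1) char]) simp_all
    then have "algebra_iso (coord_algebra G) (coord_algebra G')" by (rule sym(1))
    from algebra_iso_trans[OF sym(1)[OF G(3)] algebra_iso_trans[OF this G'(3)]] show ?thesis .
  qed
  show "algebra_iso C C'" if "algebra_iso (trace_zero_algebra C q) (trace_zero_algebra C' q')"
  proof -
    have "algebra_iso (coord_algebra G) (coord_algebra G')"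
      by (rule algebra_iso_trans[OF G(3) algebra_iso_trans[OF that sym(1)[OF G'(3)]]])
    then have "algebra_iso (octonions G M) (octonions G' M')" by (intro octonions_iso[OF G(1) G'(1)]) simp_all
    from algebra_iso_trans[OF sym(3)[OF G(2)] algebra_iso_trans[OF this G'(2)]] show ?thesis .
  qed
qed

theorem corollary11:
  assumes "CHAR('a::field) = 3"
  shows
    "(\<exists>D :: ('a, nat \<Rightarrow> 'a) module set \<Rightarrow> ('a, nat \<Rightarrow> 'a) module set.
        (\<forall>(C :: ('a, nat \<Rightarrow> 'a) module) q. cayley_algebra C q \<longrightarrow>
           D (iso_class C) = iso_class (derivation_algebra C)) \<and>
        bij_betw D Isom_Cayley Isom_G2) \<and>
     (\<exists>T :: ('a, nat \<Rightarrow> 'a) module set \<Rightarrow> ('a, nat \<Rightarrow> 'a) module set.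
        (\<forall>(C :: ('a, nat \<Rightarrow> 'a) module) q. cayley_algebra C q \<longrightarrow>
           T (iso_class C) = iso_class (trace_zero_algebra C q)) \<and>
        bij_betw T Isom_Cayley Isom_A2_bar)"
proof -
  note char = assms
  have bij: "\<exists>D. (\<forall>(C :: ('a, nat \<Rightarrow> 'a) module) q. cayley_algebra C q \<longrightarrow> D (iso_class C) = F C q) \<and> bij_betw D Isom_Cayley S"
    if F: "\<And>(C :: ('a, nat \<Rightarrow> 'a) module) q C' q'. cayley_algebra C q \<Longrightarrow> cayley_algebra C' q' \<Longrightarrow>
        F C q = F C' q' \<longleftrightarrow> algebra_iso C C'"
      and mem: "\<And>C q. cayley_algebra C q \<Longrightarrow> F C q \<in> S"
      and surj: "\<And>Y. Y \<in> S \<Longrightarrow> \<exists>C q. cayley_algebra C q \<and> Y = F C q"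
    for F :: "('a, nat \<Rightarrow> 'a) module \<Rightarrow> ((nat \<Rightarrow> 'a) \<Rightarrow> 'a) \<Rightarrow> ('a, nat \<Rightarrow> 'a) module set" and S
  proof -
    define D where "D Z = (SOME Y. \<exists>C q. cayley_algebra C q \<and> Z = iso_class C \<and> Y = F C q)" for Z
    have iso: "iso_class C = iso_class C' \<longleftrightarrow> algebra_iso C C'" if "cayley_algebra C q" "cayley_algebra C' q'"
      for C C' :: "('a, nat \<Rightarrow> 'a) module" and q q'
      using that iso_class_eqI[of C C'] iso_class_eqD[of C' C] nonassoc_algebra_closed unfolding cayley_algebra_def by metis
    have D: "D (iso_class C) = F C q" if C: "cayley_algebra C q" for C q
    proof -
      have "\<exists>C' q'. cayley_algebra C' q' \<and> iso_class C = iso_class C' \<and> D (iso_class C) = F C' q'"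
        unfolding D_def by (rule someI[of _ "F C q"]) (use C in blast)
      then obtain C' q' where C': "cayley_algebra C' q'" "iso_class C = iso_class C'" "D (iso_class C) = F C' q'" by blast
      then show ?thesis using F[OF C C'(1)] iso[OF C C'(1)] by simp
    qed
    have "inj_on D Isom_Cayley"
    proof (rule inj_onI)
      fix Y Z :: "('a, nat \<Rightarrow> 'a) module set" assume "Y \<in> Isom_Cayley" "Z \<in> Isom_Cayley" and eq: "D Y = D Z"
      then obtain C C' :: "('a, nat \<Rightarrow> 'a) module" and q q' where C: "Y = iso_class C" "cayley_algebra C q" and C': "Z = iso_class C'" "cayley_algebra C' q'"
        unfolding Isom_Cayley_def by blast
      then have "F C q = F C' q'" using eq D by simp
      then show "Y = Z" using F[OF C(2) C'(2)] iso[OF C(2) C'(2)] C(1) C'(1) by simp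
    qed
    moreover have "D ` Isom_Cayley = S"
    proof (intro subset_antisym subsetI)
      fix Y assume "Y \<in> D ` Isom_Cayley"
      then show "Y \<in> S" unfolding Isom_Cayley_def using D mem by auto
    next
      fix Y assume "Y \<in> S"
      then obtain C q where C: "cayley_algebra C q" "Y = F C q" using surj by blast
      then have "iso_class C \<in> Isom_Cayley" unfolding Isom_Cayley_def by blast
      then show "Y \<in> D ` Isom_Cayley" using D[OF C(1)] C(2) by (metis imageI)
    qed
    ultimately have "bij_betw D Isom_Cayley S" by (simp add: bij_betw_def)
    then show ?thesis using D by blast
  qed
  have "\<exists>D :: ('a, nat \<Rightarrow> 'a) module set \<Rightarrow> ('a, nat \<Rightarrow> 'a) module set.
      (\<forall>(C :: ('a, nat \<Rightarrow> 'a) module) q. cayley_algebra C q \<longrightarrow> D (iso_class C) = iso_class (derivation_algebra C)) \<and> bij_betw D Isom_Cayley Isom_G2"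
  proof (rule bij[where F = "\<lambda>C q. iso_class (derivation_algebra C)" and S = Isom_G2])
    fix C :: "('a, nat \<Rightarrow> 'a) module" and q assume C: "cayley_algebra C q"
    obtain G and M :: "7 \<Rightarrow> 7 \<Rightarrow> 'a" where G: "cross_product G M" "algebra_iso (Der G) (derivation_algebra C)"
      by (rule cayley_coordinates[OF C char]) blast
    obtain A :: "('a, nat \<Rightarrow> 'a) module" where A: "nonassoc_algebra A" "G2_twisted_form A" "algebra_iso (Der G) A"
      by (rule Der_G2_twisted[OF G(1) char]) simp
    have closed: "closed_algebra (derivation_algebra C)" by (rule closed_algebra_iso[OF closed_Der G(2)])
    have DA: "algebra_iso (derivation_algebra C) A" using algebra_iso_trans algebra_iso_sym[OF closed_Der G(2)] A(3) by blast
    have eq: "iso_class (derivation_algebra C) = iso_class A" by (rule iso_class_eqI[OF closed DA])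
    then show "iso_class (derivation_algebra C) \<in> Isom_G2" unfolding Isom_G2_def using A(2) by blast
    fix C' :: "('a, nat \<Rightarrow> 'a) module" and q' assume C': "cayley_algebra C' q'"
    note iff = cayley_iso_iff[OF char C C']
    show "iso_class (derivation_algebra C) = iso_class (derivation_algebra C') \<longleftrightarrow> algebra_iso C C'"
    proof
      assume h: "iso_class (derivation_algebra C) = iso_class (derivation_algebra C')"
      have "algebra_iso (derivation_algebra C') A" by (rule iso_class_eqD[OF _ A(1)]) (simp add: eq[symmetric] h)
      then have "algebra_iso (derivation_algebra C') (derivation_algebra C)"
        using algebra_iso_trans algebra_iso_sym[OF closed DA] by blast
      note iso = cayley_iso_iff(2,3)[OF char C' C]
      have "algebra_iso C' C" by (rule iso(2)[OF iso(1)]) fact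
      then show "algebra_iso C C'"
        using C' algebra_iso_sym nonassoc_algebra_closed unfolding cayley_algebra_def by blast
    qed (rule iso_class_eqI[OF closed iff(1)])
  next
    fix Y :: "('a, nat \<Rightarrow> 'a) module set" assume "Y \<in> Isom_G2"
    then obtain A where A: "Y = iso_class A" "G2_twisted_form (A :: ('a, nat \<Rightarrow> 'a) module)" unfolding Isom_G2_def by blast
    obtain J and M :: "split_index \<Rightarrow> split_index \<Rightarrow> 'a" where J: "cross_product J M" "algebra_iso (Der J) A"
      by (rule G2_twisted_Der[OF char A(2)])
    obtain C :: "('a, nat \<Rightarrow> 'a) module" and q where C: "cayley_algebra C q" "algebra_iso (coord_algebra J) (trace_zero_algebra C q)"
      "algebra_iso (Der J) (derivation_algebra C)"
      by (rule cross_product_cayley[OF J(1) char card_split_index])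
    have "iso_class (Der J) = iso_class A" "iso_class (Der J) = iso_class (derivation_algebra C)"
      by (rule iso_class_eqI[OF closed_Der J(2)], rule iso_class_eqI[OF closed_Der C(3)])
    then show "\<exists>(C :: ('a, nat \<Rightarrow> 'a) module) q. cayley_algebra C q \<and> Y = iso_class (derivation_algebra C)" using A(1) C(1) by metis
  qed
  moreover have "\<exists>T :: ('a, nat \<Rightarrow> 'a) module set \<Rightarrow> ('a, nat \<Rightarrow> 'a) module set.
      (\<forall>(C :: ('a, nat \<Rightarrow> 'a) module) q. cayley_algebra C q \<longrightarrow> T (iso_class C) = iso_class (trace_zero_algebra C q)) \<and> bij_betw T Isom_Cayley Isom_A2_bar"
  proof (rule bij[where F = "\<lambda>C q. iso_class (trace_zero_algebra C q)" and S = Isom_A2_bar])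
    fix C :: "('a, nat \<Rightarrow> 'a) module" and q assume C: "cayley_algebra C q"
    obtain G and M :: "7 \<Rightarrow> 7 \<Rightarrow> 'a" where G: "cross_product G M" "algebra_iso (coord_algebra G) (trace_zero_algebra C q)"
      by (rule cayley_coordinates[OF C char]) blast
    have na: "nonassoc_algebra (trace_zero_algebra C q)" by (rule nonassoc_trace_zero[OF C char])
    have "twisted_form (trace_zero_algebra C q) (psl3 :: ('a, ('a^3^3) set) module)"
      by (rule cross_product_twisted_psl3[OF G(1) char _ na G(2)]) simp
    then show "iso_class (trace_zero_algebra C q) \<in> Isom_A2_bar" unfolding Isom_A2_bar_def by blast
    fix C' :: "('a, nat \<Rightarrow> 'a) module" and q' assume C': "cayley_algebra C' q'"
    note iff = cayley_iso_iff[OF char C C']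
    show "iso_class (trace_zero_algebra C q) = iso_class (trace_zero_algebra C' q') \<longleftrightarrow> algebra_iso C C'"
    proof
      assume h: "iso_class (trace_zero_algebra C q) = iso_class (trace_zero_algebra C' q')"
      have "algebra_iso (trace_zero_algebra C q) (trace_zero_algebra C' q')"
        by (rule iso_class_eqD[OF h[symmetric] nonassoc_trace_zero[OF C' char]])
      then show "algebra_iso C C'" by (rule iff(3))
    qed (rule iso_class_eqI[OF nonassoc_algebra_closed[OF na] iff(2)[OF iff(1)]])
  next
    fix Y :: "('a, nat \<Rightarrow> 'a) module set" assume "Y \<in> Isom_A2_bar"
    then obtain A where A: "Y = iso_class A" "twisted_form (A :: ('a, nat \<Rightarrow> 'a) module) (psl3 :: ('a, ('a^3^3) set) module)"
      unfolding Isom_A2_bar_def by blast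
    obtain J and M :: "split_index \<Rightarrow> split_index \<Rightarrow> 'a" where J: "cross_product J M" "algebra_iso (coord_algebra J) A"
      by (rule twisted_psl3_cross_product[OF char A(2)])
    obtain C :: "('a, nat \<Rightarrow> 'a) module" and q where C: "cayley_algebra C q" "algebra_iso (coord_algebra J) (trace_zero_algebra C q)"
      "algebra_iso (Der J) (derivation_algebra C)"
      by (rule cross_product_cayley[OF J(1) char card_split_index])
    have "iso_class (coord_algebra J) = iso_class A" "iso_class (coord_algebra J) = iso_class (trace_zero_algebra C q)"
      by (rule iso_class_eqI[OF closed_coord_algebra J(2)], rule iso_class_eqI[OF closed_coord_algebra C(2)])
    then show "\<exists>(C :: ('a, nat \<Rightarrow> 'a) module) q. cayley_algebra C q \<and> Y = iso_class (trace_zero_algebra C q)" using A(1) C(1) by metis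
  qed
  ultimately show ?thesis by (rule conjI)
qed

end
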